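(* Let $M$ be a complex manifold and let $\Omega^\bullet$ be the complex of sheaves $$\Omega^0 \xrightarrow{d} \Omega^1 \xrightarrow{d} \Omega^2 \to \cdots$$ of holomorphic forms on $M$. Then for every integer $k \ge 0$ there is an isomorphism $$H_{\mathrm{sing}}^k(M, \mathbb{C}) \simeq \mathbb{H}^k(M, \Omega^\bullet)$$ between the singular cohomology of $M$ with complex coefficients and the hypercohomology of $\Omega^\bullet$.
   Context: Complex manifolds are Hausdorff and second countable. A differential $k$-form on a complex manifold is holomorphic if locally it can be written as $\sum a_I\, dz^{i_1}\wedge\cdots\wedge dz^{i_k}$ with $(U,z^1,\dots,z^n)$ a complex chart and the $a_I$ holomorphic functions on $U$. $\Omega^k$ is the sheaf of holomorphic $k$-forms on $M$, and $d$ is the exterior derivative. All sheaves are sheaves of abelian groups. Godement resolution. For a sheaf $\mathcal{F}$ on a topological space $X$, let $\mathcal{C}^0\mathcal{F}$ be the sheaf $U \mapsto \prod_{p\in U}\mathcal{F}_p$ (with restriction given by projection), i.e. the sheaf of all, not necessarily continuous, sections of the étalé space of $\mathcal{F}$. There is an injection $\mathcal{F}\to\mathcal{C}^0\mathcal{F}$ sending a section to its family of germs. Put $\mathcal{Q}^0=\mathcal{F}$ and recursively $\mathcal{C}^k\mathcal{F}=\mathcal{C}^0\mathcal{Q}^k$ and $\mathcal{Q}^{k+1}=\mathcal{C}^k\mathcal{F}/\mathcal{Q}^k$ (quotient sheaf). The composites $\delta\colon\mathcal{C}^k\mathcal{F}\to\mathcal{Q}^{k+1}\to\mathcal{C}^0\mathcal{Q}^{k+1}=\mathcal{C}^{k+1}\mathcal{F}$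 give an exact sequence $0\to\mathcal{F}\to\mathcal{C}^0\mathcal{F}\to\mathcal{C}^1\mathcal{F}\to\cdots$, the Godement canonical resolution. Each $\mathcal{C}^k(\ )$ is a functor from sheaves to sheaves. Hypercohomology. For a complex of sheaves $\mathcal{L}^\bullet\colon \mathcal{L}^0\to\mathcal{L}^1\to\mathcal{L}^2\to\cdots$ on $X$, let $K^{p,q}=\Gamma(X,\mathcal{C}^p\mathcal{L}^q)$ for $p,q\ge 0$, with horizontal differential $\delta\colon K^{p,q}\to K^{p+1,q}$ from the Godement resolution of $\mathcal{L}^q$ and vertical differential $d\colon K^{p,q}\to K^{p,q+1}$ induced from $\mathcal{L}^q\to\mathcal{L}^{q+1}$ by the functor $\mathcal{C}^p$; these commute. Let $K^k=\bigoplus_{p+q=k}K^{p,q}$ with $D=\delta+(-1)^p d$. The hypercohomology $\mathbb{H}^k(X,\mathcal{L}^\bullet)$ is the $k$th cohomology of $(K^\bullet,D)$. *)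

theory Defs
  imports
    "HOL-Analysis.Analysis"
    "HOL-Combinatorics.Permutations"
    "HOL-Homology.Homology"
begin

section \<open>Complex manifolds\<close>

text \<open>
  The model space \<open>\<complex>\<^sup>n\<close> is rendered as in \<^const>\<open>Euclidean_space\<close>: sequences vanishing from
  index \<open>n\<close> on, with the product topology. So \<open>n\<close> is an ordinary natural number and \<open>n = 0\<close>
  is allowed.
\<close>

definition complex_space :: "nat \<Rightarrow> (nat \<Rightarrow> complex) topology" where
  "complex_space n = subtopology (product_topology (\<lambda>i. euclidean) UNIV) {z. \<forall>i\<ge>n. z i = 0}"

text \<open>
  Holomorphy in several variables on an open \<open>D \<subseteq> \<complex>\<^sup>n\<close>: continuous, and holomorphic in each
  variable separately.
\<close>

definition holomorphic_on_Cn :: "nat \<Rightarrow> (nat \<Rightarrow> complex) set \<Rightarrow> ((nat \<Rightarrow> complex) \<Rightarrow> complex) \<Rightarrow> bool"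
  where
  "holomorphic_on_Cn n D f \<longleftrightarrow>
     continuous_map (subtopology (complex_space n) D) euclidean f \<and>
     (\<forall>z\<in>D. \<forall>i<n. (\<lambda>w. f (z(i := w))) field_differentiable at (z i))"

definition partial_deriv :: "nat \<Rightarrow> ((nat \<Rightarrow> complex) \<Rightarrow> complex) \<Rightarrow> (nat \<Rightarrow> complex) \<Rightarrow> complex" where
  "partial_deriv i f z = deriv (\<lambda>w. f (z(i := w))) (z i)"

text \<open>A chart is a pair of its domain and its coordinate map.\<close>

type_synonym 'a chart = "'a set \<times> ('a \<Rightarrow> nat \<Rightarrow> complex)"

definition transition :: "'a chart \<Rightarrow> 'a chart \<Rightarrow> (nat \<Rightarrow> complex) \<Rightarrow> nat \<Rightarrow> complex" where
  "transition c d z = snd d (inv_into (fst c) (snd c) z)"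

definition complex_manifold :: "nat \<Rightarrow> 'a topology \<Rightarrow> 'a chart set \<Rightarrow> bool" where
  "complex_manifold n X A \<longleftrightarrow>
     Hausdorff_space X \<and> second_countable X \<and>
     (\<forall>(U, z)\<in>A. openin X U \<and> openin (complex_space n) (z ` U) \<and>
        homeomorphic_map (subtopology X U) (subtopology (complex_space n) (z ` U)) z) \<and>
     (\<Union>c\<in>A. fst c) = topspace X \<and>
     (\<forall>c\<in>A. \<forall>d\<in>A. \<forall>j<n.
        holomorphic_on_Cn n (snd c ` (fst c \<inter> fst d)) (\<lambda>z. transition c d z j))"


section \<open>Holomorphic forms\<close>

text \<open>
  A tangent vector at \<open>p\<close> assigns to every chart around \<open>p\<close> its components in that chart,
  transforming by the Jacobian matrices of the coordinate changes. With \<open>\<complex>\<^sup>n = \<real>\<^sup>2\<^sup>n\<close> this is the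
  tangent space of the underlying real manifold. Charts not containing \<open>p\<close> get the value \<open>0\<close>.
\<close>

type_synonym 'a tangent = "'a chart \<Rightarrow> nat \<Rightarrow> complex"

definition tangent_space :: "nat \<Rightarrow> 'a chart set \<Rightarrow> 'a \<Rightarrow> 'a tangent set" where
  "tangent_space n A p =
     {v. (\<forall>c. c \<notin> A \<or> p \<notin> fst c \<longrightarrow> v c = (\<lambda>i. 0)) \<and>
         (\<forall>c\<in>A. p \<in> fst c \<longrightarrow> v c \<in> topspace (complex_space n)) \<and>
         (\<forall>c\<in>A. \<forall>d\<in>A. p \<in> fst c \<longrightarrow> p \<in> fst d \<longrightarrow> (\<forall>j<n.
            v d j = (\<Sum>i<n. partial_deriv i (\<lambda>z. transition c d z j) (snd c p) * v c i)))}"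

definition tangent_lists :: "nat \<Rightarrow> 'a chart set \<Rightarrow> nat \<Rightarrow> 'a \<Rightarrow> 'a tangent list set" where
  "tangent_lists n A k p = {vs. length vs = k \<and> set vs \<subseteq> tangent_space n A p}"

text \<open>
  A \<open>k\<close>-form evaluates, at a point, lists of \<open>k\<close> tangent vectors. \<open>wedge_dz c [i\<^sub>1,\<dots>,i\<^sub>k]\<close> is
  \<open>dz\<^sup>i\<^sup>1 \<and> \<dots> \<and> dz\<^sup>i\<^sup>k\<close> for the coordinates of the chart \<open>c\<close>, i.e. the determinant of the
  matrix of the values \<open>dz\<^sup>i(v) = v c i\<close>.
\<close>

type_synonym 'a form = "'a \<Rightarrow> 'a tangent list \<Rightarrow> complex"

definition wedge_dz :: "'a chart \<Rightarrow> nat list \<Rightarrow> 'a tangent list \<Rightarrow> complex" where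
  "wedge_dz c I vs =
     (\<Sum>\<sigma> | \<sigma> permutes {..<length I}.
        of_int (sign \<sigma>) * (\<Prod>b<length I. (vs ! \<sigma> b) c (I ! b)))"

definition multi_indices :: "nat \<Rightarrow> nat \<Rightarrow> nat list set" where
  "multi_indices n k = {I. length I = k \<and> sorted_wrt (<) I \<and> set I \<subseteq> {..<n}}"

text \<open>
  \<open>\<omega> = \<Sum>\<^sub>I a\<^sub>I dz\<^sup>I\<close> on the open subset \<open>N\<close> of the domain of \<open>c\<close>, with holomorphic coefficients
  (functions of the coordinates). Thus \<open>N\<close> with the restricted coordinates is the chart in the
  definition of a holomorphic form.
\<close>

definition local_expansion ::
  "nat \<Rightarrow> 'a topology \<Rightarrow> 'a chart set \<Rightarrow> nat \<Rightarrow> 'a form \<Rightarrow> 'a chart \<Rightarrow> 'a set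
    \<Rightarrow> (nat list \<Rightarrow> (nat \<Rightarrow> complex) \<Rightarrow> complex) \<Rightarrow> bool" where
  "local_expansion n X A k \<omega> c N a \<longleftrightarrow>
     c \<in> A \<and> openin X N \<and> N \<subseteq> fst c \<and>
     (\<forall>I\<in>multi_indices n k. holomorphic_on_Cn n (snd c ` N) (a I)) \<and>
     (\<forall>q\<in>N. \<forall>vs\<in>tangent_lists n A k q.
        \<omega> q vs = (\<Sum>I\<in>multi_indices n k. a I (snd c q) * wedge_dz c I vs))"

text \<open>
  Holomorphic \<open>k\<close>-forms on \<open>W\<close>. Being alternating, multilinear and smooth follows from the local
  expansions. Values off \<open>W\<close> or off lists of \<open>k\<close> tangent vectors are normalised to \<open>0\<close>.
\<close>

definition holomorphic_forms :: "nat \<Rightarrow> 'a topology \<Rightarrow> 'a chart set \<Rightarrow> nat \<Rightarrow> 'a set \<Rightarrow> 'a form set"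
  where
  "holomorphic_forms n X A k W =
     {\<omega>. (\<forall>p\<in>W. \<exists>c N a. p \<in> N \<and> N \<subseteq> W \<and> local_expansion n X A k \<omega> c N a) \<and>
         (\<forall>p vs. p \<notin> W \<or> vs \<notin> tangent_lists n A k p \<longrightarrow> \<omega> p vs = 0)}"

text \<open>
  \<open>d (\<Sum>\<^sub>I a\<^sub>I dz\<^sup>I) = \<Sum>\<^sub>I \<Sum>\<^sub>j (\<partial>a\<^sub>I/\<partial>z\<^sup>j) dz\<^sup>j \<and> dz\<^sup>I\<close> in any local expansion; the value does not
  depend on the expansion, which is what the definite description refers to.
\<close>

definition exterior_derivative ::
  "nat \<Rightarrow> 'a topology \<Rightarrow> 'a chart set \<Rightarrow> nat \<Rightarrow> 'a set \<Rightarrow> 'a form \<Rightarrow> 'a form" where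
  "exterior_derivative n X A k W \<omega> = (\<lambda>p vs.
     if p \<in> W \<and> vs \<in> tangent_lists n A (Suc k) p
     then THE y. \<exists>c N a. p \<in> N \<and> N \<subseteq> W \<and> local_expansion n X A k \<omega> c N a \<and>
            y = (\<Sum>I\<in>multi_indices n k. \<Sum>j<n.
                   partial_deriv j (a I) (snd c p) * wedge_dz c (j # I) vs)
     else 0)"


section \<open>Presheaves, stalks and sheafification\<close>

text \<open>
  Sections over \<open>U\<close> form a group (only open \<open>U\<close> matter); \<open>restriction F U V\<close> is the restriction
  map for \<open>V \<subseteq> U\<close>. Groups are written multiplicatively, as in HOL-Algebra.
\<close>

record ('a, 'v) presheaf =
  sections :: "'a set \<Rightarrow> 'v monoid"
  restriction :: "'a set \<Rightarrow> 'a set \<Rightarrow> 'v \<Rightarrow> 'v"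

text \<open>
  The Godement construction iterates the passage from a sheaf to families of its germs, which would
  change the type of sections at every step. All sections therefore live in one datatype, closed
  under forming families \<open>p \<mapsto> (U, s)\<close> of germs given by representatives. Since equivalence
  classes would not fit into such a type, germs and cosets are identified with chosen
  representatives of their classes.
\<close>

datatype ('a, 'b) gsec = Base (base: 'b) | Family (family: "'a \<Rightarrow> 'a set \<times> ('a, 'b) gsec")

text \<open>The chosen representative of the germ at \<open>p\<close> of \<open>s \<in> F(U)\<close>.\<close>

definition germ :: "'a topology \<Rightarrow> ('a, 'v) presheaf \<Rightarrow> 'a \<Rightarrow> 'a set \<Rightarrow> 'v \<Rightarrow> 'a set \<times> 'v" where
  "germ X F p U s = (SOME (V, t). openin X V \<and> p \<in> V \<and> t \<in> carrier (sections F V) \<and>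
     (\<exists>W. openin X W \<and> p \<in> W \<and> W \<subseteq> U \<inter> V \<and> restriction F U W s = restriction F V W t))"

definition stalk :: "'a topology \<Rightarrow> ('a, 'v) presheaf \<Rightarrow> 'a \<Rightarrow> ('a set \<times> 'v) monoid" where
  "stalk X F p =
     \<lparr>carrier = {germ X F p U s |U s. openin X U \<and> p \<in> U \<and> s \<in> carrier (sections F U)},
      monoid.mult = (\<lambda>(U, s) (V, t). germ X F p (U \<inter> V)
        (restriction F U (U \<inter> V) s \<otimes>\<^bsub>sections F (U \<inter> V)\<^esub> restriction F V (U \<inter> V) t)),
      one = germ X F p (topspace X) \<one>\<^bsub>sections F (topspace X)\<^esub>\<rparr>"

text \<open>\<open>\<C>\<^sup>0F\<close>: the product of the stalks over the points of \<open>U\<close>, transported along \<^const>\<open>Family\<close>.\<close>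

definition godement_sheaf ::
  "'a topology \<Rightarrow> ('a, ('a, 'b) gsec) presheaf \<Rightarrow> ('a, ('a, 'b) gsec) presheaf" where
  "godement_sheaf X F =
     \<lparr>sections = (\<lambda>U. let P = product_group U (stalk X F) in
        \<lparr>carrier = Family ` carrier P,
         monoid.mult = (\<lambda>x y. Family (family x \<otimes>\<^bsub>P\<^esub> family y)),
         one = Family \<one>\<^bsub>P\<^esub>\<rparr>),
      restriction = (\<lambda>U V x. Family (restrict (family x) V))\<rparr>"

definition germ_family ::
  "'a topology \<Rightarrow> ('a, ('a, 'b) gsec) presheaf \<Rightarrow> 'a set \<Rightarrow> ('a, 'b) gsec \<Rightarrow> ('a, 'b) gsec" where
  "germ_family X F U s = Family (\<lambda>p\<in>U. germ X F p U s)"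

text \<open>The sheaf associated to a presheaf: families of germs that are locally induced by sections.\<close>

definition sheafification ::
  "'a topology \<Rightarrow> ('a, ('a, 'b) gsec) presheaf \<Rightarrow> ('a, ('a, 'b) gsec) presheaf" where
  "sheafification X P =
     \<lparr>sections = (\<lambda>U. (sections (godement_sheaf X P) U)
        \<lparr>carrier := {x \<in> carrier (sections (godement_sheaf X P) U).
           \<forall>p\<in>U. \<exists>V t. openin X V \<and> p \<in> V \<and> V \<subseteq> U \<and> t \<in> carrier (sections P V) \<and>
             restriction (godement_sheaf X P) U V x = germ_family X P V t}\<rparr>),
      restriction = restriction (godement_sheaf X P)\<rparr>"

text \<open>The quotient presheaf \<open>U \<mapsto> G(U)/S(U)\<close>, cosets being replaced by chosen representatives.\<close>

definition coset_rep :: "'v monoid \<Rightarrow> 'v set \<Rightarrow> 'v \<Rightarrow> 'v" where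
  "coset_rep G H x = (SOME y. y \<in> H #>\<^bsub>G\<^esub> x)"

definition quotient_presheaf :: "('a, 'v) presheaf \<Rightarrow> ('a set \<Rightarrow> 'v set) \<Rightarrow> ('a, 'v) presheaf" where
  "quotient_presheaf G S =
     \<lparr>sections = (\<lambda>U. let \<pi> = coset_rep (sections G U) (S U) in
        \<lparr>carrier = \<pi> ` carrier (sections G U),
         monoid.mult = (\<lambda>x y. \<pi> (x \<otimes>\<^bsub>sections G U\<^esub> y)),
         one = \<pi> \<one>\<^bsub>sections G U\<^esub>\<rparr>),
      restriction = (\<lambda>U V x. coset_rep (sections G V) (S V) (restriction G U V x))\<rparr>"


section \<open>The Godement resolution\<close>

definition germ_image :: "'a topology \<Rightarrow> ('a, ('a, 'b) gsec) presheaf \<Rightarrow> 'a set \<Rightarrow> ('a, 'b) gsec set"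
  where
  "germ_image X F U = germ_family X F U ` carrier (sections F U)"

definition godement_quotient_presheaf ::
  "'a topology \<Rightarrow> ('a, ('a, 'b) gsec) presheaf \<Rightarrow> ('a, ('a, 'b) gsec) presheaf" where
  "godement_quotient_presheaf X F = quotient_presheaf (godement_sheaf X F) (germ_image X F)"

primrec godement_Q ::
  "'a topology \<Rightarrow> ('a, ('a, 'b) gsec) presheaf \<Rightarrow> nat \<Rightarrow> ('a, ('a, 'b) gsec) presheaf" where
  "godement_Q X F 0 = F"
| "godement_Q X F (Suc k) = sheafification X (godement_quotient_presheaf X (godement_Q X F k))"

definition godement_C ::
  "'a topology \<Rightarrow> ('a, ('a, 'b) gsec) presheaf \<Rightarrow> nat \<Rightarrow> ('a, ('a, 'b) gsec) presheaf" where
  "godement_C X F k = godement_sheaf X (godement_Q X F k)"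

text \<open>\<open>\<delta> : \<C>\<^sup>kF \<rightarrow> Q\<^sup>k\<^sup>+\<^sup>1 \<rightarrow> \<C>\<^sup>0Q\<^sup>k\<^sup>+\<^sup>1 = \<C>\<^sup>k\<^sup>+\<^sup>1F\<close> on sections over \<open>U\<close>.\<close>

definition godement_to_Q ::
  "'a topology \<Rightarrow> ('a, ('a, 'b) gsec) presheaf \<Rightarrow> nat \<Rightarrow> 'a set \<Rightarrow> ('a, 'b) gsec \<Rightarrow> ('a, 'b) gsec"
  where
  "godement_to_Q X F k U x =
     germ_family X (godement_quotient_presheaf X (godement_Q X F k)) U
       (coset_rep (sections (godement_C X F k) U) (germ_image X (godement_Q X F k) U) x)"

definition godement_delta ::
  "'a topology \<Rightarrow> ('a, ('a, 'b) gsec) presheaf \<Rightarrow> nat \<Rightarrow> 'a set \<Rightarrow> ('a, 'b) gsec \<Rightarrow> ('a, 'b) gsec"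
  where
  "godement_delta X F k U x = germ_family X (godement_Q X F (Suc k)) U (godement_to_Q X F k U x)"

text \<open>
  Functoriality. A morphism \<open>F \<rightarrow> G\<close> is given by its maps \<open>f U : F(U) \<rightarrow> G(U)\<close>. As germs carry
  representatives, the source does not occur in the formulas. \<open>family_map X G f\<close> serves both as
  \<open>\<C>\<^sup>0F \<rightarrow> \<C>\<^sup>0G\<close> and as the map of associated sheaves.
\<close>

definition family_map ::
  "'a topology \<Rightarrow> ('a, ('a, 'b) gsec) presheaf \<Rightarrow> ('a set \<Rightarrow> ('a, 'b) gsec \<Rightarrow> ('a, 'b) gsec)
    \<Rightarrow> 'a set \<Rightarrow> ('a, 'b) gsec \<Rightarrow> ('a, 'b) gsec" where
  "family_map X G f U x =
     Family (\<lambda>p\<in>U. case family x p of (V, s) \<Rightarrow> germ X G p V (f V s))"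

primrec godement_Q_map ::
  "'a topology \<Rightarrow> ('a, ('a, 'b) gsec) presheaf \<Rightarrow> ('a set \<Rightarrow> ('a, 'b) gsec \<Rightarrow> ('a, 'b) gsec)
    \<Rightarrow> nat \<Rightarrow> 'a set \<Rightarrow> ('a, 'b) gsec \<Rightarrow> ('a, 'b) gsec" where
  "godement_Q_map X G f 0 = f"
| "godement_Q_map X G f (Suc k) =
     family_map X (godement_quotient_presheaf X (godement_Q X G k))
       (\<lambda>U x. coset_rep (sections (godement_C X G k) U) (germ_image X (godement_Q X G k) U)
          (family_map X (godement_Q X G k) (godement_Q_map X G f k) U x))"

definition godement_C_map ::
  "'a topology \<Rightarrow> ('a, ('a, 'b) gsec) presheaf \<Rightarrow> ('a set \<Rightarrow> ('a, 'b) gsec \<Rightarrow> ('a, 'b) gsec)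
    \<Rightarrow> nat \<Rightarrow> 'a set \<Rightarrow> ('a, 'b) gsec \<Rightarrow> ('a, 'b) gsec" where
  "godement_C_map X G f k = family_map X (godement_Q X G k) (godement_Q_map X G f k)"


section \<open>Cohomology of cochain complexes of abelian groups\<close>

definition coboundaries :: "(nat \<Rightarrow> 'c monoid) \<Rightarrow> (nat \<Rightarrow> 'c \<Rightarrow> 'c) \<Rightarrow> nat \<Rightarrow> 'c set" where
  "coboundaries K D k =
     (case k of 0 \<Rightarrow> {\<one>\<^bsub>K 0\<^esub>} | Suc j \<Rightarrow> D j ` carrier (K j))"

definition cohomology_group :: "(nat \<Rightarrow> 'c monoid) \<Rightarrow> (nat \<Rightarrow> 'c \<Rightarrow> 'c) \<Rightarrow> nat \<Rightarrow> 'c set monoid" where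
  "cohomology_group K D k =
     subgroup_generated (K k) (kernel (K k) (K (Suc k)) (D k)) Mod coboundaries K D k"

text \<open>
  The map induced by a cochain map into \<open>(K, D)\<close>; the image of a coset is only part of a coset, so
  the coboundaries are added again.
\<close>

definition cohomology_map ::
  "(nat \<Rightarrow> 'c monoid) \<Rightarrow> (nat \<Rightarrow> 'c \<Rightarrow> 'c) \<Rightarrow> (nat \<Rightarrow> 'e \<Rightarrow> 'c) \<Rightarrow> nat \<Rightarrow> 'e set \<Rightarrow> 'c set" where
  "cohomology_map K D f k x = coboundaries K D k <#>\<^bsub>K k\<^esub> (f k ` x)"


section \<open>Hypercohomology\<close>

text \<open>\<open>L q\<close> are the sheaves of the complex and \<open>d q : L q \<rightarrow> L (q+1)\<close> its differentials.\<close>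

definition godement_bicomplex ::
  "'a topology \<Rightarrow> (nat \<Rightarrow> ('a, ('a, 'b) gsec) presheaf) \<Rightarrow> nat \<Rightarrow> nat \<Rightarrow> ('a, 'b) gsec monoid" where
  "godement_bicomplex X L p q = sections (godement_C X (L q) p) (topspace X)"

text \<open>An element of \<open>K\<^sup>k\<close> is the family, indexed by \<open>p \<le> k\<close>, of its components in \<open>K\<^sup>p\<^sup>,\<^sup>k\<^sup>-\<^sup>p\<close>.\<close>

definition total_group ::
  "'a topology \<Rightarrow> (nat \<Rightarrow> ('a, ('a, 'b) gsec) presheaf) \<Rightarrow> nat \<Rightarrow> (nat \<Rightarrow> ('a, 'b) gsec) monoid" where
  "total_group X L k = product_group {..k} (\<lambda>p. godement_bicomplex X L p (k - p))"

text \<open>\<open>D = \<delta> + (-1)\<^sup>p d\<close>; in degree \<open>k + 1\<close> the \<open>p\<close>-component is \<open>\<delta> x\<^sub>p\<^sub>-\<^sub>1 + (-1)\<^sup>p d x\<^sub>p\<close>.\<close>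

definition total_differential ::
  "'a topology \<Rightarrow> (nat \<Rightarrow> ('a, ('a, 'b) gsec) presheaf)
    \<Rightarrow> (nat \<Rightarrow> 'a set \<Rightarrow> ('a, 'b) gsec \<Rightarrow> ('a, 'b) gsec)
    \<Rightarrow> nat \<Rightarrow> (nat \<Rightarrow> ('a, 'b) gsec) \<Rightarrow> nat \<Rightarrow> ('a, 'b) gsec" where
  "total_differential X L d k x = (\<lambda>p\<in>{..Suc k}.
     let G = godement_bicomplex X L p (Suc k - p) in
       (case p of 0 \<Rightarrow> \<one>\<^bsub>G\<^esub>
          | Suc r \<Rightarrow> godement_delta X (L (k - r)) r (topspace X) (x r))
       \<otimes>\<^bsub>G\<^esub>
       (if p \<le> k
        then godement_C_map X (L (Suc (k - p))) (d (k - p)) p (topspace X) (x p)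
               [^]\<^bsub>G\<^esub> ((- 1 :: int) ^ p)
        else \<one>\<^bsub>G\<^esub>))"

definition hypercohomology ::
  "'a topology \<Rightarrow> (nat \<Rightarrow> ('a, ('a, 'b) gsec) presheaf)
    \<Rightarrow> (nat \<Rightarrow> 'a set \<Rightarrow> ('a, 'b) gsec \<Rightarrow> ('a, 'b) gsec)
    \<Rightarrow> nat \<Rightarrow> (nat \<Rightarrow> ('a, 'b) gsec) set monoid" where
  "hypercohomology X L d = cohomology_group (total_group X L) (total_differential X L d)"

text \<open>The map into the hypercohomology of \<open>(L, d)\<close> induced by a morphism \<open>f\<close> of complexes into it.\<close>

definition hypercohomology_map ::
  "'a topology \<Rightarrow> (nat \<Rightarrow> ('a, ('a, 'b) gsec) presheaf)
    \<Rightarrow> (nat \<Rightarrow> 'a set \<Rightarrow> ('a, 'b) gsec \<Rightarrow> ('a, 'b) gsec)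
    \<Rightarrow> (nat \<Rightarrow> 'a set \<Rightarrow> ('a, 'b) gsec \<Rightarrow> ('a, 'b) gsec)
    \<Rightarrow> nat \<Rightarrow> (nat \<Rightarrow> ('a, 'b) gsec) set \<Rightarrow> (nat \<Rightarrow> ('a, 'b) gsec) set" where
  "hypercohomology_map X L d f =
     cohomology_map (total_group X L) (total_differential X L d)
       (\<lambda>k x. \<lambda>p\<in>{..k}. godement_C_map X (L (k - p)) (f (k - p)) p (topspace X) (x p))"


section \<open>The holomorphic de Rham complex\<close>

definition Omega ::
  "nat \<Rightarrow> 'a topology \<Rightarrow> 'a chart set \<Rightarrow> nat \<Rightarrow> ('a, ('a, 'a form) gsec) presheaf" where
  "Omega n X A k =
     \<lparr>sections = (\<lambda>U.
        \<lparr>carrier = Base ` holomorphic_forms n X A k U,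
         monoid.mult = (\<lambda>x y. Base (\<lambda>p vs. base x p vs + base y p vs)),
         one = Base (\<lambda>p vs. 0)\<rparr>),
      restriction = (\<lambda>U V x. Base (\<lambda>p vs. if p \<in> V then base x p vs else 0))\<rparr>"

definition d_Omega ::
  "nat \<Rightarrow> 'a topology \<Rightarrow> 'a chart set \<Rightarrow> nat \<Rightarrow> 'a set
    \<Rightarrow> ('a, 'a form) gsec \<Rightarrow> ('a, 'a form) gsec" where
  "d_Omega n X A k U x = Base (exterior_derivative n X A k U (base x))"

text \<open>Multiplication by a complex number, an endomorphism of every sheaf \<^term>\<open>Omega n X A k\<close>.\<close>

definition scale_Omega :: "complex \<Rightarrow> 'a set \<Rightarrow> ('a, 'a form) gsec \<Rightarrow> ('a, 'a form) gsec" where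
  "scale_Omega c U x = Base (\<lambda>p vs. c * base x p vs)"


section \<open>Singular cohomology with complex coefficients\<close>

definition complex_group :: "complex monoid" where
  "complex_group = \<lparr>carrier = UNIV, monoid.mult = (+), one = 0\<rparr>"

definition singular_cochain_group :: "'a topology \<Rightarrow> nat \<Rightarrow> ('a chain \<Rightarrow> complex) monoid" where
  "singular_cochain_group X k =
     \<lparr>carrier = hom (chain_group k X) complex_group \<inter> extensional (carrier (chain_group k X)),
      monoid.mult = (\<lambda>f g. \<lambda>x\<in>carrier (chain_group k X). f x + g x),
      one = (\<lambda>x\<in>carrier (chain_group k X). 0)\<rparr>"

definition singular_coboundary ::
  "'a topology \<Rightarrow> nat \<Rightarrow> ('a chain \<Rightarrow> complex) \<Rightarrow> 'a chain \<Rightarrow> complex" where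
  "singular_coboundary X k f =
     (\<lambda>x\<in>carrier (chain_group (Suc k) X). f (chain_boundary (Suc k) x))"

definition singular_cohomology :: "'a topology \<Rightarrow> nat \<Rightarrow> ('a chain \<Rightarrow> complex) set monoid" where
  "singular_cohomology X = cohomology_group (singular_cochain_group X) (singular_coboundary X)"

definition scale_singular_cohomology ::
  "complex \<Rightarrow> 'a topology \<Rightarrow> nat \<Rightarrow> ('a chain \<Rightarrow> complex) set \<Rightarrow> ('a chain \<Rightarrow> complex) set" where
  "scale_singular_cohomology c X =
     cohomology_map (singular_cochain_group X) (singular_coboundary X)
       (\<lambda>k f. \<lambda>x\<in>carrier (chain_group k X). c * f x)"

end

theory Submission
  imports Defs "Jordan_Normal_Form.Determinant" "HOL-Complex_Analysis.Cauchy_Integral_Formula"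
begin

text \<open>
  By the holomorphic Poincare lemma the complex \<open>0 \<rightarrow> \<complex> \<rightarrow> \<Omega>\<^sup>0 \<rightarrow> \<Omega>\<^sup>1 \<rightarrow> \<dots>\<close> is locally exact. So is
  \<open>0 \<rightarrow> \<complex> \<rightarrow> S\<^sup>0 \<rightarrow> S\<^sup>1 \<rightarrow> \<dots>\<close> for the presheaves \<open>S\<^sup>q\<close> of singular cochains, since polydiscs are
  contractible and \<open>\<complex>\<close> is an injective abelian group. The functors \<open>\<Gamma>(X, \<C>\<^sup>p -)\<close> see only germs and are
  exact, so the total complex of \<open>\<Gamma>(X, \<C>\<^sup>p \<Omega>\<^sup>q)\<close> and that of \<open>\<Gamma>(X, \<C>\<^sup>p S\<^sup>q)\<close> both have the cohomology of
  \<open>\<Gamma>(X, \<C>\<^sup>p \<complex>)\<close>. Finally, \<open>S\<^sup>q\<close> is flabby and its sections map onto those of the associated sheaf, by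
  paracompactness. Hence the Godement direction of the second double complex is exact in positive
  degrees, and what remains are the singular cochains modulo the locally vanishing ones, which form
  an acyclic complex by barycentric subdivision.
\<close>


section \<open>Presheaves of abelian groups\<close>

text \<open>The comparison takes place on presheaves, not on sheaves, and this shapes most
  definitions below. Neither the constant presheaf nor the presheaves of singular cochains are
  sheaves: a cochain may vanish on all small simplices without being zero. Hence
  \<open>flabby\<close> asks for gluing but not for separatedness, exactness is tested on germs, and
  the edge map from the singular complex into its double complex has a kernel whose acyclicity is a
  separate matter. Every \<open>QQ\<close>, however, is an honest sheaf, and there local equalities
  become global ones. Germs and cosets are representatives picked by Hilbert choice; they are
  handled through \<open>germ_eq_iff\<close> and \<open>coset_rep_props\<close>. All presheaves
  joined by morphisms must share one type of sections. Since the chain of comparisons contains an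
  arrow in the wrong direction, cohomology is compared by relations between cocycles, which can be
  reversed and composed. Multiplication by complex numbers is carried through every comparison, so
  that the final isomorphism respects it.\<close>

abbreviation Sc :: "('a, 'v) presheaf \<Rightarrow> 'a set \<Rightarrow> 'v set" where
  "Sc F U \<equiv> carrier (sections F U)"

locale abpresheaf =
  fixes X :: "'a topology" and F :: "('a, 'v) presheaf"
  assumes sections_comm_group: "openin X U \<Longrightarrow> comm_group (sections F U)"
    and res_hom: "\<lbrakk>openin X U; openin X V; V \<subseteq> U\<rbrakk>
      \<Longrightarrow> restriction F U V \<in> hom (sections F U) (sections F V)"
    and res_id: "\<lbrakk>openin X U; s \<in> Sc F U\<rbrakk> \<Longrightarrow> restriction F U U s = s"
    and res_res: "\<lbrakk>openin X U; openin X V; openin X W; V \<subseteq> U; W \<subseteq> V; s \<in> Sc F U\<rbrakk>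
      \<Longrightarrow> restriction F V W (restriction F U V s) = restriction F U W s"

text \<open>The relation whose classes \<open>germ\<close> represents, isolated because a chosen
  representative can only be used through it.\<close>

definition same_germ :: "'a topology \<Rightarrow> ('a, 'v) presheaf \<Rightarrow> 'a \<Rightarrow> 'a set \<Rightarrow> 'v \<Rightarrow> 'a set \<Rightarrow> 'v \<Rightarrow> bool"
  where "same_germ X F p U s V t \<longleftrightarrow>
    (\<exists>W. openin X W \<and> p \<in> W \<and> W \<subseteq> U \<inter> V \<and> restriction F U W s = restriction F V W t)"

lemma group_hom_of:
  assumes "comm_group G" "comm_group H" "f \<in> hom G H"
  shows "group_hom G H f"
  using assms by (simp add: comm_group_def group_hom_axioms_def group_hom_def)

text \<open>Serves the two constructions whose carriers are defined as images, namely families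
  wrapped by \<open>Family\<close> and chosen coset representatives; each group law is read off from
  preimages.\<close>

lemma comm_group_surj:
  assumes G: "comm_group G" and im: "h ` carrier G = carrier H"
    and mult: "\<And>x y. \<lbrakk>x \<in> carrier G; y \<in> carrier G\<rbrakk> \<Longrightarrow> h (x \<otimes>\<^bsub>G\<^esub> y) = h x \<otimes>\<^bsub>H\<^esub> h y"
    and one: "h \<one>\<^bsub>G\<^esub> = \<one>\<^bsub>H\<^esub>"
  shows "comm_group H"
proof -
  interpret comm_group G by fact
  have car: "h x \<in> carrier H" if "x \<in> carrier G" for x using im that by blast
  have ex: "\<exists>a\<in>carrier G. x = h a" if "x \<in> carrier H" for x using im that by blast
  show ?thesis
  proof (rule comm_groupI)
    show "x \<otimes>\<^bsub>H\<^esub> y \<in> carrier H" if "x \<in> carrier H" "y \<in> carrier H" for x y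
      using ex[OF that(1)] ex[OF that(2)] by (metis mult car m_closed)
    show "\<one>\<^bsub>H\<^esub> \<in> carrier H" using car one by (metis one_closed)
    show "x \<otimes>\<^bsub>H\<^esub> y \<otimes>\<^bsub>H\<^esub> z = x \<otimes>\<^bsub>H\<^esub> (y \<otimes>\<^bsub>H\<^esub> z)"
      if "x \<in> carrier H" "y \<in> carrier H" "z \<in> carrier H" for x y z
      using ex[OF that(1)] ex[OF that(2)] ex[OF that(3)] by (metis mult m_assoc m_closed)
    show "x \<otimes>\<^bsub>H\<^esub> y = y \<otimes>\<^bsub>H\<^esub> x" if "x \<in> carrier H" "y \<in> carrier H" for x y
      using ex[OF that(1)] ex[OF that(2)] by (metis mult m_comm)
    show "\<one>\<^bsub>H\<^esub> \<otimes>\<^bsub>H\<^esub> x = x" if "x \<in> carrier H" for x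
      using ex[OF that] by (metis mult one one_closed l_one)
    show "\<exists>y\<in>carrier H. y \<otimes>\<^bsub>H\<^esub> x = \<one>\<^bsub>H\<^esub>" if "x \<in> carrier H" for x
      using ex[OF that] by (metis mult one inv_closed l_inv car)
  qed
qed

context abpresheaf
begin

lemma res_closed [intro]: "\<lbrakk>openin X U; openin X V; V \<subseteq> U; s \<in> Sc F U\<rbrakk> \<Longrightarrow> restriction F U V s \<in> Sc F V"
  using res_hom by (auto simp: hom_def)

lemma res_mult: "\<lbrakk>openin X U; openin X V; V \<subseteq> U; s \<in> Sc F U; t \<in> Sc F U\<rbrakk> \<Longrightarrow>
   restriction F U V (s \<otimes>\<^bsub>sections F U\<^esub> t) = restriction F U V s \<otimes>\<^bsub>sections F V\<^esub> restriction F U V t"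
  using res_hom by (auto simp: hom_def)

lemma sections_group: "openin X U \<Longrightarrow> group (sections F U)"
  using sections_comm_group comm_group_def by blast

lemma res_one: "\<lbrakk>openin X U; openin X V; V \<subseteq> U\<rbrakk> \<Longrightarrow> restriction F U V \<one>\<^bsub>sections F U\<^esub> = \<one>\<^bsub>sections F V\<^esub>"
  using hom_one[OF res_hom sections_group sections_group] by blast

lemma one_closed [intro]: "openin X U \<Longrightarrow> \<one>\<^bsub>sections F U\<^esub> \<in> Sc F U"
  using sections_group group.is_monoid monoid.one_closed by blast

lemma mult_closed [intro]: "\<lbrakk>openin X U; s \<in> Sc F U; t \<in> Sc F U\<rbrakk> \<Longrightarrow> s \<otimes>\<^bsub>sections F U\<^esub> t \<in> Sc F U"
  using sections_group group.is_monoid monoid.m_closed by metis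

lemma inv_closed [intro]: "\<lbrakk>openin X U; s \<in> Sc F U\<rbrakk> \<Longrightarrow> inv\<^bsub>sections F U\<^esub> s \<in> Sc F U"
  using sections_group group.inv_closed by metis

lemma res_inv: "\<lbrakk>openin X U; openin X V; V \<subseteq> U; s \<in> Sc F U\<rbrakk> \<Longrightarrow>
   restriction F U V (inv\<^bsub>sections F U\<^esub> s) = inv\<^bsub>sections F V\<^esub> (restriction F U V s)"
  by (rule group_hom.hom_inv[OF group_hom_of[OF sections_comm_group sections_comm_group res_hom]])

lemma same_germ_refl: "\<lbrakk>openin X U; p \<in> U\<rbrakk> \<Longrightarrow> same_germ X F p U s U s"
  by (auto simp: same_germ_def)

lemma same_germ_sym: "same_germ X F p U s V t \<Longrightarrow> same_germ X F p V t U s"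
  unfolding same_germ_def by (metis Int_commute)

lemma same_germ_trans:
  assumes st: "same_germ X F p U s V t" "same_germ X F p V t W u"
    and op: "openin X U" "openin X V" "openin X W"
    and sec: "s \<in> Sc F U" "t \<in> Sc F V" "u \<in> Sc F W"
  shows "same_germ X F p U s W u"
proof -
  obtain A where A: "openin X A" "p \<in> A" "A \<subseteq> U \<inter> V" "restriction F U A s = restriction F V A t"
    using st by (auto simp: same_germ_def)
  obtain B where B: "openin X B" "p \<in> B" "B \<subseteq> V \<inter> W" "restriction F V B t = restriction F W B u"
    using st by (auto simp: same_germ_def)
  have o: "openin X (A \<inter> B)" using A B by blast
  have "restriction F U (A \<inter> B) s = restriction F A (A \<inter> B) (restriction F U A s)"
    using res_res[of U A "A \<inter> B" s] A o op sec by auto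
  also have "\<dots> = restriction F V (A \<inter> B) t"
    using res_res[of V A "A \<inter> B" t] A o op sec by auto
  also have "\<dots> = restriction F B (A \<inter> B) (restriction F V B t)"
    using res_res[of V B "A \<inter> B" t] B o op sec by auto
  also have "\<dots> = restriction F W (A \<inter> B) u"
    using res_res[of W B "A \<inter> B" u] B o op sec by auto
  finally show ?thesis unfolding same_germ_def using A B o by (intro exI[of _ "A \<inter> B"]) auto
qed

text \<open>The choice in \<open>germ\<close> is not void: the pair \<open>(U, s)\<close> is itself
  a candidate.\<close>

lemma germ_rep:
  assumes "openin X U" "p \<in> U" "s \<in> Sc F U"
  obtains V t where "germ X F p U s = (V, t)" "openin X V" "p \<in> V" "t \<in> Sc F V" "same_germ X F p U s V t"
proof -
  let ?P = "\<lambda>(V, t). openin X V \<and> p \<in> V \<and> t \<in> Sc F V \<and> same_germ X F p U s V t"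
  have "?P (U, s)" using assms same_germ_refl by auto
  then have "?P (SOME x. ?P x)" by (rule someI)
  moreover have "germ X F p U s = (SOME x. ?P x)"
    unfolding germ_def same_germ_def by (rule arg_cong[where f = Eps]) auto
  ultimately have "?P (germ X F p U s)" by simp
  then show ?thesis using that by (cases "germ X F p U s") auto
qed

text \<open>Equivalent inputs hand the choice operator the very same predicate, so the chosen
  representatives coincide. This is what allows them to stand for equivalence classes.\<close>

lemma germ_eq_iff:
  assumes "openin X U" "p \<in> U" "s \<in> Sc F U" "openin X V" "p \<in> V" "t \<in> Sc F V"
  shows "germ X F p U s = germ X F p V t \<longleftrightarrow> same_germ X F p U s V t"
proof
  assume e: "germ X F p U s = germ X F p V t"
  obtain W u where W: "germ X F p U s = (W, u)" "openin X W" "u \<in> Sc F W" "same_germ X F p U s W u"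
    using germ_rep[OF assms(1-3)] by metis
  moreover have "same_germ X F p V t W u"
    using germ_rep[OF assms(4-6)] e W(1) by (metis prod.inject)
  ultimately show "same_germ X F p U s V t"
    using same_germ_trans same_germ_sym assms by metis
next
  assume s: "same_germ X F p U s V t"
  have "same_germ X F p U s W u \<longleftrightarrow> same_germ X F p V t W u" if "openin X W" "u \<in> Sc F W" for W u
    using same_germ_trans[OF s, of W u] same_germ_trans[OF same_germ_sym[OF s], of W u] that assms by blast
  then have "(\<lambda>(W, u). openin X W \<and> p \<in> W \<and> u \<in> Sc F W \<and> same_germ X F p U s W u) =
     (\<lambda>(W, u). openin X W \<and> p \<in> W \<and> u \<in> Sc F W \<and> same_germ X F p V t W u)"
    by fastforce
  then show "germ X F p U s = germ X F p V t"
    unfolding germ_def same_germ_def by metis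
qed

lemma germ_res:
  assumes "openin X U" "openin X V" "V \<subseteq> U" "p \<in> V" "s \<in> Sc F U"
  shows "germ X F p V (restriction F U V s) = germ X F p U s"
proof -
  have "restriction F V V (restriction F U V s) = restriction F U V s"
    using assms res_id by blast
  then have "same_germ X F p V (restriction F U V s) U s"
    unfolding same_germ_def using assms by (intro exI[of _ V]) auto
  then show ?thesis using assms by (subst germ_eq_iff) auto
qed

section \<open>The groups of germs\<close>

lemma stalkI: "\<lbrakk>openin X U; p \<in> U; s \<in> Sc F U\<rbrakk> \<Longrightarrow> germ X F p U s \<in> carrier (stalk X F p)"
  by (auto simp: stalk_def)

lemma stalkE:
  assumes "g \<in> carrier (stalk X F p)"
  obtains U s where "openin X U" "p \<in> U" "s \<in> Sc F U" "g = germ X F p U s"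
  using assms by (auto simp: stalk_def)

lemma stalk_rep:
  assumes "g \<in> carrier (stalk X F p)"
  shows "openin X (fst g)" "p \<in> fst g" "snd g \<in> Sc F (fst g)" "germ X F p (fst g) (snd g) = g"
proof -
  obtain U s where U: "openin X U" "p \<in> U" "s \<in> Sc F U" "g = germ X F p U s"
    using assms by (rule stalkE)
  then obtain V t where V: "germ X F p U s = (V, t)" "openin X V" "p \<in> V" "t \<in> Sc F V" "same_germ X F p U s V t"
    using germ_rep by metis
  then show "openin X (fst g)" "p \<in> fst g" "snd g \<in> Sc F (fst g)" using U by auto
  show "germ X F p (fst g) (snd g) = g" using V U germ_eq_iff by fastforce
qed

lemma stalk_common:
  assumes "g \<in> carrier (stalk X F p)" "h \<in> carrier (stalk X F p)"
  obtains U s t where "openin X U" "p \<in> U" "s \<in> Sc F U" "t \<in> Sc F U" "g = germ X F p U s" "h = germ X F p U t"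
proof -
  obtain U s where U: "openin X U" "p \<in> U" "s \<in> Sc F U" "g = germ X F p U s"
    using assms(1) by (rule stalkE)
  obtain V t where V: "openin X V" "p \<in> V" "t \<in> Sc F V" "h = germ X F p V t"
    using assms(2) by (rule stalkE)
  have o: "openin X (U \<inter> V)" using U V by blast
  show ?thesis
    by (rule that[of "U \<inter> V" "restriction F U (U \<inter> V) s" "restriction F V (U \<inter> V) t"])
      (use U V o germ_res in auto)
qed

text \<open>The product of \<open>stalk\<close> multiplies the chosen representatives over the
  intersection of their domains. On the smaller set \<open>C\<close> they agree with
  \<open>s\<close> and \<open>t\<close>, which frees the product from the choice.\<close>

lemma stalk_mult:
  assumes U: "openin X U" "p \<in> U" "s \<in> Sc F U" "t \<in> Sc F U"
  shows "germ X F p U s \<otimes>\<^bsub>stalk X F p\<^esub> germ X F p U t = germ X F p U (s \<otimes>\<^bsub>sections F U\<^esub> t)"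
proof -
  obtain V s' where V: "germ X F p U s = (V, s')" "openin X V" "p \<in> V" "s' \<in> Sc F V" "same_germ X F p U s V s'"
    using U germ_rep by metis
  obtain W t' where W: "germ X F p U t = (W, t')" "openin X W" "p \<in> W" "t' \<in> Sc F W" "same_germ X F p U t W t'"
    using U germ_rep by metis
  obtain A where A: "openin X A" "p \<in> A" "A \<subseteq> U \<inter> V" "restriction F U A s = restriction F V A s'"
    using V by (auto simp: same_germ_def)
  obtain B where B: "openin X B" "p \<in> B" "B \<subseteq> U \<inter> W" "restriction F U B t = restriction F W B t'"
    using W by (auto simp: same_germ_def)
  define C where "C = A \<inter> B"
  have C: "openin X C" "p \<in> C" "C \<subseteq> A" "C \<subseteq> B" "C \<subseteq> U" "C \<subseteq> V" "C \<subseteq> W" "C \<subseteq> V \<inter> W"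
    using A B by (auto simp: C_def)
  have s: "restriction F U C s = restriction F V C s'"
    using res_res[of U A C s] res_res[of V A C s'] A C V U by auto
  have t: "restriction F U C t = restriction F W C t'"
    using res_res[of U B C t] res_res[of W B C t'] B C W U by auto
  have VW: "openin X (V \<inter> W)" using V W by blast
  define m where "m = restriction F V (V \<inter> W) s' \<otimes>\<^bsub>sections F (V \<inter> W)\<^esub> restriction F W (V \<inter> W) t'"
  have m: "m \<in> Sc F (V \<inter> W)" unfolding m_def using V W VW by auto
  have "restriction F (V \<inter> W) C m = restriction F V C s' \<otimes>\<^bsub>sections F C\<^esub> restriction F W C t'"
    unfolding m_def using V W VW C res_res[of V "V \<inter> W" C s'] res_res[of W "V \<inter> W" C t']
    by (subst res_mult) auto
  also have "\<dots> = restriction F U C (s \<otimes>\<^bsub>sections F U\<^esub> t)"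
    using U C s t by (subst res_mult) auto
  finally have "same_germ X F p (V \<inter> W) m U (s \<otimes>\<^bsub>sections F U\<^esub> t)"
    unfolding same_germ_def using C by (intro exI[of _ C]) auto
  then have "germ X F p (V \<inter> W) m = germ X F p U (s \<otimes>\<^bsub>sections F U\<^esub> t)"
    using m VW V W U by (subst germ_eq_iff) auto
  then show ?thesis by (simp add: V(1) W(1) stalk_def m_def)
qed

lemma stalk_one:
  assumes "openin X U" "p \<in> U"
  shows "germ X F p U \<one>\<^bsub>sections F U\<^esub> = \<one>\<^bsub>stalk X F p\<^esub>"
proof -
  have t: "openin X (topspace X)" "p \<in> topspace X" "U \<subseteq> topspace X"
    using assms openin_subset by auto
  have "germ X F p U (restriction F (topspace X) U \<one>\<^bsub>sections F (topspace X)\<^esub>) =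
      germ X F p (topspace X) \<one>\<^bsub>sections F (topspace X)\<^esub>"
    using assms t by (intro germ_res) auto
  then show ?thesis using assms t by (simp add: res_one stalk_def)
qed

lemma stalk_one_iff:
  assumes "openin X U" "p \<in> U" "s \<in> Sc F U"
  shows "germ X F p U s = \<one>\<^bsub>stalk X F p\<^esub> \<longleftrightarrow>
    (\<exists>W. openin X W \<and> p \<in> W \<and> W \<subseteq> U \<and> restriction F U W s = \<one>\<^bsub>sections F W\<^esub>)"
proof -
  have "germ X F p U s = \<one>\<^bsub>stalk X F p\<^esub> \<longleftrightarrow> same_germ X F p U s U \<one>\<^bsub>sections F U\<^esub>"
    using assms germ_eq_iff[OF assms, of U "\<one>\<^bsub>sections F U\<^esub>"] by (simp add: one_closed stalk_one)
  also have "\<dots> \<longleftrightarrow> (\<exists>W. openin X W \<and> p \<in> W \<and> W \<subseteq> U \<and> restriction F U W s = \<one>\<^bsub>sections F W\<^esub>)"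
    unfolding same_germ_def using assms res_one by (metis Int_absorb)
  finally show ?thesis .
qed

lemma stalk_comm_group:
  assumes p: "p \<in> topspace X"
  shows "comm_group (stalk X F p)"
proof (rule comm_groupI)
  fix g h k assume ghk: "g \<in> carrier (stalk X F p)" "h \<in> carrier (stalk X F p)" "k \<in> carrier (stalk X F p)"
  obtain V s1 t1 where 1: "openin X V" "p \<in> V" "s1 \<in> Sc F V" "t1 \<in> Sc F V"
     "g = germ X F p V s1" "h = germ X F p V t1" using stalk_common ghk by metis
  obtain W u where 2: "openin X W" "p \<in> W" "u \<in> Sc F W" "k = germ X F p W u"
    using stalkE ghk by metis
  define U where "U = V \<inter> W"
  have U: "openin X U" "p \<in> U" "U \<subseteq> V" "U \<subseteq> W" using 1 2 by (auto simp: U_def)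
  define a b c where "a = restriction F V U s1" "b = restriction F V U t1" "c = restriction F W U u"
  have abc: "a \<in> Sc F U" "b \<in> Sc F U" "c \<in> Sc F U" "g = germ X F p U a" "h = germ X F p U b" "k = germ X F p U c"
    unfolding a_b_c_def using 1 2 U germ_res by auto
  interpret comm_group "sections F U" using U sections_comm_group by blast
  show "g \<otimes>\<^bsub>stalk X F p\<^esub> h \<otimes>\<^bsub>stalk X F p\<^esub> k = g \<otimes>\<^bsub>stalk X F p\<^esub> (h \<otimes>\<^bsub>stalk X F p\<^esub> k)"
    using abc U by (simp add: stalk_mult m_assoc)
  show "g \<otimes>\<^bsub>stalk X F p\<^esub> h \<in> carrier (stalk X F p)"
    using abc U by (auto simp: stalk_mult intro: stalkI)
  show "g \<otimes>\<^bsub>stalk X F p\<^esub> h = h \<otimes>\<^bsub>stalk X F p\<^esub> g"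
    using abc U by (simp add: stalk_mult m_comm)
  show "\<one>\<^bsub>stalk X F p\<^esub> \<otimes>\<^bsub>stalk X F p\<^esub> g = g"
    using abc U by (simp add: stalk_mult flip: stalk_one[of U])
  show "\<exists>y\<in>carrier (stalk X F p). y \<otimes>\<^bsub>stalk X F p\<^esub> g = \<one>\<^bsub>stalk X F p\<^esub>"
    by (rule bexI[of _ "germ X F p U (inv\<^bsub>sections F U\<^esub> a)"])
      (use abc U in \<open>auto simp: stalk_mult stalkI simp flip: stalk_one[of U]\<close>)
next
  show "\<one>\<^bsub>stalk X F p\<^esub> \<in> carrier (stalk X F p)"
    using p stalk_one[of "topspace X" p] stalkI[of "topspace X" p] by (metis one_closed openin_topspace)
qed

end

section \<open>The sheaf of discontinuous sections\<close>

text \<open>The membership condition of \<open>sheafification\<close>, phrased by values of families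
  so that the sheaf axiom and \<open>flabby\<close> can use it as well.\<close>

definition induced :: "'a topology \<Rightarrow> ('a, ('a, 'b) gsec) presheaf \<Rightarrow> 'a set \<Rightarrow> ('a, 'b) gsec \<Rightarrow> bool" where
  "induced X F U x \<longleftrightarrow> x \<in> Sc (godement_sheaf X F) U \<and>
     (\<forall>p\<in>U. \<exists>V t. openin X V \<and> p \<in> V \<and> V \<subseteq> U \<and> t \<in> Sc F V \<and> (\<forall>q\<in>V. family x q = germ X F q V t))"

text \<open>Equivalent to separatedness together with gluing: passing from sections to compatible
  families of germs is a bijection.\<close>

definition is_sheaf :: "'a topology \<Rightarrow> ('a, ('a, 'b) gsec) presheaf \<Rightarrow> bool" where
  "is_sheaf X F \<longleftrightarrow> (\<forall>U. openin X U \<longrightarrow> inj_on (germ_family X F U) (Sc F U)) \<and>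
     (\<forall>U x. openin X U \<longrightarrow> induced X F U x \<longrightarrow> x \<in> germ_image X F U)"

lemma is_sheafD:
  assumes "is_sheaf X F" "openin X U"
  shows "\<lbrakk>s \<in> Sc F U; t \<in> Sc F U; germ_family X F U s = germ_family X F U t\<rbrakk> \<Longrightarrow> s = t"
    and "induced X F U x \<Longrightarrow> x \<in> germ_image X F U"
  using assms by (auto simp: is_sheaf_def inj_on_def)

lemma G_carrier: "Sc (godement_sheaf X F) U = Family ` (\<Pi>\<^sub>E p\<in>U. carrier (stalk X F p))"
  by (simp add: godement_sheaf_def Let_def)

lemma G_at: "\<lbrakk>x \<in> Sc (godement_sheaf X F) U; p \<in> U\<rbrakk> \<Longrightarrow> family x p \<in> carrier (stalk X F p)"
  by (auto simp: G_carrier)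

lemma G_memI: "(\<And>p. p \<in> U \<Longrightarrow> g p \<in> carrier (stalk X F p)) \<Longrightarrow> Family (restrict g U) \<in> Sc (godement_sheaf X F) U"
  by (auto simp: G_carrier)

lemma G_eqI: "\<lbrakk>x \<in> Sc (godement_sheaf X F) U; y \<in> Sc (godement_sheaf X F) U;
   \<And>p. p \<in> U \<Longrightarrow> family x p = family y p\<rbrakk> \<Longrightarrow> x = y"
  by (clarsimp simp: G_carrier) (metis PiE_ext)

lemma G_mult_at: "p \<in> U \<Longrightarrow>
   family (x \<otimes>\<^bsub>sections (godement_sheaf X F) U\<^esub> y) p = family x p \<otimes>\<^bsub>stalk X F p\<^esub> family y p"
  by (simp add: godement_sheaf_def Let_def)

lemma G_one_at: "p \<in> U \<Longrightarrow> family \<one>\<^bsub>sections (godement_sheaf X F) U\<^esub> p = \<one>\<^bsub>stalk X F p\<^esub>"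
  by (simp add: godement_sheaf_def Let_def)

lemma G_res_at: "p \<in> V \<Longrightarrow> family (restriction (godement_sheaf X F) U V x) p = family x p"
  by (simp add: godement_sheaf_def)

lemma germ_family_at: "p \<in> U \<Longrightarrow> family (germ_family X F U s) p = germ X F p U s"
  by (simp add: germ_family_def)

definition pshom :: "'a topology \<Rightarrow> ('a, 'v) presheaf \<Rightarrow> ('a, 'v) presheaf \<Rightarrow> ('a set \<Rightarrow> 'v \<Rightarrow> 'v) \<Rightarrow> bool" where
  "pshom X F G f \<longleftrightarrow> (\<forall>U. openin X U \<longrightarrow> f U \<in> hom (sections F U) (sections G U)) \<and>
    (\<forall>U V s. openin X U \<longrightarrow> openin X V \<longrightarrow> V \<subseteq> U \<longrightarrow> s \<in> Sc F U \<longrightarrow>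
        restriction G U V (f U s) = f V (restriction F U V s))"

lemma pshomD:
  assumes "pshom X F G f" "openin X U"
  shows "s \<in> Sc F U \<Longrightarrow> f U s \<in> Sc G U"
    and "\<lbrakk>s \<in> Sc F U; t \<in> Sc F U\<rbrakk> \<Longrightarrow> f U (s \<otimes>\<^bsub>sections F U\<^esub> t) = f U s \<otimes>\<^bsub>sections G U\<^esub> f U t"
    and "\<lbrakk>openin X V; V \<subseteq> U; s \<in> Sc F U\<rbrakk> \<Longrightarrow> restriction G U V (f U s) = f V (restriction F U V s)"
    and "f U \<in> hom (sections F U) (sections G U)"
  using assms by (auto simp: pshom_def hom_def)

lemma pshom_one:
  assumes "abpresheaf X F" "abpresheaf X G" "pshom X F G f" "openin X U"
  shows "f U \<one>\<^bsub>sections F U\<^esub> = \<one>\<^bsub>sections G U\<^esub>"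
  by (rule hom_one[OF pshomD(4)[OF assms(3,4)] abpresheaf.sections_group[OF assms(1,4)] abpresheaf.sections_group[OF assms(2,4)]])

lemma pshom_inv:
  assumes "abpresheaf X F" "abpresheaf X G" "pshom X F G f" "openin X U" "s \<in> Sc F U"
  shows "f U (inv\<^bsub>sections F U\<^esub> s) = inv\<^bsub>sections G U\<^esub> (f U s)"
  by (rule group_hom.hom_inv[OF group_hom_of[OF abpresheaf.sections_comm_group[OF assms(1,4)]
     abpresheaf.sections_comm_group[OF assms(2,4)] pshomD(4)[OF assms(3,4)]] assms(5)])

locale gpresheaf = abpresheaf X F for X :: "'a topology" and F :: "('a, ('a, 'b) gsec) presheaf"
begin

abbreviation "GF \<equiv> godement_sheaf X F"

lemma G_comm_group:
  assumes "openin X U"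
  shows "comm_group (sections GF U)"
proof (rule comm_group_surj)
  have "U \<subseteq> topspace X" using assms openin_subset by blast
  then have g: "comm_group (stalk X F p)" if "p \<in> U" for p using that by (intro stalk_comm_group) auto
  have "group (product_group U (stalk X F))" by (intro product_group comm_group.axioms(2) g)
  then show "comm_group (product_group U (stalk X F))"
  proof (rule group.group_comm_groupI)
    fix x y assume "x \<in> carrier (product_group U (stalk X F))" "y \<in> carrier (product_group U (stalk X F))"
    then have "x i \<otimes>\<^bsub>stalk X F i\<^esub> y i = y i \<otimes>\<^bsub>stalk X F i\<^esub> x i" if "i \<in> U" for i
      using that by (intro comm_monoid.m_comm[OF comm_group.axioms(1)[OF g[OF that]]]) auto
    then show "x \<otimes>\<^bsub>product_group U (stalk X F)\<^esub> y = y \<otimes>\<^bsub>product_group U (stalk X F)\<^esub> x"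
      by (auto intro: restrict_ext)
  qed
  show "Family ` carrier (product_group U (stalk X F)) = Sc GF U" by (simp add: G_carrier)
qed (auto simp: godement_sheaf_def Let_def)

lemma G_res_closed: "V \<subseteq> U \<Longrightarrow> x \<in> Sc GF U \<Longrightarrow> restriction GF U V x \<in> Sc GF V"
  by (force simp: godement_sheaf_def Let_def)

lemma G_mult_closed: "openin X U \<Longrightarrow> x \<in> Sc GF U \<Longrightarrow> y \<in> Sc GF U \<Longrightarrow> x \<otimes>\<^bsub>sections GF U\<^esub> y \<in> Sc GF U"
  using G_comm_group by (meson comm_group.axioms(2) group.is_monoid monoid.m_closed)

lemma G_one_closed: "openin X U \<Longrightarrow> \<one>\<^bsub>sections GF U\<^esub> \<in> Sc GF U"
  using G_comm_group by (meson comm_group.axioms(2) group.is_monoid monoid.one_closed)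

lemma G_abpresheaf: "gpresheaf X GF"
proof (intro gpresheaf.intro abpresheaf.intro)
  show "comm_group (sections GF U)" if "openin X U" for U using G_comm_group that .
  show "restriction GF U V \<in> hom (sections GF U) (sections GF V)"
    if "openin X U" "openin X V" "V \<subseteq> U" for U V
    using that by (intro homI G_res_closed G_eqI[of _ X F V])
      (auto simp: G_res_at G_mult_at subset_iff intro!: G_mult_closed G_res_closed)
  show "restriction GF U U s = s" if "openin X U" "s \<in> Sc GF U" for U s
    using that by (intro G_eqI[of _ X F U]) (auto simp: G_res_at G_res_closed)
  show "restriction GF V W (restriction GF U V s) = restriction GF U W s"
    if "openin X U" "openin X V" "openin X W" "V \<subseteq> U" "W \<subseteq> V" "s \<in> Sc GF U" for U V W s
    using that by (intro G_eqI[of _ X F W]) (auto simp: G_res_at subset_iff intro!: G_res_closed)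
qed

lemma germ_family_closed: "openin X U \<Longrightarrow> s \<in> Sc F U \<Longrightarrow> germ_family X F U s \<in> Sc GF U"
  unfolding germ_family_def by (intro G_memI stalkI)

lemma germ_family_pshom: "pshom X F GF (germ_family X F)"
  unfolding pshom_def
proof (intro conjI allI impI)
  show "germ_family X F U \<in> hom (sections F U) (sections GF U)" if "openin X U" for U
    using that by (intro homI G_eqI[of _ X F U])
      (auto simp: germ_family_at G_mult_at stalk_mult intro: germ_family_closed G_mult_closed mult_closed)
  show "restriction GF U V (germ_family X F U s) = germ_family X F V (restriction F U V s)"
    if "openin X U" "openin X V" "V \<subseteq> U" "s \<in> Sc F U" for U V s
    using that by (intro G_eqI[of _ X F V])
      (auto simp: germ_family_at G_res_at germ_res subset_iff intro!: germ_family_closed G_res_closed)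
qed

lemma germ_family_eq_iff:
  assumes "openin X U" "x \<in> Sc GF U" "s \<in> Sc F U"
  shows "x = germ_family X F U s \<longleftrightarrow> (\<forall>p\<in>U. family x p = germ X F p U s)"
  using assms by (auto simp: germ_family_at intro!: G_eqI[of _ X F U] germ_family_closed)

lemma germ_family_locally_inj:
  assumes "openin X U" "p \<in> U" "s \<in> Sc F U" "germ_family X F U s = \<one>\<^bsub>sections GF U\<^esub>"
  obtains W where "openin X W" "p \<in> W" "W \<subseteq> U" "restriction F U W s = \<one>\<^bsub>sections F W\<^esub>"
proof -
  have "germ X F p U s = \<one>\<^bsub>stalk X F p\<^esub>"
    using assms by (metis G_one_at germ_family_at)
  then show ?thesis using assms that by (auto simp: stalk_one_iff)
qed

lemma germ_image_subgroup:
  assumes "openin X U"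
  shows "subgroup (germ_image X F U) (sections GF U)"
proof -
  interpret group_hom "sections F U" "sections GF U" "germ_family X F U"
    using assms germ_family_pshom by (intro group_hom_of sections_comm_group G_comm_group) (auto simp: pshom_def)
  show ?thesis unfolding germ_image_def by (rule img_is_subgroup)
qed

lemma induced_iff:
  assumes "openin X U"
  shows "induced X F U x \<longleftrightarrow> x \<in> Sc GF U \<and>
    (\<forall>p\<in>U. \<exists>V t. openin X V \<and> p \<in> V \<and> V \<subseteq> U \<and> t \<in> Sc F V \<and>
       restriction GF U V x = germ_family X F V t)"
proof -
  have "(\<forall>q\<in>V. family x q = germ X F q V t) \<longleftrightarrow> restriction GF U V x = germ_family X F V t"
    if "openin X V" "V \<subseteq> U" "t \<in> Sc F V" "x \<in> Sc GF U" for V t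
    using germ_family_eq_iff[OF that(1) G_res_closed[OF that(2,4)] that(3)] by (simp add: G_res_at)
  then show ?thesis
    unfolding induced_def by (intro conj_cong refl ball_cong iff_exI) assumption+
qed

lemma induced_local:
  assumes "openin X U" "x \<in> Sc GF U"
    and "\<And>p. p \<in> U \<Longrightarrow> \<exists>V. openin X V \<and> p \<in> V \<and> V \<subseteq> U \<and> induced X F V (restriction GF U V x)"
  shows "induced X F U x"
  unfolding induced_def
proof (intro conjI ballI assms)
  fix p assume "p \<in> U"
  then obtain V where V: "openin X V" "p \<in> V" "V \<subseteq> U" "induced X F V (restriction GF U V x)"
    using assms by blast
  then obtain W t where "openin X W" "p \<in> W" "W \<subseteq> V" "t \<in> Sc F W"
    "\<forall>q\<in>W. family (restriction GF U V x) q = germ X F q W t"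
    unfolding induced_def by blast
  then show "\<exists>V t. openin X V \<and> p \<in> V \<and> V \<subseteq> U \<and> t \<in> Sc F V \<and> (\<forall>q\<in>V. family x q = germ X F q V t)"
    using V by (metis G_res_at order.trans subsetD)
qed

lemma induced_res:
  assumes "openin X U" "openin X V" "V \<subseteq> U" "induced X F U x"
  shows "induced X F V (restriction GF U V x)"
  unfolding induced_def
proof (intro conjI ballI)
  show "restriction GF U V x \<in> Sc GF V" using assms by (auto simp: induced_def intro: G_res_closed)
  fix p assume p: "p \<in> V"
  then obtain W t where W: "openin X W" "p \<in> W" "W \<subseteq> U" "t \<in> Sc F W" "\<forall>q\<in>W. family x q = germ X F q W t"
    using assms unfolding induced_def by blast
  have "openin X (V \<inter> W)" using W assms by blast
  then show "\<exists>W t. openin X W \<and> p \<in> W \<and> W \<subseteq> V \<and> t \<in> Sc F W \<and> (\<forall>q\<in>W. family (restriction GF U V x) q = germ X F q W t)"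
    using W p by (intro exI[of _ "V \<inter> W"] exI[of _ "restriction F W (V \<inter> W) t"]) (auto simp: G_res_at germ_res)
qed

lemma induced_mult:
  assumes "openin X U" "induced X F U x" "induced X F U y"
  shows "induced X F U (x \<otimes>\<^bsub>sections GF U\<^esub> y)"
  unfolding induced_def
proof (intro conjI ballI)
  show "x \<otimes>\<^bsub>sections GF U\<^esub> y \<in> Sc GF U" using assms by (auto simp: induced_def intro: G_mult_closed)
  fix p assume p: "p \<in> U"
  obtain V s where V: "openin X V" "p \<in> V" "V \<subseteq> U" "s \<in> Sc F V" "\<forall>q\<in>V. family x q = germ X F q V s"
    using assms(2) p unfolding induced_def by blast
  obtain W t where W: "openin X W" "p \<in> W" "W \<subseteq> U" "t \<in> Sc F W" "\<forall>q\<in>W. family y q = germ X F q W t"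
    using assms(3) p unfolding induced_def by blast
  have o: "openin X (V \<inter> W)" using V W by blast
  show "\<exists>A r. openin X A \<and> p \<in> A \<and> A \<subseteq> U \<and> r \<in> Sc F A \<and>
      (\<forall>q\<in>A. family (x \<otimes>\<^bsub>sections GF U\<^esub> y) q = germ X F q A r)"
  proof (intro exI conjI ballI)
    show "restriction F V (V \<inter> W) s \<otimes>\<^bsub>sections F (V \<inter> W)\<^esub> restriction F W (V \<inter> W) t \<in> Sc F (V \<inter> W)"
      using V W o by auto
    fix q assume q: "q \<in> V \<inter> W"
    then have "family (x \<otimes>\<^bsub>sections GF U\<^esub> y) q = germ X F q V s \<otimes>\<^bsub>stalk X F q\<^esub> germ X F q W t"
      using V W by (auto simp: G_mult_at subset_iff)
    also have "germ X F q V s = germ X F q (V \<inter> W) (restriction F V (V \<inter> W) s)"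
      using V W o q by (intro germ_res[symmetric]) auto
    also have "germ X F q W t = germ X F q (V \<inter> W) (restriction F W (V \<inter> W) t)"
      using V W o q by (intro germ_res[symmetric]) auto
    finally show "family (x \<otimes>\<^bsub>sections GF U\<^esub> y) q = germ X F q (V \<inter> W)
      (restriction F V (V \<inter> W) s \<otimes>\<^bsub>sections F (V \<inter> W)\<^esub> restriction F W (V \<inter> W) t)"
      using V W o q by (subst (asm) stalk_mult) auto
  qed (use V W o in auto)
qed

lemma induced_germ_family: "openin X U \<Longrightarrow> s \<in> Sc F U \<Longrightarrow> induced X F U (germ_family X F U s)"
  unfolding induced_def
  by (intro conjI ballI exI[of _ U] exI[of _ s]) (auto simp: germ_family_at intro: germ_family_closed)

lemma induced_inv:
  assumes "openin X U" "induced X F U x"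
  shows "induced X F U (inv\<^bsub>sections GF U\<^esub> x)"
proof (rule induced_local)
  have x: "x \<in> Sc GF U" using assms by (simp add: induced_def)
  interpret G: gpresheaf X GF by (rule G_abpresheaf)
  show "inv\<^bsub>sections GF U\<^esub> x \<in> Sc GF U" using x assms by auto
  fix p assume "p \<in> U"
  then obtain V t where V: "openin X V" "p \<in> V" "V \<subseteq> U" "t \<in> Sc F V" "restriction GF U V x = germ_family X F V t"
    using assms by (auto simp: induced_iff)
  have "restriction GF U V (inv\<^bsub>sections GF U\<^esub> x) = germ_family X F V (inv\<^bsub>sections F V\<^esub> t)"
    using V assms x pshom_inv[OF abpresheaf_axioms G.abpresheaf_axioms germ_family_pshom]
    by (simp add: G.res_inv)
  then show "\<exists>V. openin X V \<and> p \<in> V \<and> V \<subseteq> U \<and> induced X F V (restriction GF U V (inv\<^bsub>sections GF U\<^esub> x))"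
    using V by (metis induced_germ_family inv_closed)
qed (use assms in auto)

section \<open>The associated sheaf\<close>

abbreviation "SF \<equiv> sheafification X F"

lemma S_simps:
  "sections SF U = (sections GF U)\<lparr>carrier := {x. x \<in> Sc GF U \<and> induced X F U x}\<rparr>" if "openin X U"
  using that by (auto simp: sheafification_def induced_iff)

lemma S_carrier: "openin X U \<Longrightarrow> x \<in> Sc SF U \<longleftrightarrow> induced X F U x"
  by (auto simp: S_simps induced_def)

lemma S_mult: "openin X U \<Longrightarrow> x \<otimes>\<^bsub>sections SF U\<^esub> y = x \<otimes>\<^bsub>sections GF U\<^esub> y"
  and S_one: "openin X U \<Longrightarrow> \<one>\<^bsub>sections SF U\<^esub> = \<one>\<^bsub>sections GF U\<^esub>"
  and S_res: "restriction SF = restriction GF"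
  by (auto simp: sheafification_def)

lemma S_in_G: "openin X U \<Longrightarrow> x \<in> Sc SF U \<Longrightarrow> x \<in> Sc GF U"
  by (auto simp: S_carrier induced_def)

lemma induced_one:
  assumes "openin X U" shows "induced X F U \<one>\<^bsub>sections GF U\<^esub>"
proof -
  have "germ_family X F U \<one>\<^bsub>sections F U\<^esub> = \<one>\<^bsub>sections GF U\<^esub>"
    using assms pshom_one[OF abpresheaf_axioms _ germ_family_pshom] G_abpresheaf gpresheaf_def by blast
  then show ?thesis using assms by (metis induced_germ_family one_closed)
qed

lemma S_abpresheaf: "gpresheaf X SF"
proof -
  interpret G: gpresheaf X GF by (rule G_abpresheaf)
  show ?thesis
  proof (intro gpresheaf.intro abpresheaf.intro)
    fix U assume U: "openin X U"
    interpret comm_group "sections GF U" using U by (rule G_comm_group)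
    have c: "x \<in> carrier (sections GF U)" if "induced X F U x" for x
      using that by (simp add: induced_def)
    show "comm_group (sections SF U)"
    proof (rule comm_groupI)
      fix x assume "x \<in> Sc SF U"
      then show "\<exists>y\<in>Sc SF U. y \<otimes>\<^bsub>sections SF U\<^esub> x = \<one>\<^bsub>sections SF U\<^esub>"
        using U S_in_G by (intro bexI[of _ "inv\<^bsub>sections GF U\<^esub> x"]) (auto simp: S_mult S_one S_carrier induced_inv)
    qed (use U in \<open>auto simp: S_carrier S_mult S_one induced_mult induced_one c m_assoc intro: m_comm\<close>)
  next
    show "restriction SF U V \<in> hom (sections SF U) (sections SF V)"
      if "openin X U" "openin X V" "V \<subseteq> U" for U V
      using that by (intro homI) (auto simp: S_res S_mult S_carrier S_in_G G.res_mult induced_res)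
  next
    show "restriction SF U U s = s" if "openin X U" "s \<in> Sc SF U" for U s
      using that by (auto simp: S_res S_in_G G.res_id)
    show "restriction SF V W (restriction SF U V s) = restriction SF U W s"
      if "openin X U" "openin X V" "openin X W" "V \<subseteq> U" "W \<subseteq> V" "s \<in> Sc SF U" for U V W s
      using that by (auto simp: S_res S_in_G G.res_res)
  qed
qed

text \<open>Restriction of families keeps values, so a germ of \<open>SF\<close> at \<open>q\<close>
  determines the value at \<open>q\<close> of the underlying family (\<open>fam\<close>). This gives
  injectivity. For gluing, the glued family takes at each point the value of the local section
  chosen there, and \<open>fam\<close> makes it agree with all the other local sections.\<close>

lemma S_is_sheaf: "is_sheaf X SF"
  unfolding is_sheaf_def
proof (intro conjI allI impI)
  interpret S: gpresheaf X SF by (rule S_abpresheaf)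
  have fam: "family s q = family t q"
    if "openin X U" "openin X V" "q \<in> U" "q \<in> V" "s \<in> Sc SF U" "t \<in> Sc SF V" "germ X SF q U s = germ X SF q V t"
    for U V q s t
  proof -
    have "same_germ X SF q U s V t" using that S.germ_eq_iff by blast
    then show ?thesis unfolding same_germ_def S_res by (metis G_res_at)
  qed
  fix U assume U: "openin X U"
  show "inj_on (germ_family X SF U) (Sc SF U)"
  proof (rule inj_onI)
    fix s t assume st: "s \<in> Sc SF U" "t \<in> Sc SF U" "germ_family X SF U s = germ_family X SF U t"
    then have "family s q = family t q" if "q \<in> U" for q
      using fam[OF U U that that] that by (metis germ_family_at)
    then show "s = t" using st U S_in_G by (intro G_eqI[of s X F U]) auto
  qed
  fix z assume z: "induced X SF U z"
  then have "\<forall>p\<in>U. \<exists>V t. openin X V \<and> p \<in> V \<and> V \<subseteq> U \<and> t \<in> Sc SF V \<and> (\<forall>q\<in>V. family z q = germ X SF q V t)"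
    by (auto simp: induced_def)
  then obtain V t where V: "\<And>p. p \<in> U \<Longrightarrow> openin X (V p)" "\<And>p. p \<in> U \<Longrightarrow> p \<in> V p" "\<And>p. p \<in> U \<Longrightarrow> V p \<subseteq> U"
     "\<And>p. p \<in> U \<Longrightarrow> t p \<in> Sc SF (V p)" "\<And>p q. \<lbrakk>p \<in> U; q \<in> V p\<rbrakk> \<Longrightarrow> family z q = germ X SF q (V p) (t p)"
    by metis
  define x where "x = Family (\<lambda>p\<in>U. family (t p) p)"
  have x: "x \<in> Sc GF U" unfolding x_def
    by (intro G_memI G_at[OF S_in_G[OF V(1) V(4)] V(2)])
  have xt: "family x q = family (t p) q" if "p \<in> U" "q \<in> V p" for p q
  proof -
    have "q \<in> U" using V that by blast
    then have "family (t q) q = family (t p) q"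
      using that V(1-4) V(5)[of q q] V(5)[of p q] by (intro fam[of "V q" "V p"]) auto
    then show ?thesis using \<open>q \<in> U\<close> by (simp add: x_def)
  qed
  have rt: "restriction GF U (V p) x = t p" if "p \<in> U" for p
    using that V x xt S_in_G by (intro G_eqI[of _ X F "V p"] G_res_closed) (auto simp: G_res_at)
  have ix: "x \<in> Sc SF U" unfolding S_carrier[OF U]
    by (rule induced_local[OF U x]) (metis V rt S_carrier)
  have "z = germ_family X SF U x"
  proof (subst S.germ_family_eq_iff[OF U _ ix])
    show "z \<in> Sc (godement_sheaf X SF) U" using z by (simp add: induced_def)
    show "\<forall>p\<in>U. family z p = germ X SF p U x"
      using V rt S.germ_res[OF U, of "V p" p x for p] ix by (metis S_res)
  qed
  then show "z \<in> germ_image X SF U" unfolding germ_image_def using ix by blast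
qed

end

section \<open>Quotients\<close>

text \<open>The choice in \<open>coset_rep\<close> sees only the coset, whence the third part. The
  fourth part identifies the kernel of the passage to representatives.\<close>

lemma coset_rep_props:
  fixes G (structure)
  assumes G: "comm_group G" and H: "subgroup H G"
  shows "x \<in> carrier G \<Longrightarrow> coset_rep G H x \<in> carrier G"
    and "x \<in> carrier G \<Longrightarrow> \<exists>h\<in>H. coset_rep G H x = h \<otimes>\<^bsub>G\<^esub> x"
    and "\<lbrakk>x \<in> carrier G; h \<in> H\<rbrakk> \<Longrightarrow> coset_rep G H (h \<otimes>\<^bsub>G\<^esub> x) = coset_rep G H x"
    and "\<lbrakk>x \<in> carrier G; coset_rep G H x = coset_rep G H \<one>\<^bsub>G\<^esub>\<rbrakk> \<Longrightarrow> x \<in> H"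
proof -
  interpret comm_group G by fact
  interpret H: subgroup H G by fact
  have rep: "\<exists>h\<in>H. coset_rep G H x = h \<otimes> x" if "x \<in> carrier G" for x
  proof -
    have "x \<in> H #> x" using that H rcos_self by blast
    then have "coset_rep G H x \<in> H #> x" unfolding coset_rep_def by (rule someI)
    then show ?thesis by (auto simp: r_coset_def)
  qed
  show 1: "\<exists>h\<in>H. coset_rep G H x = h \<otimes> x" if "x \<in> carrier G" for x using rep that .
  show "coset_rep G H x \<in> carrier G" if "x \<in> carrier G" for x using rep[OF that] that by auto
  show "coset_rep G H (h \<otimes> x) = coset_rep G H x" if "x \<in> carrier G" "h \<in> H" for x h
  proof -
    have "H #> (h \<otimes> x) = H #> x"
      using that by (metis H H.mem_carrier coset_mult_assoc coset_join2 H.subset)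
    then show ?thesis by (simp add: coset_rep_def)
  qed
  show "x \<in> H" if x: "x \<in> carrier G" and e: "coset_rep G H x = coset_rep G H \<one>"
  proof -
    obtain h k where h: "h \<in> H" "coset_rep G H x = h \<otimes> x" and k: "k \<in> H" "coset_rep G H \<one> = k \<otimes> \<one>"
      using rep[OF x] rep[OF one_closed] by blast
    then have "h \<otimes> x = k" using e by simp
    then have "x = inv h \<otimes> k" using h k x by (metis H.mem_carrier inv_solve_left')
    then show ?thesis using h k by simp
  qed
qed

context gpresheaf
begin

abbreviation "im \<equiv> germ_image X F"
abbreviation "QP \<equiv> godement_quotient_presheaf X F"
abbreviation "\<rho> U \<equiv> coset_rep (sections GF U) (im U)"

lemma rho_carrier: "Sc QP U = \<rho> U ` Sc GF U"
  and rho_one: "\<one>\<^bsub>sections QP U\<^esub> = \<rho> U \<one>\<^bsub>sections GF U\<^esub>"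
  by (auto simp: godement_quotient_presheaf_def quotient_presheaf_def Let_def)

lemmas rho_props = coset_rep_props[OF G_comm_group germ_image_subgroup]

lemma rho_mult:
  assumes "openin X U" "x \<in> Sc GF U" "y \<in> Sc GF U"
  shows "\<rho> U (x \<otimes>\<^bsub>sections GF U\<^esub> y) = \<rho> U x \<otimes>\<^bsub>sections QP U\<^esub> \<rho> U y"
proof -
  interpret comm_group "sections GF U" using assms G_comm_group by blast
  interpret H: subgroup "im U" "sections GF U" using assms germ_image_subgroup by blast
  obtain h k where h: "h \<in> im U" "\<rho> U x = h \<otimes>\<^bsub>sections GF U\<^esub> x" and k: "k \<in> im U" "\<rho> U y = k \<otimes>\<^bsub>sections GF U\<^esub> y"
    using rho_props(2)[OF assms(1,1)] assms by meson
  have "\<rho> U x \<otimes>\<^bsub>sections QP U\<^esub> \<rho> U y = \<rho> U (\<rho> U x \<otimes>\<^bsub>sections GF U\<^esub> \<rho> U y)"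
    by (auto simp: godement_quotient_presheaf_def quotient_presheaf_def Let_def)
  also have "\<rho> U x \<otimes>\<^bsub>sections GF U\<^esub> \<rho> U y = (h \<otimes>\<^bsub>sections GF U\<^esub> k) \<otimes>\<^bsub>sections GF U\<^esub> (x \<otimes>\<^bsub>sections GF U\<^esub> y)"
    using h k assms by (simp add: m_ac)
  also have "\<rho> U \<dots> = \<rho> U (x \<otimes>\<^bsub>sections GF U\<^esub> y)"
    using h k assms by (intro rho_props(3)) auto
  finally show ?thesis ..
qed

lemma rho_res:
  assumes "openin X U" "openin X V" "V \<subseteq> U" "x \<in> Sc GF U"
  shows "restriction QP U V (\<rho> U x) = \<rho> V (restriction GF U V x)"
proof -
  interpret G: gpresheaf X GF by (rule G_abpresheaf)
  obtain s where s: "s \<in> Sc F U" "\<rho> U x = germ_family X F U s \<otimes>\<^bsub>sections GF U\<^esub> x"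
    using rho_props(2)[OF assms(1,1,4)] by (auto simp: germ_image_def)
  have "restriction GF U V (\<rho> U x) = germ_family X F V (restriction F U V s) \<otimes>\<^bsub>sections GF V\<^esub> restriction GF U V x"
    unfolding s(2) using assms s germ_family_closed pshomD(3)[OF germ_family_pshom] by (subst G.res_mult) auto
  moreover have "germ_family X F V (restriction F U V s) \<in> im V"
    unfolding germ_image_def using assms s by blast
  ultimately have "\<rho> V (restriction GF U V (\<rho> U x)) = \<rho> V (restriction GF U V x)"
    using assms rho_props(3)[OF assms(2,2)] G.res_closed by metis
  then show ?thesis by (simp add: godement_quotient_presheaf_def quotient_presheaf_def)
qed

lemma QP_abpresheaf: "gpresheaf X QP"
proof (intro gpresheaf.intro abpresheaf.intro)
  interpret G: gpresheaf X GF by (rule G_abpresheaf)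
  show "comm_group (sections QP U)" if "openin X U" for U
    by (rule comm_group_surj[OF G_comm_group[OF that], of "\<rho> U"])
      (use that in \<open>auto simp: rho_carrier rho_one rho_mult\<close>)
  show "restriction QP U V \<in> hom (sections QP U) (sections QP V)"
    if "openin X U" "openin X V" "V \<subseteq> U" for U V
    using that by (intro homI)
      (auto simp: rho_carrier rho_res G.res_mult G.mult_closed G.res_closed simp flip: rho_mult)
  show "restriction QP U U s = s" if "openin X U" "s \<in> Sc QP U" for U s
    using that by (auto simp: rho_carrier rho_res G.res_id)
  show "restriction QP V W (restriction QP U V s) = restriction QP U W s"
    if "openin X U" "openin X V" "openin X W" "V \<subseteq> U" "W \<subseteq> V" "s \<in> Sc QP U" for U V W s
    using that by (auto simp: rho_carrier rho_res G.res_res G.res_closed)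
qed

end

text \<open>One step \<open>C^0 F / F\<close> of the Godement construction. Properties are proved
  for a single step and iterated by induction through \<open>godement_Q_Suc\<close>.\<close>

definition QQ :: "'a topology \<Rightarrow> ('a, ('a, 'b) gsec) presheaf \<Rightarrow> ('a, ('a, 'b) gsec) presheaf" where
  "QQ X F = sheafification X (godement_quotient_presheaf X F)"

definition to_QQ :: "'a topology \<Rightarrow> ('a, ('a, 'b) gsec) presheaf \<Rightarrow> 'a set \<Rightarrow> ('a, 'b) gsec \<Rightarrow> ('a, 'b) gsec" where
  "to_QQ X F U x = germ_family X (godement_quotient_presheaf X F) U
     (coset_rep (sections (godement_sheaf X F) U) (germ_image X F U) x)"

definition QQ_map :: "'a topology \<Rightarrow> ('a, ('a, 'b) gsec) presheaf \<Rightarrow> ('a set \<Rightarrow> ('a, 'b) gsec \<Rightarrow> ('a, 'b) gsec)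
    \<Rightarrow> 'a set \<Rightarrow> ('a, 'b) gsec \<Rightarrow> ('a, 'b) gsec" where
  "QQ_map X G f = family_map X (godement_quotient_presheaf X G)
     (\<lambda>U x. coset_rep (sections (godement_sheaf X G) U) (germ_image X G U) (family_map X G f U x))"

context gpresheaf
begin

lemma QQ_abpresheaf: "gpresheaf X (QQ X F)"
  unfolding QQ_def by (rule gpresheaf.S_abpresheaf[OF QP_abpresheaf])

lemma QQ_is_sheaf: "is_sheaf X (QQ X F)"
  unfolding QQ_def by (rule gpresheaf.S_is_sheaf[OF QP_abpresheaf])

lemma to_QQ_pshom: "pshom X GF (QQ X F) (to_QQ X F)"
proof -
  interpret Q: gpresheaf X QP by (rule QP_abpresheaf)
  interpret G: gpresheaf X GF by (rule G_abpresheaf)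
  have c: "\<rho> U x \<in> Sc QP U" if "x \<in> Sc GF U" for U x using that by (auto simp: rho_carrier)
  show ?thesis
    unfolding pshom_def
  proof (intro conjI allI impI)
    show "to_QQ X F U \<in> hom (sections GF U) (sections (QQ X F) U)" if "openin X U" for U
      using that c pshomD(2)[OF Q.germ_family_pshom that] unfolding to_QQ_def QQ_def
      by (intro homI) (auto simp: Q.S_carrier Q.S_mult rho_mult intro: Q.induced_germ_family)
    show "restriction (QQ X F) U V (to_QQ X F U s) = to_QQ X F V (restriction GF U V s)"
      if "openin X U" "openin X V" "V \<subseteq> U" "s \<in> Sc GF U" for U V s
      using that c pshomD(3)[OF Q.germ_family_pshom that(1)] unfolding to_QQ_def QQ_def
      by (auto simp: Q.S_res rho_res)
  qed
qed

lemma to_QQ_germ_family: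
  assumes "openin X U" "s \<in> Sc F U"
  shows "to_QQ X F U (germ_family X F U s) = \<one>\<^bsub>sections (QQ X F) U\<^esub>"
proof -
  interpret Q: gpresheaf X QP by (rule QP_abpresheaf)
  interpret comm_group "sections GF U" using assms G_comm_group by blast
  have "\<rho> U (germ_family X F U s \<otimes>\<^bsub>sections GF U\<^esub> \<one>\<^bsub>sections GF U\<^esub>) = \<rho> U \<one>\<^bsub>sections GF U\<^esub>"
    using assms by (intro rho_props(3)) (auto simp: germ_image_def)
  then have "\<rho> U (germ_family X F U s) = \<one>\<^bsub>sections QP U\<^esub>"
    using assms germ_family_closed by (simp add: rho_one)
  then show ?thesis
    using assms pshom_one[OF Q.abpresheaf_axioms _ Q.germ_family_pshom] Q.G_abpresheaf
    by (simp add: to_QQ_def QQ_def Q.S_one gpresheaf_def)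
qed

text \<open>Two shrinkings are hidden here: the class is trivial in the associated sheaf, hence
  trivial in the quotient presheaf near \<open>p\<close>, hence there in the image of
  \<open>F\<close>. For a presheaf \<open>F\<close> no global section can be expected.\<close>

lemma to_QQ_kernel:
  assumes "openin X U" "x \<in> Sc GF U" "to_QQ X F U x = \<one>\<^bsub>sections (QQ X F) U\<^esub>" "p \<in> U"
  obtains V s where "openin X V" "p \<in> V" "V \<subseteq> U" "s \<in> Sc F V" "restriction GF U V x = germ_family X F V s"
proof -
  interpret Q: gpresheaf X QP by (rule QP_abpresheaf)
  have "\<rho> U x \<in> Sc QP U" using assms by (auto simp: rho_carrier)
  moreover have "germ_family X QP U (\<rho> U x) = \<one>\<^bsub>sections (godement_sheaf X QP) U\<^esub>"
    using assms by (simp add: to_QQ_def QQ_def Q.S_one)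
  ultimately obtain V where V: "openin X V" "p \<in> V" "V \<subseteq> U" "restriction QP U V (\<rho> U x) = \<one>\<^bsub>sections QP V\<^esub>"
    using Q.germ_family_locally_inj assms by metis
  then have "\<rho> V (restriction GF U V x) = \<rho> V \<one>\<^bsub>sections GF V\<^esub>"
    using assms by (simp add: rho_res rho_one)
  then have "restriction GF U V x \<in> im V"
    using rho_props(4)[OF V(1,1)] V assms G_res_closed by blast
  then show ?thesis using that V by (auto simp: germ_image_def)
qed

lemma to_QQ_locally_surj:
  assumes "openin X U" "y \<in> Sc (QQ X F) U" "p \<in> U"
  obtains V x where "openin X V" "p \<in> V" "V \<subseteq> U" "x \<in> Sc GF V" "restriction (QQ X F) U V y = to_QQ X F V x"
proof -
  interpret Q: gpresheaf X QP by (rule QP_abpresheaf)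
  obtain V t where "openin X V" "p \<in> V" "V \<subseteq> U" "t \<in> Sc QP V"
     "restriction (godement_sheaf X QP) U V y = germ_family X QP V t"
    using assms unfolding QQ_def by (auto simp: Q.S_carrier Q.induced_iff)
  then show ?thesis using that by (auto simp: rho_carrier to_QQ_def QQ_def Q.S_res)
qed

end

section \<open>Functoriality\<close>

locale gmor =
  fixes X :: "'a topology" and F G :: "('a, ('a, 'b) gsec) presheaf" and f
  assumes gF: "gpresheaf X F" and gG: "gpresheaf X G" and mor: "pshom X F G f"
begin

sublocale F: gpresheaf X F by (rule gF)
sublocale G: gpresheaf X G by (rule gG)

lemmas mor_closed = pshomD(1)[OF mor]
  and mor_mult = pshomD(2)[OF mor]
  and mor_res = pshomD(3)[OF mor]
  and mor_one = pshom_one[OF F.abpresheaf_axioms G.abpresheaf_axioms mor]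
  and mor_inv = pshom_inv[OF F.abpresheaf_axioms G.abpresheaf_axioms mor]

abbreviation "fm \<equiv> family_map X G f"

text \<open>\<open>family_map\<close> applies \<open>f\<close> to the stored representative of a
  germ; by naturality any other representative gives the same germ.\<close>

lemma fm_at:
  assumes x: "p \<in> U" and s: "openin X V" "p \<in> V" "s \<in> Sc F V" "family x p = germ X F p V s"
  shows "family (fm U x) p = germ X G p V (f V s)"
proof -
  obtain V' t where t: "germ X F p V s = (V', t)" "openin X V'" "p \<in> V'" "t \<in> Sc F V'" "same_germ X F p V s V' t"
    using F.germ_rep[OF s(1-3)] by metis
  then obtain W where W: "openin X W" "p \<in> W" "W \<subseteq> V \<inter> V'" "restriction F V W s = restriction F V' W t"
    by (auto simp: same_germ_def)
  have "restriction G V' W (f V' t) = restriction G V W (f V s)"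
    using W t s by (simp add: mor_res)
  then have "same_germ X G p V' (f V' t) V (f V s)"
    unfolding same_germ_def using W by (intro exI[of _ W]) auto
  then have "germ X G p V' (f V' t) = germ X G p V (f V s)"
    using t s by (subst G.germ_eq_iff) (auto intro: mor_closed)
  then show ?thesis using x s(4) t(1) by (simp add: family_map_def)
qed

lemma fm_closed: "x \<in> Sc F.GF U \<Longrightarrow> fm U x \<in> Sc G.GF U"
proof -
  assume x: "x \<in> Sc F.GF U"
  have "(case family x p of (V, s) \<Rightarrow> germ X G p V (f V s)) \<in> carrier (stalk X G p)" if "p \<in> U" for p
    using F.stalk_rep[OF G_at[OF x that]] by (auto simp: split_beta intro!: G.stalkI mor_closed)
  then show ?thesis unfolding family_map_def by (rule G_memI)
qed

lemma fm_at':
  assumes "x \<in> Sc F.GF U" "p \<in> U"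
  obtains V s where "openin X V" "p \<in> V" "s \<in> Sc F V" "family x p = germ X F p V s"
    "family (fm U x) p = germ X G p V (f V s)"
  using F.stalkE[OF G_at[OF assms]] fm_at[OF assms(2)] by metis

lemma fm_pshom: "pshom X F.GF G.GF fm"
  unfolding pshom_def
proof (intro conjI allI impI homI)
  fix U x assume U: "openin X U" and x: "x \<in> Sc F.GF U"
  show "fm U x \<in> Sc G.GF U" using x by (rule fm_closed)
  fix y assume y: "y \<in> Sc F.GF U"
  show "fm U (x \<otimes>\<^bsub>sections F.GF U\<^esub> y) = fm U x \<otimes>\<^bsub>sections G.GF U\<^esub> fm U y"
  proof (rule G_eqI)
    show "fm U (x \<otimes>\<^bsub>sections F.GF U\<^esub> y) \<in> Sc G.GF U" "fm U x \<otimes>\<^bsub>sections G.GF U\<^esub> fm U y \<in> Sc G.GF U"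
      using x y U by (auto intro!: fm_closed F.G_mult_closed G.G_mult_closed)
    fix p assume p: "p \<in> U"
    obtain V s t where st: "openin X V" "p \<in> V" "s \<in> Sc F V" "t \<in> Sc F V" "family x p = germ X F p V s"
        "family y p = germ X F p V t"
      using F.stalk_common[OF G_at[OF x p] G_at[OF y p]] by metis
    have 1: "family (fm U x) p = germ X G p V (f V s)" "family (fm U y) p = germ X G p V (f V t)"
      by (intro fm_at[OF p] st)+
    have 2: "family (fm U (x \<otimes>\<^bsub>sections F.GF U\<^esub> y)) p = germ X G p V (f V (s \<otimes>\<^bsub>sections F V\<^esub> t))"
      by (intro fm_at[OF p]) (use st p in \<open>auto simp: G_mult_at F.stalk_mult\<close>)
    show "family (fm U (x \<otimes>\<^bsub>sections F.GF U\<^esub> y)) p = family (fm U x \<otimes>\<^bsub>sections G.GF U\<^esub> fm U y) p"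
      using st p by (simp add: 1 2 G_mult_at G.stalk_mult mor_mult mor_closed)
  qed
next
  fix U V x assume UV: "openin X U" "openin X V" "V \<subseteq> U" and x: "x \<in> Sc F.GF U"
  show "restriction G.GF U V (fm U x) = fm V (restriction F.GF U V x)"
  proof (rule G_eqI)
    show "restriction G.GF U V (fm U x) \<in> Sc G.GF V" "fm V (restriction F.GF U V x) \<in> Sc G.GF V"
      using x UV by (auto intro!: fm_closed F.G_res_closed G.G_res_closed)
    fix p assume "p \<in> V"
    then show "family (restriction G.GF U V (fm U x)) p = family (fm V (restriction F.GF U V x)) p"
      using UV by (simp add: G_res_at) (auto simp: family_map_def G_res_at)
  qed
qed

lemma fm_germ_family:
  assumes "openin X U" "s \<in> Sc F U"
  shows "fm U (germ_family X F U s) = germ_family X G U (f U s)"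
proof (rule G_eqI)
  show "fm U (germ_family X F U s) \<in> Sc G.GF U" "germ_family X G U (f U s) \<in> Sc G.GF U"
    using assms by (auto intro!: fm_closed F.germ_family_closed G.germ_family_closed mor_closed)
  fix p assume p: "p \<in> U"
  show "family (fm U (germ_family X F U s)) p = family (germ_family X G U (f U s)) p"
    using fm_at[OF p assms(1) p assms(2)] p by (simp add: germ_family_at)
qed

lemma GF_gmor: "gmor X F.GF G.GF fm"
  by (intro gmor.intro F.G_abpresheaf G.G_abpresheaf fm_pshom)

lemma fm_induced:
  assumes U: "openin X U" and "induced X F U x"
  shows "induced X G U (fm U x)"
  unfolding induced_def
proof (intro conjI ballI)
  show "fm U x \<in> Sc G.GF U" using assms by (auto simp: induced_def intro: fm_closed)
  fix p assume "p \<in> U"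
  then obtain V t where V: "openin X V" "p \<in> V" "V \<subseteq> U" "t \<in> Sc F V" "\<forall>q\<in>V. family x q = germ X F q V t"
    using assms unfolding induced_def by blast
  have "family (fm U x) q = germ X G q V (f V t)" if "q \<in> V" for q
    using that V by (intro fm_at) auto
  then show "\<exists>V t. openin X V \<and> p \<in> V \<and> V \<subseteq> U \<and> t \<in> Sc G V \<and> (\<forall>q\<in>V. family (fm U x) q = germ X G q V t)"
    by (intro exI[of _ V] exI[of _ "f V t"]) (use V in \<open>simp add: mor_closed\<close>)
qed

lemma SF_gmor: "gmor X F.SF G.SF fm"
proof (intro gmor.intro F.S_abpresheaf G.S_abpresheaf)
  show "pshom X F.SF G.SF fm"
    unfolding pshom_def
  proof (intro conjI allI impI homI)
    fix U V x assume "openin X U" "openin X V" "V \<subseteq> U" "x \<in> Sc F.SF U"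
    then show "restriction G.SF U V (fm U x) = fm V (restriction F.SF U V x)"
      by (simp add: F.S_res G.S_res F.S_in_G pshomD(3)[OF fm_pshom])
  next
    fix U x assume U: "openin X U" and x: "x \<in> Sc F.SF U"
    then show "fm U x \<in> Sc G.SF U" by (simp add: F.S_carrier G.S_carrier fm_induced)
    fix y assume "y \<in> Sc F.SF U"
    then show "fm U (x \<otimes>\<^bsub>sections F.SF U\<^esub> y) = fm U x \<otimes>\<^bsub>sections G.SF U\<^esub> fm U y"
      using U x by (simp add: F.S_mult G.S_mult F.S_in_G pshomD(2)[OF fm_pshom])
  qed
qed

abbreviation "qf U x \<equiv> coset_rep (sections G.GF U) (G.im U) (fm U x)"

text \<open>The induced map on the quotient is evaluated on chosen representatives. The choice is
  harmless because \<open>f\<close> sends germ families of \<open>F\<close> to germ families of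
  \<open>G\<close>.\<close>

lemma qf_rho:
  assumes "openin X U" "x \<in> Sc F.GF U"
  shows "qf U (coset_rep (sections F.GF U) (F.im U) x) = qf U x"
proof -
  obtain s where s: "s \<in> Sc F U" "coset_rep (sections F.GF U) (F.im U) x = germ_family X F U s \<otimes>\<^bsub>sections F.GF U\<^esub> x"
    using F.rho_props(2)[OF assms(1,1,2)] by (auto simp: germ_image_def)
  have "fm U (germ_family X F U s \<otimes>\<^bsub>sections F.GF U\<^esub> x) = germ_family X G U (f U s) \<otimes>\<^bsub>sections G.GF U\<^esub> fm U x"
    using s assms by (simp add: pshomD(2)[OF fm_pshom] F.germ_family_closed fm_germ_family)
  moreover have "germ_family X G U (f U s) \<in> G.im U"
    using s assms by (auto simp: germ_image_def intro: mor_closed)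
  ultimately show ?thesis using s(2) G.rho_props(3)[OF assms(1,1) fm_closed[OF assms(2)]] by simp
qed

lemma QP_gmor: "gmor X F.QP G.QP (\<lambda>U x. qf U x)"
proof (intro gmor.intro F.QP_abpresheaf G.QP_abpresheaf)
  show "pshom X F.QP G.QP (\<lambda>U x. qf U x)"
    unfolding pshom_def
  proof (intro conjI allI impI homI)
    fix U V x assume UV: "openin X U" "openin X V" "V \<subseteq> U" and "x \<in> Sc F.QP U"
    then show "restriction G.QP U V (qf U x) = qf V (restriction F.QP U V x)"
      by (auto simp: F.rho_carrier qf_rho G.rho_res fm_closed F.rho_res F.G_res_closed pshomD(3)[OF fm_pshom])
  next
    fix U x assume U: "openin X U" and x: "x \<in> Sc F.QP U"
    then show "qf U x \<in> Sc G.QP U" by (auto simp: F.rho_carrier G.rho_carrier qf_rho fm_closed)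
    fix y assume "y \<in> Sc F.QP U"
    then show "qf U (x \<otimes>\<^bsub>sections F.QP U\<^esub> y) = qf U x \<otimes>\<^bsub>sections G.QP U\<^esub> qf U y"
      using U x by (auto simp: F.rho_carrier qf_rho fm_closed F.G_mult_closed pshomD(2)[OF fm_pshom]
          simp flip: F.rho_mult G.rho_mult)
  qed
qed

lemma QQ_gmor: "gmor X (QQ X F) (QQ X G) (QQ_map X G f)"
  unfolding QQ_def QQ_map_def by (rule gmor.SF_gmor[OF QP_gmor])

lemma QQ_map_to_QQ:
  assumes "openin X U" "x \<in> Sc F.GF U"
  shows "QQ_map X G f U (to_QQ X F U x) = to_QQ X G U (fm U x)"
  using gmor.fm_germ_family[OF QP_gmor assms(1)] assms
  by (auto simp: QQ_map_def to_QQ_def F.rho_carrier qf_rho)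

end

text \<open>Stated for a square with two intermediate presheaves, so that it covers both the
  compatibility of scalars with differentials and, with the trivial morphism on one path, the
  vanishing of composites. The check is made on one representative per point.\<close>

lemma family_map_square:
  assumes "gmor X F G f" "gmor X G H g" "gmor X F G' f'" "gmor X G' H g'"
    and sq: "\<And>U s. \<lbrakk>openin X U; s \<in> Sc F U\<rbrakk> \<Longrightarrow> g U (f U s) = g' U (f' U s)"
    and U: "openin X U" and x: "x \<in> Sc (godement_sheaf X F) U"
  shows "family_map X H g U (family_map X G f U x) = family_map X H g' U (family_map X G' f' U x)"
proof -
  interpret f: gmor X F G f by fact
  interpret g: gmor X G H g by fact
  interpret f': gmor X F G' f' by fact
  interpret g': gmor X G' H g' by fact
  show ?thesis
  proof (rule G_eqI)
    show "g.fm U (f.fm U x) \<in> Sc g.G.GF U" "g'.fm U (f'.fm U x) \<in> Sc g.G.GF U"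
      using x by (auto intro!: f.fm_closed g.fm_closed f'.fm_closed g'.fm_closed)
    fix p assume p: "p \<in> U"
    obtain V s where s: "openin X V" "p \<in> V" "s \<in> Sc F V" "family x p = germ X F p V s"
      using f.F.stalkE[OF G_at[OF x p]] .
    have "family (g.fm U (f.fm U x)) p = germ X H p V (g V (f V s))"
      by (intro g.fm_at f.fm_at p s f.mor_closed)
    moreover have "family (g'.fm U (f'.fm U x)) p = germ X H p V (g' V (f' V s))"
      by (intro g'.fm_at f'.fm_at p s f'.mor_closed)
    ultimately show "family (g.fm U (f.fm U x)) p = family (g'.fm U (f'.fm U x)) p" using sq s by simp
  qed
qed

text \<open>The square commutes on local lifts to \<open>C^0\<close>, and sections of the sheaf
  \<open>QQ X H\<close> that agree locally are equal.\<close>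

lemma QQ_map_square:
  assumes "gmor X F G f" "gmor X G H g" "gmor X F G' f'" "gmor X G' H g'"
    and sq: "\<And>U s. \<lbrakk>openin X U; s \<in> Sc F U\<rbrakk> \<Longrightarrow> g U (f U s) = g' U (f' U s)"
    and U: "openin X U" and y: "y \<in> Sc (QQ X F) U"
  shows "QQ_map X H g U (QQ_map X G f U y) = QQ_map X H g' U (QQ_map X G' f' U y)"
proof -
  interpret f: gmor X F G f by fact
  interpret g: gmor X G H g by fact
  interpret f': gmor X F G' f' by fact
  interpret g': gmor X G' H g' by fact
  interpret Qf: gmor X "QQ X F" "QQ X G" "QQ_map X G f" by (rule f.QQ_gmor)
  interpret Qg: gmor X "QQ X G" "QQ X H" "QQ_map X H g" by (rule g.QQ_gmor)
  interpret Qf': gmor X "QQ X F" "QQ X G'" "QQ_map X G' f'" by (rule f'.QQ_gmor)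
  interpret Qg': gmor X "QQ X G'" "QQ X H" "QQ_map X H g'" by (rule g'.QQ_gmor)
  let ?a = "QQ_map X H g U (QQ_map X G f U y)" and ?b = "QQ_map X H g' U (QQ_map X G' f' U y)"
  have ab: "?a \<in> Sc (QQ X H) U" "?b \<in> Sc (QQ X H) U"
    using U y by (auto intro!: Qf.mor_closed Qg.mor_closed Qf'.mor_closed Qg'.mor_closed)
  have "germ X (QQ X H) p U ?a = germ X (QQ X H) p U ?b" if p: "p \<in> U" for p
  proof -
    obtain V x where V: "openin X V" "p \<in> V" "V \<subseteq> U" "x \<in> Sc f.F.GF V" "restriction (QQ X F) U V y = to_QQ X F V x"
      by (rule f.F.to_QQ_locally_surj[OF U y p])
    have "restriction (QQ X H) U V ?a = to_QQ X H V (g.fm V (f.fm V x))"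
      using V U y by (simp add: Qf.mor_closed Qg.mor_res Qf.mor_res f.QQ_map_to_QQ g.QQ_map_to_QQ f.fm_closed)
    moreover have "restriction (QQ X H) U V ?b = to_QQ X H V (g'.fm V (f'.fm V x))"
      using V U y by (simp add: Qf'.mor_closed Qg'.mor_res Qf'.mor_res f'.QQ_map_to_QQ g'.QQ_map_to_QQ f'.fm_closed)
    moreover have "g.fm V (f.fm V x) = g'.fm V (f'.fm V x)"
      by (rule family_map_square[OF assms(1-4) sq V(1,4)])
    ultimately have "restriction (QQ X H) U V ?a = restriction (QQ X H) U V ?b" by simp
    then show ?thesis using Qg.G.germ_res[OF U V(1,3,2) ab(1)] Qg.G.germ_res[OF U V(1,3,2) ab(2)] by simp
  qed
  then have "germ_family X (QQ X H) U ?a = germ_family X (QQ X H) U ?b"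
    unfolding germ_family_def by (auto intro: restrict_ext)
  then show ?thesis using is_sheafD(1)[OF g.G.QQ_is_sheaf U ab] by simp
qed

text \<open>Allows a trivial composite to be treated as a degenerate commuting square.\<close>

definition triv_mor :: "('a, 'v) presheaf \<Rightarrow> 'a set \<Rightarrow> 'v \<Rightarrow> 'v" where
  "triv_mor G U s = \<one>\<^bsub>sections G U\<^esub>"

lemma triv_gmor:
  assumes "gpresheaf X F" "gpresheaf X G"
  shows "gmor X F G (triv_mor G)"
proof -
  interpret F: gpresheaf X F by fact
  interpret G: gpresheaf X G by fact
  have "\<one>\<^bsub>sections G U\<^esub> \<otimes>\<^bsub>sections G U\<^esub> \<one>\<^bsub>sections G U\<^esub> = \<one>\<^bsub>sections G U\<^esub>" if "openin X U" for U
    using G.sections_group[OF that] group.is_monoid monoid.l_one G.one_closed[OF that] by metis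
  then show ?thesis
    by (intro gmor.intro assms) (auto simp: pshom_def triv_mor_def hom_def G.res_one intro: G.one_closed)
qed

lemma family_map_triv:
  assumes "gmor X F G f" "openin X U" "x \<in> Sc (godement_sheaf X F) U"
    and "\<And>V s. \<lbrakk>openin X V; s \<in> Sc F V\<rbrakk> \<Longrightarrow> f V s = \<one>\<^bsub>sections G V\<^esub>"
  shows "family_map X G f U x = \<one>\<^bsub>sections (godement_sheaf X G) U\<^esub>"
proof -
  interpret f: gmor X F G f by fact
  show ?thesis
  proof (rule G_eqI)
    show "f.fm U x \<in> Sc f.G.GF U" using assms by (intro f.fm_closed)
    show "\<one>\<^bsub>sections (f.G.GF) U\<^esub> \<in> Sc f.G.GF U" using assms by (intro f.G.G_one_closed)
    fix p assume p: "p \<in> U"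
    obtain V s where "openin X V" "p \<in> V" "s \<in> Sc F V" "family (f.fm U x) p = germ X G p V (f V s)"
      using f.fm_at'[OF assms(3) p] by metis
    then show "family (f.fm U x) p = family \<one>\<^bsub>sections (f.G.GF) U\<^esub> p"
      using assms(4) p by (simp add: G_one_at f.G.stalk_one)
  qed
qed

lemma QQ_map_triv:
  assumes "gmor X F G f" "openin X U" "y \<in> Sc (QQ X F) U"
    and "\<And>V s. \<lbrakk>openin X V; s \<in> Sc F V\<rbrakk> \<Longrightarrow> f V s = \<one>\<^bsub>sections G V\<^esub>"
  shows "QQ_map X G f U y = \<one>\<^bsub>sections (QQ X G) U\<^esub>"
proof -
  interpret f: gmor X F G f by fact
  interpret Qf: gmor X "QQ X F" "QQ X G" "QQ_map X G f" by (rule f.QQ_gmor)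
  interpret q: gmor X f.F.QP f.G.QP "\<lambda>U x. f.qf U x" by (rule f.QP_gmor)
  have "f.qf V s = \<one>\<^bsub>sections f.G.QP V\<^esub>" if "openin X V" "s \<in> Sc f.F.QP V" for V s
    using that family_map_triv[OF assms(1) that(1) _ assms(4)] by (auto simp: f.F.rho_carrier f.qf_rho f.G.rho_one)
  then have "q.fm U y = \<one>\<^bsub>sections (godement_sheaf X f.G.QP) U\<^esub>"
    using assms q.F.S_in_G by (intro family_map_triv[OF q.gmor_axioms]) (auto simp: QQ_def)
  then show ?thesis using assms q.G.S_one by (simp add: QQ_map_def QQ_def)
qed

lemma family_map_comp_triv:
  assumes "gmor X F G f" "gmor X G H g"
    and "\<And>U s. \<lbrakk>openin X U; s \<in> Sc F U\<rbrakk> \<Longrightarrow> g U (f U s) = \<one>\<^bsub>sections H U\<^esub>"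
    and "openin X U" "x \<in> Sc (godement_sheaf X F) U"
  shows "family_map X H g U (family_map X G f U x) = \<one>\<^bsub>sections (godement_sheaf X H) U\<^esub>"
proof -
  interpret f: gmor X F G f by fact
  interpret g: gmor X G H g by fact
  interpret t: gmor X F G "triv_mor G" by (rule triv_gmor[OF f.gF f.gG])
  have "g.fm U (f.fm U x) = g.fm U (t.fm U x)"
    by (rule family_map_square[OF assms(1,2) t.gmor_axioms assms(2) _ assms(4,5)])
      (simp add: assms triv_mor_def g.mor_one)
  also have "t.fm U x = \<one>\<^bsub>sections f.G.GF U\<^esub>"
    using assms by (intro family_map_triv[OF t.gmor_axioms]) (auto simp: triv_mor_def)
  finally show ?thesis using gmor.mor_one[OF g.GF_gmor assms(4)] by simp
qed

lemma QQ_map_comp_triv: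
  assumes "gmor X F G f" "gmor X G H g"
    and "\<And>U s. \<lbrakk>openin X U; s \<in> Sc F U\<rbrakk> \<Longrightarrow> g U (f U s) = \<one>\<^bsub>sections H U\<^esub>"
    and "openin X U" "y \<in> Sc (QQ X F) U"
  shows "QQ_map X H g U (QQ_map X G f U y) = \<one>\<^bsub>sections (QQ X H) U\<^esub>"
proof -
  interpret f: gmor X F G f by fact
  interpret g: gmor X G H g by fact
  interpret t: gmor X F G "triv_mor G" by (rule triv_gmor[OF f.gF f.gG])
  have "QQ_map X H g U (QQ_map X G f U y) = QQ_map X H g U (QQ_map X G (triv_mor G) U y)"
    by (rule QQ_map_square[OF assms(1,2) t.gmor_axioms assms(2) _ assms(4,5)])
      (simp add: assms triv_mor_def g.mor_one)
  also have "QQ_map X G (triv_mor G) U y = \<one>\<^bsub>sections (QQ X G) U\<^esub>"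
    using assms by (intro QQ_map_triv[OF t.gmor_axioms]) (auto simp: triv_mor_def)
  finally show ?thesis using gmor.mor_one[OF g.QQ_gmor assms(4)] by simp
qed

section \<open>Locally exact complexes\<close>

definition presheaf_complex ::
  "'a topology \<Rightarrow> (nat \<Rightarrow> ('a, ('a, 'b) gsec) presheaf) \<Rightarrow> (nat \<Rightarrow> 'a set \<Rightarrow> ('a, 'b) gsec \<Rightarrow> ('a, 'b) gsec) \<Rightarrow> bool"
  where "presheaf_complex X F d \<longleftrightarrow> (\<forall>q. gmor X (F q) (F (Suc q)) (d q)) \<and>
    (\<forall>q U s. openin X U \<longrightarrow> s \<in> Sc (F q) U \<longrightarrow> d (Suc q) U (d q U s) = \<one>\<^bsub>sections (F (Suc (Suc q))) U\<^esub>)"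

text \<open>Exactness of \<open>0 -> F 0 -> F 1 -> ...\<close> on all stalks, written with
  representatives. The resolved presheaf has index 0, so the resolution itself starts at index
  1.\<close>

definition locally_exact ::
  "'a topology \<Rightarrow> (nat \<Rightarrow> ('a, ('a, 'b) gsec) presheaf) \<Rightarrow> (nat \<Rightarrow> 'a set \<Rightarrow> ('a, 'b) gsec \<Rightarrow> ('a, 'b) gsec) \<Rightarrow> bool"
  where "locally_exact X F d \<longleftrightarrow> presheaf_complex X F d \<and>
    (\<forall>U s p. openin X U \<longrightarrow> p \<in> U \<longrightarrow> s \<in> Sc (F 0) U \<longrightarrow> d 0 U s = \<one>\<^bsub>sections (F 1) U\<^esub> \<longrightarrow>
      (\<exists>V. openin X V \<and> p \<in> V \<and> V \<subseteq> U \<and> restriction (F 0) U V s = \<one>\<^bsub>sections (F 0) V\<^esub>)) \<and>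
    (\<forall>q U s p. openin X U \<longrightarrow> p \<in> U \<longrightarrow> s \<in> Sc (F (Suc q)) U \<longrightarrow>
      d (Suc q) U s = \<one>\<^bsub>sections (F (Suc (Suc q))) U\<^esub> \<longrightarrow>
      (\<exists>V t. openin X V \<and> p \<in> V \<and> V \<subseteq> U \<and> t \<in> Sc (F q) V \<and> d q V t = restriction (F (Suc q)) U V s))"

lemma presheaf_complexD:
  assumes "presheaf_complex X F d"
  shows "gmor X (F q) (F (Suc q)) (d q)"
    and "\<lbrakk>openin X U; s \<in> Sc (F q) U\<rbrakk> \<Longrightarrow> d (Suc q) U (d q U s) = \<one>\<^bsub>sections (F (Suc (Suc q))) U\<^esub>"
    and "gpresheaf X (F q)"
  using assms by (auto simp: presheaf_complex_def dest: gmor.gF)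

lemma presheaf_complex_QQ:
  assumes "presheaf_complex X F d"
  shows "presheaf_complex X (\<lambda>q. QQ X (F q)) (\<lambda>q. QQ_map X (F (Suc q)) (d q))"
  unfolding presheaf_complex_def
proof (intro conjI allI impI)
  note D = presheaf_complexD[OF assms]
  show "gmor X (QQ X (F q)) (QQ X (F (Suc q))) (QQ_map X (F (Suc q)) (d q))" for q
    by (rule gmor.QQ_gmor[OF D(1)])
  show "QQ_map X (F (Suc (Suc q))) (d (Suc q)) U (QQ_map X (F (Suc q)) (d q) U s) =
      \<one>\<^bsub>sections (QQ X (F (Suc (Suc q)))) U\<^esub>"
    if "openin X U" "s \<in> Sc (QQ X (F q)) U" for q U s
    by (rule QQ_map_comp_triv[OF D(1) D(1) D(2) that])
qed

text \<open>A section of \<open>C^0\<close> is an arbitrary family of germs, so local primitives may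
  be chosen at each point independently, with no compatibility between points.\<close>

lemma godement_exact:
  assumes ex: "locally_exact X F d" and U: "openin X U"
  shows "\<lbrakk>x \<in> Sc (godement_sheaf X (F 0)) U;
      family_map X (F 1) (d 0) U x = \<one>\<^bsub>sections (godement_sheaf X (F 1)) U\<^esub>\<rbrakk>
      \<Longrightarrow> x = \<one>\<^bsub>sections (godement_sheaf X (F 0)) U\<^esub>"
    and "\<lbrakk>y \<in> Sc (godement_sheaf X (F (Suc q))) U;
      family_map X (F (Suc (Suc q))) (d (Suc q)) U y = \<one>\<^bsub>sections (godement_sheaf X (F (Suc (Suc q)))) U\<^esub>\<rbrakk>
      \<Longrightarrow> \<exists>w. w \<in> Sc (godement_sheaf X (F q)) U \<and> family_map X (F (Suc q)) (d q) U w = y"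
proof -
  have pc: "presheaf_complex X F d" using ex by (simp add: locally_exact_def)
  \<comment> \<open>A trivial image germ means a trivial differential only after shrinking, so the
    representative is restricted to where its differential is exactly trivial.\<close>
  have ker: "\<exists>V s. openin X V \<and> p \<in> V \<and> V \<subseteq> U \<and> s \<in> Sc (F q) V \<and> family z p = germ X (F q) p V s \<and>
      d q V s = \<one>\<^bsub>sections (F (Suc q)) V\<^esub>"
    if z: "z \<in> Sc (godement_sheaf X (F q)) U"
      and dz: "family_map X (F (Suc q)) (d q) U z = \<one>\<^bsub>sections (godement_sheaf X (F (Suc q))) U\<^esub>"
      and p: "p \<in> U" for q z p
  proof -
    interpret gmor X "F q" "F (Suc q)" "d q" by (rule presheaf_complexD(1)[OF pc])
    obtain V s where V: "openin X V" "p \<in> V" "s \<in> Sc (F q) V" "family z p = germ X (F q) p V s"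
      "family (fm U z) p = germ X (F (Suc q)) p V (d q V s)"
      using fm_at'[OF z p] by metis
    then have "germ X (F (Suc q)) p V (d q V s) = \<one>\<^bsub>stalk X (F (Suc q)) p\<^esub>"
      using dz p by (simp add: G_one_at)
    then obtain W where W: "openin X W" "p \<in> W" "W \<subseteq> V" "restriction (F (Suc q)) V W (d q V s) = \<one>\<^bsub>sections (F (Suc q)) W\<^esub>"
      using G.stalk_one_iff[OF V(1,2) mor_closed[OF V(1,3)]] by auto
    define A where "A = W \<inter> U"
    have A: "openin X A" "p \<in> A" "A \<subseteq> V" "A \<subseteq> W" "A \<subseteq> U" using W U p by (auto simp: A_def)
    have "d q A (restriction (F q) V A s) = restriction (F (Suc q)) V A (d q V s)"
      using A V by (simp add: mor_res)
    also have "\<dots> = restriction (F (Suc q)) W A (restriction (F (Suc q)) V W (d q V s))"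
      using A W V by (intro G.res_res[symmetric] mor_closed)
    also have "\<dots> = \<one>\<^bsub>sections (F (Suc q)) A\<^esub>" unfolding W(4) using W A by (intro G.res_one)
    finally show ?thesis
      using A V F.res_closed F.germ_res by (intro exI[of _ A] exI[of _ "restriction (F q) V A s"]) auto
  qed
  show "x = \<one>\<^bsub>sections (godement_sheaf X (F 0)) U\<^esub>"
    if x: "x \<in> Sc (godement_sheaf X (F 0)) U"
      "family_map X (F 1) (d 0) U x = \<one>\<^bsub>sections (godement_sheaf X (F 1)) U\<^esub>"
  proof -
    interpret F: gpresheaf X "F 0" by (rule presheaf_complexD(3)[OF pc])
    show ?thesis
    proof (rule G_eqI[OF x(1) F.G_one_closed[OF U]])
      fix p assume p: "p \<in> U"
      obtain V s where V: "openin X V" "p \<in> V" "s \<in> Sc (F 0) V" "family x p = germ X (F 0) p V s"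
         "d 0 V s = \<one>\<^bsub>sections (F 1) V\<^esub>" using ker[OF x(1) _ p] x(2) by auto
      then have "\<exists>W. openin X W \<and> p \<in> W \<and> W \<subseteq> V \<and> restriction (F 0) V W s = \<one>\<^bsub>sections (F 0) W\<^esub>"
        using ex unfolding locally_exact_def by metis
      then have "family x p = \<one>\<^bsub>stalk X (F 0) p\<^esub>" using V F.stalk_one_iff by auto
      then show "family x p = family \<one>\<^bsub>sections (godement_sheaf X (F 0)) U\<^esub> p" using p by (simp add: G_one_at)
    qed
  qed
  show "\<exists>w. w \<in> Sc (godement_sheaf X (F q)) U \<and> family_map X (F (Suc q)) (d q) U w = y"
    if y: "y \<in> Sc (godement_sheaf X (F (Suc q))) U"
      "family_map X (F (Suc (Suc q))) (d (Suc q)) U y = \<one>\<^bsub>sections (godement_sheaf X (F (Suc (Suc q)))) U\<^esub>"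
  proof -
    interpret gmor X "F q" "F (Suc q)" "d q" by (rule presheaf_complexD(1)[OF pc])
    have "\<exists>V t. openin X V \<and> p \<in> V \<and> t \<in> Sc (F q) V \<and> family y p = germ X (F (Suc q)) p V (d q V t)"
      if p: "p \<in> U" for p
    proof -
      obtain V s where V: "openin X V" "p \<in> V" "s \<in> Sc (F (Suc q)) V" "family y p = germ X (F (Suc q)) p V s"
         "d (Suc q) V s = \<one>\<^bsub>sections (F (Suc (Suc q))) V\<^esub>" using ker[OF y p] by auto
      then obtain W t where W: "openin X W" "p \<in> W" "W \<subseteq> V" "t \<in> Sc (F q) W" "d q W t = restriction (F (Suc q)) V W s"
        using ex unfolding locally_exact_def by metis
      then have "family y p = germ X (F (Suc q)) p W (d q W t)" using V G.germ_res[of V W p s] by simp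
      then show ?thesis using W by blast
    qed
    then obtain V t where V: "\<And>p. p \<in> U \<Longrightarrow> openin X (V p)" "\<And>p. p \<in> U \<Longrightarrow> p \<in> V p"
       "\<And>p. p \<in> U \<Longrightarrow> t p \<in> Sc (F q) (V p)" "\<And>p. p \<in> U \<Longrightarrow> family y p = germ X (F (Suc q)) p (V p) (d q (V p) (t p))"
      by metis
    define w where "w = Family (\<lambda>p\<in>U. germ X (F q) p (V p) (t p))"
    have w: "w \<in> Sc F.GF U" unfolding w_def by (intro G_memI F.stalkI V)
    have "fm U w = y"
    proof (rule G_eqI[OF fm_closed[OF w] y(1)])
      fix p assume p: "p \<in> U"
      show "family (fm U w) p = family y p"
        unfolding V(4)[OF p] by (intro fm_at p V) (simp add: w_def p)
    qed
    then show ?thesis using w by blast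
  qed
qed

text \<open>The argument of the nine lemma on germs. A cocycle \<open>z\<close> of the quotient
  lifts locally to \<open>y\<close> in \<open>C^0\<close>; the differential of \<open>y\<close> is
  locally the germ family of some \<open>x\<close>; \<open>x\<close> is a cocycle and so locally the
  differential of some \<open>t\<close>. Correcting \<open>y\<close> by \<open>t\<close> gives a
  cocycle of \<open>C^0\<close> lifting \<open>z\<close> (\<open>key\<close>), to which
  \<open>godement_exact\<close> applies.\<close>

lemma locally_exact_QQ:
  assumes ex: "locally_exact X F d"
  shows "locally_exact X (\<lambda>q. QQ X (F q)) (\<lambda>q. QQ_map X (F (Suc q)) (d q))"
proof -
  have pc: "presheaf_complex X F d" using ex by (simp add: locally_exact_def)
  let ?C = "\<lambda>q. godement_sheaf X (F q)"
  have key: "\<exists>V y. openin X V \<and> p \<in> V \<and> V \<subseteq> U \<and> y \<in> Sc (?C q) V \<and>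
      restriction (QQ X (F q)) U V z = to_QQ X (F q) V y \<and>
      family_map X (F (Suc q)) (d q) V y = \<one>\<^bsub>sections (?C (Suc q)) V\<^esub>"
    if U: "openin X U" and p: "p \<in> U" and z: "z \<in> Sc (QQ X (F q)) U"
      and dz: "QQ_map X (F (Suc q)) (d q) U z = \<one>\<^bsub>sections (QQ X (F (Suc q))) U\<^esub>" for U p z q
  proof -
    interpret a: gmor X "F q" "F (Suc q)" "d q" by (rule presheaf_complexD(1)[OF pc])
    interpret b: gmor X "F (Suc q)" "F (Suc (Suc q))" "d (Suc q)" by (rule presheaf_complexD(1)[OF pc])
    interpret Qa: gmor X "QQ X (F q)" "QQ X (F (Suc q))" "QQ_map X (F (Suc q)) (d q)" by (rule a.QQ_gmor)
    interpret Ca: gmor X "?C q" "?C (Suc q)" "a.fm" by (rule a.GF_gmor)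
    interpret \<pi>: gmor X "?C q" "QQ X (F q)" "to_QQ X (F q)"
      by (intro gmor.intro a.F.G_abpresheaf a.F.QQ_abpresheaf a.F.to_QQ_pshom)
    interpret \<iota>: gmor X "F q" "?C q" "germ_family X (F q)"
      by (intro gmor.intro a.gF a.F.G_abpresheaf a.F.germ_family_pshom)
    interpret \<iota>b: gmor X "F (Suc q)" "?C (Suc q)" "germ_family X (F (Suc q))"
      by (intro gmor.intro a.gG a.G.G_abpresheaf a.G.germ_family_pshom)
    obtain V y where V: "openin X V" "p \<in> V" "V \<subseteq> U" "y \<in> Sc (?C q) V" "restriction (QQ X (F q)) U V z = to_QQ X (F q) V y"
      by (rule a.F.to_QQ_locally_surj[OF U z p])
    have "to_QQ X (F (Suc q)) V (a.fm V y) = restriction (QQ X (F (Suc q))) U V (QQ_map X (F (Suc q)) (d q) U z)"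
      using V U z by (simp add: Qa.mor_res flip: a.QQ_map_to_QQ)
    also have "\<dots> = \<one>\<^bsub>sections (QQ X (F (Suc q))) V\<^esub>" using U V dz by (simp add: Qa.G.res_one)
    finally obtain W x where W: "openin X W" "p \<in> W" "W \<subseteq> V" "x \<in> Sc (F (Suc q)) W"
        "restriction (?C (Suc q)) V W (a.fm V y) = germ_family X (F (Suc q)) W x"
      using a.G.to_QQ_kernel[OF V(1) a.fm_closed[OF V(4)] _ V(2)] by metis
    define y' where "y' = restriction (?C q) V W y"
    have y': "y' \<in> Sc (?C q) W" "a.fm W y' = germ_family X (F (Suc q)) W x"
      using V W by (auto simp: y'_def Ca.mor_res intro: Ca.F.res_closed)
    \<comment> \<open>The cocycle condition for \<open>x\<close> is only visible on germs, hence one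
      more shrinking to \<open>A\<close> before local exactness can supply \<open>t\<close>.\<close>
    have "germ_family X (F (Suc (Suc q))) W (d (Suc q) W x) = b.fm W (a.fm W y')"
      using W y' by (simp add: b.fm_germ_family)
    also have "\<dots> = \<one>\<^bsub>sections (?C (Suc (Suc q))) W\<^esub>"
      by (rule family_map_comp_triv[OF a.gmor_axioms b.gmor_axioms presheaf_complexD(2)[OF pc] W(1) y'(1)])
    finally obtain A where A: "openin X A" "p \<in> A" "A \<subseteq> W"
        "restriction (F (Suc (Suc q))) W A (d (Suc q) W x) = \<one>\<^bsub>sections (F (Suc (Suc q))) A\<^esub>"
      using b.G.germ_family_locally_inj[OF W(1,2) b.mor_closed[OF W(1,4)]] by metis
    then have "d (Suc q) A (restriction (F (Suc q)) W A x) = \<one>\<^bsub>sections (F (Suc (Suc q))) A\<^esub>"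
      using W by (simp add: b.mor_res)
    moreover have "restriction (F (Suc q)) W A x \<in> Sc (F (Suc q)) A" using A W by auto
    ultimately obtain B t where B: "openin X B" "p \<in> B" "B \<subseteq> A" "t \<in> Sc (F q) B"
        "d q B t = restriction (F (Suc q)) A B (restriction (F (Suc q)) W A x)"
      using ex A unfolding locally_exact_def by metis
    have dt: "d q B t = restriction (F (Suc q)) W B x" using A B W a.G.res_res by simp
    \<comment> \<open>The germs of \<open>t\<close> do not change the class in the quotient but
      cancel the differential of \<open>y\<close>.\<close>
    define w where "w = restriction (?C q) V B y \<otimes>\<^bsub>sections (?C q) B\<^esub> inv\<^bsub>sections (?C q) B\<^esub> (germ_family X (F q) B t)"
    have BV: "B \<subseteq> V" "B \<subseteq> U" "B \<subseteq> W" using B A W V by auto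
    have g: "restriction (?C q) V B y \<in> Sc (?C q) B" "germ_family X (F q) B t \<in> Sc (?C q) B"
      using B V BV by (auto intro: \<iota>.mor_closed)
    have gi: "inv\<^bsub>sections (?C q) B\<^esub> (germ_family X (F q) B t) \<in> Sc (?C q) B"
      using B(1) g(2) by (rule Ca.F.inv_closed)
    have w: "w \<in> Sc (?C q) B" unfolding w_def using B(1) g(1) gi by (rule Ca.F.mult_closed)
    have yB: "a.fm B (restriction (?C q) V B y) = germ_family X (F (Suc q)) B (d q B t)"
    proof -
      have "a.fm B (restriction (?C q) V B y) = restriction (?C (Suc q)) W B (a.fm W y')"
        using B V W BV y'(1) by (simp add: Ca.mor_res) (simp add: y'_def Ca.F.res_res)
      then show ?thesis using y' W B BV dt by (simp add: \<iota>b.mor_res)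
    qed
    interpret gB: comm_group "sections (?C (Suc q)) B" using B a.G.G_comm_group by blast
    interpret qB: comm_group "sections (QQ X (F q)) B" using B Qa.F.sections_comm_group by blast
    have "a.fm B w = \<one>\<^bsub>sections (?C (Suc q)) B\<^esub>"
      unfolding w_def Ca.mor_mult[OF B(1) g(1) gi] Ca.mor_inv[OF B(1) g(2)] yB a.fm_germ_family[OF B(1,4)]
      by (intro gB.r_inv \<iota>b.mor_closed a.mor_closed B)
    moreover have "restriction (QQ X (F q)) U B z = to_QQ X (F q) B w"
    proof -
      have "restriction (QQ X (F q)) U B z = to_QQ X (F q) B (restriction (?C q) V B y)"
        using V B BV U z by (metis \<pi>.mor_res Qa.F.res_res)
      then show ?thesis
        unfolding w_def \<pi>.mor_mult[OF B(1) g(1) gi] \<pi>.mor_inv[OF B(1) g(2)] a.F.to_QQ_germ_family[OF B(1,4)]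
        using \<pi>.mor_closed[OF B(1) g(1)] by simp
    qed
    ultimately show ?thesis using B BV w by blast
  qed
  show ?thesis
    unfolding locally_exact_def
  proof (intro conjI allI impI)
    show "presheaf_complex X (\<lambda>q. QQ X (F q)) (\<lambda>q. QQ_map X (F (Suc q)) (d q))"
      by (rule presheaf_complex_QQ[OF pc])
  next
    fix U s p assume U: "openin X U" "p \<in> U" "s \<in> Sc (QQ X (F 0)) U"
      "QQ_map X (F (Suc 0)) (d 0) U s = \<one>\<^bsub>sections (QQ X (F 1)) U\<^esub>"
    then obtain V y where V: "openin X V" "p \<in> V" "V \<subseteq> U" "y \<in> Sc (?C 0) V"
      "restriction (QQ X (F 0)) U V s = to_QQ X (F 0) V y"
      "family_map X (F 1) (d 0) V y = \<one>\<^bsub>sections (?C 1) V\<^esub>" using key[of U p s 0] by auto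
    interpret F: gpresheaf X "F 0" by (rule presheaf_complexD(3)[OF pc])
    have "y = \<one>\<^bsub>sections (?C 0) V\<^esub>" by (rule godement_exact(1)[OF ex V(1,4,6)])
    then have "restriction (QQ X (F 0)) U V s = \<one>\<^bsub>sections (QQ X (F 0)) V\<^esub>"
      using V(1,5) pshom_one[OF _ _ F.to_QQ_pshom] F.G_abpresheaf F.QQ_abpresheaf by (simp add: gpresheaf_def)
    then show "\<exists>V. openin X V \<and> p \<in> V \<and> V \<subseteq> U \<and> restriction (QQ X (F 0)) U V s = \<one>\<^bsub>sections (QQ X (F 0)) V\<^esub>"
      using V by blast
  next
    fix q U s p assume U: "openin X U" "p \<in> U" "s \<in> Sc (QQ X (F (Suc q))) U"
      "QQ_map X (F (Suc (Suc q))) (d (Suc q)) U s = \<one>\<^bsub>sections (QQ X (F (Suc (Suc q)))) U\<^esub>"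
    interpret a: gmor X "F q" "F (Suc q)" "d q" by (rule presheaf_complexD(1)[OF pc])
    obtain V y where V: "openin X V" "p \<in> V" "V \<subseteq> U" "y \<in> Sc (?C (Suc q)) V"
      "restriction (QQ X (F (Suc q))) U V s = to_QQ X (F (Suc q)) V y"
      "family_map X (F (Suc (Suc q))) (d (Suc q)) V y = \<one>\<^bsub>sections (?C (Suc (Suc q))) V\<^esub>" using key[OF U] by metis
    obtain w where w: "w \<in> Sc (?C q) V" "a.fm V w = y"
      using godement_exact(2)[OF ex V(1,4,6)] by blast
    show "\<exists>V t. openin X V \<and> p \<in> V \<and> V \<subseteq> U \<and> t \<in> Sc (QQ X (F q)) V \<and>
        QQ_map X (F (Suc q)) (d q) V t = restriction (QQ X (F (Suc q))) U V s"
      using V w a.QQ_map_to_QQ[OF V(1) w(1)] pshomD(1)[OF a.F.to_QQ_pshom V(1) w(1)]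
      by (intro exI[of _ V] exI[of _ "to_QQ X (F q) V w"]) auto
  qed
qed

section \<open>Iterating the one-step construction\<close>

lemma godement_Q_Suc: "godement_Q X F (Suc k) = QQ X (godement_Q X F k)"
  by (simp add: QQ_def)

lemma godement_Q_map_Suc: "godement_Q_map X G f (Suc k) = QQ_map X (godement_Q X G k) (godement_Q_map X G f k)"
  by (simp add: QQ_map_def godement_C_def)

lemma locally_exact_godement_Q:
  assumes "locally_exact X F d"
  shows "locally_exact X (\<lambda>q. godement_Q X (F q) k) (\<lambda>q. godement_Q_map X (F (Suc q)) (d q) k)"
proof (induction k)
  case 0
  then show ?case using assms by (simp add: godement_Q.simps(1) godement_Q_map.simps(1))
next
  case (Suc k)
  then show ?case unfolding godement_Q_Suc godement_Q_map_Suc by (rule locally_exact_QQ)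
qed

lemma gmor_godement_Q: "gmor X F G f \<Longrightarrow> gmor X (godement_Q X F k) (godement_Q X G k) (godement_Q_map X G f k)"
  by (induction k) (simp, metis godement_Q_Suc godement_Q_map_Suc gmor.QQ_gmor)

lemma gpresheaf_godement_Q: "gpresheaf X F \<Longrightarrow> gpresheaf X (godement_Q X F k)"
  by (induction k) (simp, metis godement_Q_Suc gpresheaf.QQ_abpresheaf)

lemma gmor_godement_C: "gmor X F G f \<Longrightarrow> gmor X (godement_C X F k) (godement_C X G k) (godement_C_map X G f k)"
  unfolding godement_C_def godement_C_map_def by (intro gmor.GF_gmor gmor_godement_Q)

lemma godement_Q_map_square:
  assumes "gmor X F G f" "gmor X G H g" "gmor X F G' f'" "gmor X G' H g'"
    and "\<And>U s. \<lbrakk>openin X U; s \<in> Sc F U\<rbrakk> \<Longrightarrow> g U (f U s) = g' U (f' U s)"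
  shows "\<lbrakk>openin X U; y \<in> Sc (godement_Q X F k) U\<rbrakk> \<Longrightarrow>
    godement_Q_map X H g k U (godement_Q_map X G f k U y) = godement_Q_map X H g' k U (godement_Q_map X G' f' k U y)"
proof (induction k arbitrary: U y)
  case 0
  then show ?case using assms(5) by simp
next
  case (Suc k)
  then show ?case unfolding godement_Q_Suc godement_Q_map_Suc
    by (intro QQ_map_square[OF assms(1-4)[THEN gmor_godement_Q]]) auto
qed

lemma godement_C_map_square:
  assumes "gmor X F G f" "gmor X G H g" "gmor X F G' f'" "gmor X G' H g'"
    and "\<And>U s. \<lbrakk>openin X U; s \<in> Sc F U\<rbrakk> \<Longrightarrow> g U (f U s) = g' U (f' U s)"
    and "openin X U" "y \<in> Sc (godement_C X F k) U"
  shows "godement_C_map X H g k U (godement_C_map X G f k U y) = godement_C_map X H g' k U (godement_C_map X G' f' k U y)"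
  using assms(6,7) unfolding godement_C_def godement_C_map_def
  by (intro family_map_square[OF assms(1-4)[THEN gmor_godement_Q]] godement_Q_map_square[OF assms(1-5)]) auto

lemma godement_C_exact:
  assumes "locally_exact X F d" and U: "openin X U"
  shows "\<lbrakk>x \<in> Sc (godement_C X (F 0) k) U;
      godement_C_map X (F 1) (d 0) k U x = \<one>\<^bsub>sections (godement_C X (F 1) k) U\<^esub>\<rbrakk>
      \<Longrightarrow> x = \<one>\<^bsub>sections (godement_C X (F 0) k) U\<^esub>"
    and "\<lbrakk>y \<in> Sc (godement_C X (F (Suc q)) k) U;
      godement_C_map X (F (Suc (Suc q))) (d (Suc q)) k U y = \<one>\<^bsub>sections (godement_C X (F (Suc (Suc q))) k) U\<^esub>\<rbrakk>
      \<Longrightarrow> \<exists>w. w \<in> Sc (godement_C X (F q) k) U \<and> godement_C_map X (F (Suc q)) (d q) k U w = y"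
  using godement_exact[OF locally_exact_godement_Q[OF assms(1), of k] U]
  unfolding godement_C_def godement_C_map_def by (auto simp: One_nat_def)

subsection \<open>The Godement differential\<close>

lemma godement_to_Q_eq: "godement_to_Q X F k = to_QQ X (godement_Q X F k)"
  unfolding godement_to_Q_def to_QQ_def godement_C_def by (intro ext) simp

lemma godement_delta_eq: "godement_delta X F k U x =
   germ_family X (QQ X (godement_Q X F k)) U (to_QQ X (godement_Q X F k) U x)"
  unfolding godement_delta_def godement_to_Q_eq godement_Q_Suc ..

lemma gmor_comp: "\<lbrakk>gmor X F G f; gmor X G H g\<rbrakk> \<Longrightarrow> gmor X F H (\<lambda>U s. g U (f U s))"
  unfolding gmor_def pshom_def by (auto simp: hom_def Pi_iff)

lemma gmor_to_QQ: "gpresheaf X F \<Longrightarrow> gmor X (godement_sheaf X F) (QQ X F) (to_QQ X F)"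
  by (intro gmor.intro gpresheaf.G_abpresheaf gpresheaf.QQ_abpresheaf gpresheaf.to_QQ_pshom)

lemma gmor_germ_family: "gpresheaf X F \<Longrightarrow> gmor X F (godement_sheaf X F) (germ_family X F)"
  by (intro gmor.intro gpresheaf.G_abpresheaf gpresheaf.germ_family_pshom)

lemma gmor_godement_delta:
  assumes "gpresheaf X F"
  shows "gmor X (godement_C X F k) (godement_C X F (Suc k)) (godement_delta X F k)"
proof -
  have Q: "gpresheaf X (godement_Q X F k)" by (rule gpresheaf_godement_Q[OF assms])
  have "godement_delta X F k = (\<lambda>U x. germ_family X (QQ X (godement_Q X F k)) U (to_QQ X (godement_Q X F k) U x))"
    by (intro ext godement_delta_eq)
  then show ?thesis
    using gmor_comp[OF gmor_to_QQ[OF Q] gmor_germ_family[OF gpresheaf.QQ_abpresheaf[OF Q]]]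
    by (simp add: godement_C_def godement_Q_Suc del: godement_Q.simps)
qed

text \<open>The composite contains \<open>Q^(k+1) -> C^(k+1) -> Q^(k+2)\<close>, and the quotient
  map kills germ families.\<close>

lemma godement_delta_delta:
  assumes "gpresheaf X F" "openin X U" "x \<in> Sc (godement_C X F k) U"
  shows "godement_delta X F (Suc k) U (godement_delta X F k U x) = \<one>\<^bsub>sections (godement_C X F (Suc (Suc k))) U\<^esub>"
proof -
  interpret Q: gpresheaf X "godement_Q X F k" by (rule gpresheaf_godement_Q[OF assms(1)])
  interpret QQ: gpresheaf X "QQ X (godement_Q X F k)" by (rule Q.QQ_abpresheaf)
  interpret \<pi>: gmor X "Q.GF" "QQ X (godement_Q X F k)" "to_QQ X (godement_Q X F k)"
    by (rule gmor_to_QQ[OF Q.gpresheaf_axioms])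
  interpret \<iota>: gmor X "QQ X (QQ X (godement_Q X F k))" "godement_C X F (Suc (Suc k))" "germ_family X (QQ X (QQ X (godement_Q X F k)))"
    unfolding godement_C_def godement_Q_Suc by (rule gmor_germ_family[OF QQ.QQ_abpresheaf])
  have "to_QQ X (godement_Q X F k) U x \<in> Sc (QQ X (godement_Q X F k)) U"
    using assms unfolding godement_C_def by (intro \<pi>.mor_closed)
  then show ?thesis
    using assms(2) by (simp add: godement_delta_eq godement_Q_Suc QQ.to_QQ_germ_family \<iota>.mor_one del: godement_Q.simps)
qed

lemma godement_delta_natural:
  assumes f: "gmor X F G f" and U: "openin X U" and x: "x \<in> Sc (godement_C X F k) U"
  shows "godement_delta X G k U (godement_C_map X G f k U x) = godement_C_map X G f (Suc k) U (godement_delta X F k U x)"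
proof -
  interpret q: gmor X "godement_Q X F k" "godement_Q X G k" "godement_Q_map X G f k" by (rule gmor_godement_Q[OF f])
  interpret Q: gmor X "QQ X (godement_Q X F k)" "QQ X (godement_Q X G k)" "QQ_map X (godement_Q X G k) (godement_Q_map X G f k)"
    by (rule q.QQ_gmor)
  interpret \<pi>: gmor X "q.F.GF" "QQ X (godement_Q X F k)" "to_QQ X (godement_Q X F k)"
    by (rule gmor_to_QQ[OF q.gF])
  have x: "x \<in> Sc q.F.GF U" using x by (simp add: godement_C_def)
  have "to_QQ X (godement_Q X F k) U x \<in> Sc (QQ X (godement_Q X F k)) U"
    using x U by (intro \<pi>.mor_closed)
  then show ?thesis
    unfolding godement_delta_eq godement_C_map_def godement_Q_Suc godement_Q_map_Suc
    using x U by (simp add: Q.fm_germ_family q.QQ_map_to_QQ)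
qed

section \<open>Flabby presheaves\<close>

text \<open>Besides extension of sections to the whole space, only the gluing half of
  \<open>is_sheaf\<close> is demanded. The other half fails for singular cochains, where nonzero
  sections can have trivial germs everywhere.\<close>

definition flabby :: "'a topology \<Rightarrow> ('a, ('a, 'b) gsec) presheaf \<Rightarrow> bool" where
  "flabby X F \<longleftrightarrow>
    (\<forall>U s. openin X U \<longrightarrow> s \<in> Sc F U \<longrightarrow> (\<exists>t\<in>Sc F (topspace X). restriction F (topspace X) U t = s)) \<and>
    (\<forall>U x. openin X U \<longrightarrow> induced X F U x \<longrightarrow> x \<in> germ_image X F U)"

context gpresheaf
begin

lemma G_glue_family:
  assumes "\<And>A. A \<in> \<A> \<Longrightarrow> y A \<in> Sc GF A"
    and "\<And>A B p. \<lbrakk>A \<in> \<A>; B \<in> \<A>; p \<in> A; p \<in> B\<rbrakk> \<Longrightarrow> family (y A) p = family (y B) p"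
  obtains x where "x \<in> Sc GF (\<Union>\<A>)" "\<And>A p. \<lbrakk>A \<in> \<A>; p \<in> A\<rbrakk> \<Longrightarrow> family x p = family (y A) p"
proof -
  define S where "S p = (SOME A. A \<in> \<A> \<and> p \<in> A)" for p
  have S: "S p \<in> \<A>" "p \<in> S p" if "p \<in> \<Union>\<A>" for p
  proof -
    have "\<exists>A. A \<in> \<A> \<and> p \<in> A" using that by blast
    then have "S p \<in> \<A> \<and> p \<in> S p" unfolding S_def by (rule someI_ex)
    then show "S p \<in> \<A>" "p \<in> S p" by auto
  qed
  define x where "x = Family (\<lambda>p\<in>\<Union>\<A>. family (y (S p)) p)"
  show ?thesis
  proof (rule that)
    show "x \<in> Sc GF (\<Union>\<A>)" unfolding x_def
      by (intro G_memI G_at[OF assms(1)[OF S(1)] S(2)])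
    show "family x p = family (y A) p" if "A \<in> \<A>" "p \<in> A" for A p
    proof -
      have "p \<in> \<Union>\<A>" using that by blast
      then show ?thesis unfolding x_def using assms(2)[OF S(1) that(1) S(2) that(2)] by simp
    qed
  qed
qed

text \<open>Zorn's lemma: a maximal open set over which a section of the quotient lifts is everything,
  as flabbiness corrects a local lift so as to agree with the given one.\<close>

lemma to_QQ_surj:
  assumes fl: "flabby X F" and U: "openin X U" and y: "y \<in> Sc (QQ X F) U"
  obtains x where "x \<in> Sc GF U" "to_QQ X F U x = y"
proof -
  interpret G: gpresheaf X GF by (rule G_abpresheaf)
  interpret Q: gpresheaf X "QQ X F" by (rule QQ_abpresheaf)
  interpret \<pi>: gmor X GF "QQ X F" "to_QQ X F" by (rule gmor_to_QQ[OF gpresheaf_axioms])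
  interpret \<iota>: gmor X F GF "germ_family X F" by (rule gmor_germ_family[OF gpresheaf_axioms])
  define P where "P A x \<longleftrightarrow> openin X A \<and> A \<subseteq> U \<and> x \<in> Sc GF A \<and> to_QQ X F A x = restriction (QQ X F) U A y" for A x
  define L where "L = {(A, x). P A x}"
  define ord where "ord = {((A, x), (B, z)). P A x \<and> P B z \<and> A \<subseteq> B \<and> (\<forall>p\<in>A. family x p = family z p)}"
  \<comment> \<open>Sections of the quotient may be compared locally: it is a sheaf even when
    \<open>F\<close> is not.\<close>
  have sep: "z1 = z2" if A: "openin X A" "z1 \<in> Sc (QQ X F) A" "z2 \<in> Sc (QQ X F) A"
    "\<And>p. p \<in> A \<Longrightarrow> \<exists>V. openin X V \<and> p \<in> V \<and> V \<subseteq> A \<and> restriction (QQ X F) A V z1 = restriction (QQ X F) A V z2"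
    for A z1 z2
  proof (rule is_sheafD(1)[OF QQ_is_sheaf A(1-3)])
    have "germ X (QQ X F) p A z1 = germ X (QQ X F) p A z2" if "p \<in> A" for p
    proof -
      obtain V where V: "openin X V" "V \<subseteq> A" "p \<in> V" "restriction (QQ X F) A V z1 = restriction (QQ X F) A V z2"
        using A(4) \<open>p \<in> A\<close> by blast
      show ?thesis
        using Q.germ_res[OF A(1) V(1-3) A(2)] Q.germ_res[OF A(1) V(1-3) A(3)] V(4) by simp
    qed
    then show "germ_family X (QQ X F) A z1 = germ_family X (QQ X F) A z2"
      unfolding germ_family_def by (auto intro: restrict_ext)
  qed
  have FL: "Field ord = L" by (auto simp: Field_def ord_def L_def)
  have "\<exists>m\<in>Field ord. \<forall>a\<in>Field ord. (m, a) \<in> ord \<longrightarrow> a = m"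
  proof (rule Zorns_po_lemma)
    show "Partial_order ord"
      unfolding partial_order_on_def preorder_on_def
    proof (intro conjI)
      show "refl_on (Field ord) ord" unfolding FL by (auto simp: refl_on_def L_def ord_def)
      show "trans ord" unfolding trans_def ord_def by (auto simp: subset_iff)
      show "antisym ord" unfolding antisym_def ord_def P_def by (auto intro: G_eqI)
    qed (auto simp: ord_def Field_def)
    show "\<exists>u\<in>Field ord. \<forall>a\<in>C. (a, u) \<in> ord" if C: "C \<in> Chains ord" for C
    proof -
      have CL: "P A x" if "(A, x) \<in> C" for A x
        using Chains_subset C that by (auto simp: ord_def Chains_def)
      have cmp: "family x p = family z p" if "(A, x) \<in> C" "(B, z) \<in> C" "p \<in> A" "p \<in> B" for A x B z p
      proof -
        have "((A, x), (B, z)) \<in> ord \<or> ((B, z), (A, x)) \<in> ord" using C that by (auto simp: Chains_def)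
        then show ?thesis using that by (auto simp: ord_def)
      qed
      define \<A> where "\<A> = fst ` C"
      define yy where "yy A = (SOME x. (A, x) \<in> C)" for A
      have yy: "(A, yy A) \<in> C" if A: "A \<in> \<A>" for A
      proof -
        obtain x where "(A, x) \<in> C" using A by (auto simp: \<A>_def)
        then show ?thesis unfolding yy_def by (rule someI)
      qed
      have yG: "yy A \<in> Sc GF A" if "A \<in> \<A>" for A using CL[OF yy[OF that]] by (simp add: P_def)
      have yc: "family (yy A) p = family (yy B) p" if "A \<in> \<A>" "B \<in> \<A>" "p \<in> A" "p \<in> B" for A B p
        by (rule cmp[OF yy[OF that(1)] yy[OF that(2)] that(3,4)])
      have "\<exists>x. x \<in> Sc GF (\<Union>\<A>) \<and> (\<forall>A\<in>\<A>. \<forall>p\<in>A. family x p = family (yy A) p)"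
        by (rule G_glue_family[of \<A> yy, OF yG yc]) blast+
      then obtain x where x: "x \<in> Sc GF (\<Union>\<A>)" "\<And>A p. \<lbrakk>A \<in> \<A>; p \<in> A\<rbrakk> \<Longrightarrow> family x p = family (yy A) p"
        by blast
      have op: "openin X A" "A \<subseteq> U" if "A \<in> \<A>" for A using CL[OF yy[OF that]] by (simp_all add: P_def)
      then have o: "openin X (\<Union>\<A>)" "\<Union>\<A> \<subseteq> U" by auto
      have r: "restriction GF (\<Union>\<A>) A x = yy A" if "A \<in> \<A>" for A
        using that x by (intro G_eqI[OF G_res_closed[OF _ x(1)] yG]) (auto simp: G_res_at)
      have "to_QQ X F (\<Union>\<A>) x = restriction (QQ X F) U (\<Union>\<A>) y"
      proof (rule sep[OF o(1)])
        show "to_QQ X F (\<Union>\<A>) x \<in> Sc (QQ X F) (\<Union>\<A>)" by (rule \<pi>.mor_closed[OF o(1) x(1)])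
        show "restriction (QQ X F) U (\<Union>\<A>) y \<in> Sc (QQ X F) (\<Union>\<A>)" by (rule Q.res_closed[OF U o y])
        fix p assume "p \<in> \<Union>\<A>"
        then obtain A where A: "A \<in> \<A>" "p \<in> A" by blast
        have "restriction (QQ X F) (\<Union>\<A>) A (to_QQ X F (\<Union>\<A>) x) = to_QQ X F A (yy A)"
          using A op o x r by (subst \<pi>.mor_res) auto
        also have "\<dots> = restriction (QQ X F) U A y" using CL[OF yy[OF A(1)]] by (simp add: P_def)
        also have "\<dots> = restriction (QQ X F) (\<Union>\<A>) A (restriction (QQ X F) U (\<Union>\<A>) y)"
          using A op o U y by (intro Q.res_res[symmetric]) auto
        finally show "\<exists>V. openin X V \<and> p \<in> V \<and> V \<subseteq> \<Union>\<A> \<and> restriction (QQ X F) (\<Union>\<A>) V (to_QQ X F (\<Union>\<A>) x) =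
            restriction (QQ X F) (\<Union>\<A>) V (restriction (QQ X F) U (\<Union>\<A>) y)"
          using A op by blast
      qed
      then have Px: "P (\<Union>\<A>) x" using o x by (simp add: P_def)
      have "((A, z), (\<Union>\<A>, x)) \<in> ord" if "(A, z) \<in> C" for A z
      proof -
        have A: "A \<in> \<A>" using that by (force simp: \<A>_def)
        have "family z p = family x p" if "p \<in> A" for p
          using x(2)[OF A that] cmp[OF \<open>(A, z) \<in> C\<close> yy[OF A] that that] by simp
        then show ?thesis using A Px CL[OF that] by (auto simp: ord_def)
      qed
      then show ?thesis using Px unfolding FL by (intro bexI[of _ "(\<Union>\<A>, x)"]) (auto simp: L_def)
    qed
  qed
  then obtain A x where m: "(A, x) \<in> L" "\<And>a. \<lbrakk>a \<in> L; ((A, x), a) \<in> ord\<rbrakk> \<Longrightarrow> a = (A, x)"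
    unfolding FL by auto
  have max: "P A x" using m(1) by (simp add: L_def)
  have max': "B = A" if "P B z" "A \<subseteq> B" "\<forall>p\<in>A. family x p = family z p" for B z
    using m(2)[of "(B, z)"] that max by (simp add: L_def ord_def)
  note A = max[unfolded P_def]
  have "p \<in> A" if p: "p \<in> U" for p
  proof -
    obtain V w where V: "openin X V" "p \<in> V" "V \<subseteq> U" "w \<in> Sc GF V" "restriction (QQ X F) U V y = to_QQ X F V w"
      by (rule to_QQ_locally_surj[OF U y p])
    define W where "W = A \<inter> V"
    have W: "openin X W" "W \<subseteq> A" "W \<subseteq> V" "W \<subseteq> U" using A V by (auto simp: W_def)
    interpret gW: comm_group "sections GF W" using W G_comm_group by blast
    interpret qW: comm_group "sections (QQ X F) W" using W Q.sections_comm_group by blast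
    define xW wW where "xW = restriction GF A W x" and "wW = restriction GF V W w"
    have c: "xW \<in> Sc GF W" "wW \<in> Sc GF W" using A V W by (auto simp: xW_def wW_def intro: G_res_closed)
    have "to_QQ X F W xW = restriction (QQ X F) U W y"
      using A W U y by (simp add: xW_def Q.res_res flip: \<pi>.mor_res)
    moreover have "to_QQ X F W wW = restriction (QQ X F) U W y"
    proof -
      have "to_QQ X F W wW = restriction (QQ X F) V W (to_QQ X F V w)" unfolding wW_def using V W by (simp add: \<pi>.mor_res)
      also have "\<dots> = restriction (QQ X F) U W y" unfolding V(5)[symmetric] using V W U y by (intro Q.res_res)
      finally show ?thesis .
    qed
    ultimately have "to_QQ X F W (xW \<otimes>\<^bsub>sections GF W\<^esub> inv\<^bsub>sections GF W\<^esub> wW) = \<one>\<^bsub>sections (QQ X F) W\<^esub>"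
      using c W qW.r_inv[OF \<pi>.mor_closed[OF W(1) c(2)]] by (simp add: \<pi>.mor_mult \<pi>.mor_inv)
    \<comment> \<open>On the overlap \<open>W\<close> the two lifts of \<open>y\<close> differ by
      \<open>z\<close>, which lies in the kernel and so comes from a section \<open>s\<close> of
      \<open>F\<close>. Extending \<open>s\<close> to the whole space lets \<open>w\<close> be
      corrected on all of \<open>V\<close>, after which it agrees with \<open>x\<close> on
      \<open>W\<close>.\<close>
    moreover define z where "z = xW \<otimes>\<^bsub>sections GF W\<^esub> inv\<^bsub>sections GF W\<^esub> wW"
    ultimately have z: "z \<in> Sc GF W" "to_QQ X F W z = \<one>\<^bsub>sections (QQ X F) W\<^esub>" using c by auto
    have "induced X F W z"
      unfolding induced_iff[OF W(1)]
    proof (intro conjI ballI z)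
      fix q assume q: "q \<in> W"
      obtain B t where "openin X B" "q \<in> B" "B \<subseteq> W" "t \<in> Sc F B" "restriction GF W B z = germ_family X F B t"
        by (rule to_QQ_kernel[OF W(1) z q])
      then show "\<exists>V t. openin X V \<and> q \<in> V \<and> V \<subseteq> W \<and> t \<in> Sc F V \<and> restriction GF W V z = germ_family X F V t"
        by blast
    qed
    then obtain s where s: "s \<in> Sc F W" "z = germ_family X F W s"
      using fl W unfolding flabby_def germ_image_def by blast
    then obtain t where t: "t \<in> Sc F (topspace X)" "restriction F (topspace X) W t = s"
      using fl W unfolding flabby_def by metis
    have VX: "V \<subseteq> topspace X" using V openin_subset by blast
    define t' where "t' = restriction F (topspace X) V t"
    have t': "t' \<in> Sc F V" "restriction F V W t' = s" unfolding t'_def using t V W VX by (auto simp: res_res)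
    define w' where "w' = germ_family X F V t' \<otimes>\<^bsub>sections GF V\<^esub> w"
    have gt: "germ_family X F V t' \<in> Sc GF V" using t' V by (intro \<iota>.mor_closed)
    have w': "w' \<in> Sc GF V" unfolding w'_def using gt V by (intro G.mult_closed)
    interpret qV: comm_group "sections (QQ X F) V" using V Q.sections_comm_group by blast
    have w'y: "to_QQ X F V w' = restriction (QQ X F) U V y"
      unfolding w'_def V(5) using gt V t' \<pi>.mor_closed[OF V(1,4)] by (simp add: \<pi>.mor_mult to_QQ_germ_family)
    have "restriction GF V W w' = z \<otimes>\<^bsub>sections GF W\<^esub> wW"
      unfolding w'_def wW_def s(2) using gt V W t' by (simp add: G.res_mult \<iota>.mor_res)
    also have "\<dots> = xW" unfolding z_def using c by (simp add: gW.m_assoc)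
    finally have agree: "family x q = family w' q" if "q \<in> A" "q \<in> V" for q
      using that unfolding xW_def by (metis G_res_at IntI W_def)
    obtain v where v: "v \<in> Sc GF (\<Union>{A, V})" "\<And>B p. \<lbrakk>B \<in> {A, V}; p \<in> B\<rbrakk> \<Longrightarrow> family v p = family (if B = A then x else w') p"
      by (rule G_glue_family[of "{A, V}" "\<lambda>B. if B = A then x else w'"]) (use A V w' agree in auto)
    define B where "B = A \<union> V"
    have B: "openin X B" "B \<subseteq> U" "A \<subseteq> B" "V \<subseteq> B" using A V by (auto simp: B_def)
    have vB: "v \<in> Sc GF B" using v(1) by (simp add: B_def)
    have vA: "restriction GF B A v = x"
      using v(2)[of A] A B vB by (intro G_eqI[OF G_res_closed]) (auto simp: G_res_at)
    have "family v q = family w' q" if "q \<in> V" for q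
      using v(2)[of V q] that agree by (cases "V = A") auto
    then have vV: "restriction GF B V v = w'"
      using w' B vB by (intro G_eqI[OF G_res_closed]) (auto simp: G_res_at)
    have "to_QQ X F B v = restriction (QQ X F) U B y"
    proof (rule sep[OF B(1) \<pi>.mor_closed[OF B(1) vB] Q.res_closed[OF U B(1,2) y]])
      fix q assume "q \<in> B"
      moreover have "restriction (QQ X F) B A (to_QQ X F B v) = restriction (QQ X F) B A (restriction (QQ X F) U B y)"
        using A B vB vA U y by (simp add: \<pi>.mor_res Q.res_res)
      moreover have "restriction (QQ X F) B V (to_QQ X F B v) = restriction (QQ X F) B V (restriction (QQ X F) U B y)"
        using V B vB vV U y w'y by (simp add: \<pi>.mor_res Q.res_res)
      ultimately show "\<exists>V. openin X V \<and> q \<in> V \<and> V \<subseteq> B \<and> restriction (QQ X F) B V (to_QQ X F B v) =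
          restriction (QQ X F) B V (restriction (QQ X F) U B y)"
        using A V B unfolding B_def by blast
    qed
    then have "P B v" using B vB by (simp add: P_def)
    moreover have "\<forall>q\<in>A. family x q = family v q" using v(2)[of A] by simp
    ultimately have "B = A" using max' B by blast
    then show ?thesis using V B by blast
  qed
  then have "A = U" using A by blast
  then show ?thesis using that[of x] A U y by (simp add: Q.res_id)
qed

text \<open>Sections of \<open>C^0 F\<close> extend trivially, by neutral germs outside
  \<open>U\<close>. Lifting \<open>y\<close> there with \<open>to_QQ_surj\<close>, extending and
  projecting again extends \<open>y\<close>. Gluing is automatic because the quotient is a
  sheaf.\<close>

lemma flabby_QQ:
  assumes fl: "flabby X F"
  shows "flabby X (QQ X F)"
  unfolding flabby_def
proof (intro conjI allI impI)
  interpret \<pi>: gmor X GF "QQ X F" "to_QQ X F" by (rule gmor_to_QQ[OF gpresheaf_axioms])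
  interpret G: gpresheaf X GF by (rule G_abpresheaf)
  fix U y assume U: "openin X U" and y: "y \<in> Sc (QQ X F) U"
  obtain x where x: "x \<in> Sc GF U" "to_QQ X F U x = y" by (rule to_QQ_surj[OF fl U y])
  have UX: "U \<subseteq> topspace X" using U openin_subset by blast
  define x' where "x' = Family (\<lambda>p\<in>topspace X. if p \<in> U then family x p else \<one>\<^bsub>stalk X F p\<^esub>)"
  have x': "x' \<in> Sc GF (topspace X)" unfolding x'_def
  proof (rule G_memI)
    fix p assume p: "p \<in> topspace X"
    show "(if p \<in> U then family x p else \<one>\<^bsub>stalk X F p\<^esub>) \<in> carrier (stalk X F p)"
      using G_at[OF x(1)] stalkI[OF openin_topspace p one_closed[OF openin_topspace]]
        stalk_one[OF openin_topspace p] by auto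
  qed
  have "restriction GF (topspace X) U x' = x"
    using UX by (intro G_eqI[OF G_res_closed[OF UX x'] x(1)]) (auto simp: G_res_at x'_def)
  then have "restriction (QQ X F) (topspace X) U (to_QQ X F (topspace X) x') = y"
    using x x' U UX by (simp add: \<pi>.mor_res)
  then show "\<exists>t\<in>Sc (QQ X F) (topspace X). restriction (QQ X F) (topspace X) U t = y"
    using \<pi>.mor_closed[OF openin_topspace x'] by blast
next
  fix U x assume "openin X U" "induced X (QQ X F) U x"
  then show "x \<in> germ_image X (QQ X F) U" by (rule is_sheafD(2)[OF QQ_is_sheaf])
qed

text \<open>The local sections given by \<open>to_QQ_kernel\<close> form an induced family, and the
  gluing half of \<open>flabby\<close> turns it into one section.\<close>

lemma flabby_kernel:
  assumes fl: "flabby X F" and U: "openin X U" and z: "z \<in> Sc GF U" "to_QQ X F U z = \<one>\<^bsub>sections (QQ X F) U\<^esub>"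
  obtains s where "s \<in> Sc F U" "z = germ_family X F U s"
proof -
  have "induced X F U z"
    unfolding induced_iff[OF U]
  proof (intro conjI ballI z)
    fix q assume q: "q \<in> U"
    obtain B t where "openin X B" "q \<in> B" "B \<subseteq> U" "t \<in> Sc F B" "restriction GF U B z = germ_family X F B t"
      by (rule to_QQ_kernel[OF U z q])
    then show "\<exists>V t. openin X V \<and> q \<in> V \<and> V \<subseteq> U \<and> t \<in> Sc F V \<and> restriction GF U V z = germ_family X F V t"
      by blast
  qed
  then show ?thesis using fl U that unfolding flabby_def germ_image_def by blast
qed

end

lemma flabby_godement_Q: "\<lbrakk>gpresheaf X F; flabby X F\<rbrakk> \<Longrightarrow> flabby X (godement_Q X F k)"
proof (induction k)
  case (Suc k)
  then show ?case
    using gpresheaf.flabby_QQ[OF gpresheaf_godement_Q[OF Suc.prems(1)]] by (simp only: godement_Q_Suc)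
qed simp

text \<open>On sections over \<open>U\<close>, the sequence \<open>Q^k -> C^k -> Q^(k+1)\<close> is
  exact in the middle and onto at the end, and \<open>Q^(k+1) -> C^(k+1)\<close> is injective
  because \<open>Q^(k+1)\<close> is a sheaf. Splicing two neighbouring sequences gives the claim. In
  degree 0 only a germ family is obtained, as \<open>F -> C^0 F\<close> need not be
  injective.\<close>

lemma flabby_godement_exact:
  assumes F: "gpresheaf X F" and fl: "flabby X F" and U: "openin X U" and x: "x \<in> Sc (godement_C X F k) U"
    and dx: "godement_delta X F k U x = \<one>\<^bsub>sections (godement_C X F (Suc k)) U\<^esub>"
  shows "case k of 0 \<Rightarrow> \<exists>s\<in>Sc F U. x = germ_family X F U s
    | Suc j \<Rightarrow> \<exists>w\<in>Sc (godement_C X F j) U. godement_delta X F j U w = x"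
proof -
  interpret Qk: gpresheaf X "godement_Q X F k" by (rule gpresheaf_godement_Q[OF F])
  interpret \<pi>: gmor X Qk.GF "QQ X (godement_Q X F k)" "to_QQ X (godement_Q X F k)" by (rule gmor_to_QQ[OF Qk.gpresheaf_axioms])
  interpret \<iota>: gmor X "QQ X (godement_Q X F k)" "godement_sheaf X (QQ X (godement_Q X F k))" "germ_family X (QQ X (godement_Q X F k))"
    by (rule gmor_germ_family[OF \<pi>.gG])
  have x': "x \<in> Sc Qk.GF U" using x by (simp add: godement_C_def)
  have "germ_family X (QQ X (godement_Q X F k)) U (to_QQ X (godement_Q X F k) U x) =
     germ_family X (QQ X (godement_Q X F k)) U \<one>\<^bsub>sections (QQ X (godement_Q X F k)) U\<^esub>"
    using dx U by (simp add: godement_delta_eq godement_C_def godement_Q_Suc \<iota>.mor_one del: godement_Q.simps)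
  then have "to_QQ X (godement_Q X F k) U x = \<one>\<^bsub>sections (QQ X (godement_Q X F k)) U\<^esub>"
    by (rule is_sheafD(1)[OF Qk.QQ_is_sheaf U \<pi>.mor_closed[OF U x'] \<pi>.G.one_closed[OF U]])
  then obtain s where s: "s \<in> Sc (godement_Q X F k) U" "x = germ_family X (godement_Q X F k) U s"
    using Qk.flabby_kernel[OF flabby_godement_Q[OF F fl] U x'] by metis
  show ?thesis
  proof (cases k)
    case 0
    then show ?thesis using s by auto
  next
    case (Suc j)
    interpret Qj: gpresheaf X "godement_Q X F j" by (rule gpresheaf_godement_Q[OF F])
    have s': "s \<in> Sc (QQ X (godement_Q X F j)) U" using s(1) unfolding Suc godement_Q_Suc .
    obtain w where w: "w \<in> Sc Qj.GF U" "to_QQ X (godement_Q X F j) U w = s"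
      by (rule Qj.to_QQ_surj[OF flabby_godement_Q[OF F fl] U s'])
    then have "godement_delta X F j U w = x"
      using s(2) unfolding Suc godement_Q_Suc godement_delta_eq by simp
    then show ?thesis using w Suc by (auto simp: godement_C_def)
  qed
qed

section \<open>Cochain complexes\<close>

locale cochain =
  fixes K :: "nat \<Rightarrow> 'c monoid" and D :: "nat \<Rightarrow> 'c \<Rightarrow> 'c"
  assumes grp: "comm_group (K k)" and D_hom: "D k \<in> hom (K k) (K (Suc k))"
    and DD: "x \<in> carrier (K k) \<Longrightarrow> D (Suc k) (D k x) = \<one>\<^bsub>K (Suc (Suc k))\<^esub>"
begin

lemma K_comm_group: "comm_group (K k)" by (rule grp)

sublocale K: comm_group "K k" for k by (rule K_comm_group)

abbreviation "Z k \<equiv> kernel (K k) (K (Suc k)) (D k)"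
abbreviation "B k \<equiv> coboundaries K D k"

lemma D_group_hom: "group_hom (K k) (K (Suc k)) (D k)"
  by (rule group_hom_of[OF grp grp D_hom])

lemma D_closed [simp]: "x \<in> carrier (K k) \<Longrightarrow> D k x \<in> carrier (K (Suc k))"
  using D_hom by (auto simp: hom_def)

lemma D_mult: "\<lbrakk>x \<in> carrier (K k); y \<in> carrier (K k)\<rbrakk> \<Longrightarrow> D k (x \<otimes>\<^bsub>K k\<^esub> y) = D k x \<otimes>\<^bsub>K (Suc k)\<^esub> D k y"
  using D_hom by (auto simp: hom_def)

lemma D_one [simp]: "D k \<one>\<^bsub>K k\<^esub> = \<one>\<^bsub>K (Suc k)\<^esub>"
  using group_hom.hom_one[OF D_group_hom] .

lemma D_inv: "x \<in> carrier (K k) \<Longrightarrow> D k (inv\<^bsub>K k\<^esub> x) = inv\<^bsub>K (Suc k)\<^esub> (D k x)"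
  using group_hom.hom_inv[OF D_group_hom] .

lemma Z_iff: "x \<in> Z k \<longleftrightarrow> x \<in> carrier (K k) \<and> D k x = \<one>\<^bsub>K (Suc k)\<^esub>"
  by (auto simp: kernel_def)

lemma Z_subgroup: "subgroup (Z k) (K k)"
  by (rule group_hom.subgroup_kernel[OF D_group_hom])

lemma B_subgroup: "subgroup (B k) (K k)"
proof (cases k)
  case 0
  then show ?thesis by (simp add: coboundaries_def K.triv_subgroup)
next
  case (Suc j)
  then show ?thesis using group_hom.img_is_subgroup[OF D_group_hom] by (simp add: coboundaries_def)
qed

lemma B_sub_Z: "B k \<subseteq> Z k"
  by (cases k) (auto simp: coboundaries_def Z_iff DD)

lemma B_carrier: "b \<in> B k \<Longrightarrow> b \<in> carrier (K k)"
  using B_sub_Z Z_iff by blast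

lemma B_D: "b \<in> B k \<Longrightarrow> D k b = \<one>\<^bsub>K (Suc k)\<^esub>"
  using B_sub_Z Z_iff by blast

lemma B_mult: "\<lbrakk>a \<in> B k; b \<in> B k\<rbrakk> \<Longrightarrow> a \<otimes>\<^bsub>K k\<^esub> b \<in> B k"
  using subgroup.m_closed[OF B_subgroup] .

lemma B_one: "\<one>\<^bsub>K k\<^esub> \<in> B k"
  using subgroup.one_closed[OF B_subgroup] .

lemma B_cancel:
  assumes "x \<in> carrier (K k)" "b \<in> B k"
  shows "x \<otimes>\<^bsub>K k\<^esub> b \<in> B k \<longleftrightarrow> x \<in> B k"
proof
  assume "x \<otimes>\<^bsub>K k\<^esub> b \<in> B k"
  then have "(x \<otimes>\<^bsub>K k\<^esub> b) \<otimes>\<^bsub>K k\<^esub> inv\<^bsub>K k\<^esub> b \<in> B k"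
    using assms B_mult subgroup.m_inv_closed[OF B_subgroup] by blast
  then show "x \<in> B k" using assms B_carrier by (simp add: K.m_assoc)
qed (use assms B_mult in blast)

abbreviation "H k \<equiv> cohomology_group K D k"

lemma H_simps:
  "mult (H k) = set_mult (K k)" "\<one>\<^bsub>H k\<^esub> = B k"
  by (auto simp: cohomology_group_def FactGroup_def set_mult_def fun_eq_iff)

lemma r_coset_eq: "B k #>\<^bsub>subgroup_generated (K k) (Z k)\<^esub> a = B k #>\<^bsub>K k\<^esub> a"
  by (simp add: r_coset_def)

lemma H_carrier: "carrier (H k) = (\<lambda>a. B k #>\<^bsub>K k\<^esub> a) ` Z k"
  using subgroup.carrier_subgroup_generated_subgroup[OF Z_subgroup]
  by (auto simp: cohomology_group_def FactGroup_def RCOSETS_def r_coset_eq)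

lemma coset_eq_iff:
  assumes "a \<in> carrier (K k)" "b \<in> carrier (K k)"
  shows "B k #>\<^bsub>K k\<^esub> a = B k #>\<^bsub>K k\<^esub> b \<longleftrightarrow> a \<otimes>\<^bsub>K k\<^esub> inv\<^bsub>K k\<^esub> b \<in> B k"
proof
  assume "B k #>\<^bsub>K k\<^esub> a = B k #>\<^bsub>K k\<^esub> b"
  then have "a \<in> B k #>\<^bsub>K k\<^esub> b" using K.rcos_self[OF assms(1) B_subgroup] by blast
  then obtain h where "h \<in> B k" "a = h \<otimes>\<^bsub>K k\<^esub> b" by (auto simp: r_coset_def)
  then show "a \<otimes>\<^bsub>K k\<^esub> inv\<^bsub>K k\<^esub> b \<in> B k" using assms B_carrier by (simp add: K.m_assoc)
next
  assume h: "a \<otimes>\<^bsub>K k\<^esub> inv\<^bsub>K k\<^esub> b \<in> B k"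
  have "a = (a \<otimes>\<^bsub>K k\<^esub> inv\<^bsub>K k\<^esub> b) \<otimes>\<^bsub>K k\<^esub> b" using assms by (simp add: K.m_assoc)
  then have "a \<in> B k #>\<^bsub>K k\<^esub> b" using h unfolding r_coset_def by blast
  then show "B k #>\<^bsub>K k\<^esub> a = B k #>\<^bsub>K k\<^esub> b"
    using K.repr_independence[OF _ assms(2) B_subgroup] by simp
qed

lemma coset_mult: "\<lbrakk>a \<in> carrier (K k); b \<in> carrier (K k)\<rbrakk> \<Longrightarrow>
  (B k #>\<^bsub>K k\<^esub> a) <#>\<^bsub>K k\<^esub> (B k #>\<^bsub>K k\<^esub> b) = B k #>\<^bsub>K k\<^esub> (a \<otimes>\<^bsub>K k\<^esub> b)"
  by (rule normal.rcos_sum[OF K.subgroup_imp_normal[OF B_subgroup]])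

text \<open>Since \<open>f\<close> preserves coboundaries, multiplying the image of a coset by all
  coboundaries fills exactly one coset.\<close>

lemma cohomology_map_coset:
  assumes f: "f k \<in> hom (K k) (K k)" "f k ` B k \<subseteq> B k" and a: "a \<in> carrier (K k)"
  shows "cohomology_map K D f k (B k #>\<^bsub>K k\<^esub> a) = B k #>\<^bsub>K k\<^esub> f k a"
proof -
  have fm: "f k (x \<otimes>\<^bsub>K k\<^esub> y) = f k x \<otimes>\<^bsub>K k\<^esub> f k y" "f k x \<in> carrier (K k)"
    if "x \<in> carrier (K k)" "y \<in> carrier (K k)" for x y using f that by (auto simp: hom_def)
  have f1: "f k \<one>\<^bsub>K k\<^esub> = \<one>\<^bsub>K k\<^esub>" using hom_one[OF f(1)] by simp
  have "B k <#>\<^bsub>K k\<^esub> f k ` (B k #>\<^bsub>K k\<^esub> a) = B k #>\<^bsub>K k\<^esub> f k a" (is "?L = ?R")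
  proof
    show "?L \<subseteq> ?R"
    proof
      fix x assume "x \<in> ?L"
      then obtain b c where bc: "b \<in> B k" "c \<in> B k" "x = b \<otimes>\<^bsub>K k\<^esub> f k (c \<otimes>\<^bsub>K k\<^esub> a)"
        by (auto simp: set_mult_def r_coset_def)
      then have fc: "f k c \<in> B k" using f by blast
      have "x = (b \<otimes>\<^bsub>K k\<^esub> f k c) \<otimes>\<^bsub>K k\<^esub> f k a"
        using bc fc a fm[OF B_carrier[OF bc(2)] a] fm(2)[OF a a] B_carrier by (simp add: K.m_assoc)
      then show "x \<in> ?R" using B_mult[OF bc(1) fc] unfolding r_coset_def by blast
    qed
    show "?R \<subseteq> ?L"
    proof
      fix x assume "x \<in> ?R"
      then obtain b where b: "b \<in> B k" "x = b \<otimes>\<^bsub>K k\<^esub> f k a" by (auto simp: r_coset_def)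
      have "a \<in> B k #>\<^bsub>K k\<^esub> a" by (rule K.rcos_self[OF a B_subgroup])
      then show "x \<in> ?L" using b unfolding set_mult_def by blast
    qed
  qed
  then show ?thesis by (simp add: cohomology_map_def)
qed

end

text \<open>Isomorphisms in cohomology are composed as relations between cocycles, without choosing maps.\<close>

definition cohrel :: "(nat \<Rightarrow> 'c monoid) \<Rightarrow> (nat \<Rightarrow> 'c \<Rightarrow> 'c) \<Rightarrow> (nat \<Rightarrow> 'e monoid) \<Rightarrow> (nat \<Rightarrow> 'e \<Rightarrow> 'e) \<Rightarrow> nat \<Rightarrow>
    ('c \<Rightarrow> 'e \<Rightarrow> bool) \<Rightarrow> bool" where
  "cohrel K D K' D' k R \<longleftrightarrow>
    (\<forall>a b. R a b \<longrightarrow> a \<in> kernel (K k) (K (Suc k)) (D k) \<and> b \<in> kernel (K' k) (K' (Suc k)) (D' k)) \<and>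
    (\<forall>a b a' b'. R a b \<longrightarrow> R a' b' \<longrightarrow> R (a \<otimes>\<^bsub>K k\<^esub> a') (b \<otimes>\<^bsub>K' k\<^esub> b')) \<and>
    (\<forall>a \<in> kernel (K k) (K (Suc k)) (D k). \<exists>b. R a b) \<and>
    (\<forall>b \<in> kernel (K' k) (K' (Suc k)) (D' k). \<exists>a. R a b) \<and>
    (\<forall>a b. R a b \<longrightarrow> (a \<in> coboundaries K D k \<longleftrightarrow> b \<in> coboundaries K' D' k))"

lemma cohrel_converse: "cohrel K D K' D' k R \<Longrightarrow> cohrel K' D' K D k (\<lambda>a b. R b a)"
  unfolding cohrel_def by blast

lemma cohrel_compose:
  "\<lbrakk>cohrel K D K' D' k R; cohrel K' D' K'' D'' k S\<rbrakk> \<Longrightarrow> cohrel K D K'' D'' k (R OO S)"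
  unfolding cohrel_def relcompp_apply by meson

text \<open>The compatibility of a relation with coboundaries concerns single pairs.
  Multiplicativity turns it into the equivalence \<open>key\<close>, whose two directions are
  well-definedness and injectivity of the induced map.\<close>

lemma cohrel_iso_ex:
  assumes K: "cochain K D" and K': "cochain K' D'" and R: "cohrel K D K' D' k R"
  obtains h where "h \<in> iso (cohomology_group K D k) (cohomology_group K' D' k)"
    and "\<And>a b. R a b \<Longrightarrow> h (coboundaries K D k #>\<^bsub>K k\<^esub> a) = coboundaries K' D' k #>\<^bsub>K' k\<^esub> b"
proof -
  interpret K: cochain K D by fact
  interpret K': cochain K' D' by fact
  have RZ: "a \<in> K.Z k" "b \<in> K'.Z k" "a \<in> carrier (K k)" "b \<in> carrier (K' k)" if "R a b" for a b
    using R that unfolding cohrel_def K.Z_iff K'.Z_iff by blast+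
  have Rm: "R (a \<otimes>\<^bsub>K k\<^esub> a') (b \<otimes>\<^bsub>K' k\<^esub> b')" if "R a b" "R a' b'" for a b a' b'
    using R that unfolding cohrel_def by blast
  have Rt: "\<exists>b. R a b" if "a \<in> K.Z k" for a using R that unfolding cohrel_def by blast
  have Rs: "\<exists>a. R a b" if "b \<in> K'.Z k" for b using R that unfolding cohrel_def by blast
  have RB: "a \<in> K.B k \<longleftrightarrow> b \<in> K'.B k" if "R a b" for a b using R that unfolding cohrel_def by blast
  have key: "K.B k #>\<^bsub>K k\<^esub> a = K.B k #>\<^bsub>K k\<^esub> a' \<longleftrightarrow> K'.B k #>\<^bsub>K' k\<^esub> b = K'.B k #>\<^bsub>K' k\<^esub> b'"
    if ab: "R a b" "R a' b'" for a b a' b'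
  proof -
    note Zs = RZ[OF ab(1)] RZ[OF ab(2)]
    have "inv\<^bsub>K k\<^esub> a' \<in> K.Z k" using Zs subgroup.m_inv_closed[OF K.Z_subgroup] by blast
    \<comment> \<open>Nothing is known about inverses of related elements, so a partner
      \<open>c\<close> of the inverse of \<open>a'\<close> is chosen. As \<open>b'\<close> times
      \<open>c\<close> is related to the neutral element, it is a coboundary, and \<open>c\<close>
      can replace the inverse of \<open>b'\<close>.\<close>
    then obtain c where c: "R (inv\<^bsub>K k\<^esub> a') c" using Rt by blast
    have cc: "c \<in> carrier (K' k)" using RZ[OF c] by blast
    have "R \<one>\<^bsub>K k\<^esub> (b' \<otimes>\<^bsub>K' k\<^esub> c)" using Rm[OF ab(2) c] Zs by simp
    then have bc: "b' \<otimes>\<^bsub>K' k\<^esub> c \<in> K'.B k" using RB K.B_one by blast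
    have "inv\<^bsub>K' k\<^esub> b' \<otimes>\<^bsub>K' k\<^esub> (b' \<otimes>\<^bsub>K' k\<^esub> c) = c"
      using Zs cc by (simp flip: K'.K.m_assoc)
    then have "(b \<otimes>\<^bsub>K' k\<^esub> inv\<^bsub>K' k\<^esub> b') \<otimes>\<^bsub>K' k\<^esub> (b' \<otimes>\<^bsub>K' k\<^esub> c) = b \<otimes>\<^bsub>K' k\<^esub> (inv\<^bsub>K' k\<^esub> b' \<otimes>\<^bsub>K' k\<^esub> b') \<otimes>\<^bsub>K' k\<^esub> c"
      using Zs cc by (simp add: K'.K.m_assoc)
    then have "(b \<otimes>\<^bsub>K' k\<^esub> inv\<^bsub>K' k\<^esub> b') \<otimes>\<^bsub>K' k\<^esub> (b' \<otimes>\<^bsub>K' k\<^esub> c) = b \<otimes>\<^bsub>K' k\<^esub> c"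
      using Zs cc by simp
    then have "b \<otimes>\<^bsub>K' k\<^esub> c \<in> K'.B k \<longleftrightarrow> b \<otimes>\<^bsub>K' k\<^esub> inv\<^bsub>K' k\<^esub> b' \<in> K'.B k"
      using K'.B_cancel[OF _ bc] Zs by (metis K'.K.inv_closed K'.K.m_closed)
    then show ?thesis
      using RB[OF Rm[OF ab(1) c]] Zs by (simp add: K.coset_eq_iff K'.coset_eq_iff)
  qed
  define h where "h c = K'.B k #>\<^bsub>K' k\<^esub> (SOME b. \<exists>a. R a b \<and> c = K.B k #>\<^bsub>K k\<^esub> a)" for c
  have h: "h (K.B k #>\<^bsub>K k\<^esub> a) = K'.B k #>\<^bsub>K' k\<^esub> b" if "R a b" for a b
  proof -
    have "\<exists>b'. \<exists>a'. R a' b' \<and> K.B k #>\<^bsub>K k\<^esub> a = K.B k #>\<^bsub>K k\<^esub> a'" using that by blast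
    from someI_ex[OF this] obtain a' where
      "R a' (SOME b'. \<exists>a'. R a' b' \<and> K.B k #>\<^bsub>K k\<^esub> a = K.B k #>\<^bsub>K k\<^esub> a')" "K.B k #>\<^bsub>K k\<^esub> a = K.B k #>\<^bsub>K k\<^esub> a'" by blast
    then show ?thesis using key[OF _ that] unfolding h_def by blast
  qed
  have hc: "h x \<in> carrier (K'.H k)" if x: "x \<in> carrier (K.H k)" for x
  proof -
    obtain a where a: "a \<in> K.Z k" "x = K.B k #>\<^bsub>K k\<^esub> a" using x unfolding K.H_carrier by blast
    obtain b where b: "R a b" using Rt a by blast
    show ?thesis unfolding a(2) h[OF b] K'.H_carrier using RZ[OF b] by blast
  qed
  have "h \<in> iso (K.H k) (K'.H k)"
    unfolding iso_def
  proof (intro CollectI conjI homI)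
    show "h x \<in> carrier (K'.H k)" if "x \<in> carrier (K.H k)" for x
      using that by (rule hc)
    show "h (x \<otimes>\<^bsub>K.H k\<^esub> y) = h x \<otimes>\<^bsub>K'.H k\<^esub> h y" if xy: "x \<in> carrier (K.H k)" "y \<in> carrier (K.H k)" for x y
    proof -
      obtain a a' where a: "a \<in> K.Z k" "a' \<in> K.Z k" "x = K.B k #>\<^bsub>K k\<^esub> a" "y = K.B k #>\<^bsub>K k\<^esub> a'"
        using xy unfolding K.H_carrier by blast
      obtain b b' where b: "R a b" "R a' b'" using Rt a by blast
      show ?thesis
        using RZ[OF b(1)] RZ[OF b(2)] a h[OF b(1)] h[OF b(2)] h[OF Rm[OF b]]
        by (simp add: K.H_simps K'.H_simps K.coset_mult K'.coset_mult)
    qed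
    show "bij_betw h (carrier (K.H k)) (carrier (K'.H k))"
      unfolding bij_betw_def
    proof
      show "inj_on h (carrier (K.H k))"
      proof (rule inj_onI)
        fix x y assume xy: "x \<in> carrier (K.H k)" "y \<in> carrier (K.H k)" "h x = h y"
        obtain a a' where a: "a \<in> K.Z k" "a' \<in> K.Z k" "x = K.B k #>\<^bsub>K k\<^esub> a" "y = K.B k #>\<^bsub>K k\<^esub> a'"
          using xy unfolding K.H_carrier by blast
        obtain b b' where b: "R a b" "R a' b'" using Rt a by blast
        then show "x = y" using xy(3) a h key by simp
      qed
      show "h ` carrier (K.H k) = carrier (K'.H k)"
      proof
        show "h ` carrier (K.H k) \<subseteq> carrier (K'.H k)"
          using hc by blast
        show "carrier (K'.H k) \<subseteq> h ` carrier (K.H k)"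
        proof
          fix y assume "y \<in> carrier (K'.H k)"
          then obtain b where b: "b \<in> K'.Z k" "y = K'.B k #>\<^bsub>K' k\<^esub> b" unfolding K'.H_carrier by blast
          then obtain a where a: "R a b" using Rs by blast
          have "K.B k #>\<^bsub>K k\<^esub> a \<in> carrier (K.H k)" using RZ[OF a] unfolding K.H_carrier by blast
          then show "y \<in> h ` carrier (K.H k)" using b h[OF a] by blast
        qed
      qed
    qed
  qed
  then show ?thesis using that h by blast
qed

text \<open>The graph of \<open>j\<close> on cocycles, widened by coboundaries of the target so that
  every target cocycle can have a partner.\<close>

definition qrel :: "(nat \<Rightarrow> 'c monoid) \<Rightarrow> (nat \<Rightarrow> 'c \<Rightarrow> 'c) \<Rightarrow> (nat \<Rightarrow> 'e monoid) \<Rightarrow> (nat \<Rightarrow> 'e \<Rightarrow> 'e) \<Rightarrow>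
    (nat \<Rightarrow> 'c \<Rightarrow> 'e) \<Rightarrow> nat \<Rightarrow> 'c \<Rightarrow> 'e \<Rightarrow> bool" where
  "qrel K D K' D' j k = (\<lambda>a x. a \<in> kernel (K k) (K (Suc k)) (D k) \<and>
     (\<exists>b\<in>coboundaries K' D' k. x = j k a \<otimes>\<^bsub>K' k\<^esub> b))"

text \<open>\<open>lift\<close> says that the cokernel complex of \<open>j\<close> is acyclic,
  \<open>acyc\<close> that the kernel complex is; together they make \<open>j\<close> a
  quasi-isomorphism. The kernel has to be allowed because locally vanishing singular cochains are
  lost in the Godement resolution.\<close>

lemma cohrel_qrel:
  assumes K: "cochain K D" and K': "cochain K' D'"
    and j: "\<And>k. j k \<in> hom (K k) (K' k)"
    and jD: "\<And>k a. a \<in> carrier (K k) \<Longrightarrow> D' k (j k a) = j (Suc k) (D k a)"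
    and lift: "\<And>k x a. \<lbrakk>x \<in> carrier (K' k); a \<in> carrier (K (Suc k)); D' k x = j (Suc k) a\<rbrakk>
       \<Longrightarrow> \<exists>c\<in>carrier (K k). \<exists>b\<in>coboundaries K' D' k. x = j k c \<otimes>\<^bsub>K' k\<^esub> b"
    and acyc: "\<And>k a. \<lbrakk>a \<in> carrier (K k); j k a = \<one>\<^bsub>K' k\<^esub>; D k a = \<one>\<^bsub>K (Suc k)\<^esub>\<rbrakk> \<Longrightarrow>
       case k of 0 \<Rightarrow> a = \<one>\<^bsub>K k\<^esub> | Suc r \<Rightarrow> \<exists>c\<in>carrier (K r). j r c = \<one>\<^bsub>K' r\<^esub> \<and> D r c = a"
  shows "cohrel K D K' D' k (qrel K D K' D' j k)"
proof -
  interpret K: cochain K D by fact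
  interpret K': cochain K' D' by fact
  have gh: "group_hom (K k) (K' k) (j k)" for k by (rule group_hom_of[OF K.grp K'.grp j])
  have jc: "a \<in> carrier (K k) \<Longrightarrow> j k a \<in> carrier (K' k)" for k a using j[of k] by (auto simp: hom_def)
  have jm: "\<lbrakk>a \<in> carrier (K k); b \<in> carrier (K k)\<rbrakk> \<Longrightarrow> j k (a \<otimes>\<^bsub>K k\<^esub> b) = j k a \<otimes>\<^bsub>K' k\<^esub> j k b" for k a b
    using j[of k] by (auto simp: hom_def)
  note j1 = group_hom.hom_one[OF gh] and jinv = group_hom.hom_inv[OF gh]
  have jB: "a \<in> K.B k \<longleftrightarrow> j k a \<in> K'.B k" if a: "a \<in> K.Z k" for a
  proof
    assume "a \<in> K.B k"
    then show "j k a \<in> K'.B k"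
      by (cases k) (auto simp: coboundaries_def j1 jc simp flip: jD)
  next
    assume ja: "j k a \<in> K'.B k"
    show "a \<in> K.B k"
    proof (cases k)
      case 0
      then show ?thesis using ja acyc[of a k] a by (simp add: coboundaries_def K.Z_iff)
    next
      case (Suc r)
      then obtain y where y: "y \<in> carrier (K' r)" "D' r y = j k a" using ja by (auto simp: coboundaries_def)
      then obtain c b where c: "c \<in> carrier (K r)" "b \<in> K'.B r" "y = j r c \<otimes>\<^bsub>K' r\<^esub> b"
        using lift[of y r a] a Suc by (auto simp: K.Z_iff)
      have b: "b \<in> carrier (K' r)" "D' r b = \<one>\<^bsub>K' (Suc r)\<^esub>" using K'.B_carrier[OF c(2)] K'.B_D[OF c(2)] by auto
      have jj: "j k a = j k (D r c)" using y(2) c b Suc by (simp add: K'.D_mult jc jD)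
      \<comment> \<open>\<open>a\<close> and \<open>D r c\<close> have the same image, so their
        quotient is a cocycle in the kernel of \<open>j\<close>, and \<open>acyc\<close> applies to
        it.\<close>
      define a' where "a' = a \<otimes>\<^bsub>K k\<^esub> inv\<^bsub>K k\<^esub> (D r c)"
      have Dc: "D r c \<in> carrier (K k)" "D k (D r c) = \<one>\<^bsub>K (Suc k)\<^esub>" using c Suc K.DD K.D_closed by auto
      have a0: "a \<in> carrier (K k)" "D k a = \<one>\<^bsub>K (Suc k)\<^esub>" using a by (auto simp: K.Z_iff)
      have "a' \<in> carrier (K k)" "j k a' = \<one>\<^bsub>K' k\<^esub>" "D k a' = \<one>\<^bsub>K (Suc k)\<^esub>"
        using Dc a0 jc[OF Dc(1)] by (auto simp: a'_def jm jinv jj K.D_mult K.D_inv)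
      then obtain e where e: "e \<in> carrier (K r)" "D r e = a'" using acyc[of a' k] Suc by auto
      have "D r (e \<otimes>\<^bsub>K r\<^esub> c) = a" using e c a0 Dc Suc by (simp add: K.D_mult a'_def K.K.m_assoc)
      then show ?thesis using e c Suc by (auto simp: coboundaries_def intro!: image_eqI[of _ _ "e \<otimes>\<^bsub>K r\<^esub> c"])
    qed
  qed
  have jZ: "j k a \<in> K'.Z k" if "a \<in> K.Z k" for a
    using that by (auto simp: K.Z_iff K'.Z_iff jc jD j1)
  show ?thesis
    unfolding cohrel_def qrel_def
  proof (intro conjI allI ballI impI; (elim conjE bexE)?)
    fix a x b assume a: "a \<in> K.Z k" and b: "b \<in> K'.B k" and x: "x = j k a \<otimes>\<^bsub>K' k\<^esub> b"
    show "a \<in> K.Z k" by fact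
    show "x \<in> K'.Z k" unfolding x
      using subgroup.m_closed[OF K'.Z_subgroup jZ[OF a]] b K'.B_sub_Z by blast
    show "a \<in> K.B k \<longleftrightarrow> x \<in> K'.B k" unfolding x jB[OF a]
      using K'.B_cancel[OF _ b, of "j k a"] jZ[OF a] by (simp add: K'.Z_iff)
  next
    fix a x b a' x' b' assume *: "a \<in> K.Z k" "b \<in> K'.B k" "x = j k a \<otimes>\<^bsub>K' k\<^esub> b"
      "a' \<in> K.Z k" "b' \<in> K'.B k" "x' = j k a' \<otimes>\<^bsub>K' k\<^esub> b'"
    show "a \<otimes>\<^bsub>K k\<^esub> a' \<in> K.Z k" using * subgroup.m_closed[OF K.Z_subgroup] by blast
    have "x \<otimes>\<^bsub>K' k\<^esub> x' = j k (a \<otimes>\<^bsub>K k\<^esub> a') \<otimes>\<^bsub>K' k\<^esub> (b \<otimes>\<^bsub>K' k\<^esub> b')"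
      using * by (simp add: K.Z_iff jm jc K'.B_carrier K'.K.m_ac)
    then show "\<exists>c\<in>K'.B k. x \<otimes>\<^bsub>K' k\<^esub> x' = j k (a \<otimes>\<^bsub>K k\<^esub> a') \<otimes>\<^bsub>K' k\<^esub> c"
      using * K'.B_mult by blast
  next
    fix a assume a: "a \<in> K.Z k"
    show "\<exists>x. a \<in> K.Z k \<and> (\<exists>b\<in>K'.B k. x = j k a \<otimes>\<^bsub>K' k\<^esub> b)"
      using a K'.B_one by blast
  next
    fix x assume x: "x \<in> K'.Z k"
    then obtain c b where c: "c \<in> carrier (K k)" "b \<in> K'.B k" "x = j k c \<otimes>\<^bsub>K' k\<^esub> b"
      using lift[of x k "\<one>\<^bsub>K (Suc k)\<^esub>"] by (auto simp: K'.Z_iff j1)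
    have b: "b \<in> carrier (K' k)" "D' k b = \<one>\<^bsub>K' (Suc k)\<^esub>" using K'.B_carrier[OF c(2)] K'.B_D[OF c(2)] by auto
    have "j (Suc k) (D k c) = \<one>\<^bsub>K' (Suc k)\<^esub>"
      using x c(1) b unfolding K'.Z_iff c(3) by (simp add: K'.D_mult jc jD)
    \<comment> \<open>\<open>D k c\<close> is a cocycle in the kernel of \<open>j\<close>, hence the
      differential of some \<open>g\<close> in that kernel. Dividing \<open>c\<close> by
      \<open>g\<close> gives a cocycle with the same image.\<close>
    then obtain g where g: "g \<in> carrier (K k)" "j k g = \<one>\<^bsub>K' k\<^esub>" "D k g = D k c"
      using acyc[of "D k c" "Suc k"] c by (auto simp: K.DD)
    define a where "a = c \<otimes>\<^bsub>K k\<^esub> inv\<^bsub>K k\<^esub> g"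
    have "a \<in> K.Z k" using g c by (simp add: a_def K.Z_iff K.D_mult K.D_inv)
    moreover have "j k a = j k c" using g c jc[OF c(1)] by (simp add: a_def jm jinv)
    ultimately show "\<exists>a. a \<in> K.Z k \<and> (\<exists>b\<in>K'.B k. x = j k a \<otimes>\<^bsub>K' k\<^esub> b)"
      using c(2,3) by (intro exI[of _ a] conjI bexI[of _ b]) simp_all
  qed
qed

locale cochain_endo = cochain +
  fixes f
  assumes f_hom: "f k \<in> hom (K k) (K k)" and f_D: "a \<in> carrier (K k) \<Longrightarrow> f (Suc k) (D k a) = D k (f k a)"
begin

lemma f_closed: "a \<in> carrier (K k) \<Longrightarrow> f k a \<in> carrier (K k)"
  using f_hom by (auto simp: hom_def)

lemma f_one: "f k \<one>\<^bsub>K k\<^esub> = \<one>\<^bsub>K k\<^esub>"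
  using hom_one[OF f_hom] by simp

lemma f_Z: "a \<in> Z k \<Longrightarrow> f k a \<in> Z k"
  by (auto simp: Z_iff f_one f_closed simp flip: f_D)

lemma f_B: "f k ` B k \<subseteq> B k"
  by (cases k) (auto simp: coboundaries_def f_one f_D f_closed)

end

lemma qrel_endo:
  assumes "cochain_endo K D f" "cochain_endo K' D' f'"
    and j: "\<And>k. j k \<in> hom (K k) (K' k)"
    and jf: "\<And>a. a \<in> carrier (K k) \<Longrightarrow> f' k (j k a) = j k (f k a)"
    and R: "qrel K D K' D' j k a x"
  shows "qrel K D K' D' j k (f k a) (f' k x)"
proof -
  interpret K: cochain_endo K D f by fact
  interpret K': cochain_endo K' D' f' by fact
  obtain b where a: "a \<in> K.Z k" and b: "b \<in> K'.B k" and x: "x = j k a \<otimes>\<^bsub>K' k\<^esub> b"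
    using R by (auto simp: qrel_def)
  have "a \<in> carrier (K k)" using a by (simp add: K.Z_iff)
  moreover from this have "j k a \<in> carrier (K' k)" using j[of k] by (auto simp: hom_def)
  ultimately have "f' k x = j k (f k a) \<otimes>\<^bsub>K' k\<^esub> f' k b"
    using K'.f_hom[of k] K'.B_carrier[OF b] by (simp add: x hom_def jf)
  then show ?thesis using a b K.f_Z K'.f_B unfolding qrel_def by blast
qed

text \<open>The isomorphism is built from \<open>R\<close> before any \<open>c\<close> is mentioned,
  so one and the same \<open>h\<close> commutes with all endomorphisms respected by
  \<open>R\<close>.\<close>

lemma cohrel_iso_endo:
  assumes K: "cochain K D" and K': "cochain K' D'" and R: "cohrel K D K' D' k R"
    and f: "\<And>c. cochain_endo K D (f c)" "\<And>c. cochain_endo K' D' (f' c)"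
    and Rf: "\<And>c a b. R a b \<Longrightarrow> R (f c k a) (f' c k b)"
  shows "\<exists>h \<in> iso (cohomology_group K D k) (cohomology_group K' D' k).
    \<forall>c. \<forall>x \<in> carrier (cohomology_group K D k).
       h (cohomology_map K D (f c) k x) = cohomology_map K' D' (f' c) k (h x)"
proof -
  interpret K: cochain K D by fact
  interpret K': cochain K' D' by fact
  obtain h where h: "h \<in> iso (cohomology_group K D k) (cohomology_group K' D' k)"
    and hR: "\<And>a b. R a b \<Longrightarrow> h (K.B k #>\<^bsub>K k\<^esub> a) = K'.B k #>\<^bsub>K' k\<^esub> b"
    using cohrel_iso_ex[OF K K' R] by metis
  have "h (cohomology_map K D (f c) k x) = cohomology_map K' D' (f' c) k (h x)"
    if x: "x \<in> carrier (cohomology_group K D k)" for c x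
  proof -
    interpret f: cochain_endo K D "f c" by fact
    interpret f': cochain_endo K' D' "f' c" by fact
    obtain a where a: "a \<in> K.Z k" "x = K.B k #>\<^bsub>K k\<^esub> a" using x unfolding K.H_carrier by blast
    obtain b where b: "R a b" using R a unfolding cohrel_def by blast
    then have bZ: "b \<in> K'.Z k" using R unfolding cohrel_def by blast
    have "cohomology_map K D (f c) k x = K.B k #>\<^bsub>K k\<^esub> f c k a"
      unfolding a(2) using a(1) by (intro K.cohomology_map_coset f.f_hom f.f_B) (simp add: K.Z_iff)
    moreover have "cohomology_map K' D' (f' c) k (h x) = K'.B k #>\<^bsub>K' k\<^esub> f' c k b"
      unfolding a(2) hR[OF b] using bZ by (intro K'.cohomology_map_coset f'.f_hom f'.f_B) (simp add: K'.Z_iff)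
    ultimately show ?thesis using hR[OF Rf[OF b]] by simp
  qed
  then show ?thesis using h by blast
qed

section \<open>Double complexes\<close>

text \<open>Together with \<open>tot_diff\<close> the abstract form of \<open>total_group\<close>
  and \<open>total_differential\<close>, so that the diagram chases see only groups and
  maps.\<close>

definition tot_group :: "(nat \<Rightarrow> nat \<Rightarrow> 'g monoid) \<Rightarrow> nat \<Rightarrow> (nat \<Rightarrow> 'g) monoid" where
  "tot_group K k = product_group {..k} (\<lambda>p. K p (k - p))"

definition tot_diff :: "(nat \<Rightarrow> nat \<Rightarrow> 'g monoid) \<Rightarrow> (nat \<Rightarrow> nat \<Rightarrow> 'g \<Rightarrow> 'g) \<Rightarrow> (nat \<Rightarrow> nat \<Rightarrow> 'g \<Rightarrow> 'g) \<Rightarrow>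
    nat \<Rightarrow> (nat \<Rightarrow> 'g) \<Rightarrow> nat \<Rightarrow> 'g" where
  "tot_diff K \<delta> d k x = (\<lambda>p\<in>{..Suc k}.
     (case p of 0 \<Rightarrow> \<one>\<^bsub>K p (Suc k - p)\<^esub> | Suc r \<Rightarrow> \<delta> r (k - r) (x r))
       \<otimes>\<^bsub>K p (Suc k - p)\<^esub>
       (if p \<le> k then d p (k - p) (x p) [^]\<^bsub>K p (Suc k - p)\<^esub> ((- 1 :: int) ^ p) else \<one>\<^bsub>K p (Suc k - p)\<^esub>))"

locale bicomplex =
  fixes K :: "nat \<Rightarrow> nat \<Rightarrow> 'g monoid" and \<delta> d :: "nat \<Rightarrow> nat \<Rightarrow> 'g \<Rightarrow> 'g"
  assumes K_grp: "comm_group (K p q)"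
    and \<delta>_hom: "\<delta> p q \<in> hom (K p q) (K (Suc p) q)" and d_hom: "d p q \<in> hom (K p q) (K p (Suc q))"
    and \<delta>\<delta>: "x \<in> carrier (K p q) \<Longrightarrow> \<delta> (Suc p) q (\<delta> p q x) = \<one>\<^bsub>K (Suc (Suc p)) q\<^esub>"
    and dd: "x \<in> carrier (K p q) \<Longrightarrow> d p (Suc q) (d p q x) = \<one>\<^bsub>K p (Suc (Suc q))\<^esub>"
    and \<delta>d: "x \<in> carrier (K p q) \<Longrightarrow> \<delta> p (Suc q) (d p q x) = d (Suc p) q (\<delta> p q x)"
begin

lemma K_comm_group: "comm_group (K p q)" by (rule K_grp)

sublocale K: comm_group "K p q" for p q by (rule K_comm_group)

lemma \<delta>_group_hom: "group_hom (K p q) (K (Suc p) q) (\<delta> p q)"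
  by (rule group_hom_of[OF K_grp K_grp \<delta>_hom])

lemma d_group_hom: "group_hom (K p q) (K p (Suc q)) (d p q)"
  by (rule group_hom_of[OF K_grp K_grp d_hom])

sublocale \<delta>: group_hom "K p q" "K (Suc p) q" "\<delta> p q" for p q by (rule \<delta>_group_hom)
sublocale d: group_hom "K p q" "K p (Suc q)" "d p q" for p q by (rule d_group_hom)

text \<open>The sign \<open>(-1)^p\<close> in multiplicative notation. Its exponent is independent
  of the position \<open>(a, b)\<close>, since a sign must keep its value when it is moved across
  \<open>\<delta>\<close> or \<open>d\<close>.\<close>

definition sg :: "nat \<Rightarrow> nat \<Rightarrow> nat \<Rightarrow> 'g \<Rightarrow> 'g" where
  "sg p a b x = (if even p then x else inv\<^bsub>K a b\<^esub> x)"

lemma pow_sg: "x \<in> carrier (K a b) \<Longrightarrow> x [^]\<^bsub>K a b\<^esub> ((- 1 :: int) ^ p) = sg p a b x"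
  by (cases "even p") (auto simp: sg_def K.int_pow_neg K.int_pow_1)

lemma sg_closed [simp]: "x \<in> carrier (K a b) \<Longrightarrow> sg p a b x \<in> carrier (K a b)"
  by (simp add: sg_def)

lemma sg_one [simp]: "sg p a b \<one>\<^bsub>K a b\<^esub> = \<one>\<^bsub>K a b\<^esub>" by (simp add: sg_def)

lemma sg_sg [simp]: "x \<in> carrier (K a b) \<Longrightarrow> sg p a b (sg p a b x) = x" by (simp add: sg_def)

lemma sg_eq_one: "x \<in> carrier (K a b) \<Longrightarrow> sg p a b x = \<one>\<^bsub>K a b\<^esub> \<longleftrightarrow> x = \<one>\<^bsub>K a b\<^esub>"
  by (simp add: sg_def K.inv_eq_1_iff)

lemma sg_mult: "\<lbrakk>x \<in> carrier (K a b); y \<in> carrier (K a b)\<rbrakk> \<Longrightarrow>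
    sg p a b (x \<otimes>\<^bsub>K a b\<^esub> y) = sg p a b x \<otimes>\<^bsub>K a b\<^esub> sg p a b y"
  by (simp add: sg_def K.inv_mult)

lemma \<delta>_sg: "x \<in> carrier (K a b) \<Longrightarrow> \<delta> a b (sg p a b x) = sg p (Suc a) b (\<delta> a b x)"
  by (simp add: sg_def)

lemma d_sg: "x \<in> carrier (K a b) \<Longrightarrow> d a b (sg p a b x) = sg p a (Suc b) (d a b x)"
  by (simp add: sg_def)

lemma sg_cancel: "x \<in> carrier (K a b) \<Longrightarrow> sg p a b x \<otimes>\<^bsub>K a b\<^esub> sg (Suc p) a b x = \<one>\<^bsub>K a b\<^esub>"
  by (simp add: sg_def)

abbreviation "T \<equiv> tot_group K"
abbreviation "D \<equiv> tot_diff K \<delta> d"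

lemma T_carrier: "x \<in> carrier (T k) \<longleftrightarrow> x \<in> extensional {..k} \<and> (\<forall>p\<le>k. x p \<in> carrier (K p (k - p)))"
  by (auto simp: tot_group_def PiE_def Pi_def)

lemma T_at: "x \<in> carrier (T k) \<Longrightarrow> p \<le> k \<Longrightarrow> x p \<in> carrier (K p (k - p))"
  by (simp add: T_carrier)

lemma T_eqI: "\<lbrakk>x \<in> carrier (T k); y \<in> carrier (T k); \<And>p. p \<le> k \<Longrightarrow> x p = y p\<rbrakk> \<Longrightarrow> x = y"
  unfolding T_carrier by (auto intro: extensionalityI)

lemma T_mult: "p \<le> k \<Longrightarrow> (x \<otimes>\<^bsub>T k\<^esub> y) p = x p \<otimes>\<^bsub>K p (k - p)\<^esub> y p"
  by (simp add: tot_group_def)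

lemma T_one: "p \<le> k \<Longrightarrow> \<one>\<^bsub>T k\<^esub> p = \<one>\<^bsub>K p (k - p)\<^esub>"
  by (simp add: tot_group_def)

lemma T_grp: "comm_group (T k)"
proof -
  have "group (T k)" unfolding tot_group_def by (intro product_group K.is_group)
  then show ?thesis
  proof (rule group.group_comm_groupI)
    fix x y assume "x \<in> carrier (T k)" "y \<in> carrier (T k)"
    then show "x \<otimes>\<^bsub>T k\<^esub> y = y \<otimes>\<^bsub>T k\<^esub> x"
      unfolding tot_group_def by (auto intro!: restrict_ext K.m_comm)
  qed
qed

sublocale T: comm_group "T k" for k by (rule T_grp)

lemma T_inv: "x \<in> carrier (T k) \<Longrightarrow> p \<le> k \<Longrightarrow> (inv\<^bsub>T k\<^esub> x) p = inv\<^bsub>K p (k - p)\<^esub> (x p)"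
  unfolding tot_group_def by (subst inv_product_group) (auto simp: K.is_group)

lemma D_0: "x \<in> carrier (T k) \<Longrightarrow> D k x 0 = d 0 k (x 0)"
  using T_at[of x k 0] by (simp add: tot_diff_def)

lemma D_Suc:
  assumes x: "x \<in> carrier (T k)" and p: "p < k"
  shows "D k x (Suc p) = \<delta> p (k - p) (x p) \<otimes>\<^bsub>K (Suc p) (k - p)\<^esub> sg (Suc p) (Suc p) (k - p) (d (Suc p) (k - Suc p) (x (Suc p)))"
proof -
  have "Suc (k - Suc p) = k - p" using p by simp
  then have "d (Suc p) (k - Suc p) (x (Suc p)) \<in> carrier (K (Suc p) (k - p))"
    using d.hom_closed[of "x (Suc p)" "Suc p" "k - Suc p"] T_at[OF x, of "Suc p"] p by simp
  then show ?thesis using p pow_sg[of _ "Suc p" "k - p" "Suc p"] by (simp add: tot_diff_def del: power_Suc)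
qed

lemma D_last:
  assumes x: "x \<in> carrier (T k)"
  shows "D k x (Suc k) = \<delta> k 0 (x k)"
  using T_at[OF x, of k] by (simp add: tot_diff_def)

lemma D_closed:
  assumes x: "x \<in> carrier (T k)"
  shows "D k x \<in> carrier (T (Suc k))"
proof -
  have "D k x p \<in> carrier (K p (Suc k - p))" if "p \<le> Suc k" for p
  proof (cases p)
    case 0
    then show ?thesis using D_0[OF x] T_at[OF x, of 0] by simp
  next
    case (Suc r)
    show ?thesis
    proof (cases "r < k")
      case True
      have "Suc (k - Suc r) = k - r" using True by simp
      then have "d (Suc r) (k - Suc r) (x (Suc r)) \<in> carrier (K (Suc r) (k - r))"
        using d.hom_closed[of "x (Suc r)" "Suc r" "k - Suc r"] T_at[OF x, of "Suc r"] True by simp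
      then show ?thesis using True D_Suc[OF x True] T_at[OF x, of r] Suc by simp
    next
      case False
      then have "r = k" using that Suc by simp
      then show ?thesis using D_last[OF x] T_at[OF x, of k] Suc by simp
    qed
  qed
  moreover have "D k x \<in> extensional {..Suc k}" by (simp add: tot_diff_def)
  ultimately show ?thesis by (simp add: T_carrier)
qed

lemma p_cases:
  assumes "p \<le> Suc (k::nat)"
  obtains "p = 0" | r where "p = Suc r" "r < k" | "p = Suc k"
  using assms by (cases p) (auto simp: le_less)

lemma D_hom: "D k \<in> hom (T k) (T (Suc k))"
proof (rule homI)
  show "D k x \<in> carrier (T (Suc k))" if "x \<in> carrier (T k)" for x using D_closed[OF that] .
  fix x y assume x: "x \<in> carrier (T k)" and y: "y \<in> carrier (T k)"
  show "D k (x \<otimes>\<^bsub>T k\<^esub> y) = D k x \<otimes>\<^bsub>T (Suc k)\<^esub> D k y"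
  proof (rule T_eqI)
    show "D k (x \<otimes>\<^bsub>T k\<^esub> y) \<in> carrier (T (Suc k))" "D k x \<otimes>\<^bsub>T (Suc k)\<^esub> D k y \<in> carrier (T (Suc k))"
      using x y by (auto intro: D_closed)
    note m = T.m_closed[OF x y]
    fix p assume "p \<le> Suc k"
    then show "D k (x \<otimes>\<^bsub>T k\<^esub> y) p = (D k x \<otimes>\<^bsub>T (Suc k)\<^esub> D k y) p"
    proof (cases rule: p_cases)
      case 1
      then show ?thesis using T_at[OF x, of 0] T_at[OF y, of 0] by (simp add: T_mult D_0 x y)
    next
      case (2 r)
      have e: "Suc (k - Suc r) = k - r" using 2 by simp
      have xr: "x r \<in> carrier (K r (k - r))" "y r \<in> carrier (K r (k - r))" using T_at x y 2 by auto
      have xr': "x (Suc r) \<in> carrier (K (Suc r) (k - Suc r))" "y (Suc r) \<in> carrier (K (Suc r) (k - Suc r))" using T_at x y 2 by auto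
      have dx: "d (Suc r) (k - Suc r) (x (Suc r)) \<in> carrier (K (Suc r) (k - r))"
          "d (Suc r) (k - Suc r) (y (Suc r)) \<in> carrier (K (Suc r) (k - r))"
        using d.hom_closed[OF xr'(1)] d.hom_closed[OF xr'(2)] e by auto
      show ?thesis
        using 2 xr xr' dx d.hom_mult[OF xr'] e by (simp add: T_mult D_Suc x y sg_mult K.m_ac)
    next
      case 3
      then show ?thesis using T_at[OF x, of k] T_at[OF y, of k] by (simp add: T_mult D_last x y)
    qed
  qed
qed

text \<open>In an inner component only the two mixed terms survive. They are \<open>d\<close> of
  \<open>\<delta>\<close> of the same entry, once with the sign of \<open>r\<close>
  (\<open>A\<close>) and once with that of \<open>r + 1\<close> (\<open>Bq\<close>), and so
  cancel.\<close>

lemma D_D: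
  assumes x: "x \<in> carrier (T k)"
  shows "D (Suc k) (D k x) = \<one>\<^bsub>T (Suc (Suc k))\<^esub>"
proof (rule T_eqI)
  note Dx = D_closed[OF x]
  show "D (Suc k) (D k x) \<in> carrier (T (Suc (Suc k)))" by (rule D_closed[OF Dx])
  show "\<one>\<^bsub>T (Suc (Suc k))\<^esub> \<in> carrier (T (Suc (Suc k)))" by simp
  fix p assume p: "p \<le> Suc (Suc k)"
  have "D (Suc k) (D k x) p = \<one>\<^bsub>K p (Suc (Suc k) - p)\<^esub>"
    using p
  proof (cases rule: p_cases)
    case 1
    then show ?thesis using T_at[OF x, of 0] by (simp add: D_0 x Dx dd)
  next
    case (2 r)
    have xr: "x r \<in> carrier (K r (k - r))" using T_at x 2 by auto
    have e: "Suc k - r = Suc (k - r)" using 2 by simp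
    have \<delta>x: "\<delta> r (k - r) (x r) \<in> carrier (K (Suc r) (k - r))" using xr by simp
    define y where "y = d (Suc r) (k - r) (\<delta> r (k - r) (x r))"
    have y: "y \<in> carrier (K (Suc r) (Suc (k - r)))" unfolding y_def using \<delta>x by simp
    have A: "\<delta> r (Suc (k - r)) (D k x r) = sg r (Suc r) (Suc (k - r)) y"
    proof (cases r)
      case 0
      then show ?thesis using xr by (simp add: D_0 x \<delta>d y_def sg_def)
    next
      case (Suc s)
      have e2: "k - s = Suc (k - r)" using 2 Suc by simp
      have xs: "x s \<in> carrier (K s (Suc (k - r)))" using T_at[OF x, of s] 2 Suc e2 by simp
      have "D k x r = \<delta> s (Suc (k - r)) (x s) \<otimes>\<^bsub>K r (Suc (k - r))\<^esub> sg r r (Suc (k - r)) (d r (k - r) (x r))"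
        using D_Suc[OF x, of s] Suc 2 e2 by simp
      moreover have "\<delta> s (Suc (k - r)) (x s) \<in> carrier (K r (Suc (k - r)))" using xs Suc by simp
      moreover have "\<delta> r (Suc (k - r)) (\<delta> s (Suc (k - r)) (x s)) = \<one>\<^bsub>K (Suc r) (Suc (k - r))\<^esub>"
        using \<delta>\<delta>[OF xs] Suc by simp
      ultimately show ?thesis using xr y by (simp add: \<delta>_sg \<delta>d y_def)
    qed
    have Bq: "d (Suc r) (k - r) (D k x (Suc r)) = y"
    proof (cases "r = k")
      case True
      then show ?thesis by (simp add: D_last x y_def)
    next
      case False
      have e3: "Suc (k - Suc r) = k - r" using False 2 by simp
      have xr': "x (Suc r) \<in> carrier (K (Suc r) (k - Suc r))" using T_at x False 2 by auto
      have dx: "d (Suc r) (k - Suc r) (x (Suc r)) \<in> carrier (K (Suc r) (k - r))"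
        using d.hom_closed[OF xr'] e3 by simp
      have "d (Suc r) (k - r) (d (Suc r) (k - Suc r) (x (Suc r))) = \<one>\<^bsub>K (Suc r) (Suc (k - r))\<^esub>"
        using dd[OF xr'] e3 by simp
      then show ?thesis using D_Suc[OF x, of r] False 2 dx \<delta>x y by (simp add: d_sg y_def)
    qed
    show ?thesis using D_Suc[OF Dx, of r] 2 A Bq y e by (simp add: sg_cancel)
  next
    case 3
    then show ?thesis using T_at[OF x, of k] by (simp add: D_last x Dx \<delta>\<delta>)
  qed
  then show "D (Suc k) (D k x) p = \<one>\<^bsub>T (Suc (Suc k))\<^esub> p" using p by (simp add: T_one)
qed

lemma cochain_tot: "cochain T D"
  by (intro cochain.intro T_grp D_hom D_D)

sublocale tot: cochain T D by (rule cochain_tot)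

text \<open>The name stands for a single entry, not for singular chains. Edge maps into a row or
  column of the double complex are written with it.\<close>

definition sing :: "nat \<Rightarrow> nat \<Rightarrow> 'g \<Rightarrow> nat \<Rightarrow> 'g" where
  "sing k p z = (\<lambda>i\<in>{..k}. if i = p then z else \<one>\<^bsub>K i (k - i)\<^esub>)"

lemma sing_closed: "p \<le> k \<Longrightarrow> z \<in> carrier (K p (k - p)) \<Longrightarrow> sing k p z \<in> carrier (T k)"
  by (auto simp: sing_def T_carrier)

lemma sing_at: "i \<le> k \<Longrightarrow> sing k p z i = (if i = p then z else \<one>\<^bsub>K i (k - i)\<^esub>)"
  by (simp add: sing_def)

lemma sing_hom: "p \<le> k \<Longrightarrow> sing k p \<in> hom (K p (k - p)) (T k)"
  by (intro homI T_eqI) (auto simp: sing_closed sing_at T_mult)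

lemma one_at [simp]:
  "\<delta> p q \<one>\<^bsub>K p q\<^esub> = \<one>\<^bsub>K (Suc p) q\<^esub>" "d p q \<one>\<^bsub>K p q\<^esub> = \<one>\<^bsub>K p (Suc q)\<^esub>"
  by simp_all

lemma D_sing:
  assumes p: "p \<le> k" and z: "z \<in> carrier (K p (k - p))" and i: "i \<le> Suc k"
  shows "D k (sing k p z) i = (if i = p then sg p p (Suc (k - p)) (d p (k - p) z)
     else if i = Suc p then \<delta> p (k - p) z else \<one>\<^bsub>K i (Suc k - i)\<^esub>)"
  using i
proof (cases rule: p_cases)
  case 1
  then show ?thesis using z by (auto simp: D_0 sing_closed p sing_at sg_def)
next
  case (2 r)
  have e: "Suc (k - Suc r) = k - r" using 2 by simp
  have o: "d (Suc r) (k - Suc r) \<one>\<^bsub>K (Suc r) (k - Suc r)\<^esub> = \<one>\<^bsub>K (Suc r) (k - r)\<^esub>" using e by (metis one_at(2))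
  have o': "p = Suc r \<Longrightarrow> d (Suc r) (k - Suc r) z \<in> carrier (K (Suc r) (k - r))"
    using d.hom_closed[OF z] e by simp
  have "r = p \<Longrightarrow> \<delta> p (k - p) z \<in> carrier (K (Suc p) (k - p))" using z by simp
  then show ?thesis using 2 e o o' D_Suc[OF sing_closed[OF p z], of r] by (auto simp: sing_at)
next
  case 3
  then show ?thesis using p z by (auto simp: D_last sing_closed sing_at)
qed

lemma D_quot:
  assumes x: "x \<in> carrier (T k)" and b: "b \<in> tot.B k"
  shows "D k (x \<otimes>\<^bsub>T k\<^esub> inv\<^bsub>T k\<^esub> b) = D k x"
  using x tot.B_carrier[OF b] tot.B_D[OF b] by (simp add: tot.D_mult tot.D_inv D_closed)

text \<open>The columns are exact above row 0, so the entries of \<open>x\<close> can be cleared one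
  by one from column 0 upwards. Once the columns before \<open>m\<close> are clear, entry
  \<open>m\<close> of \<open>D k x\<close> is the vertical differential of entry \<open>m\<close> up
  to sign; as it is trivial, that entry has a vertical preimage, whose total differential is divided
  out.\<close>

lemma chase_up:
  assumes ex: "\<And>p q z. \<lbrakk>z \<in> carrier (K p (Suc q)); d p (Suc q) z = \<one>\<^bsub>K p (Suc (Suc q))\<^esub>\<rbrakk>
      \<Longrightarrow> \<exists>w\<in>carrier (K p q). d p q w = z"
    and x: "x \<in> carrier (T k)" and Dx: "\<And>i. i < k \<Longrightarrow> D k x i = \<one>\<^bsub>K i (Suc k - i)\<^esub>"
  shows "\<exists>e\<in>carrier (K k 0). \<exists>b\<in>tot.B k. x = sing k k e \<otimes>\<^bsub>T k\<^esub> b"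
proof -
  have "\<exists>b\<in>tot.B k. \<forall>i<m. (x \<otimes>\<^bsub>T k\<^esub> inv\<^bsub>T k\<^esub> b) i = \<one>\<^bsub>K i (k - i)\<^esub>" if "m \<le> k" for m
    using that
  proof (induction m)
    case 0
    then show ?case using tot.B_one by blast
  next
    case (Suc m)
    then obtain b where b: "b \<in> tot.B k" "\<And>i. i < m \<Longrightarrow> (x \<otimes>\<^bsub>T k\<^esub> inv\<^bsub>T k\<^esub> b) i = \<one>\<^bsub>K i (k - i)\<^esub>" by auto
    define y where "y = x \<otimes>\<^bsub>T k\<^esub> inv\<^bsub>T k\<^esub> b"
    have y: "y \<in> carrier (T k)" unfolding y_def using x tot.B_carrier[OF b(1)] by simp
    obtain q where q: "k = Suc (m + q)" using Suc.prems by (metis less_eq_Suc_le less_imp_Suc_add)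
    have ym: "y m \<in> carrier (K m (Suc q))" using T_at[OF y, of m] q by simp
    have "D k y m = \<one>\<^bsub>K m (Suc (Suc q))\<^esub>" using D_quot[OF x b(1)] Dx[of m] q by (simp add: y_def)
    moreover have "D k y m = sg m m (Suc (Suc q)) (d m (Suc q) (y m))"
    proof (cases m)
      case 0
      then show ?thesis using D_0[OF y] q ym by (simp add: sg_def)
    next
      case (Suc r)
      have "y r = \<one>\<^bsub>K r (k - r)\<^esub>" using b(2)[of r] Suc by (simp add: y_def)
      then have "\<delta> r (k - r) (y r) = \<one>\<^bsub>K m (Suc (Suc q))\<^esub>" using Suc q by simp
      moreover have "k - r = Suc (Suc q)" "k - Suc r = Suc q" using Suc q by auto
      ultimately show ?thesis using D_Suc[OF y, of r] Suc q ym by simp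
    qed
    ultimately have "d m (Suc q) (y m) = \<one>\<^bsub>K m (Suc (Suc q))\<^esub>" using ym by (simp add: sg_eq_one)
    then obtain w where w: "w \<in> carrier (K m q)" "d m q w = y m" using ex ym by blast
    \<comment> \<open>The degree \<open>m + q\<close> is \<open>k - 1\<close>. The sign is put in
      beforehand because \<open>D\<close> applies the same sign to the vertical differential in
      column \<open>m\<close>.\<close>
    define s where "s = sing (m + q) m (sg m m q w)"
    have w': "sg m m q w \<in> carrier (K m (m + q - m))" using w by simp
    have s: "s \<in> carrier (T (m + q))" unfolding s_def by (rule sing_closed[OF _ w']) simp
    have Ds: "D (m + q) s \<in> tot.B k" using s q by (auto simp: coboundaries_def)
    have Dsm: "D (m + q) s m = y m" and Dsi: "\<And>i. i < m \<Longrightarrow> D (m + q) s i = \<one>\<^bsub>K i (k - i)\<^esub>"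
      unfolding s_def using D_sing[OF _ w'] w ym q by (auto simp: d_sg)
    have bc: "b \<in> carrier (T k)" "D (m + q) s \<in> carrier (T k)" using tot.B_carrier b(1) Ds by blast+
    have "(x \<otimes>\<^bsub>T k\<^esub> inv\<^bsub>T k\<^esub> (b \<otimes>\<^bsub>T k\<^esub> D (m + q) s)) i = \<one>\<^bsub>K i (k - i)\<^esub>" if "i < Suc m" for i
    proof -
      have "x \<otimes>\<^bsub>T k\<^esub> inv\<^bsub>T k\<^esub> (b \<otimes>\<^bsub>T k\<^esub> D (m + q) s) = y \<otimes>\<^bsub>T k\<^esub> inv\<^bsub>T k\<^esub> (D (m + q) s)"
        using x bc by (simp add: y_def T.inv_mult T.m_assoc)
      moreover have "(y \<otimes>\<^bsub>T k\<^esub> inv\<^bsub>T k\<^esub> (D (m + q) s)) i = \<one>\<^bsub>K i (k - i)\<^esub>"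
      proof (cases "i = m")
        case True
        then show ?thesis using ym q Dsm bc by (simp add: T_mult T_inv)
      next
        case False
        then have "i < m" using that by simp
        then show ?thesis using b(2)[of i] q Dsi[of i] bc unfolding y_def[symmetric] by (simp add: T_mult T_inv)
      qed
      ultimately show ?thesis by simp
    qed
    then show ?case using tot.B_mult[OF b(1) Ds] by blast
  qed
  then obtain b where b: "b \<in> tot.B k" "\<And>i. i < k \<Longrightarrow> (x \<otimes>\<^bsub>T k\<^esub> inv\<^bsub>T k\<^esub> b) i = \<one>\<^bsub>K i (k - i)\<^esub>" by auto
  define y where "y = x \<otimes>\<^bsub>T k\<^esub> inv\<^bsub>T k\<^esub> b"
  have bc: "b \<in> carrier (T k)" using tot.B_carrier b(1) .
  have y: "y \<in> carrier (T k)" unfolding y_def using x bc by simp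
  have yk: "y k \<in> carrier (K k 0)" using T_at[OF y, of k] by simp
  have "y = sing k k (y k)"
    using b(2) yk by (intro T_eqI[of _ k] y sing_closed) (auto simp: sing_at simp flip: y_def)
  moreover have "x = y \<otimes>\<^bsub>T k\<^esub> b" unfolding y_def using x bc by (simp add: T.m_assoc)
  ultimately show ?thesis using yk b(1) by metis
qed

text \<open>Mirror image of \<open>chase_up\<close>: with rows exact from column 1 on, entries are
  cleared from column \<open>k\<close> down to column 1. No sign enters, since
  \<open>\<delta>\<close> is unsigned in \<open>D\<close>. Entries 0 and 1 of \<open>D k x\<close>
  stay unrestricted, as the chase ends in column 0.\<close>

lemma chase_down:
  assumes ex: "\<And>p q z. \<lbrakk>z \<in> carrier (K (Suc p) q); \<delta> (Suc p) q z = \<one>\<^bsub>K (Suc (Suc p)) q\<^esub>\<rbrakk>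
      \<Longrightarrow> \<exists>w\<in>carrier (K p q). \<delta> p q w = z"
    and x: "x \<in> carrier (T k)" and Dx: "\<And>i. \<lbrakk>1 < i; i \<le> Suc k\<rbrakk> \<Longrightarrow> D k x i = \<one>\<^bsub>K i (Suc k - i)\<^esub>"
  shows "\<exists>e\<in>carrier (K 0 k). \<exists>b\<in>tot.B k. x = sing k 0 e \<otimes>\<^bsub>T k\<^esub> b"
proof -
  have "\<exists>b\<in>tot.B k. \<forall>i. k - m < i \<longrightarrow> i \<le> k \<longrightarrow> (x \<otimes>\<^bsub>T k\<^esub> inv\<^bsub>T k\<^esub> b) i = \<one>\<^bsub>K i (k - i)\<^esub>" if "m \<le> k" for m
    using that
  proof (induction m)
    case 0
    then show ?case using tot.B_one by auto
  next
    case (Suc m)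
    then obtain b where b: "b \<in> tot.B k" "\<And>i. \<lbrakk>k - m < i; i \<le> k\<rbrakk> \<Longrightarrow> (x \<otimes>\<^bsub>T k\<^esub> inv\<^bsub>T k\<^esub> b) i = \<one>\<^bsub>K i (k - i)\<^esub>" by auto
    define y where "y = x \<otimes>\<^bsub>T k\<^esub> inv\<^bsub>T k\<^esub> b"
    have y: "y \<in> carrier (T k)" unfolding y_def using x tot.B_carrier[OF b(1)] by simp
    obtain p where p: "k = Suc (m + p)" using Suc.prems by (metis less_eq_Suc_le less_imp_Suc_add)
    have ym: "y (Suc p) \<in> carrier (K (Suc p) m)" using T_at[OF y, of "Suc p"] p by simp
    have "D k y (Suc (Suc p)) = \<one>\<^bsub>K (Suc (Suc p)) m\<^esub>"
      using D_quot[OF x b(1)] Dx[of "Suc (Suc p)"] p by (simp add: y_def)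
    moreover have "D k y (Suc (Suc p)) = \<delta> (Suc p) m (y (Suc p))"
    proof (cases m)
      case 0
      then have "k = Suc p" using p by simp
      then show ?thesis using D_last[OF y] 0 by simp
    next
      case (Suc r)
      have "y (Suc (Suc p)) = \<one>\<^bsub>K (Suc (Suc p)) r\<^esub>" using b(2)[of "Suc (Suc p)"] Suc p by (simp add: y_def)
      then have "d (Suc (Suc p)) r (y (Suc (Suc p))) = \<one>\<^bsub>K (Suc (Suc p)) m\<^esub>" using Suc by simp
      moreover have "k - Suc p = m" "k - Suc (Suc p) = r" using Suc p by auto
      ultimately show ?thesis using D_Suc[OF y, of "Suc p"] Suc p ym by simp
    qed
    ultimately have "\<delta> (Suc p) m (y (Suc p)) = \<one>\<^bsub>K (Suc (Suc p)) m\<^esub>" by simp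
    then obtain w where w: "w \<in> carrier (K p m)" "\<delta> p m w = y (Suc p)" using ex ym by blast
    define s where "s = sing (m + p) p w"
    have w': "w \<in> carrier (K p (m + p - p))" using w by simp
    have s: "s \<in> carrier (T (m + p))" unfolding s_def by (rule sing_closed[OF _ w']) simp
    have Ds: "D (m + p) s \<in> tot.B k" using s p by (auto simp: coboundaries_def)
    have Dsm: "D (m + p) s (Suc p) = y (Suc p)"
      and Dsi: "\<And>i. \<lbrakk>Suc p < i; i \<le> k\<rbrakk> \<Longrightarrow> D (m + p) s i = \<one>\<^bsub>K i (k - i)\<^esub>"
      unfolding s_def using D_sing[OF _ w'] w ym p by auto
    have bc: "b \<in> carrier (T k)" "D (m + p) s \<in> carrier (T k)" using tot.B_carrier b(1) Ds by blast+
    have "(x \<otimes>\<^bsub>T k\<^esub> inv\<^bsub>T k\<^esub> (b \<otimes>\<^bsub>T k\<^esub> D (m + p) s)) i = \<one>\<^bsub>K i (k - i)\<^esub>" if "k - Suc m < i" "i \<le> k" for i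
    proof -
      have "x \<otimes>\<^bsub>T k\<^esub> inv\<^bsub>T k\<^esub> (b \<otimes>\<^bsub>T k\<^esub> D (m + p) s) = y \<otimes>\<^bsub>T k\<^esub> inv\<^bsub>T k\<^esub> (D (m + p) s)"
        using x bc by (simp add: y_def T.inv_mult T.m_assoc)
      moreover have "(y \<otimes>\<^bsub>T k\<^esub> inv\<^bsub>T k\<^esub> (D (m + p) s)) i = \<one>\<^bsub>K i (k - i)\<^esub>"
      proof (cases "i = Suc p")
        case True
        then show ?thesis using ym p Dsm bc by (simp add: T_mult T_inv)
      next
        case False
        then have "Suc p < i" using that p by simp
        then show ?thesis using b(2)[of i] p that Dsi[of i] bc unfolding y_def[symmetric] by (simp add: T_mult T_inv)
      qed
      ultimately show ?thesis by simp
    qed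
    then show ?case using tot.B_mult[OF b(1) Ds] by blast
  qed
  from this[of k] obtain b where b: "b \<in> tot.B k" "\<And>i. \<lbrakk>0 < i; i \<le> k\<rbrakk> \<Longrightarrow> (x \<otimes>\<^bsub>T k\<^esub> inv\<^bsub>T k\<^esub> b) i = \<one>\<^bsub>K i (k - i)\<^esub>" by auto
  define y where "y = x \<otimes>\<^bsub>T k\<^esub> inv\<^bsub>T k\<^esub> b"
  have bc: "b \<in> carrier (T k)" using tot.B_carrier b(1) .
  have y: "y \<in> carrier (T k)" unfolding y_def using x bc by simp
  have yk: "y 0 \<in> carrier (K 0 k)" using T_at[OF y, of 0] by simp
  have "y = sing k 0 (y 0)"
    using b(2) yk by (intro T_eqI[of _ k] y sing_closed) (auto simp: sing_at simp flip: y_def)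
  moreover have "x = y \<otimes>\<^bsub>T k\<^esub> b" unfolding y_def using x bc by (simp add: T.m_assoc)
  ultimately show ?thesis using yk b(1) by metis
qed

text \<open>\<open>\<epsilon>\<close> identifies \<open>E\<close> with the kernel of the first
  vertical differential, and \<open>chase_up\<close> moves every class into row 0. As
  \<open>\<epsilon>\<close> is injective, the kernel condition of \<open>cohrel_qrel\<close> is
  trivial.\<close>

lemma cohrel_bottom:
  assumes E: "cochain E \<delta>'" and \<epsilon>: "\<And>p. \<epsilon> p \<in> hom (E p) (K p 0)"
    and \<epsilon>\<delta>: "\<And>p e. e \<in> carrier (E p) \<Longrightarrow> \<delta> p 0 (\<epsilon> p e) = \<epsilon> (Suc p) (\<delta>' p e)"
    and inj: "\<And>p e. \<lbrakk>e \<in> carrier (E p); \<epsilon> p e = \<one>\<^bsub>K p 0\<^esub>\<rbrakk> \<Longrightarrow> e = \<one>\<^bsub>E p\<^esub>"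
    and d\<epsilon>: "\<And>p e. e \<in> carrier (E p) \<Longrightarrow> d p 0 (\<epsilon> p e) = \<one>\<^bsub>K p 1\<^esub>"
    and im: "\<And>p z. \<lbrakk>z \<in> carrier (K p 0); d p 0 z = \<one>\<^bsub>K p 1\<^esub>\<rbrakk> \<Longrightarrow> \<exists>e\<in>carrier (E p). z = \<epsilon> p e"
    and ex: "\<And>p q z. \<lbrakk>z \<in> carrier (K p (Suc q)); d p (Suc q) z = \<one>\<^bsub>K p (Suc (Suc q))\<^esub>\<rbrakk>
      \<Longrightarrow> \<exists>w\<in>carrier (K p q). d p q w = z"
  shows "\<And>k. (\<lambda>e. sing k k (\<epsilon> k e)) \<in> hom (E k) (T k)"
    and "cohrel E \<delta>' T D k (qrel E \<delta>' T D (\<lambda>k e. sing k k (\<epsilon> k e)) k)"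
proof -
  interpret E: cochain E \<delta>' by fact
  have \<epsilon>c: "e \<in> carrier (E p) \<Longrightarrow> \<epsilon> p e \<in> carrier (K p 0)" for p e using \<epsilon>[of p] by (auto simp: hom_def)
  show hom: "(\<lambda>e. sing k k (\<epsilon> k e)) \<in> hom (E k) (T k)" for k
    using hom_compose[OF \<epsilon>[of k], of "sing k k" "T k"] sing_hom[of k k] by (simp add: comp_def)
  show "cohrel E \<delta>' T D k (qrel E \<delta>' T D (\<lambda>k e. sing k k (\<epsilon> k e)) k)"
  proof (rule cohrel_qrel[OF E cochain_tot hom])
    show "D k (sing k k (\<epsilon> k a)) = sing (Suc k) (Suc k) (\<epsilon> (Suc k) (\<delta>' k a))" if "a \<in> carrier (E k)" for k a
      using that \<epsilon>c by (intro T_eqI[of _ "Suc k"] D_closed sing_closed) (auto simp: D_sing sing_at d\<epsilon> \<epsilon>\<delta>)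
  next
    fix k x a assume x: "x \<in> carrier (T k)" "a \<in> carrier (E (Suc k))" "D k x = sing (Suc k) (Suc k) (\<epsilon> (Suc k) a)"
    then obtain e b where e: "e \<in> carrier (K k 0)" "b \<in> tot.B k" "x = sing k k e \<otimes>\<^bsub>T k\<^esub> b"
      using chase_up[OF ex x(1)] by (auto simp: sing_at)
    have ec: "e \<in> carrier (K k (k - k))" using e by simp
    have "D k x = D k (sing k k e)"
      unfolding e(3) using e tot.B_carrier[OF e(2)] tot.B_D[OF e(2)] sing_closed[OF _ ec]
      by (simp add: tot.D_mult)
    then have "sing (Suc k) (Suc k) (\<epsilon> (Suc k) a) k = sg k k 1 (d k 0 e)"
      using x(3) D_sing[OF _ ec, of k] by simp
    then have "sg k k 1 (d k 0 e) = \<one>\<^bsub>K k 1\<^esub>" by (simp add: sing_at)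
    then have "d k 0 e = \<one>\<^bsub>K k 1\<^esub>" using d.hom_closed[OF e(1)] by (simp add: sg_eq_one)
    then obtain c where "c \<in> carrier (E k)" "e = \<epsilon> k c" using im e by blast
    then show "\<exists>c\<in>carrier (E k). \<exists>b\<in>tot.B k. x = sing k k (\<epsilon> k c) \<otimes>\<^bsub>T k\<^esub> b" using e by blast
  next
    fix k a assume a: "a \<in> carrier (E k)" "sing k k (\<epsilon> k a) = \<one>\<^bsub>T k\<^esub>"
    have "\<epsilon> k a = \<one>\<^bsub>K k 0\<^esub>" using sing_at[of k k k "\<epsilon> k a"] T_one[of k k] a(2) by simp
    then have "a = \<one>\<^bsub>E k\<^esub>" using inj a by blast
    moreover have "sing r r (\<epsilon> r \<one>\<^bsub>E r\<^esub>) = \<one>\<^bsub>T r\<^esub>" for r using hom_one[OF hom[of r]] by simp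
    ultimately show "case k of 0 \<Rightarrow> a = \<one>\<^bsub>E k\<^esub>
      | Suc r \<Rightarrow> \<exists>c\<in>carrier (E r). sing r r (\<epsilon> r c) = \<one>\<^bsub>T r\<^esub> \<and> \<delta>' r c = a"
      by (auto split: nat.split intro!: bexI[of _ "\<one>\<^bsub>E r\<^esub>" for r])
  qed
qed

text \<open>The transposed statement, with \<open>chase_down\<close> moving classes into column 0.
  Here \<open>\<epsilon>\<close> may have a kernel; the assumption \<open>acyc\<close> requires that
  kernel to be acyclic.\<close>

lemma cohrel_left:
  assumes E: "cochain E dE" and \<epsilon>: "\<And>q. \<epsilon> q \<in> hom (E q) (K 0 q)"
    and \<epsilon>d: "\<And>q e. e \<in> carrier (E q) \<Longrightarrow> d 0 q (\<epsilon> q e) = \<epsilon> (Suc q) (dE q e)"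
    and \<delta>\<epsilon>: "\<And>q e. e \<in> carrier (E q) \<Longrightarrow> \<delta> 0 q (\<epsilon> q e) = \<one>\<^bsub>K 1 q\<^esub>"
    and im: "\<And>q z. \<lbrakk>z \<in> carrier (K 0 q); \<delta> 0 q z = \<one>\<^bsub>K 1 q\<^esub>\<rbrakk> \<Longrightarrow> \<exists>e\<in>carrier (E q). z = \<epsilon> q e"
    and ex: "\<And>p q z. \<lbrakk>z \<in> carrier (K (Suc p) q); \<delta> (Suc p) q z = \<one>\<^bsub>K (Suc (Suc p)) q\<^esub>\<rbrakk>
      \<Longrightarrow> \<exists>w\<in>carrier (K p q). \<delta> p q w = z"
    and acyc: "\<And>k a. \<lbrakk>a \<in> carrier (E k); \<epsilon> k a = \<one>\<^bsub>K 0 k\<^esub>; dE k a = \<one>\<^bsub>E (Suc k)\<^esub>\<rbrakk> \<Longrightarrow>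
       case k of 0 \<Rightarrow> a = \<one>\<^bsub>E k\<^esub> | Suc r \<Rightarrow> \<exists>c\<in>carrier (E r). \<epsilon> r c = \<one>\<^bsub>K 0 r\<^esub> \<and> dE r c = a"
  shows "\<And>k. (\<lambda>e. sing k 0 (\<epsilon> k e)) \<in> hom (E k) (T k)"
    and "cohrel E dE T D k (qrel E dE T D (\<lambda>k e. sing k 0 (\<epsilon> k e)) k)"
proof -
  interpret E: cochain E dE by fact
  have \<epsilon>c: "e \<in> carrier (E p) \<Longrightarrow> \<epsilon> p e \<in> carrier (K 0 p)" for p e using \<epsilon>[of p] by (auto simp: hom_def)
  show hom: "(\<lambda>e. sing k 0 (\<epsilon> k e)) \<in> hom (E k) (T k)" for k
    using hom_compose[OF \<epsilon>[of k], of "sing k 0" "T k"] sing_hom[of 0 k] by (simp add: comp_def)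
  have sing1: "sing r 0 z = \<one>\<^bsub>T r\<^esub> \<longleftrightarrow> z = \<one>\<^bsub>K 0 r\<^esub>" if "z \<in> carrier (K 0 r)" for r z
  proof
    assume "sing r 0 z = \<one>\<^bsub>T r\<^esub>"
    then have "sing r 0 z 0 = \<one>\<^bsub>T r\<^esub> 0" by simp
    then show "z = \<one>\<^bsub>K 0 r\<^esub>" by (simp add: sing_at T_one)
  next
    assume "z = \<one>\<^bsub>K 0 r\<^esub>"
    then show "sing r 0 z = \<one>\<^bsub>T r\<^esub>" by (intro T_eqI[of _ r] sing_closed) (auto simp: sing_at T_one)
  qed
  show "cohrel E dE T D k (qrel E dE T D (\<lambda>k e. sing k 0 (\<epsilon> k e)) k)"
  proof (rule cohrel_qrel[OF E cochain_tot hom])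
    show "D k (sing k 0 (\<epsilon> k a)) = sing (Suc k) 0 (\<epsilon> (Suc k) (dE k a))" if "a \<in> carrier (E k)" for k a
      using that \<epsilon>c by (intro T_eqI[of _ "Suc k"] D_closed sing_closed) (auto simp: D_sing sing_at \<delta>\<epsilon> \<epsilon>d sg_def)
  next
    fix k x a assume x: "x \<in> carrier (T k)" "a \<in> carrier (E (Suc k))" "D k x = sing (Suc k) 0 (\<epsilon> (Suc k) a)"
    then obtain e b where e: "e \<in> carrier (K 0 k)" "b \<in> tot.B k" "x = sing k 0 e \<otimes>\<^bsub>T k\<^esub> b"
      using chase_down[OF ex x(1)] by (auto simp: sing_at)
    have ec: "e \<in> carrier (K 0 (k - 0))" using e by simp
    have "D k x = D k (sing k 0 e)"
      unfolding e(3) using e tot.B_carrier[OF e(2)] tot.B_D[OF e(2)] sing_closed[OF _ ec]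
      by (simp add: tot.D_mult)
    then have "sing (Suc k) 0 (\<epsilon> (Suc k) a) 1 = \<delta> 0 k e"
      using x(3) D_sing[OF _ ec, of 1] by simp
    then have "\<delta> 0 k e = \<one>\<^bsub>K 1 k\<^esub>" by (simp add: sing_at)
    then obtain c where "c \<in> carrier (E k)" "e = \<epsilon> k c" using im e by blast
    then show "\<exists>c\<in>carrier (E k). \<exists>b\<in>tot.B k. x = sing k 0 (\<epsilon> k c) \<otimes>\<^bsub>T k\<^esub> b" using e by blast
  next
    fix k a assume a: "a \<in> carrier (E k)" "sing k 0 (\<epsilon> k a) = \<one>\<^bsub>T k\<^esub>" "dE k a = \<one>\<^bsub>E (Suc k)\<^esub>"
    then have "\<epsilon> k a = \<one>\<^bsub>K 0 k\<^esub>" using sing1 \<epsilon>c by blast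
    then show "case k of 0 \<Rightarrow> a = \<one>\<^bsub>E k\<^esub>
      | Suc r \<Rightarrow> \<exists>c\<in>carrier (E r). sing r 0 (\<epsilon> r c) = \<one>\<^bsub>T r\<^esub> \<and> dE r c = a"
      using acyc[OF a(1) _ a(3)] sing1 \<epsilon>c by (auto split: nat.splits)
  qed
qed

lemma cochain_endo_tot:
  assumes f: "\<And>p q. f p q \<in> hom (K p q) (K p q)"
    and f\<delta>: "\<And>p q z. z \<in> carrier (K p q) \<Longrightarrow> f (Suc p) q (\<delta> p q z) = \<delta> p q (f p q z)"
    and fd: "\<And>p q z. z \<in> carrier (K p q) \<Longrightarrow> f p (Suc q) (d p q z) = d p q (f p q z)"
  shows "cochain_endo T D (\<lambda>k x. \<lambda>p\<in>{..k}. f p (k - p) (x p))"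
proof -
  have fc: "z \<in> carrier (K p q) \<Longrightarrow> f p q z \<in> carrier (K p q)" for p q z using f[of p q] by (auto simp: hom_def)
  have fm: "\<lbrakk>z \<in> carrier (K p q); w \<in> carrier (K p q)\<rbrakk> \<Longrightarrow> f p q (z \<otimes>\<^bsub>K p q\<^esub> w) = f p q z \<otimes>\<^bsub>K p q\<^esub> f p q w" for p q z w
    using f[of p q] by (auto simp: hom_def)
  have fi: "z \<in> carrier (K p q) \<Longrightarrow> f p q (sg r p q z) = sg r p q (f p q z)" for p q z r
    using group_hom.hom_inv[OF group_hom_of[OF K_grp K_grp f[of p q]]] by (simp add: sg_def)
  let ?F = "\<lambda>k x. \<lambda>p\<in>{..k}. f p (k - p) (x p)"
  have F: "?F k x \<in> carrier (T k)" if "x \<in> carrier (T k)" for k x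
    using that by (auto simp: T_carrier fc)
  show ?thesis
  proof (intro cochain_endo.intro cochain_tot cochain_endo_axioms.intro homI)
    fix k x assume x: "x \<in> carrier (T k)"
    show "?F k x \<in> carrier (T k)" using F[OF x] .
    show "?F k (x \<otimes>\<^bsub>T k\<^esub> y) = ?F k x \<otimes>\<^bsub>T k\<^esub> ?F k y" if y: "y \<in> carrier (T k)" for y
      using x y F by (intro T_eqI[of _ k]) (auto simp: T_mult fm T_at)
    show "?F (Suc k) (D k x) = D k (?F k x)"
    proof (rule T_eqI[OF F[OF D_closed[OF x]] D_closed[OF F[OF x]]])
      fix p assume p: "p \<le> Suc k"
      then have "f p (Suc k - p) (D k x p) = D k (?F k x) p"
      proof (cases rule: p_cases)
        case 1
        then show ?thesis using T_at[OF x, of 0] by (simp add: D_0 x F fd)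
      next
        case (2 r)
        have e: "Suc (k - Suc r) = k - r" using 2 by simp
        have xr: "x r \<in> carrier (K r (k - r))" "x (Suc r) \<in> carrier (K (Suc r) (k - Suc r))" using T_at x 2 by auto
        have dx: "d (Suc r) (k - Suc r) (x (Suc r)) \<in> carrier (K (Suc r) (k - r))"
          using d.hom_closed[OF xr(2)] e by simp
        have "f (Suc r) (k - r) (d (Suc r) (k - Suc r) (x (Suc r))) = d (Suc r) (k - Suc r) (f (Suc r) (k - Suc r) (x (Suc r)))"
          using fd[OF xr(2)] e by simp
        then show ?thesis using 2 xr dx D_Suc[OF F[OF x], of r] by (simp add: D_Suc x fm fi f\<delta>)
      next
        case 3
        then show ?thesis using T_at[OF x, of k] by (simp add: D_last x F f\<delta>)
      qed
      then show "?F (Suc k) (D k x) p = D k (?F k x) p" using p by simp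
    qed
  qed
qed

end

section \<open>Hypercohomology of complexes of presheaves\<close>

abbreviation "bi_delta X L \<equiv> (\<lambda>p q. godement_delta X (L q) p (topspace X))"
abbreviation "bi_d X L d \<equiv> (\<lambda>p q. godement_C_map X (L (Suc q)) (d q) p (topspace X))"

lemma total_group_eq: "total_group X L = tot_group (godement_bicomplex X L)"
  by (intro ext) (simp add: total_group_def tot_group_def)

lemma total_differential_eq:
  "total_differential X L d = tot_diff (godement_bicomplex X L) (bi_delta X L) (bi_d X L d)"
  by (intro ext) (simp add: total_differential_def tot_diff_def Let_def)

lemma gmor_zero:
  assumes "gmor X F G f" "gmor X G H g"
    and "\<And>U s. \<lbrakk>openin X U; s \<in> Sc F U\<rbrakk> \<Longrightarrow> g U (f U s) = \<one>\<^bsub>sections H U\<^esub>"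
    and "openin X U" "y \<in> Sc (godement_C X F k) U"
  shows "godement_C_map X H g k U (godement_C_map X G f k U y) = \<one>\<^bsub>sections (godement_C X H k) U\<^esub>"
proof -
  have "godement_Q_map X H g k V (godement_Q_map X G f k V s) = \<one>\<^bsub>sections (godement_Q X H k) V\<^esub>"
    if "openin X V" "s \<in> Sc (godement_Q X F k) V" for V s
    using that
  proof (induction k arbitrary: V s)
    case 0
    then show ?case using assms(3) by simp
  next
    case (Suc k)
    then show ?case unfolding godement_Q_Suc godement_Q_map_Suc
      by (intro QQ_map_comp_triv[OF gmor_godement_Q[OF assms(1)] gmor_godement_Q[OF assms(2)]]) auto
  qed
  then show ?thesis using assms(4,5) unfolding godement_C_map_def godement_C_def
    by (intro family_map_comp_triv[OF gmor_godement_Q[OF assms(1)] gmor_godement_Q[OF assms(2)]]) auto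
qed

lemma bicomplex_godement:
  assumes pc: "presheaf_complex X L d"
  shows "bicomplex (godement_bicomplex X L) (bi_delta X L) (bi_d X L d)"
proof (rule bicomplex.intro)
  fix p q
  note D = presheaf_complexD[OF pc]
  interpret a: gmor X "godement_C X (L q) p" "godement_C X (L q) (Suc p)" "godement_delta X (L q) p"
    by (rule gmor_godement_delta[OF D(3)])
  interpret b: gmor X "godement_C X (L q) p" "godement_C X (L (Suc q)) p" "godement_C_map X (L (Suc q)) (d q) p"
    by (rule gmor_godement_C[OF D(1)])
  show "comm_group (godement_bicomplex X L p q)"
    unfolding godement_bicomplex_def by (rule a.F.sections_comm_group) simp
  show "bi_delta X L p q \<in> hom (godement_bicomplex X L p q) (godement_bicomplex X L (Suc p) q)"
    unfolding godement_bicomplex_def by (rule pshomD(4)[OF a.mor]) simp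
  show "bi_d X L d p q \<in> hom (godement_bicomplex X L p q) (godement_bicomplex X L p (Suc q))"
    unfolding godement_bicomplex_def by (rule pshomD(4)[OF b.mor]) simp
  fix x assume "x \<in> carrier (godement_bicomplex X L p q)"
  then have x: "x \<in> Sc (godement_C X (L q) p) (topspace X)" by (simp add: godement_bicomplex_def)
  show "bi_delta X L (Suc p) q (bi_delta X L p q x) = \<one>\<^bsub>godement_bicomplex X L (Suc (Suc p)) q\<^esub>"
    unfolding godement_bicomplex_def by (rule godement_delta_delta[OF D(3) openin_topspace x])
  show "bi_d X L d p (Suc q) (bi_d X L d p q x) = \<one>\<^bsub>godement_bicomplex X L p (Suc (Suc q))\<^esub>"
    unfolding godement_bicomplex_def by (rule gmor_zero[OF D(1) D(1) D(2) openin_topspace x])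
  show "bi_delta X L p (Suc q) (bi_d X L d p q x) = bi_d X L d (Suc p) q (bi_delta X L p q x)"
    by (rule godement_delta_natural[OF D(1) openin_topspace x])
qed

lemma cochain_godement:
  assumes "gpresheaf X F"
  shows "cochain (\<lambda>p. sections (godement_C X F p) (topspace X)) (\<lambda>p. godement_delta X F p (topspace X))"
proof (rule cochain.intro)
  fix p
  interpret a: gmor X "godement_C X F p" "godement_C X F (Suc p)" "godement_delta X F p"
    by (rule gmor_godement_delta[OF assms])
  show "comm_group (sections (godement_C X F p) (topspace X))" by (rule a.F.sections_comm_group) simp
  show "godement_delta X F p (topspace X) \<in>
      hom (sections (godement_C X F p) (topspace X)) (sections (godement_C X F (Suc p)) (topspace X))"
    by (rule pshomD(4)[OF a.mor]) simp
  show "godement_delta X F (Suc p) (topspace X) (godement_delta X F p (topspace X) x) =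
      \<one>\<^bsub>sections (godement_C X F (Suc (Suc p))) (topspace X)\<^esub>"
    if "x \<in> Sc (godement_C X F p) (topspace X)" for x
    by (rule godement_delta_delta[OF assms openin_topspace that])
qed

lemma cochain_endo_godement:
  assumes s: "gmor X F F s"
  shows "cochain_endo (\<lambda>p. sections (godement_C X F p) (topspace X)) (\<lambda>p. godement_delta X F p (topspace X))
    (\<lambda>p. godement_C_map X F s p (topspace X))"
proof (intro cochain_endo.intro cochain_godement cochain_endo_axioms.intro)
  show "gpresheaf X F" using s by (rule gmor.gF)
  show "godement_C_map X F s p (topspace X) \<in> hom (sections (godement_C X F p) (topspace X)) (sections (godement_C X F p) (topspace X))" for p
    by (rule pshomD(4)[OF gmor.mor[OF gmor_godement_C[OF s]]]) simp
  show "godement_C_map X F s (Suc p) (topspace X) (godement_delta X F p (topspace X) a) =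
      godement_delta X F p (topspace X) (godement_C_map X F s p (topspace X) a)"
    if "a \<in> Sc (godement_C X F p) (topspace X)" for p a
    by (rule godement_delta_natural[OF s openin_topspace that, symmetric])
qed

abbreviation "tot_endo X L f \<equiv> (\<lambda>k x. \<lambda>p\<in>{..k}. godement_C_map X (L (k - p)) (f (k - p)) p (topspace X) (x p))"

lemma cochain_endo_total:
  assumes pc: "presheaf_complex X L d" and s: "\<And>q. gmor X (L q) (L q) (s q)"
    and sd: "\<And>q U x. \<lbrakk>openin X U; x \<in> Sc (L q) U\<rbrakk> \<Longrightarrow> s (Suc q) U (d q U x) = d q U (s q U x)"
  shows "cochain_endo (total_group X L) (total_differential X L d) (tot_endo X L s)"
proof -
  interpret bicomplex "godement_bicomplex X L" "bi_delta X L" "bi_d X L d" by (rule bicomplex_godement[OF pc])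
  note D = presheaf_complexD[OF pc]
  show ?thesis
    unfolding total_group_eq total_differential_eq
  proof (rule cochain_endo_tot[of "\<lambda>p q. godement_C_map X (L q) (s q) p (topspace X)"])
    fix p q
    show "godement_C_map X (L q) (s q) p (topspace X) \<in> hom (godement_bicomplex X L p q) (godement_bicomplex X L p q)"
      unfolding godement_bicomplex_def by (rule pshomD(4)[OF gmor.mor[OF gmor_godement_C[OF s]]]) simp
    fix z assume "z \<in> carrier (godement_bicomplex X L p q)"
    then have z: "z \<in> Sc (godement_C X (L q) p) (topspace X)" by (simp add: godement_bicomplex_def)
    show "godement_C_map X (L q) (s q) (Suc p) (topspace X) (bi_delta X L p q z) =
        bi_delta X L p q (godement_C_map X (L q) (s q) p (topspace X) z)"
      by (rule godement_delta_natural[OF s openin_topspace z, symmetric])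
    show "godement_C_map X (L (Suc q)) (s (Suc q)) p (topspace X) (bi_d X L d p q z) =
        bi_d X L d p q (godement_C_map X (L q) (s q) p (topspace X) z)"
      by (rule godement_C_map_square[OF D(1) s s D(1) sd openin_topspace z])
  qed
qed

text \<open>Each functor \<open>C^p\<close> keeps the augmented complex exact by
  \<open>godement_C_exact\<close>; these are the columns required by \<open>cohrel_bottom\<close>.
  The index \<open>c\<close> lets one relation respect a whole family of endomorphisms.\<close>

lemma resolution_cohrel:
  fixes F :: "nat \<Rightarrow> ('a, ('a, 'b) gsec) presheaf"
  assumes ex: "locally_exact X F d"
    and s: "\<And>c q. gmor X (F q) (F q) (s c q)"
    and sd: "\<And>c q U x. \<lbrakk>openin X U; x \<in> Sc (F q) U\<rbrakk> \<Longrightarrow> s c (Suc q) U (d q U x) = d q U (s c q U x)"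
  defines "L \<equiv> \<lambda>q. F (Suc q)" and "dL \<equiv> \<lambda>q. d (Suc q)"
  obtains R where
    "cohrel (\<lambda>p. sections (godement_C X (F 0) p) (topspace X)) (\<lambda>p. godement_delta X (F 0) p (topspace X))
       (total_group X L) (total_differential X L dL) k R"
    "\<And>c a b. R a b \<Longrightarrow> R (godement_C_map X (F 0) (s c 0) k (topspace X) a) (tot_endo X L (\<lambda>q. s c (Suc q)) k b)"
    "presheaf_complex X L dL"
proof -
  have pcF: "presheaf_complex X F d" using ex by (simp add: locally_exact_def)
  then have pc: "presheaf_complex X L dL" by (simp add: presheaf_complex_def L_def dL_def)
  note D = presheaf_complexD[OF pcF]
  interpret bicomplex "godement_bicomplex X L" "bi_delta X L" "bi_d X L dL" by (rule bicomplex_godement[OF pc])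
  let ?E = "\<lambda>p. sections (godement_C X (F 0) p) (topspace X)"
  let ?\<epsilon> = "\<lambda>p. godement_C_map X (F (Suc 0)) (d 0) p (topspace X)"
  have B: "godement_bicomplex X L p q = sections (godement_C X (F (Suc q)) p) (topspace X)" for p q
    by (simp add: godement_bicomplex_def L_def)
  have \<epsilon>: "gmor X (godement_C X (F 0) p) (godement_C X (F (Suc 0)) p) (godement_C_map X (F (Suc 0)) (d 0) p)" for p
    by (rule gmor_godement_C[OF D(1)])
  note EX = godement_C_exact[OF ex openin_topspace]
  have 1: "?\<epsilon> p \<in> hom (?E p) (godement_bicomplex X L p 0)" for p
    unfolding B by (rule pshomD(4)[OF gmor.mor[OF \<epsilon>]]) simp
  have 2: "bi_delta X L p 0 (?\<epsilon> p e) = ?\<epsilon> (Suc p) (godement_delta X (F 0) p (topspace X) e)"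
    if "e \<in> carrier (?E p)" for p e
    unfolding L_def by (rule godement_delta_natural[OF D(1) openin_topspace that])
  have 3: "e = \<one>\<^bsub>?E p\<^esub>" if "e \<in> carrier (?E p)" "?\<epsilon> p e = \<one>\<^bsub>godement_bicomplex X L p 0\<^esub>" for p e
    using EX(1)[OF that(1)] that(2) unfolding B by simp
  have 4: "bi_d X L dL p 0 (?\<epsilon> p e) = \<one>\<^bsub>godement_bicomplex X L p 1\<^esub>" if "e \<in> carrier (?E p)" for p e
    unfolding B unfolding L_def dL_def using gmor_zero[OF D(1) D(1) D(2) openin_topspace that] by simp
  have 5: "\<exists>e\<in>carrier (?E p). z = ?\<epsilon> p e"
    if z: "z \<in> carrier (godement_bicomplex X L p 0)" "bi_d X L dL p 0 z = \<one>\<^bsub>godement_bicomplex X L p 1\<^esub>" for p z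
    using EX(2)[of z 0 p] z unfolding B unfolding L_def dL_def by auto
  have 6: "\<exists>w\<in>carrier (godement_bicomplex X L p q). bi_d X L dL p q w = z"
    if z: "z \<in> carrier (godement_bicomplex X L p (Suc q))" "bi_d X L dL p (Suc q) z = \<one>\<^bsub>godement_bicomplex X L p (Suc (Suc q))\<^esub>" for p q z
    using EX(2)[of z "Suc q" p] z unfolding B unfolding L_def dL_def by auto
  note CR = cohrel_bottom[of ?E _ ?\<epsilon>, OF cochain_godement[OF D(3)] 1 2 3 4 5 6]
  let ?R = "qrel ?E (\<lambda>p. godement_delta X (F 0) p (topspace X)) T (D) (\<lambda>k e. sing k k (?\<epsilon> k e)) k"
  have endo: "?R (godement_C_map X (F 0) (s c 0) k (topspace X) a) (tot_endo X L (\<lambda>q. s c (Suc q)) k b)"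
    if R: "?R a b" for c a b
  proof (rule qrel_endo[OF cochain_endo_godement[OF s] _ CR(1) _ R])
    show "cochain_endo T D (tot_endo X L (\<lambda>q. s c (Suc q)))"
      using cochain_endo_total[OF pc, of "\<lambda>q. s c (Suc q)"] s sd
      unfolding total_group_eq total_differential_eq by (simp add: L_def dL_def)
    fix e assume e: "e \<in> carrier (?E k)"
    have "godement_C_map X (F (Suc 0)) (s c (Suc 0)) k (topspace X) (?\<epsilon> k e) =
        ?\<epsilon> k (godement_C_map X (F 0) (s c 0) k (topspace X) e)"
      by (rule godement_C_map_square[OF D(1) s s D(1) sd openin_topspace e])
    moreover have "godement_C_map X (L q) (s c (Suc q)) p (topspace X) \<one>\<^bsub>godement_bicomplex X L p q\<^esub> = \<one>\<^bsub>godement_bicomplex X L p q\<^esub>" for p q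
      unfolding B unfolding L_def by (rule gmor.mor_one[OF gmor_godement_C[OF s]]) simp
    ultimately show "tot_endo X L (\<lambda>q. s c (Suc q)) k (sing k k (?\<epsilon> k e)) =
        sing k k (?\<epsilon> k (godement_C_map X (F 0) (s c 0) k (topspace X) e))"
      unfolding sing_def by (auto intro!: restrict_ext simp: L_def)
  qed
  show ?thesis
    by (rule that[of ?R]; (rule endo pc)?) (unfold total_group_eq total_differential_eq, rule CR(2))
qed

text \<open>Flabbiness makes the Godement rows exact and the kernel of the first
  \<open>\<delta>\<close> equal to the germ families of global sections, as
  \<open>cohrel_left\<close> needs. \<open>E\<close> is kept apart from the groups of global
  sections because singular cochains have another type. The elements with trivial germs everywhere
  form the kernel of the edge map; \<open>acyc\<close> deals with them.\<close>

lemma flabby_cohrel: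
  fixes L :: "nat \<Rightarrow> ('a, ('a, 'b) gsec) presheaf" and E :: "nat \<Rightarrow> 'e monoid"
  assumes pc: "presheaf_complex X L d" and fl: "\<And>q. flabby X (L q)"
    and s: "\<And>c q. gmor X (L q) (L q) (s c q)"
    and sd: "\<And>c q U x. \<lbrakk>openin X U; x \<in> Sc (L q) U\<rbrakk> \<Longrightarrow> s c (Suc q) U (d q U x) = d q U (s c q U x)"
    and E: "cochain E dE" and e: "\<And>q. e q \<in> hom (E q) (sections (L q) (topspace X))"
    and surj: "\<And>q. e q ` carrier (E q) = Sc (L q) (topspace X)"
    and ed: "\<And>q a. a \<in> carrier (E q) \<Longrightarrow> d q (topspace X) (e q a) = e (Suc q) (dE q a)"
    and sE: "\<And>c. cochain_endo E dE (sE c)"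
    and es: "\<And>c q a. a \<in> carrier (E q) \<Longrightarrow> s c q (topspace X) (e q a) = e q (sE c q a)"
    and acyc: "\<And>k a. \<lbrakk>a \<in> carrier (E k); dE k a = \<one>\<^bsub>E (Suc k)\<^esub>;
       \<And>p. p \<in> topspace X \<Longrightarrow> germ X (L k) p (topspace X) (e k a) = \<one>\<^bsub>stalk X (L k) p\<^esub>\<rbrakk> \<Longrightarrow>
       case k of 0 \<Rightarrow> a = \<one>\<^bsub>E k\<^esub> | Suc r \<Rightarrow> \<exists>c\<in>carrier (E r).
         (\<forall>p\<in>topspace X. germ X (L r) p (topspace X) (e r c) = \<one>\<^bsub>stalk X (L r) p\<^esub>) \<and> dE r c = a"
  obtains R where
    "cohrel E dE (total_group X L) (total_differential X L d) k R"
    "\<And>c a b. R a b \<Longrightarrow> R (sE c k a) (tot_endo X L (s c) k b)"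
proof -
  interpret bicomplex "godement_bicomplex X L" "bi_delta X L" "bi_d X L d" by (rule bicomplex_godement[OF pc])
  note D = presheaf_complexD[OF pc]
  let ?X = "topspace X"
  have B: "godement_bicomplex X L p q = sections (godement_C X (L q) p) ?X" for p q
    by (simp add: godement_bicomplex_def)
  have B0: "godement_bicomplex X L 0 q = sections (godement_sheaf X (L q)) ?X" for q
    by (simp add: godement_bicomplex_def godement_C_def)
  have ec: "a \<in> carrier (E q) \<Longrightarrow> e q a \<in> Sc (L q) ?X" for q a using e[of q] by (auto simp: hom_def)
  let ?\<epsilon> = "\<lambda>q a. germ_family X (L q) ?X (e q a)"
  have one: "?\<epsilon> q a = \<one>\<^bsub>godement_bicomplex X L 0 q\<^esub> \<longleftrightarrow>
     (\<forall>p\<in>?X. germ X (L q) p ?X (e q a) = \<one>\<^bsub>stalk X (L q) p\<^esub>)" if a: "a \<in> carrier (E q)" for q a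
  proof -
    interpret gpresheaf X "L q" by (rule D(3))
    show ?thesis
    proof
      assume e: "?\<epsilon> q a = \<one>\<^bsub>godement_bicomplex X L 0 q\<^esub>"
      show "\<forall>p\<in>?X. germ X (L q) p ?X (e q a) = \<one>\<^bsub>stalk X (L q) p\<^esub>"
      proof
        fix p assume p: "p \<in> ?X"
        have "family (?\<epsilon> q a) p = family \<one>\<^bsub>godement_bicomplex X L 0 q\<^esub> p" using e by simp
        then show "germ X (L q) p ?X (e q a) = \<one>\<^bsub>stalk X (L q) p\<^esub>" using p by (simp add: B0 G_one_at germ_family_at)
      qed
    next
      assume "\<forall>p\<in>?X. germ X (L q) p ?X (e q a) = \<one>\<^bsub>stalk X (L q) p\<^esub>"
      then show "?\<epsilon> q a = \<one>\<^bsub>godement_bicomplex X L 0 q\<^esub>"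
        unfolding B0 by (intro G_eqI[of _ X "L q" ?X] germ_family_closed G_one_closed ec a)
          (simp_all add: G_one_at germ_family_at)
    qed
  qed
  have 1: "?\<epsilon> q \<in> hom (E q) (godement_bicomplex X L 0 q)" for q
  proof -
    interpret gpresheaf X "L q" by (rule D(3))
    show ?thesis
      unfolding B0 using hom_compose[OF e pshomD(4)[OF germ_family_pshom openin_topspace]] by (simp add: comp_def)
  qed
  have 2: "bi_d X L d 0 q (?\<epsilon> q a) = ?\<epsilon> (Suc q) (dE q a)" if a: "a \<in> carrier (E q)" for q a
  proof -
    interpret gmor X "L q" "L (Suc q)" "d q" by (rule D(1))
    show ?thesis using fm_germ_family[OF openin_topspace ec[OF a]] ed[OF a] by (simp add: godement_C_map_def)
  qed
  have 3: "bi_delta X L 0 q (?\<epsilon> q a) = \<one>\<^bsub>godement_bicomplex X L 1 q\<^esub>" if a: "a \<in> carrier (E q)" for q a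
  proof -
    interpret gpresheaf X "L q" by (rule D(3))
    interpret gmor X "QQ X (L q)" "godement_C X (L q) 1" "germ_family X (QQ X (L q))"
      using gmor_germ_family[OF QQ_abpresheaf] by (simp add: godement_C_def godement_Q_Suc One_nat_def del: godement_Q.simps(2))
    show ?thesis unfolding B
      using to_QQ_germ_family[OF openin_topspace ec[OF a]] mor_one[OF openin_topspace] by (simp add: godement_delta_eq)
  qed
  have 4: "\<exists>a\<in>carrier (E q). z = ?\<epsilon> q a"
    if z: "z \<in> carrier (godement_bicomplex X L 0 q)" "bi_delta X L 0 q z = \<one>\<^bsub>godement_bicomplex X L 1 q\<^esub>" for q z
  proof -
    obtain t where t: "t \<in> Sc (L q) ?X" "z = germ_family X (L q) ?X t"
      using flabby_godement_exact[OF D(3) fl openin_topspace, of z q 0] z unfolding B by auto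
    then obtain a where "a \<in> carrier (E q)" "t = e q a" using surj[of q] by blast
    then show ?thesis using t by blast
  qed
  have 5: "\<exists>w\<in>carrier (godement_bicomplex X L p q). bi_delta X L p q w = z"
    if z: "z \<in> carrier (godement_bicomplex X L (Suc p) q)" "bi_delta X L (Suc p) q z = \<one>\<^bsub>godement_bicomplex X L (Suc (Suc p)) q\<^esub>" for p q z
    using flabby_godement_exact[OF D(3) fl openin_topspace, of z q "Suc p"] z unfolding B by simp
  have 6: "case k of 0 \<Rightarrow> a = \<one>\<^bsub>E k\<^esub> | Suc r \<Rightarrow> \<exists>c\<in>carrier (E r). ?\<epsilon> r c = \<one>\<^bsub>godement_bicomplex X L 0 r\<^esub> \<and> dE r c = a"
    if a: "a \<in> carrier (E k)" "?\<epsilon> k a = \<one>\<^bsub>godement_bicomplex X L 0 k\<^esub>" "dE k a = \<one>\<^bsub>E (Suc k)\<^esub>" for k a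
    using acyc[OF a(1,3)] a one by (auto split: nat.splits)
  note CR = cohrel_left[of E dE ?\<epsilon>, OF E 1 2 3 4 5 6]
  let ?R = "qrel E dE T D (\<lambda>k a. sing k 0 (?\<epsilon> k a)) k"
  have endo: "?R (sE c k a) (tot_endo X L (s c) k b)" if R: "?R a b" for c a b
  proof (rule qrel_endo[OF sE _ CR(1) _ R])
    show "cochain_endo T D (tot_endo X L (s c))"
      by (rule cochain_endo_total[OF pc, unfolded total_group_eq total_differential_eq, OF s]) (rule sd)
    fix a assume a: "a \<in> carrier (E k)"
    interpret sg: gmor X "L k" "L k" "s c k" by (rule s)
    have "godement_C_map X (L k) (s c k) 0 ?X (?\<epsilon> k a) = ?\<epsilon> k (sE c k a)"
      using sg.fm_germ_family[OF openin_topspace ec[OF a]] es[OF a] by (simp add: godement_C_map_def)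
    moreover have "godement_C_map X (L q) (s c q) p ?X \<one>\<^bsub>godement_bicomplex X L p q\<^esub> = \<one>\<^bsub>godement_bicomplex X L p q\<^esub>" for p q
      unfolding B by (rule gmor.mor_one[OF gmor_godement_C[OF s]]) simp
    ultimately show "tot_endo X L (s c) k (sing k 0 (?\<epsilon> k a)) = sing k 0 (?\<epsilon> k (sE c k a))"
      unfolding sing_def by (auto intro!: restrict_ext)
  qed
  show ?thesis
    by (rule that[of ?R]; (rule endo)?) (unfold total_group_eq total_differential_eq, rule CR(2))
qed

section \<open>Holomorphic functions of several variables\<close>

abbreviation Cn :: "nat \<Rightarrow> (nat \<Rightarrow> complex) set" where "Cn n \<equiv> {z. \<forall>i\<ge>n. z i = 0}"
abbreviation "cdom n D \<equiv> openin (complex_space n) D"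
abbreviation "hol \<equiv> holomorphic_on_Cn"
abbreviation "pd \<equiv> partial_deriv"

text \<open>The coordinates from \<open>n\<close> on are \<open>0\<close> rather than those of
  \<open>z\<close>, so the set always lies in \<open>Cn n\<close>, but it can contain its centre
  only if \<open>z\<close> does too.\<close>

definition polydisc :: "nat \<Rightarrow> (nat \<Rightarrow> complex) \<Rightarrow> real \<Rightarrow> (nat \<Rightarrow> complex) set" where
  "polydisc n z r = {w. (\<forall>i<n. dist (z i) (w i) < r) \<and> (\<forall>i\<ge>n. w i = 0)}"

lemma complex_space_eq: "complex_space n = top_of_set (Cn n)"
  by (simp add: complex_space_def euclidean_product_topology)

lemma topspace_complex_space: "topspace (complex_space n) = Cn n"
  by (simp add: complex_space_eq)

lemma dom_iff: "cdom n D \<longleftrightarrow> (\<exists>T. open T \<and> D = Cn n \<inter> T)"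
  by (auto simp: complex_space_eq openin_open)

lemma dom_Cn: "cdom n D \<Longrightarrow> z \<in> D \<Longrightarrow> i \<ge> n \<Longrightarrow> z i = 0"
  by (auto simp: dom_iff)

lemma open_polydisc_UNIV: "open {w::nat \<Rightarrow> complex. \<forall>i<n. dist (z i) (w i) < r}"
proof -
  have eq: "{w. \<forall>i<n. dist (z i) (w i) < r} = (\<Inter>i\<in>{..<n}. (\<lambda>w. w i) -` ball (z i) r)" by auto
  show ?thesis
    unfolding eq by (intro open_INT ballI finite_lessThan open_vimage open_ball continuous_on_product_coordinates)
qed

lemma polydisc_eq: "polydisc n z r = Cn n \<inter> {w. \<forall>i<n. dist (z i) (w i) < r}"
  by (auto simp: polydisc_def)

lemma dom_polydisc: "cdom n (polydisc n z r)"
  unfolding dom_iff polydisc_eq using open_polydisc_UNIV by blast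

lemma polydisc_center: "z \<in> Cn n \<Longrightarrow> r > 0 \<Longrightarrow> z \<in> polydisc n z r"
  by (auto simp: polydisc_def)

lemma dom_contains_polydisc:
  assumes "cdom n D" "z \<in> D"
  obtains r where "r > 0" "polydisc n z r \<subseteq> D"
proof -
  obtain T where T: "open T" "D = Cn n \<inter> T" using assms by (auto simp: dom_iff)
  have "openin (product_topology (\<lambda>i. euclidean) UNIV) T" using T by (simp add: euclidean_product_topology)
  from product_topology_open_contains_basis[OF this, of z] assms T obtain B where
    B: "z \<in> (\<Pi>\<^sub>E i\<in>UNIV. B i)" "\<And>i. open (B i)" "(\<Pi>\<^sub>E i\<in>UNIV. B i) \<subseteq> T" "finite {i. B i \<noteq> UNIV}"
    by auto
  let ?I = "{i. B i \<noteq> UNIV}"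
  have "\<exists>r>0. ball (z i) r \<subseteq> B i" for i using B(1,2) openE[of "B i" "z i"] by (metis PiE_E UNIV_I)
  then obtain r where r: "\<And>i. r i > 0" "\<And>i. ball (z i) (r i) \<subseteq> B i" by metis
  define R where "R = Min (insert 1 (r ` {..<n}))"
  have "R > 0" unfolding R_def using r by (subst Min_gr_iff) auto
  moreover have "polydisc n z R \<subseteq> D"
  proof
    fix w assume w: "w \<in> polydisc n z R"
    have "w i \<in> B i" for i
    proof (cases "i < n")
      case True
      then have "dist (z i) (w i) < R" using w by (auto simp: polydisc_def)
      also have "R \<le> r i" unfolding R_def using True by (intro Min_le) auto
      finally show ?thesis using r(2)[of i] by auto
    next
      case False
      then have "w i = z i" using w assms T by (auto simp: polydisc_def)
      then show ?thesis using B(1) by (auto simp: PiE_iff)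
    qed
    then have "w \<in> T" using B(3) by auto
    then show "w \<in> D" using w T by (auto simp: polydisc_def)
  qed
  ultimately show ?thesis using that by blast
qed

lemma polydisc_upd: "w \<in> polydisc n z r \<Longrightarrow> i < n \<Longrightarrow> dist (z i) u < r \<Longrightarrow> w(i := u) \<in> polydisc n z r"
  by (auto simp: polydisc_def)

lemma eventually_upd:
  assumes "cdom n D" "z \<in> D" "i < n"
  shows "eventually (\<lambda>w. z(i := w) \<in> D) (nhds (z i))"
proof -
  obtain r where r: "r > 0" "polydisc n z r \<subseteq> D" using dom_contains_polydisc assms by blast
  have "z \<in> polydisc n z r" using assms r dom_Cn by (intro polydisc_center) auto
  then have "\<forall>w. dist w (z i) < r \<longrightarrow> z(i := w) \<in> D"
    using r polydisc_upd[of z n z r i] assms by (auto simp: dist_commute)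
  then show ?thesis using r(1) by (auto simp: eventually_nhds_metric)
qed

lemma hol_iff:
  assumes "D \<subseteq> Cn n"
  shows "hol n D f \<longleftrightarrow> continuous_on D f \<and> (\<forall>z\<in>D. \<forall>i<n. (\<lambda>w. f (z(i := w))) field_differentiable at (z i))"
  unfolding holomorphic_on_Cn_def complex_space_eq
  using assms by (simp add: subtopology_subtopology Int_absorb1)

lemma dom_sub: "cdom n D \<Longrightarrow> D \<subseteq> Cn n" by (auto simp: dom_iff)

lemma holD:
  assumes "cdom n D" "hol n D f"
  shows "continuous_on D f"
    and "\<lbrakk>z \<in> D; i < n\<rbrakk> \<Longrightarrow> ((\<lambda>w. f (z(i := w))) has_field_derivative pd i f z) (at (z i))"
  using assms(2) unfolding hol_iff[OF dom_sub[OF assms(1)]] partial_deriv_def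
  by (auto simp: field_differentiable_derivI)

lemma holI:
  assumes "cdom n D" "continuous_on D f"
    "\<And>z i. \<lbrakk>z \<in> D; i < n\<rbrakk> \<Longrightarrow> ((\<lambda>w. f (z(i := w))) has_field_derivative f' i z) (at (z i))"
  shows "hol n D f" and "\<lbrakk>z \<in> D; i < n\<rbrakk> \<Longrightarrow> pd i f z = f' i z"
  using assms unfolding hol_iff[OF dom_sub[OF assms(1)]] partial_deriv_def field_differentiable_def
  by (auto intro: DERIV_imp_deriv)

lemma hol_subset: "hol n D f \<Longrightarrow> cdom n D \<Longrightarrow> cdom n E \<Longrightarrow> E \<subseteq> D \<Longrightarrow> hol n E f"
  using dom_sub[of n D] dom_sub[of n E] by (auto simp: hol_iff continuous_on_subset)

lemma pd_cong:
  assumes "cdom n D" "\<And>w. w \<in> D \<Longrightarrow> f w = g w" "z \<in> D" "i < n"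
  shows "pd i f z = pd i g z"
  unfolding partial_deriv_def
  by (intro deriv_cong_ev refl eventually_mono[OF eventually_upd[OF assms(1,3,4)]]) (rule assms(2))

lemma hol_cong:
  assumes D: "cdom n D" and eq: "\<And>w. w \<in> D \<Longrightarrow> f w = g w" and f: "hol n D f"
  shows "hol n D g"
proof (rule holI(1)[OF D])
  show "continuous_on D g" using holD(1)[OF D f] eq by (simp cong: continuous_on_cong)
  fix z i assume z: "z \<in> D" "i < n"
  have "eventually (\<lambda>w. f (z(i := w)) = g (z(i := w))) (nhds (z i))"
    by (rule eventually_mono[OF eventually_upd[OF D z]]) (rule eq)
  then show "((\<lambda>w. g (z(i := w))) has_field_derivative pd i f z) (at (z i))"
    using holD(2)[OF D f z] by (simp add: DERIV_cong_ev[OF refl _ refl])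
qed

lemma continuous_on_dom_local:
  assumes "D \<subseteq> Cn n" "\<And>z. z \<in> D \<Longrightarrow> \<exists>E. cdom n E \<and> z \<in> E \<and> E \<subseteq> D \<and> continuous_on E f"
  shows "continuous_on D f"
  unfolding continuous_on_eq_continuous_within
proof
  fix z assume z: "z \<in> D"
  then obtain E where E: "cdom n E" "z \<in> E" "E \<subseteq> D" "continuous_on E f" using assms(2)[OF z] by blast
  then obtain T where T: "open T" "E = Cn n \<inter> T" by (auto simp: dom_iff)
  have "at z within D = at z within E"
    by (rule at_within_nhd[of z T]) (use T E assms(1) in auto)
  moreover have "continuous (at z within E) f" using E by (simp add: continuous_on_eq_continuous_within)
  ultimately show "continuous (at z within D) f" by simp
qed

lemma hol_local:
  assumes "cdom n D" "\<And>z. z \<in> D \<Longrightarrow> \<exists>E. cdom n E \<and> z \<in> E \<and> E \<subseteq> D \<and> hol n E f"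
  shows "hol n D f"
proof (rule holI(1)[OF assms(1)])
  show "continuous_on D f"
    by (rule continuous_on_dom_local[OF dom_sub[OF assms(1)]]) (metis assms(2) holD(1))
  show "((\<lambda>w. f (z(i := w))) has_field_derivative pd i f z) (at (z i))" if "z \<in> D" "i < n" for z i
    using assms(2)[OF that(1)] holD(2) that(2) by blast
qed

lemma hol_const: "cdom n D \<Longrightarrow> hol n D (\<lambda>z. c)"
  by (rule holI(1)[where f' = "\<lambda>i z. 0"]) auto

lemma pd_const [simp]: "pd i (\<lambda>z. c) z = 0"
  by (simp add: partial_deriv_def)

lemma hol_coord: "cdom n D \<Longrightarrow> hol n D (\<lambda>z. z j)"
  by (rule holI(1)[where f' = "\<lambda>i z. if i = j then 1 else 0"])
    (auto intro: continuous_on_product_then_coordinatewise continuous_intros)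

lemma pd_coord: "pd i (\<lambda>z. z j) z = (if i = j then 1 else 0)"
  by (auto simp: partial_deriv_def)

lemma
  assumes D: "cdom n D" and f: "hol n D f" and g: "hol n D g"
  shows hol_add: "hol n D (\<lambda>z. f z + g z)"
    and pd_add: "\<lbrakk>z \<in> D; i < n\<rbrakk> \<Longrightarrow> pd i (\<lambda>z. f z + g z) z = pd i f z + pd i g z"
    and hol_mult: "hol n D (\<lambda>z. f z * g z)"
    and pd_mult: "\<lbrakk>z \<in> D; i < n\<rbrakk> \<Longrightarrow> pd i (\<lambda>z. f z * g z) z = pd i f z * g z + f z * pd i g z"
proof -
  have a: "((\<lambda>w. f (z(i := w)) + g (z(i := w))) has_field_derivative pd i f z + pd i g z) (at (z i))"
    if "z \<in> D" "i < n" for z i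
    using holD(2)[OF D f that] holD(2)[OF D g that] by (rule DERIV_add)
  have m: "((\<lambda>w. f (z(i := w)) * g (z(i := w))) has_field_derivative pd i f z * g z + f z * pd i g z) (at (z i))"
    if "z \<in> D" "i < n" for z i
    using DERIV_mult[OF holD(2)[OF D f that] holD(2)[OF D g that]] by (simp add: algebra_simps)
  have c: "continuous_on D (\<lambda>z. f z + g z)" "continuous_on D (\<lambda>z. f z * g z)"
    using holD(1)[OF D f] holD(1)[OF D g] by (auto intro: continuous_intros)
  show "hol n D (\<lambda>z. f z + g z)" "\<lbrakk>z \<in> D; i < n\<rbrakk> \<Longrightarrow> pd i (\<lambda>z. f z + g z) z = pd i f z + pd i g z"
    using holI[OF D c(1) a] by auto
  show "hol n D (\<lambda>z. f z * g z)" "\<lbrakk>z \<in> D; i < n\<rbrakk> \<Longrightarrow> pd i (\<lambda>z. f z * g z) z = pd i f z * g z + f z * pd i g z"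
    using holI[OF D c(2) m] by auto
qed

lemma
  assumes D: "cdom n D" and f: "hol n D f"
  shows hol_cmult: "hol n D (\<lambda>z. c * f z)"
    and pd_cmult: "\<lbrakk>z \<in> D; i < n\<rbrakk> \<Longrightarrow> pd i (\<lambda>z. c * f z) z = c * pd i f z"
  using hol_mult[OF D hol_const[OF D] f] pd_mult[OF D hol_const[OF D] f] by auto

lemma
  assumes D: "cdom n D" and fin: "finite S" and f: "\<And>x. x \<in> S \<Longrightarrow> hol n D (f x)"
  shows hol_sum: "hol n D (\<lambda>z. \<Sum>x\<in>S. f x z)"
    and pd_sum: "\<lbrakk>z \<in> D; i < n\<rbrakk> \<Longrightarrow> pd i (\<lambda>z. \<Sum>x\<in>S. f x z) z = (\<Sum>x\<in>S. pd i (f x) z)"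
proof -
  have "hol n D (\<lambda>z. \<Sum>x\<in>S. f x z) \<and> (z \<in> D \<longrightarrow> i < n \<longrightarrow> pd i (\<lambda>z. \<Sum>x\<in>S. f x z) z = (\<Sum>x\<in>S. pd i (f x) z))"
    using fin f by induction (auto simp: hol_const[OF D] hol_add[OF D] pd_add[OF D])
  then show "hol n D (\<lambda>z. \<Sum>x\<in>S. f x z)" "\<lbrakk>z \<in> D; i < n\<rbrakk> \<Longrightarrow> pd i (\<lambda>z. \<Sum>x\<in>S. f x z) z = (\<Sum>x\<in>S. pd i (f x) z)"
    by auto
qed

lemma hol_prod:
  assumes D: "cdom n D" and fin: "finite S" and f: "\<And>x. x \<in> S \<Longrightarrow> hol n D (f x)"
  shows "hol n D (\<lambda>z. \<Prod>x\<in>S. f x z)"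
  using fin f by induction (auto simp: hol_const[OF D] hol_mult[OF D])

section \<open>Differentiation under the integral sign and Cauchy's formula\<close>

lemma continuous_on_fun_upd:
  fixes f :: "'x::topological_space \<Rightarrow> 'i \<Rightarrow> 'y::topological_space"
  assumes "continuous_on A f" "continuous_on A g"
  shows "continuous_on A (\<lambda>x. (f x)(i := g x))"
proof (rule continuous_on_coordinatewise_then_product)
  show "continuous_on A (\<lambda>x. ((f x)(i := g x)) j)" for j
    using assms continuous_on_product_then_coordinatewise[OF assms(1)] by (cases "j = i") auto
qed

text \<open>The Leibniz rule of one complex variable, applied in each coordinate on a disc that
  keeps the point inside \<open>D\<close>. It is used for Cauchy integrals and for radial
  integrals.\<close>

lemma
  fixes g :: "(nat \<Rightarrow> complex) \<Rightarrow> real \<Rightarrow> complex"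
  assumes D: "cdom n D" and g: "continuous_on (D \<times> {0..1}) (\<lambda>(z, t). g z t)"
    and g': "\<And>i. i < n \<Longrightarrow> continuous_on (D \<times> {0..1}) (\<lambda>(z, t). g' i z t)"
    and der: "\<And>z i t. \<lbrakk>z \<in> D; i < n; t \<in> {0..1}\<rbrakk> \<Longrightarrow> ((\<lambda>w. g (z(i := w)) t) has_field_derivative g' i z t) (at (z i))"
  shows hol_integral: "hol n D (\<lambda>z. integral {0..1} (g z))"
    and pd_integral: "\<lbrakk>z \<in> D; i < n\<rbrakk> \<Longrightarrow> pd i (\<lambda>z. integral {0..1} (g z)) z = integral {0..1} (g' i z)"
proof -
  have c: "continuous_on D (\<lambda>z. integral {0..1} (g z))"
    using integral_continuous_on_param[of D 0 1 g] g by simp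
  have d: "((\<lambda>w. integral {0..1} (g (z(i := w)))) has_field_derivative integral {0..1} (g' i z)) (at (z i))"
    if z: "z \<in> D" "i < n" for z i
  proof -
    obtain r where r: "r > 0" "polydisc n z r \<subseteq> D" using dom_contains_polydisc[OF D z(1)] by blast
    have zu: "z(i := w) \<in> D" if "w \<in> ball (z i) r" for w
      using r polydisc_upd[OF polydisc_center[of z n r] z(2)] that dom_Cn[OF D z(1)] by auto
    have cu: "continuous_on (ball (z i) r \<times> {0..1::real}) (\<lambda>(w, t). (z(i := w), t))"
      unfolding case_prod_unfold
      by (intro continuous_on_Pair continuous_on_fun_upd continuous_intros)
    have "((\<lambda>w. integral (cbox 0 1) (g (z(i := w)))) has_field_derivative integral (cbox 0 1) (g' i (z(i := z i)))) (at (z i) within ball (z i) r)"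
    proof (rule leibniz_rule_field_derivative)
      fix w t assume w: "w \<in> ball (z i) r" and t: "t \<in> cbox 0 (1::real)"
      have "((\<lambda>v. g (z(i := w, i := v)) t) has_field_derivative g' i (z(i := w)) t) (at ((z(i := w)) i))"
        by (rule der) (use zu[OF w] z t in auto)
      then show "((\<lambda>v. g (z(i := v)) t) has_field_derivative g' i (z(i := w)) t) (at w within ball (z i) r)"
        by (simp add: has_field_derivative_at_within)
    next
      fix w assume w: "w \<in> ball (z i) r"
      have "continuous_on {0..1} (\<lambda>t. (\<lambda>(z, t). g z t) (z(i := w), t))"
        by (rule continuous_on_compose2[OF g]) (use zu[OF w] in \<open>auto intro!: continuous_intros\<close>)
      then show "g (z(i := w)) integrable_on cbox 0 1" by (intro integrable_continuous) simp
    next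
      have "continuous_on (ball (z i) r \<times> {0..1::real}) (\<lambda>x. (\<lambda>(z, t). g' i z t) ((\<lambda>(w, t). (z(i := w), t)) x))"
        by (rule continuous_on_compose2[OF g'[OF z(2)] cu]) (use zu in auto)
      then show "continuous_on (ball (z i) r \<times> cbox 0 1) (\<lambda>(w, t). g' i (z(i := w)) t)"
        by (simp add: case_prod_unfold)
    qed (use r in auto)
    then show ?thesis using r by (simp add: at_within_open[of "z i" "ball (z i) r"])
  qed
  show "hol n D (\<lambda>z. integral {0..1} (g z))"
    "\<lbrakk>z \<in> D; i < n\<rbrakk> \<Longrightarrow> pd i (\<lambda>z. integral {0..1} (g z)) z = integral {0..1} (g' i z)"
    using holI[OF D c d] by auto
qed

abbreviation cis1 :: "real \<Rightarrow> complex" where "cis1 t \<equiv> exp (2 * of_real pi * \<i> * of_real t)"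

text \<open>Cauchy's formula for the derivative in variable \<open>i\<close>, over the circle of
  radius \<open>r\<close> about \<open>z i\<close>. The factor 2 leaves room for this circle around
  every \<open>z\<close> of the smaller polydisc; the radius is then independent of
  \<open>z\<close>, and the integral can be differentiated in \<open>z\<close>.\<close>

lemma pd_Cauchy:
  assumes D: "cdom n D" and f: "hol n D f" and r: "r > 0" "polydisc n z0 (2 * r) \<subseteq> D"
    and z: "z \<in> polydisc n z0 r" and i: "i < n"
  shows "pd i f z = integral {0..1} (\<lambda>t. f (z(i := z i + of_real r * cis1 t)) / (of_real r * cis1 t))"
proof -
  have zu: "z(i := w) \<in> D" if "w \<in> cball (z i) r" for w
  proof -
    have "dist (z0 i) w \<le> dist (z0 i) (z i) + dist (z i) w" by (rule dist_triangle)
    moreover have "dist (z0 i) (z i) < r" using z i by (auto simp: polydisc_def)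
    ultimately have "dist (z0 i) w < 2 * r" using that by auto
    moreover have "z \<in> polydisc n z0 (2 * r)" using z r(1) by (force simp: polydisc_def)
    ultimately show ?thesis using polydisc_upd i r by blast
  qed
  define h where "h w = f (z(i := w))" for w
  have dh: "(h has_field_derivative pd i f (z(i := w))) (at w)" if "w \<in> cball (z i) r" for w
    using holD(2)[OF D f zu[OF that] i] by (simp add: h_def[abs_def])
  have hc: "continuous_on (cball (z i) r) h"
    using dh by (meson DERIV_isCont continuous_at_imp_continuous_on)
  have hh: "h holomorphic_on ball (z i) r"
    unfolding holomorphic_on_def field_differentiable_def
  proof
    fix w assume "w \<in> ball (z i) r"
    then show "\<exists>f'. (h has_field_derivative f') (at w within ball (z i) r)"
      using has_field_derivative_at_within[OF dh[of w]] by auto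
  qed
  have "(h has_field_derivative (1 / (2 * of_real pi * \<i>) * contour_integral (circlepath (z i) r) (\<lambda>u. h u / (u - z i)^2))) (at (z i))"
    using r by (intro Cauchy_derivative_integral_circlepath hc hh) simp
  then have "pd i f z = 1 / (2 * of_real pi * \<i>) * contour_integral (circlepath (z i) r) (\<lambda>u. h u / (u - z i)^2)"
    unfolding partial_deriv_def h_def by (rule DERIV_imp_deriv)
  also have "\<dots> = integral {0..1} (\<lambda>t. 1 / (2 * of_real pi * \<i>) *
      (h (circlepath (z i) r t) / (circlepath (z i) r t - z i)^2 * (2 * pi * \<i> * r * cis1 t)))"
    unfolding contour_integral_integral vector_derivative_circlepath by (rule integral_mult_right[symmetric])
  also have "\<dots> = integral {0..1} (\<lambda>t. f (z(i := z i + of_real r * cis1 t)) / (of_real r * cis1 t))"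
    using r(1) by (intro integral_cong) (simp add: circlepath h_def power2_eq_square field_simps)
  finally show ?thesis .
qed

lemma continuous_on_circle_upd:
  assumes f: "continuous_on D f" and r: "r > 0" "polydisc n z0 (2 * r) \<subseteq> D" and i: "i < n"
  shows "continuous_on (polydisc n z0 r \<times> {0..1}) (\<lambda>(z, t). f (z(i := z i + of_real r * cis1 t)) / (of_real r * cis1 t))"
proof -
  have coord: "continuous_on A (\<lambda>x. fst x j)" for A :: "((nat \<Rightarrow> complex) \<times> real) set" and j
    by (rule continuous_on_product_then_coordinatewise[OF continuous_on_fst[OF continuous_on_id]])
  have "continuous_on (polydisc n z0 r \<times> {0..1::real}) (\<lambda>x. (fst x)(i := fst x i + of_real r * cis1 (snd x)))"
    by (intro continuous_on_fun_upd continuous_intros coord)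
  moreover have "(fst x)(i := fst x i + of_real r * cis1 (snd x)) \<in> D" if x: "x \<in> polydisc n z0 r \<times> {0..1::real}" for x
  proof -
    have "dist (z0 i) (fst x i + of_real r * cis1 (snd x)) \<le> dist (z0 i) (fst x i) + dist (fst x i) (fst x i + of_real r * cis1 (snd x))"
      by (rule dist_triangle)
    moreover have "dist (fst x i) (fst x i + of_real r * cis1 (snd x)) = r"
      using r by (simp add: dist_norm norm_mult norm_exp_eq_Re)
    moreover have "dist (z0 i) (fst x i) < r" using x i by (auto simp: polydisc_def)
    ultimately have "dist (z0 i) (fst x i + of_real r * cis1 (snd x)) < 2 * r" by simp
    moreover have "fst x \<in> polydisc n z0 (2 * r)" using x r(1) by (force simp: polydisc_def)
    ultimately show ?thesis using polydisc_upd i r by blast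
  qed
  ultimately have "continuous_on (polydisc n z0 r \<times> {0..1::real}) (\<lambda>x. f ((fst x)(i := fst x i + of_real r * cis1 (snd x))))"
    by (intro continuous_on_compose2[OF f]) auto
  then show ?thesis
    unfolding case_prod_unfold using r by (intro continuous_on_divide) (auto intro!: continuous_intros)
qed

lemma dom_polydisc2:
  assumes "cdom n D" "z \<in> D"
  obtains r where "r > 0" "polydisc n z (2 * r) \<subseteq> D" "polydisc n z r \<subseteq> D" "z \<in> polydisc n z r"
proof -
  obtain r where r: "r > 0" "polydisc n z r \<subseteq> D" using dom_contains_polydisc assms by blast
  have "polydisc n z (r / 2) \<subseteq> polydisc n z r" using r by (force simp: polydisc_def)
  then show ?thesis using that[of "r / 2"] r polydisc_center[of z n "r / 2"] dom_Cn[OF assms] by auto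
qed

text \<open>Separate holomorphy says nothing about joint continuity of the partial derivatives;
  Cauchy's formula derives it from the continuity of \<open>f\<close>.\<close>

lemma pd_continuous:
  assumes D: "cdom n D" and f: "hol n D f" and i: "i < n"
  shows "continuous_on D (pd i f)"
proof (rule continuous_on_dom_local[OF dom_sub[OF D]])
  fix z0 assume "z0 \<in> D"
  then obtain r where r: "r > 0" "polydisc n z0 (2 * r) \<subseteq> D" "polydisc n z0 r \<subseteq> D" "z0 \<in> polydisc n z0 r"
    using dom_polydisc2[OF D] by metis
  have "continuous_on (polydisc n z0 r) (\<lambda>z. integral {0..1} (\<lambda>t. f (z(i := z i + of_real r * cis1 t)) / (of_real r * cis1 t)))"
    using integral_continuous_on_param[of "polydisc n z0 r" 0 1 "\<lambda>z t. f (z(i := z i + of_real r * cis1 t)) / (of_real r * cis1 t)"]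
      continuous_on_circle_upd[OF holD(1)[OF D f] r(1,2) i] by simp
  then have "continuous_on (polydisc n z0 r) (pd i f)"
    by (rule continuous_on_eq) (rule pd_Cauchy[OF D f r(1,2) _ i, symmetric])
  then show "\<exists>E. cdom n E \<and> z0 \<in> E \<and> E \<subseteq> D \<and> continuous_on E (pd i f)"
    using r dom_polydisc[of n z0 r] by (intro exI[of _ "polydisc n z0 r"]) simp
qed

text \<open>The Cauchy integral is differentiated under the integral sign. Its integrand then
  contains only first partial derivatives of \<open>f\<close>, which are already known to be
  continuous.\<close>

lemma
  assumes D: "cdom n D" and f: "hol n D f" and i: "i < n" and r: "r > 0" "polydisc n z0 (2 * r) \<subseteq> D"
  shows hol_pd_local: "hol n (polydisc n z0 r) (pd i f)"
    and pd_pd: "\<lbrakk>z \<in> polydisc n z0 r; j < n\<rbrakk> \<Longrightarrow> pd j (pd i f) z =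
      integral {0..1} (\<lambda>t. pd j f (z(i := z i + of_real r * cis1 t)) / (of_real r * cis1 t))"
proof -
    let ?P = "polydisc n z0 r"
    define G where "G z t = f (z(i := z i + of_real r * cis1 t)) / (of_real r * cis1 t)" for z t
    define G' where "G' j z t = pd j f (z(i := z i + of_real r * cis1 t)) / (of_real r * cis1 t)" for j z t
    have c: "continuous_on (?P \<times> {0..1}) (\<lambda>(z, t). G z t)"
      unfolding G_def by (rule continuous_on_circle_upd[OF holD(1)[OF D f] r i])
    have c': "continuous_on (?P \<times> {0..1}) (\<lambda>(z, t). G' j z t)" if "j < n" for j
      unfolding G'_def by (rule continuous_on_circle_upd[OF pd_continuous[OF D f that] r i])
    have der: "((\<lambda>w. G (z(j := w)) t) has_field_derivative G' j z t) (at (z j))"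
      if z: "z \<in> ?P" "j < n" "t \<in> {0..1}" for z j t
    proof -
      define c where "c = of_real r * cis1 t"
      have nc: "norm c = r" using r by (simp add: c_def norm_mult norm_exp_eq_Re)
      have c0: "c \<noteq> 0" using nc r by auto
      let ?y = "z(i := z i + c)"
      have "dist (z0 i) (z i + c) \<le> dist (z0 i) (z i) + norm c"
        using dist_triangle[of "z0 i" "z i + c" "z i"] by (simp add: dist_norm)
      then have "dist (z0 i) (z i + c) < 2 * r" using z i nc by (auto simp: polydisc_def)
      moreover have "z \<in> polydisc n z0 (2 * r)" using z r(1) by (force simp: polydisc_def)
      ultimately have y: "?y \<in> D" using polydisc_upd i r by blast
      have d: "((\<lambda>w. f (?y(j := w))) has_field_derivative pd j f ?y) (at (?y j))" by (rule holD(2)[OF D f y z(2)])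
      have "((\<lambda>w. f ((z(j := w))(i := (z(j := w)) i + c))) has_field_derivative pd j f ?y) (at (z j))"
      proof (cases "j = i")
        case True
        then have "((\<lambda>w. f (?y(i := w + c))) has_field_derivative pd j f ?y) (at (z i))"
          using d DERIV_shift[of "\<lambda>w. f (?y(i := w))" "pd j f ?y" "z i" c] by simp
        then show ?thesis using True by simp
      next
        case False
        then have "(z(j := w))(i := (z(j := w)) i + c) = ?y(j := w)" for w by auto
        then show ?thesis using d False by simp
      qed
      then show ?thesis unfolding G_def G'_def c_def[symmetric] by (rule DERIV_cdivide)
    qed
    have eq: "integral {0..1} (G z) = pd i f z" if "z \<in> ?P" for z
      unfolding G_def by (rule pd_Cauchy[OF D f r that i, symmetric])
    have "hol n ?P (pd i f)"
      by (rule hol_cong[OF dom_polydisc eq hol_integral[OF dom_polydisc c c' der]])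
    moreover have "pd j (pd i f) z = integral {0..1} (G' j z)" if "j < n" "z \<in> ?P" for j z
      using pd_cong[OF dom_polydisc eq that(2,1)] pd_integral[OF dom_polydisc c c' der that(2,1)] by simp
    ultimately show "hol n (polydisc n z0 r) (pd i f)"
      "\<lbrakk>z \<in> polydisc n z0 r; j < n\<rbrakk> \<Longrightarrow> pd j (pd i f) z =
        integral {0..1} (\<lambda>t. pd j f (z(i := z i + of_real r * cis1 t)) / (of_real r * cis1 t))"
      unfolding G'_def by auto
qed

lemma hol_pd:
  assumes D: "cdom n D" and f: "hol n D f" and i: "i < n"
  shows "hol n D (pd i f)"
proof (rule hol_local[OF D])
  fix z assume "z \<in> D"
  then obtain r where r: "r > 0" "polydisc n z (2 * r) \<subseteq> D" "polydisc n z r \<subseteq> D" "z \<in> polydisc n z r"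
    using dom_polydisc2[OF D] by metis
  then show "\<exists>E. cdom n E \<and> z \<in> E \<and> E \<subseteq> D \<and> hol n E (pd i f)"
    using dom_polydisc[of n z r] hol_pd_local[OF D f i r(1,2)] by (intro exI[of _ "polydisc n z r"]) simp
qed

text \<open>Differentiating the Cauchy integral of \<open>pd i f\<close> in direction
  \<open>j\<close> gives the Cauchy integral that represents \<open>pd i (pd j f)\<close>.\<close>

lemma pd_commute:
  assumes D: "cdom n D" and f: "hol n D f" and i: "i < n" and j: "j < n" and z: "z \<in> D"
  shows "pd j (pd i f) z = pd i (pd j f) z"
proof -
  obtain r where r: "r > 0" "polydisc n z (2 * r) \<subseteq> D" "polydisc n z r \<subseteq> D" "z \<in> polydisc n z r"
    using dom_polydisc2[OF D z] by metis
  show ?thesis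
    using pd_pd[OF D f i r(1,2,4) j] pd_Cauchy[OF D hol_pd[OF D f j] r(1,2,4) i] by simp
qed

text \<open>Only separate holomorphy is given, so the coordinates are changed one at a time.\<close>

lemma hol_curve:
  fixes \<gamma> :: "complex \<Rightarrow> nat \<Rightarrow> complex"
  assumes D: "cdom n D" and f: "hol n D f" and \<gamma>: "\<And>j. j < n \<Longrightarrow> ((\<lambda>t. \<gamma> t j) has_field_derivative \<gamma>' j) (at t0)"
    and \<gamma>0: "\<gamma> t0 \<in> D" and \<gamma>n: "\<And>t j. n \<le> j \<Longrightarrow> \<gamma> t j = 0"
  shows "((\<lambda>t. f (\<gamma> t)) has_field_derivative (\<Sum>j<n. pd j f (\<gamma> t0) * \<gamma>' j)) (at t0)"
proof -
  let ?z = "\<gamma> t0"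
  define mix where "mix m t = (\<lambda>j. if j < m then \<gamma> t j else ?z j)" for m t
  have "((\<lambda>t. f (mix m t)) has_field_derivative (\<Sum>j<m. pd j f ?z * \<gamma>' j)) (at t0)" if "m \<le> n" for m
    using that
  proof (induction m)
    case 0
    then show ?case by (simp add: mix_def)
  next
    case (Suc m)
    then have m: "m < n" by simp
    define c where "c = pd m f ?z"
    define F where "F t = f (mix (Suc m) t) - f (mix m t)" for t
    \<comment> \<open>The difference quotient in variable \<open>m\<close>, with the expected
      derivative as its value where the quotient is undefined. Its continuity at \<open>t0\<close>
      is Caratheodory's criterion for the derivative of \<open>F\<close>.\<close>
    define G where "G t = (if \<gamma> t m = ?z m then c else F t / (\<gamma> t m - ?z m))" for t
    have mS: "mix (Suc m) t = (mix m t)(m := \<gamma> t m)" for t by (auto simp: mix_def)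
    have mm: "(mix m t)(m := ?z m) = mix m t" for t by (auto simp: mix_def)
    have FG: "F t = G t * (\<gamma> t m - ?z m)" for t
      using mm[of t] by (auto simp: G_def F_def mS)
    have ev: "eventually (\<lambda>t. \<forall>j<n. dist (\<gamma> t j) (?z j) < r) (nhds t0)" if "r > 0" for r
    proof -
      have "eventually (\<lambda>t. \<forall>j\<in>{..<n}. dist (\<gamma> t j) (?z j) < r) (nhds t0)"
      proof (rule eventually_ball_finite)
        have "isCont (\<lambda>t. \<gamma> t j) t0" if "j < n" for j using \<gamma>[OF that] DERIV_isCont by blast
        then show "\<forall>j\<in>{..<n}. eventually (\<lambda>t. dist (\<gamma> t j) (?z j) < r) (nhds t0)"
          using \<open>r > 0\<close> by (auto simp: continuous_at_eps_delta eventually_nhds_metric)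
      qed simp
      then show ?thesis by (simp only: Ball_def lessThan_iff)
    qed
    have "isCont G t0"
      unfolding isCont_def tendsto_iff
    proof (intro allI impI)
      fix e :: real assume e: "e > 0"
      have "continuous_on D (pd m f)" by (rule pd_continuous[OF D f m])
      then have "\<exists>T. open T \<and> ?z \<in> T \<and> (\<forall>w\<in>D \<inter> T. dist (pd m f w) c < e / 2)"
        using e \<gamma>0 unfolding continuous_on_topological c_def
        by (drule_tac x = ?z in bspec, simp, drule_tac x = "ball (pd m f ?z) (e / 2)" in spec) (auto simp: dist_commute)
      then obtain T where T: "open T" "?z \<in> T" "\<And>w. w \<in> D \<Longrightarrow> w \<in> T \<Longrightarrow> dist (pd m f w) c < e / 2" by auto
      have "cdom n (D \<inter> T)" using D T(1) by (auto simp: dom_iff Int_assoc intro: open_Int)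
      then obtain r where r: "r > 0" "polydisc n ?z r \<subseteq> D \<inter> T"
        using dom_contains_polydisc[of n "D \<inter> T" ?z] \<gamma>0 T(2) by auto
      have "dist (G t) (G t0) < e" if t: "\<forall>j<n. dist (\<gamma> t j) (?z j) < r" for t
      proof (cases "\<gamma> t m = ?z m")
        case True
        then show ?thesis using e by (simp add: G_def)
      next
        case False
        \<comment> \<open>Subtracting the linear term leaves the derivative
          \<open>pd m f - c\<close>, small near the point by continuity of \<open>pd m f\<close>;
          the mean value inequality then bounds \<open>G t - c\<close>.\<close>
        let ?\<phi> = "\<lambda>u. f ((mix m t)(m := u)) - c * u"
        have v: "(mix m t)(m := u) \<in> polydisc n ?z r" if "u \<in> ball (?z m) r" for u
          using that t r(1) \<gamma>n m by (auto simp: mix_def polydisc_def dist_commute)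
        have "norm (?\<phi> (\<gamma> t m) - ?\<phi> (?z m)) \<le> e / 2 * norm (\<gamma> t m - ?z m)"
        proof (rule field_differentiable_bound[OF convex_ball])
          fix u assume u: "u \<in> ball (?z m) r"
          have D': "(mix m t)(m := u) \<in> D" "(mix m t)(m := u) \<in> T" using v[OF u] r by auto
          have "((\<lambda>w. f ((mix m t)(m := u, m := w))) has_field_derivative pd m f ((mix m t)(m := u))) (at (((mix m t)(m := u)) m))"
            by (rule holD(2)[OF D f D'(1) m])
          then have d1: "((\<lambda>w. f ((mix m t)(m := w))) has_field_derivative pd m f ((mix m t)(m := u))) (at u)" by simp
          show "(?\<phi> has_field_derivative pd m f ((mix m t)(m := u)) - c) (at u within ball (?z m) r)"
            by (rule has_field_derivative_at_within[OF DERIV_diff[OF d1 DERIV_cmult_Id]])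
          show "norm (pd m f ((mix m t)(m := u)) - c) \<le> e / 2" using T(3)[OF D'] by (simp add: dist_norm)
        qed (use t m r in \<open>auto simp: dist_commute\<close>)
        moreover have "?\<phi> (\<gamma> t m) - ?\<phi> (?z m) = (G t - c) * (\<gamma> t m - ?z m)"
          using FG[of t] mm[of t] by (simp add: F_def mS algebra_simps)
        ultimately have "norm (G t - c) \<le> e / 2" using False by (simp add: norm_mult)
        then show ?thesis using e by (simp add: G_def[of t0] dist_norm)
      qed
      then have "eventually (\<lambda>t. dist (G t) (G t0) < e) (nhds t0)"
        using ev[OF r(1)] by (auto elim!: eventually_mono)
      then show "eventually (\<lambda>t. dist (G t) (G t0) < e) (at t0)"
        by (rule filter_leD[OF at_within_le_nhds])
    qed
    moreover obtain h where h: "\<And>t. \<gamma> t m - ?z m = h t * (t - t0)" "isCont h t0" "h t0 = \<gamma>' m"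
      using \<gamma>[OF m] unfolding CARAT_DERIV by auto
    ultimately have "isCont (\<lambda>t. G t * h t) t0" by (intro continuous_intros)
    moreover have "F t - F t0 = G t * h t * (t - t0)" for t
      using FG[of t] FG[of t0] h(1)[of t] by simp
    moreover have "G t0 * h t0 = c * \<gamma>' m" using h by (simp add: G_def)
    ultimately have "(F has_field_derivative c * \<gamma>' m) (at t0)"
      unfolding CARAT_DERIV by (intro exI[of _ "\<lambda>t. G t * h t"]) simp
    then have "((\<lambda>t. f (mix m t) + F t) has_field_derivative (\<Sum>j<m. pd j f ?z * \<gamma>' j) + c * \<gamma>' m) (at t0)"
      using Suc by (intro DERIV_add) auto
    then show ?case by (simp add: F_def c_def)
  qed
  from this[of n] show ?thesis
  proof -
    have "mix n t = \<gamma> t" for t using \<gamma>n by (fastforce simp: mix_def)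
    then show ?thesis using \<open>n \<le> n \<Longrightarrow> ((\<lambda>t. f (mix n t)) has_field_derivative (\<Sum>j<n. pd j f ?z * \<gamma>' j)) (at t0)\<close> by simp
  qed
qed

text \<open>Composition with the curve obtained by varying one coordinate reduces the chain rule to
  \<open>hol_curve\<close>.\<close>

lemma
  assumes D: "cdom n D" and E: "cdom n E" and g: "hol n E g"
    and \<Phi>: "\<And>j. j < n \<Longrightarrow> hol n D (\<lambda>z. \<Phi> z j)" and \<Phi>E: "\<And>z. z \<in> D \<Longrightarrow> \<Phi> z \<in> E"
  shows hol_compose: "hol n D (\<lambda>z. g (\<Phi> z))"
    and pd_compose: "\<lbrakk>z \<in> D; i < n\<rbrakk> \<Longrightarrow> pd i (\<lambda>z. g (\<Phi> z)) z = (\<Sum>j<n. pd j g (\<Phi> z) * pd i (\<lambda>z. \<Phi> z j) z)"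
proof -
  have c: "continuous_on D (\<lambda>z. g (\<Phi> z))"
  proof (rule continuous_on_compose2[OF holD(1)[OF E g]])
    show "continuous_on D \<Phi>"
    proof (rule continuous_on_coordinatewise_then_product)
      fix j show "continuous_on D (\<lambda>z. \<Phi> z j)"
      proof (cases "j < n")
        case True
        then show ?thesis using holD(1)[OF D \<Phi>] by simp
      next
        case False
        then show ?thesis using dom_Cn[OF E \<Phi>E] by (simp cong: continuous_on_cong)
      qed
    qed
  qed (use \<Phi>E in auto)
  have d: "((\<lambda>w. g (\<Phi> (z(i := w)))) has_field_derivative (\<Sum>j<n. pd j g (\<Phi> z) * pd i (\<lambda>z. \<Phi> z j) z)) (at (z i))"
    if z: "z \<in> D" "i < n" for z i
  proof -
    \<comment> \<open>\<open>hol_curve\<close> wants vanishing coordinates from \<open>n\<close> on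
      for all parameters, while nothing is known about \<open>\<Phi>\<close> outside
      \<open>D\<close>; hence the cut-off, which changes nothing near \<open>z i\<close>.\<close>
    let ?\<gamma> = "\<lambda>w j. if j < n then \<Phi> (z(i := w)) j else 0"
    have e: "?\<gamma> w = \<Phi> (z(i := w))" if "z(i := w) \<in> D" for w
      using dom_Cn[OF E \<Phi>E[OF that]] by auto
    have d1: "((\<lambda>t. g (?\<gamma> t)) has_field_derivative (\<Sum>j<n. pd j g (?\<gamma> (z i)) * pd i (\<lambda>z. \<Phi> z j) z)) (at (z i))"
      by (rule hol_curve[OF E g]) (use holD(2)[OF D \<Phi> z] e[of "z i"] \<Phi>E z in auto)
    have ev: "eventually (\<lambda>w. g (?\<gamma> w) = g (\<Phi> (z(i := w)))) (nhds (z i))"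
      by (rule eventually_mono[OF eventually_upd[OF D z]]) (simp only: e)
    have "((\<lambda>w. g (\<Phi> (z(i := w)))) has_field_derivative (\<Sum>j<n. pd j g (?\<gamma> (z i)) * pd i (\<lambda>z. \<Phi> z j) z)) (at (z i))"
      by (rule iffD1[OF DERIV_cong_ev[OF refl ev refl] d1])
    then show ?thesis using e[of "z i"] z by simp
  qed
  show "hol n D (\<lambda>z. g (\<Phi> z))"
    "\<lbrakk>z \<in> D; i < n\<rbrakk> \<Longrightarrow> pd i (\<lambda>z. g (\<Phi> z)) z = (\<Sum>j<n. pd j g (\<Phi> z) * pd i (\<lambda>z. \<Phi> z j) z)"
    using holI[OF D c d] by auto
qed

text \<open>The coefficient part of the Poincare homotopy operator for the segment from
  \<open>z0\<close> to \<open>z\<close>. The weight \<open>t^m\<close> belongs to forms of degree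
  \<open>m + 1\<close>: each of the \<open>m\<close> covectors left after contraction contributes a
  factor \<open>t\<close>.\<close>

definition radial :: "(nat \<Rightarrow> complex) \<Rightarrow> nat \<Rightarrow> ((nat \<Rightarrow> complex) \<Rightarrow> complex) \<Rightarrow> (nat \<Rightarrow> complex) \<Rightarrow> complex" where
  "radial z0 m a z = integral {0..1} (\<lambda>t. of_real t ^ m * a (\<lambda>i. z0 i + of_real t * (z i - z0 i)))"

lemma polydisc_radial:
  assumes "z0 \<in> Cn n" "z \<in> polydisc n z0 r" "t \<in> {0..1}"
  shows "(\<lambda>i. z0 i + of_real t * (z i - z0 i)) \<in> polydisc n z0 r"
proof -
  have "dist (z0 i) (z0 i + of_real t * (z i - z0 i)) \<le> 1 * norm (z i - z0 i)" for i
    using assms(3) by (simp add: dist_norm norm_mult mult_left_le_one_le)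
  then have "dist (z0 i) (z0 i + of_real t * (z i - z0 i)) < r" if "i < n" for i
    using assms(2) that order.strict_trans1[of "dist (z0 i) (z0 i + of_real t * (z i - z0 i))" "norm (z i - z0 i)" r]
    by (auto simp: polydisc_def dist_norm norm_minus_commute)
  then show ?thesis using assms by (simp add: polydisc_def)
qed

lemma continuous_on_radial:
  assumes f: "continuous_on (polydisc n z0 r) f" and z0: "z0 \<in> Cn n"
  shows "continuous_on (polydisc n z0 r \<times> {0..1}) (\<lambda>(z, t). f (\<lambda>i. z0 i + of_real t * (z i - z0 i)))"
proof -
  have coord: "continuous_on A (\<lambda>x. fst x j)" for A :: "((nat \<Rightarrow> complex) \<times> real) set" and j
    by (rule continuous_on_product_then_coordinatewise[OF continuous_on_fst[OF continuous_on_id]])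
  have "continuous_on (polydisc n z0 r \<times> {0..1::real}) (\<lambda>x i. z0 i + of_real (snd x) * (fst x i - z0 i))"
    by (intro continuous_on_coordinatewise_then_product continuous_intros coord)
  then show ?thesis
    unfolding case_prod_unfold using polydisc_radial[OF z0] by (intro continuous_on_compose2[OF f]) auto
qed

lemma
  assumes z0: "z0 \<in> Cn n" and a: "hol n (polydisc n z0 r) a"
  shows hol_radial: "hol n (polydisc n z0 r) (radial z0 m a)"
    and pd_radial: "\<lbrakk>z \<in> polydisc n z0 r; i < n\<rbrakk> \<Longrightarrow> pd i (radial z0 m a) z = radial z0 (Suc m) (pd i a) z"
proof -
  let ?P = "polydisc n z0 r"
  define g where "g z t = of_real t ^ m * a (\<lambda>i. z0 i + of_real t * (z i - z0 i))" for z and t :: real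
  define g' where "g' i z t = of_real t ^ Suc m * pd i a (\<lambda>i. z0 i + of_real t * (z i - z0 i))" for i z and t :: real
  have c: "continuous_on (?P \<times> {0..1}) (\<lambda>(z, t). g z t)"
    using continuous_on_radial[OF holD(1)[OF dom_polydisc a] z0] unfolding g_def case_prod_unfold
    by (intro continuous_intros)
  have c': "continuous_on (?P \<times> {0..1}) (\<lambda>(z, t). g' i z t)" if "i < n" for i
    using continuous_on_radial[OF pd_continuous[OF dom_polydisc a that] z0] unfolding g'_def case_prod_unfold
    by (intro continuous_intros)
  have d: "((\<lambda>w. g (z(i := w)) t) has_field_derivative g' i z t) (at (z i))"
    if z: "z \<in> ?P" "i < n" "t \<in> {0..1}" for z i t
  proof -
    let ?\<gamma> = "\<lambda>w j. if j < n then z0 j + of_real t * ((z(i := w)) j - z0 j) else 0"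
    have e: "(\<lambda>j. z0 j + of_real t * ((z(i := w)) j - z0 j)) = ?\<gamma> w" for w
      using z0 z by (auto simp: polydisc_def)
    have "((\<lambda>w. a (?\<gamma> w)) has_field_derivative (\<Sum>j<n. pd j a (?\<gamma> (z i)) * (if j = i then of_real t else 0))) (at (z i))"
    proof (rule hol_curve[OF dom_polydisc a])
      show "?\<gamma> (z i) \<in> ?P" using polydisc_radial[OF z0 z(1,3)] unfolding e[symmetric] by simp
      show "((\<lambda>w. ?\<gamma> w j) has_field_derivative (if j = i then of_real t else 0)) (at (z i))" if "j < n" for j
        using that by (cases "j = i") (auto intro!: derivative_eq_intros)
    qed simp
    then have "((\<lambda>w. a (?\<gamma> w)) has_field_derivative pd i a (?\<gamma> (z i)) * of_real t) (at (z i))"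
      using z(2) by (simp add: if_distrib cong: if_cong)
    then show ?thesis
      unfolding g_def g'_def e using e[of "z i"] by (auto intro!: derivative_eq_intros simp: algebra_simps)
  qed
  have r: "radial z0 m a = (\<lambda>z. integral {0..1} (g z))" "radial z0 (Suc m) (pd i a) z = integral {0..1} (g' i z)" for i z
    by (simp_all add: radial_def[abs_def] g_def[abs_def] g'_def[abs_def])
  show "hol n ?P (radial z0 m a)"
    "\<lbrakk>z \<in> ?P; i < n\<rbrakk> \<Longrightarrow> pd i (radial z0 m a) z = radial z0 (Suc m) (pd i a) z"
    unfolding r using hol_integral[OF dom_polydisc c c' d] pd_integral[OF dom_polydisc c c' d] by auto
qed

lemma radial_sum:
  assumes "finite S" and z0: "z0 \<in> Cn n" and a: "\<And>x. x \<in> S \<Longrightarrow> continuous_on (polydisc n z0 r) (a x)"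
    and z: "z \<in> polydisc n z0 r"
  shows "radial z0 m (\<lambda>w. \<Sum>x\<in>S. a x w * c x) z = (\<Sum>x\<in>S. radial z0 m (a x) z * c x)"
proof -
  have i: "(\<lambda>t. of_real t ^ m * a x (\<lambda>i. z0 i + of_real t * (z i - z0 i))) integrable_on {0..1}" if "x \<in> S" for x
  proof (rule integrable_continuous_real)
    have "continuous_on {0..1::real} (\<lambda>t. (\<lambda>(z, t). a x (\<lambda>i. z0 i + of_real t * (z i - z0 i))) (z, t))"
      by (rule continuous_on_compose2[OF continuous_on_radial[OF a[OF that] z0]]) (use z in \<open>auto intro!: continuous_intros\<close>)
    then show "continuous_on {0..1} (\<lambda>t. of_real t ^ m * a x (\<lambda>i. z0 i + of_real t * (z i - z0 i)))"
      by (intro continuous_intros) simp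
  qed
  have "radial z0 m (\<lambda>w. \<Sum>x\<in>S. a x w * c x) z =
     integral {0..1} (\<lambda>t. \<Sum>x\<in>S. (of_real t ^ m * a x (\<lambda>i. z0 i + of_real t * (z i - z0 i))) * c x)"
    by (simp add: radial_def sum_distrib_left mult.assoc)
  also have "\<dots> = (\<Sum>x\<in>S. integral {0..1} (\<lambda>t. (of_real t ^ m * a x (\<lambda>i. z0 i + of_real t * (z i - z0 i))) * c x))"
    using assms(1) i by (intro integral_sum integrable_on_mult_left) auto
  finally show ?thesis by (simp add: radial_def integral_mult_left)
qed

text \<open>The fundamental theorem of calculus along the segment, applied to \<open>t^(m+1)\<close>
  times \<open>a\<close> for the first identity and to \<open>a\<close> itself for the
  second.\<close>

lemma radial_euler:
  assumes z0: "z0 \<in> Cn n" and a: "hol n (polydisc n z0 r) a" and z: "z \<in> polydisc n z0 r"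
  shows "(\<Sum>l<n. (z l - z0 l) * radial z0 (Suc m) (pd l a) z) + of_nat (Suc m) * radial z0 m a z = a z"
    and "(\<Sum>l<n. (z l - z0 l) * radial z0 0 (pd l a) z) = a z - a z0"
proof -
  let ?P = "polydisc n z0 r"
  let ?y = "\<lambda>t::real. \<lambda>i. z0 i + of_real t * (z i - z0 i)"
  have cont: "continuous_on {0..1} (\<lambda>t. f (?y t))" if "continuous_on ?P f" for f :: "_ \<Rightarrow> complex"
  proof -
    have "continuous_on {0..1::real} (\<lambda>t. (\<lambda>(z, t). f (\<lambda>i. z0 i + of_real t * (z i - z0 i))) (z, t))"
      by (rule continuous_on_compose2[OF continuous_on_radial[OF that z0]]) (use z in \<open>auto intro!: continuous_intros\<close>)
    then show ?thesis by simp
  qed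
  note ca = cont[OF holD(1)[OF dom_polydisc a]] and cpd = cont[OF pd_continuous[OF dom_polydisc a]]
  have d: "((\<lambda>t. a (?y t)) has_vector_derivative (\<Sum>l<n. (z l - z0 l) * pd l a (?y t))) (at t within {0..1})"
    if t: "t \<in> {0..1}" for t
  proof -
    \<comment> \<open>The segment is parametrised by a complex \<open>s\<close>, as
      \<open>hol_curve\<close> requires, and restricted to real parameters afterwards.\<close>
    let ?\<gamma> = "\<lambda>s j. if j < n then z0 j + s * (z j - z0 j) else (0::complex)"
    have e: "(\<lambda>j. z0 j + s * (z j - z0 j)) = ?\<gamma> s" for s
      using z0 z by (auto simp: polydisc_def)
    have "((\<lambda>s. a (?\<gamma> s)) has_field_derivative (\<Sum>j<n. pd j a (?\<gamma> (of_real t)) * (z j - z0 j))) (at (of_real t))"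
    proof (rule hol_curve[OF dom_polydisc a])
      show "?\<gamma> (of_real t) \<in> ?P" using polydisc_radial[OF z0 z t] unfolding e .
    qed (auto intro!: derivative_eq_intros)
    then have "((\<lambda>s. a (\<lambda>j. z0 j + s * (z j - z0 j))) has_field_derivative (\<Sum>l<n. (z l - z0 l) * pd l a (?y t))) (at (of_real t))"
      unfolding e by (simp add: mult.commute)
    then show ?thesis
      by (rule has_vector_derivative_real_field)
  qed
  have r: "(\<Sum>l<n. (z l - z0 l) * radial z0 k (pd l a) z) =
     integral {0..1} (\<lambda>t. of_real t ^ k * (\<Sum>l<n. (z l - z0 l) * pd l a (?y t)))" for k
  proof -
    have "(\<Sum>l<n. (z l - z0 l) * radial z0 k (pd l a) z) =
       (\<Sum>l<n. integral {0..1} (\<lambda>t. (z l - z0 l) * (of_real t ^ k * pd l a (?y t))))"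
      by (simp add: radial_def integral_mult_right)
    also have "\<dots> = integral {0..1} (\<lambda>t. \<Sum>l<n. (z l - z0 l) * (of_real t ^ k * pd l a (?y t)))"
      by (rule integral_sum[symmetric]) (auto intro!: integrable_continuous_real continuous_intros cpd)
    finally show ?thesis by (simp add: sum_distrib_left mult_ac)
  qed
  have cs: "continuous_on {0..1} (\<lambda>t. \<Sum>l<n. (z l - z0 l) * pd l a (?y t))"
    by (intro continuous_intros cpd) auto
  have y: "?y 1 = z" "?y 0 = z0" by auto
  have "((\<lambda>t. \<Sum>l<n. (z l - z0 l) * pd l a (?y t)) has_integral (a (?y 1) - a (?y 0))) {0..1}"
    by (rule fundamental_theorem_of_calculus[OF _ d]) auto
  then show "(\<Sum>l<n. (z l - z0 l) * radial z0 0 (pd l a) z) = a z - a z0"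
    using r[of 0] y by (simp add: integral_unique)
  have d2: "((\<lambda>t. of_real t ^ Suc m * a (?y t)) has_vector_derivative
      (of_real t ^ Suc m * (\<Sum>l<n. (z l - z0 l) * pd l a (?y t)) + of_nat (Suc m) * (of_real t ^ m * a (?y t)))) (at t within {0..1})"
    if t: "t \<in> {0..1}" for t
  proof -
    have p: "((\<lambda>t. complex_of_real t ^ Suc m) has_vector_derivative of_nat (Suc m) * of_real t ^ m) (at t within {0..1})"
      by (rule has_vector_derivative_real_field) (rule DERIV_cong[OF DERIV_power[OF DERIV_ident]], simp)
    show ?thesis using has_vector_derivative_mult[OF p d[OF t]] by (simp add: algebra_simps)
  qed
  have "((\<lambda>t. of_real t ^ Suc m * (\<Sum>l<n. (z l - z0 l) * pd l a (?y t)) + of_nat (Suc m) * (of_real t ^ m * a (?y t)))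
      has_integral (of_real 1 ^ Suc m * a (?y 1) - of_real 0 ^ Suc m * a (?y 0))) {0..1}"
    by (rule fundamental_theorem_of_calculus[OF _ d2]) auto
  then have "integral {0..1} (\<lambda>t. of_real t ^ Suc m * (\<Sum>l<n. (z l - z0 l) * pd l a (?y t)) + of_nat (Suc m) * (of_real t ^ m * a (?y t))) = a z"
    using y by (simp add: integral_unique)
  moreover have "integral {0..1} (\<lambda>t. of_real t ^ Suc m * (\<Sum>l<n. (z l - z0 l) * pd l a (?y t)) + of_nat (Suc m) * (of_real t ^ m * a (?y t))) =
      integral {0..1} (\<lambda>t. of_real t ^ Suc m * (\<Sum>l<n. (z l - z0 l) * pd l a (?y t))) + of_nat (Suc m) * radial z0 m a z"
    unfolding radial_def integral_mult_right[symmetric]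
    by (rule integral_add) (auto intro!: integrable_continuous_real continuous_intros cs ca)
  ultimately show "(\<Sum>l<n. (z l - z0 l) * radial z0 (Suc m) (pd l a) z) + of_nat (Suc m) * radial z0 m a z = a z"
    using r[of "Suc m"] by simp
qed

section \<open>Alternating forms in coordinates\<close>

text \<open>\<open>wedge_dz\<close> for component vectors in one chart. By \<open>wd_det\<close> it
  is a determinant, so Laplace expansion and row operations become available.\<close>

definition wd :: "nat list \<Rightarrow> (nat \<Rightarrow> complex) list \<Rightarrow> complex" where
  "wd I us = (\<Sum>\<sigma> | \<sigma> permutes {..<length I}. of_int (sign \<sigma>) * (\<Prod>b<length I. (us ! \<sigma> b) (I ! b)))"

definition del :: "nat \<Rightarrow> 'x list \<Rightarrow> 'x list" where
  "del b xs = take b xs @ drop (Suc b) xs"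

lemma length_del: "b < length xs \<Longrightarrow> length (del b xs) = length xs - 1"
  by (simp add: del_def)

lemma nth_del: "b < length xs \<Longrightarrow> i < length xs - 1 \<Longrightarrow> del b xs ! i = xs ! (if i < b then i else Suc i)"
  by (auto simp: del_def nth_append min_def)

lemma set_del: "set (del b xs) \<subseteq> set xs"
  unfolding del_def using set_take_subset[of b xs] set_drop_subset[of "Suc b" xs] by auto

lemma map_del: "map f (del b xs) = del b (map f xs)"
  by (simp add: del_def take_map drop_map)

lemma del_0 [simp]: "del 0 (x # xs) = xs" by (simp add: del_def)

lemma wedge_dz_eq:
  assumes "length vs = length I"
  shows "wedge_dz c I vs = wd I (map (\<lambda>v. v c) vs)"
  unfolding wedge_dz_def wd_def
proof (intro sum.cong refl arg_cong2[where f = "(*)"] prod.cong)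
  fix \<sigma> b assume "\<sigma> \<in> {\<sigma>. \<sigma> permutes {..<length I}}" "b \<in> {..<length I}"
  then have "\<sigma> b < length vs" using assms permutes_in_image[of \<sigma> "{..<length I}" b] by simp
  then show "(vs ! \<sigma> b) c (I ! b) = (map (\<lambda>v. v c) vs ! \<sigma> b) (I ! b)" by simp
qed

definition wmat :: "nat list \<Rightarrow> (nat \<Rightarrow> complex) list \<Rightarrow> complex mat" where
  "wmat I us = Matrix.mat (length I) (length I) (\<lambda>(b, j). (us ! j) (I ! b))"

lemma wmat_carrier: "wmat I us \<in> carrier_mat (length I) (length I)"
  by (simp add: wmat_def)

lemma wd_det: "wd I us = Determinant.det (wmat I us)"
  unfolding Determinant.det_def wd_def wmat_def
  by (auto simp: atLeast0LessThan permutes_in_image intro!: sum.cong prod.cong)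

lemma wmat_delete:
  assumes "b < length I" "j < length I" "length us = length I"
  shows "mat_delete (wmat I us) b j = wmat (del b I) (del j us)"
  using assms by (intro eq_matI) (auto simp: mat_delete_def wmat_def length_del nth_del)

lemma wd_row:
  assumes "b < length I" "length us = length I"
  shows "wd I us = (\<Sum>j<length I. (us ! j) (I ! b) * ((-1) ^ (b + j) * wd (del b I) (del j us)))"
  unfolding wd_det laplace_expansion_row[OF wmat_carrier assms(1)]
  using assms by (intro sum.cong) (auto simp: cofactor_def wmat_delete, simp add: wmat_def)

lemma wd_col:
  assumes "j < length I" "length us = length I"
  shows "wd I us = (\<Sum>b<length I. (us ! j) (I ! b) * ((-1) ^ (b + j) * wd (del b I) (del j us)))"
  unfolding wd_det laplace_expansion_column[OF wmat_carrier assms(1)]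
  using assms by (intro sum.cong) (auto simp: cofactor_def wmat_delete, simp add: wmat_def)

lemma wd_Cons_row:
  assumes "length us = Suc (length I)"
  shows "wd (l # I) us = (\<Sum>b<Suc (length I). (-1) ^ b * ((us ! b) l * wd I (del b us)))"
  using wd_row[of 0 "l # I" us] assms by (simp add: mult_ac)

lemma wd_Cons_col:
  assumes "length I = Suc (length us)"
  shows "wd I (v # us) = (\<Sum>b<length I. (-1) ^ b * (v (I ! b) * wd (del b I) us))"
  using wd_col[of 0 I "v # us"] assms by (simp add: mult_ac)

lemma wd_move:
  assumes "b < length I" "length us = length I"
  shows "wd (I ! b # del b I) us = (-1) ^ b * wd I us"
proof -
  have l: "Suc (length (del b I)) = length I" using assms by (simp add: length_del)
  have s: "(-1::complex) ^ b * (-1) ^ b = 1" by (simp flip: power_add mult_2)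
  have "wd (I ! b # del b I) us = (\<Sum>j<length I. (-1) ^ j * ((us ! j) (I ! b) * wd (del b I) (del j us)))"
    using wd_Cons_row[of us "del b I" "I ! b"] assms l by simp
  also have "\<dots> = (-1) ^ b * wd I us"
    unfolding wd_row[OF assms] sum_distrib_left
  proof (intro sum.cong refl)
    fix j
    have "(-1::complex) ^ b * (-1) ^ (b + j) = (-1) ^ j"
      by (simp add: power_add s mult.assoc[symmetric])
    then show "(-1) ^ j * ((us ! j) (I ! b) * wd (del b I) (del j us)) =
        (-1) ^ b * ((us ! j) (I ! b) * ((-1) ^ (b + j) * wd (del b I) (del j us)))"
      by (metis mult.assoc mult.left_commute)
  qed
  finally show ?thesis .
qed

lemma wd_identical:
  assumes "\<not> distinct I"
  shows "wd I us = 0"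
proof -
  obtain i j where ij: "i < length I" "j < length I" "i \<noteq> j" "I ! i = I ! j"
    using assms by (auto simp: distinct_conv_nth)
  then show ?thesis unfolding wd_det
    by (intro det_identical_rows[OF wmat_carrier, of i j]) (auto simp: wmat_def intro!: eq_vecI)
qed

lemma wd_swap:
  assumes "i < length I" "j < length I" "i \<noteq> j"
  shows "wd (I[i := I ! j, j := I ! i]) us = - wd I us"
proof -
  have "wmat (I[i := I ! j, j := I ! i]) us = swaprows i j (wmat I us)"
    using assms by (intro eq_matI) (auto simp: wmat_def nth_list_update)
  then show ?thesis using det_swaprows[OF assms wmat_carrier] by (simp add: wd_det)
qed

lemma wd_mset:
  assumes "mset L = mset I"
  obtains e :: complex where "\<And>us. wd L us = e * wd I us"
proof -
  obtain p where p: "p permutes {..<length I}" "permute_list p I = L"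
    using mset_eq_permutation[OF assms] by blast
  have l: "length L = length I" using p by auto
  have "wd L us = of_int (sign p) * wd I us" for us
  proof -
    have "wmat L us = Matrix.mat (length I) (length I) (\<lambda>(i, j). wmat I us $$ (p i, j))"
    proof (rule eq_matI)
      fix i j assume "i < dim_row (Matrix.mat (length I) (length I) (\<lambda>(i, j). wmat I us $$ (p i, j)))"
        "j < dim_col (Matrix.mat (length I) (length I) (\<lambda>(i, j). wmat I us $$ (p i, j)))"
      then have ij: "i < length I" "j < length I" by auto
      have "p i < length I" using permutes_in_image[OF p(1), of i] ij by simp
      then show "wmat L us $$ (i, j) = Matrix.mat (length I) (length I) (\<lambda>(i, j). wmat I us $$ (p i, j)) $$ (i, j)"
        using ij l permute_list_nth[OF p(1) ij(1)] p(2) by (simp add: wmat_def)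
    qed (simp_all add: wmat_def l)
    then show ?thesis
      using det_permute_rows[OF wmat_carrier[of I us], of p] p(1) by (simp add: wd_det atLeast0LessThan)
  qed
  then show ?thesis using that by blast
qed

section \<open>Expansions over increasing multi-indices and the exterior derivative\<close>

abbreviation "MI \<equiv> multi_indices"

lemma finite_MI: "finite (MI n k)"
  by (rule finite_subset[OF _ finite_lists_length_eq[of "{..<n}" k]]) (auto simp: multi_indices_def)

lemma MI_length: "I \<in> MI n k \<Longrightarrow> length I = k" and MI_set: "I \<in> MI n k \<Longrightarrow> set I \<subseteq> {..<n}"
  by (auto simp: multi_indices_def)

definition Lists :: "nat \<Rightarrow> nat \<Rightarrow> (nat \<Rightarrow> complex) list set" where
  "Lists n k = {us. length us = k \<and> set us \<subseteq> Cn n}"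

lemma Lists_del: "us \<in> Lists n (Suc k) \<Longrightarrow> b < Suc k \<Longrightarrow> del b us \<in> Lists n k"
  unfolding Lists_def using set_del[of b us] by (auto simp: length_del)

definition expn :: "nat \<Rightarrow> nat \<Rightarrow> (nat \<Rightarrow> complex) set \<Rightarrow> ((nat \<Rightarrow> complex) \<Rightarrow> (nat \<Rightarrow> complex) list \<Rightarrow> complex)
    \<Rightarrow> (nat list \<Rightarrow> (nat \<Rightarrow> complex) \<Rightarrow> complex) \<Rightarrow> bool" where
  "expn n k D f a \<longleftrightarrow> (\<forall>I\<in>MI n k. hol n D (a I)) \<and>
     (\<forall>z\<in>D. \<forall>us\<in>Lists n k. f z us = (\<Sum>I\<in>MI n k. a I z * wd I us))"

text \<open>Lists with a repeated index contribute 0; the others are sorted at the cost of a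
  constant factor \<open>e x\<close>, and equal sorted lists are collected. Derivatives, pullbacks
  and the homotopy operator produce such unsorted sums.\<close>

lemma expn_exists:
  assumes D: "cdom n D" and S: "finite S" and g: "\<And>x. x \<in> S \<Longrightarrow> hol n D (g x)"
    and L: "\<And>x. x \<in> S \<Longrightarrow> length (L x) = k \<and> set (L x) \<subseteq> {..<n}"
    and f: "\<And>z us. \<lbrakk>z \<in> D; us \<in> Lists n k\<rbrakk> \<Longrightarrow> f z us = (\<Sum>x\<in>S. g x z * wd (L x) us)"
  shows "\<exists>a. expn n k D f a"
proof -
  have "\<exists>e. \<forall>us. wd (L x) us = e * wd (sort (L x)) us" for x
    using wd_mset[of "L x" "sort (L x)"] by (metis mset_sort)
  then obtain e where e: "\<And>x us. wd (L x) us = e x * wd (sort (L x)) us" by metis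
  define S' where "S' = {x\<in>S. distinct (L x)}"
  have S': "finite S'" "S' \<subseteq> S" using S by (auto simp: S'_def)
  define a where "a I z = (\<Sum>x | x \<in> S' \<and> sort (L x) = I. e x * g x z)" for I z
  have "hol n D (a I)" for I
    unfolding a_def using S' g by (intro hol_sum[OF D] hol_cmult[OF D]) auto
  moreover have "f z us = (\<Sum>I\<in>MI n k. a I z * wd I us)" if z: "z \<in> D" "us \<in> Lists n k" for z us
  proof -
    have "f z us = (\<Sum>x\<in>S'. g x z * wd (L x) us)"
      unfolding f[OF z] using S by (intro sum.mono_neutral_right) (auto simp: S'_def wd_identical)
    also have "\<dots> = (\<Sum>x\<in>S'. e x * g x z * wd (sort (L x)) us)"
      by (intro sum.cong) (simp_all add: e mult_ac)
    also have "\<dots> = (\<Sum>I\<in>MI n k. \<Sum>x | x \<in> S' \<and> sort (L x) = I. e x * g x z * wd (sort (L x)) us)"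
    proof (rule sum.group[symmetric, OF S'(1) finite_MI])
      show "(\<lambda>x. sort (L x)) ` S' \<subseteq> MI n k"
        using L[THEN conjunct1] L[THEN conjunct2, THEN subsetD] by (auto simp: S'_def multi_indices_def strict_sorted_iff)
    qed
    also have "\<dots> = (\<Sum>I\<in>MI n k. a I z * wd I us)"
      unfolding a_def sum_distrib_right by (intro sum.cong) auto
    finally show ?thesis .
  qed
  ultimately show ?thesis unfolding expn_def by blast
qed

text \<open>The exterior derivative without reference to an expansion, hence independent of it.\<close>

definition Dd :: "nat \<Rightarrow> ((nat \<Rightarrow> complex) \<Rightarrow> (nat \<Rightarrow> complex) list \<Rightarrow> complex) \<Rightarrow> (nat \<Rightarrow> complex) \<Rightarrow> (nat \<Rightarrow> complex) list \<Rightarrow> complex"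
  where "Dd n f z us = (\<Sum>b<length us. (-1) ^ b * (\<Sum>l<n. (us ! b) l * pd l (\<lambda>z. f z (del b us)) z))"

lemma Dd_cong:
  assumes D: "cdom n D" and eq: "\<And>w vs. \<lbrakk>w \<in> D; vs \<in> Lists n k\<rbrakk> \<Longrightarrow> f w vs = g w vs"
    and z: "z \<in> D" "us \<in> Lists n (Suc k)"
  shows "Dd n f z us = Dd n g z us"
  unfolding Dd_def
proof (intro sum.cong refl arg_cong2[where f = "(*)"])
  fix b l assume "b \<in> {..<length us}" "l \<in> {..<n}"
  then have "del b us \<in> Lists n k" "l < n" using z Lists_del by (auto simp: Lists_def)
  then show "pd l (\<lambda>z. f z (del b us)) z = pd l (\<lambda>z. g z (del b us)) z"
    using pd_cong[OF D eq z(1)] by simp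
qed

text \<open>The alternating sum over the omitted vector is the Laplace expansion of
  \<open>wd (l # L x)\<close> along its first row. The lists may be arbitrary, so that the formula
  also serves for forms not yet brought to sorted shape.\<close>

lemma Dd_sum:
  assumes D: "cdom n D" and S: "finite S" and g: "\<And>x. x \<in> S \<Longrightarrow> hol n D (g x)"
    and L: "\<And>x. x \<in> S \<Longrightarrow> length (L x) = k"
    and f: "\<And>z us. \<lbrakk>z \<in> D; us \<in> Lists n k\<rbrakk> \<Longrightarrow> f z us = (\<Sum>x\<in>S. g x z * wd (L x) us)"
    and z: "z \<in> D" "us \<in> Lists n (Suc k)"
  shows "Dd n f z us = (\<Sum>x\<in>S. \<Sum>l<n. pd l (g x) z * wd (l # L x) us)"
proof -
  have len: "length us = Suc k" using z by (simp add: Lists_def)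
  have "pd l (\<lambda>z. f z (del b us)) z = (\<Sum>x\<in>S. pd l (g x) z * wd (L x) (del b us))" if "b < Suc k" "l < n" for b l
  proof -
    have "pd l (\<lambda>z. f z (del b us)) z = pd l (\<lambda>z. \<Sum>x\<in>S. wd (L x) (del b us) * g x z) z"
      using f Lists_del[OF z(2) that(1)] that(2) z(1) by (intro pd_cong[OF D]) (auto simp: mult_ac)
    also have "\<dots> = (\<Sum>x\<in>S. pd l (\<lambda>z. wd (L x) (del b us) * g x z) z)"
      using g that z(1) by (intro pd_sum[OF D S] hol_cmult[OF D]) auto
    also have "\<dots> = (\<Sum>x\<in>S. pd l (g x) z * wd (L x) (del b us))"
      using g that z(1) by (intro sum.cong refl) (simp add: pd_cmult[OF D])
    finally show ?thesis .
  qed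
  then have "Dd n f z us = (\<Sum>b<Suc k. \<Sum>l<n. \<Sum>x\<in>S. pd l (g x) z * ((-1) ^ b * ((us ! b) l * wd (L x) (del b us))))"
    unfolding Dd_def len by (intro sum.cong) (auto simp: sum_distrib_left mult_ac)
  also have "\<dots> = (\<Sum>l<n. \<Sum>b<Suc k. \<Sum>x\<in>S. pd l (g x) z * ((-1) ^ b * ((us ! b) l * wd (L x) (del b us))))"
    by (rule sum.swap)
  also have "\<dots> = (\<Sum>l<n. \<Sum>x\<in>S. \<Sum>b<Suc k. pd l (g x) z * ((-1) ^ b * ((us ! b) l * wd (L x) (del b us))))"
    by (intro sum.cong refl) (rule sum.swap)
  also have "\<dots> = (\<Sum>x\<in>S. \<Sum>l<n. \<Sum>b<Suc k. pd l (g x) z * ((-1) ^ b * ((us ! b) l * wd (L x) (del b us))))"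
    by (rule sum.swap)
  also have "\<dots> = (\<Sum>x\<in>S. \<Sum>l<n. pd l (g x) z * wd (l # L x) us)"
    using L len by (intro sum.cong) (simp_all add: wd_Cons_row sum_distrib_left del: sum.lessThan_Suc)
  finally show ?thesis .
qed

lemma Dd_expn:
  assumes D: "cdom n D" and f: "expn n k D f a" and z: "z \<in> D" "us \<in> Lists n (Suc k)"
  shows "Dd n f z us = (\<Sum>I\<in>MI n k. \<Sum>l<n. pd l (a I) z * wd (l # I) us)"
  using f z by (intro Dd_sum[OF D finite_MI]) (auto simp: expn_def MI_length)

lemma expn_Dd:
  assumes D: "cdom n D" and f: "expn n k D f a"
  shows "\<exists>b. expn n (Suc k) D (Dd n f) b"
proof (rule expn_exists[OF D, of "MI n k \<times> {..<n}" "\<lambda>(I, l). pd l (a I)" "\<lambda>(I, l). l # I"])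
  show "Dd n f z us = (\<Sum>x\<in>MI n k \<times> {..<n}. (case x of (I, l) \<Rightarrow> pd l (a I)) z * wd (case x of (I, l) \<Rightarrow> l # I) us)"
    if "z \<in> D" "us \<in> Lists n (Suc k)" for z us
    unfolding Dd_expn[OF D f that] sum.cartesian_product by (simp add: case_prod_unfold)
qed (use f MI_length MI_set[THEN subsetD] in \<open>auto simp: expn_def finite_MI intro: hol_pd[OF D]\<close>)

lemma sum_antisym_zero:
  fixes h :: "'i \<Rightarrow> 'i \<Rightarrow> complex"
  assumes "\<And>i j. \<lbrakk>i \<in> A; j \<in> A\<rbrakk> \<Longrightarrow> h i j = - h j i"
  shows "(\<Sum>i\<in>A. \<Sum>j\<in>A. h i j) = 0"
proof -
  have "(\<Sum>i\<in>A. \<Sum>j\<in>A. h i j) = (\<Sum>i\<in>A. \<Sum>j\<in>A. - h j i)"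
    by (intro sum.cong refl) (rule assms)
  also have "\<dots> = - (\<Sum>i\<in>A. \<Sum>j\<in>A. h i j)" by (subst sum.swap) (simp add: sum_negf)
  finally show ?thesis by simp
qed

text \<open>Second partial derivatives are symmetric in the two new indices, \<open>wd\<close> is
  antisymmetric.\<close>

lemma Dd_Dd:
  assumes D: "cdom n D" and f: "expn n k D f a" and z: "z \<in> D" "us \<in> Lists n (Suc (Suc k))"
  shows "Dd n (Dd n f) z us = 0"
proof -
  have a: "hol n D (a I)" if "I \<in> MI n k" for I using f that by (simp add: expn_def)
  have "Dd n (Dd n f) z us = (\<Sum>x\<in>MI n k \<times> {..<n}. \<Sum>l<n. pd l ((case x of (I, l) \<Rightarrow> pd l (a I))) z * wd (l # (case x of (I, l) \<Rightarrow> l # I)) us)"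
  proof (rule Dd_sum[OF D _ _ _ _ z])
    show "Dd n f z us = (\<Sum>x\<in>MI n k \<times> {..<n}. (case x of (I, l) \<Rightarrow> pd l (a I)) z * wd (case x of (I, l) \<Rightarrow> l # I) us)"
      if "z \<in> D" "us \<in> Lists n (Suc k)" for z us
      unfolding Dd_expn[OF D f that] sum.cartesian_product by (simp add: case_prod_unfold)
  qed (use a MI_length in \<open>auto simp: finite_MI intro: hol_pd[OF D]\<close>)
  also have "\<dots> = (\<Sum>I\<in>MI n k. \<Sum>j<n. \<Sum>l<n. pd l (pd j (a I)) z * wd (l # j # I) us)"
    by (simp add: sum.cartesian_product')
  also have "\<dots> = 0"
  proof (rule sum.neutral, rule ballI, rule sum_antisym_zero)
    fix I j l assume I: "I \<in> MI n k" and j: "j \<in> {..<n}" and l: "l \<in> {..<n}"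
    have "pd l (pd j (a I)) z = pd j (pd l (a I)) z" using pd_commute[OF D a[OF I] _ _ z(1)] j l by simp
    moreover have "wd (l # j # I) us = - wd (j # l # I) us"
      using wd_swap[of 0 "j # l # I" 1 us] by simp
    ultimately show "pd l (pd j (a I)) z * wd (l # j # I) us = - (pd j (pd l (a I)) z * wd (j # l # I) us)" by simp
  qed
  finally show ?thesis .
qed

subsection \<open>Change of coordinates\<close>

definition Jac :: "nat \<Rightarrow> ((nat \<Rightarrow> complex) \<Rightarrow> nat \<Rightarrow> complex) \<Rightarrow> (nat \<Rightarrow> complex) \<Rightarrow> (nat \<Rightarrow> complex) \<Rightarrow> nat \<Rightarrow> complex" where
  "Jac n \<Phi> z u = (\<lambda>i. if i < n then \<Sum>l<n. pd l (\<lambda>z. \<Phi> z i) z * u l else 0)"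

lemma Jac_Cn: "Jac n \<Phi> z u \<in> Cn n"
  by (simp add: Jac_def)

lemma Jac_ge [simp]: "n \<le> i \<Longrightarrow> Jac n \<Phi> z u i = 0"
  by (simp add: Jac_def)

lemma Lists_Jac: "us \<in> Lists n k \<Longrightarrow> map (Jac n \<Phi> z) us \<in> Lists n k"
  using Jac_Cn by (auto simp: Lists_def)

text \<open>Multilinearity in the rows: \<open>g\<close> records which coordinate is picked in each
  factor. The resulting index lists are in general neither sorted nor distinct; sorting them is left
  to \<open>expn_exists\<close>.\<close>

lemma wd_map_Jac:
  assumes "length us = length I" "set I \<subseteq> {..<n}"
  shows "wd I (map (Jac n \<Phi> z) us) = (\<Sum>g\<in>{..<length I} \<rightarrow>\<^sub>E {..<n}.
     (\<Prod>b<length I. pd (g b) (\<lambda>z. \<Phi> z (I ! b)) z) * wd (map g [0..<length I]) us)"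
proof -
  let ?k = "length I"
  let ?A = "\<lambda>b l. pd l (\<lambda>z. \<Phi> z (I ! b)) z"
  let ?G = "{..<?k} \<rightarrow>\<^sub>E {..<n}"
  have e: "(map (Jac n \<Phi> z) us ! \<sigma> b) (I ! b) = (\<Sum>l<n. ?A b l * (us ! \<sigma> b) l)"
    if "\<sigma> permutes {..<?k}" "b < ?k" for \<sigma> b
  proof -
    have "\<sigma> b < length us" using that permutes_in_image[OF that(1), of b] assms by simp
    moreover have "I ! b < n" using that(2) assms(2) nth_mem by blast
    ultimately show ?thesis by (simp add: Jac_def)
  qed
  have "wd I (map (Jac n \<Phi> z) us) = (\<Sum>\<sigma> | \<sigma> permutes {..<?k}. of_int (sign \<sigma>) * (\<Prod>b<?k. \<Sum>l<n. ?A b l * (us ! \<sigma> b) l))"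
    unfolding wd_def by (intro sum.cong refl arg_cong2[where f = "(*)"] prod.cong) (simp add: e)
  also have "\<dots> = (\<Sum>\<sigma> | \<sigma> permutes {..<?k}. \<Sum>g\<in>?G. (\<Prod>b<?k. ?A b (g b)) * (of_int (sign \<sigma>) * (\<Prod>b<?k. (us ! \<sigma> b) (g b))))"
    by (intro sum.cong refl) (simp add: prod_sum_PiE sum_distrib_left prod.distrib mult_ac)
  also have "\<dots> = (\<Sum>g\<in>?G. (\<Prod>b<?k. ?A b (g b)) * (\<Sum>\<sigma> | \<sigma> permutes {..<?k}. of_int (sign \<sigma>) * (\<Prod>b<?k. (us ! \<sigma> b) (g b))))"
    unfolding sum_distrib_left by (rule sum.swap)
  also have "\<dots> = (\<Sum>g\<in>?G. (\<Prod>b<?k. ?A b (g b)) * wd (map g [0..<?k]) us)"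
    unfolding wd_def by (intro sum.cong refl arg_cong2[where f = "(*)"]) auto
  finally show ?thesis .
qed

lemma sum_rotate: "(\<Sum>x\<in>A. \<Sum>y\<in>B. \<Sum>z\<in>C. h x y z) = (\<Sum>z\<in>C. \<Sum>x\<in>A. \<Sum>y\<in>B. h x y z)"
  by (subst sum.swap[of _ C B], rule sum.swap)

lemma pd_prod:
  assumes D: "cdom n D" and S: "finite S" and F: "\<And>b. b \<in> S \<Longrightarrow> hol n D (F b)" and z: "z \<in> D" "i < n"
  shows "pd i (\<lambda>z. \<Prod>b\<in>S. F b z) z = (\<Sum>b\<in>S. pd i (F b) z * (\<Prod>c\<in>S - {b}. F c z))"
  using S F
proof induction
  case (insert x S)
  have "(\<Sum>b\<in>S. pd i (F b) z * (\<Prod>c\<in>insert x S - {b}. F c z)) = F x z * (\<Sum>b\<in>S. pd i (F b) z * (\<Prod>c\<in>S - {b}. F c z))"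
    unfolding sum_distrib_left
  proof (intro sum.cong refl)
    fix b assume "b \<in> S"
    then have "insert x S - {b} = insert x (S - {b})" using insert by auto
    then show "pd i (F b) z * (\<Prod>c\<in>insert x S - {b}. F c z) = F x z * (pd i (F b) z * (\<Prod>c\<in>S - {b}. F c z))"
      using insert by simp
  qed
  moreover have "pd i (\<lambda>z. \<Prod>b\<in>insert x S. F b z) z = pd i (\<lambda>z. F x z * (\<Prod>b\<in>S. F b z)) z"
    using insert by simp
  ultimately show ?case
    using insert pd_mult[OF D _ hol_prod[OF D insert(1)] z, of "F x" F] by simp
qed simp

definition pull :: "nat \<Rightarrow> ((nat \<Rightarrow> complex) \<Rightarrow> nat \<Rightarrow> complex) \<Rightarrow> ((nat \<Rightarrow> complex) \<Rightarrow> (nat \<Rightarrow> complex) list \<Rightarrow> complex) \<Rightarrow>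
    (nat \<Rightarrow> complex) \<Rightarrow> (nat \<Rightarrow> complex) list \<Rightarrow> complex" where
  "pull n \<Phi> f z us = f (\<Phi> z) (map (Jac n \<Phi> z) us)"

text \<open>The derivative of a pulled-back coefficient has two kinds of terms. Those with second
  derivatives of \<open>\<Phi>\<close> cancel (\<open>zero\<close>); the others reassemble by the
  chain rule into the pullback of \<open>Dd n f\<close> (\<open>first\<close>).\<close>

lemma
  assumes D: "cdom n D" and E: "cdom n E" and f: "expn n k E f a"
    and \<Phi>: "\<And>j. j < n \<Longrightarrow> hol n D (\<lambda>z. \<Phi> z j)" and \<Phi>E: "\<And>z. z \<in> D \<Longrightarrow> \<Phi> z \<in> E"
  shows expn_pull: "\<exists>b. expn n k D (pull n \<Phi> f) b"
    and Dd_pull: "\<lbrakk>z \<in> D; us \<in> Lists n (Suc k)\<rbrakk> \<Longrightarrow> Dd n (pull n \<Phi> f) z us = pull n \<Phi> (Dd n f) z us"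
proof -
  let ?G = "{..<k} \<rightarrow>\<^sub>E {..<n}"
  let ?S = "MI n k \<times> ?G"
  let ?P = "\<lambda>I g z. \<Prod>b<k. pd (g b) (\<lambda>z. \<Phi> z (I ! b)) z"
  let ?c = "\<lambda>(I, g) z. a I (\<Phi> z) * ?P I g z"
  let ?L = "\<lambda>(I, g). map g [0..<k]"
  have fin: "finite ?G" "finite ?S" by (auto simp: finite_MI intro!: finite_PiE)
  have a: "hol n E (a I)" if "I \<in> MI n k" for I using f that by (simp add: expn_def)
  have Ib: "I ! b < n" if "I \<in> MI n k" "b < k" for I b
    using MI_set[OF that(1)] MI_length[OF that(1)] that(2) nth_mem by blast
  have gb: "g b < n" if "g \<in> ?G" "b < k" for g b using that by (auto simp: PiE_iff)
  have hA: "hol n D (pd l (\<lambda>z. \<Phi> z (I ! b)))" if "I \<in> MI n k" "b < k" "l < n" for I b l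
    using hol_pd[OF D \<Phi>[OF Ib[OF that(1,2)]] that(3)] .
  have hP: "hol n D (?P I g)" if "I \<in> MI n k" "g \<in> ?G" for I g
    using that by (intro hol_prod[OF D] hA) (auto intro: gb)
  have ha: "hol n D (\<lambda>z. a I (\<Phi> z))" if "I \<in> MI n k" for I
    by (rule hol_compose[OF D E a[OF that] \<Phi> \<Phi>E])
  have hc: "hol n D (?c x)" if "x \<in> ?S" for x
    using that by (auto intro!: hol_mult[OF D] ha hP)
  have L: "length (?L x) = k \<and> set (?L x) \<subseteq> {..<n}" if "x \<in> ?S" for x
  proof -
    have "x = (fst x, snd x)" "snd x \<in> ?G" using that by (simp_all add: mem_Times_iff)
    then obtain I g where "x = (I, g)" "g \<in> ?G" by metis
    then show ?thesis using gb[of g] by auto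
  qed
  have pf: "pull n \<Phi> f z us = (\<Sum>x\<in>?S. ?c x z * wd (?L x) us)" if "z \<in> D" "us \<in> Lists n k" for z us
  proof -
    have "wd I (map (Jac n \<Phi> z) us) = (\<Sum>g\<in>?G. ?P I g z * wd (map g [0..<k]) us)" if "I \<in> MI n k" for I
      using wd_map_Jac[of us I n \<Phi> z] MI_length[OF that] MI_set[OF that] \<open>us \<in> Lists n k\<close> by (simp add: Lists_def)
    then show ?thesis
      using f that \<Phi>E Lists_Jac[OF that(2)] unfolding pull_def expn_def
      by (simp add: sum.cartesian_product' sum_distrib_left mult.assoc)
  qed
  show "\<exists>b. expn n k D (pull n \<Phi> f) b"
    by (rule expn_exists[OF D fin(2) hc L pf])
  show "Dd n (pull n \<Phi> f) z us = pull n \<Phi> (Dd n f) z us" if z: "z \<in> D" and us: "us \<in> Lists n (Suc k)"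
  proof -
    have lus: "length us = Suc k" using us by (simp add: Lists_def)
    let ?A = "\<lambda>I b l. pd l (\<lambda>z. \<Phi> z (I ! b)) z"
    have pdc: "pd l (?c (I, g)) z = (\<Sum>m<n. pd m (a I) (\<Phi> z) * pd l (\<lambda>z. \<Phi> z m) z) * ?P I g z +
       a I (\<Phi> z) * (\<Sum>b<k. pd l (pd (g b) (\<lambda>z. \<Phi> z (I ! b))) z * (\<Prod>c\<in>{..<k} - {b}. ?A I c (g c)))"
      if "I \<in> MI n k" "g \<in> ?G" "l < n" for I g l
    proof -
      have "pd l (\<lambda>z. a I (\<Phi> z) * ?P I g z) z = pd l (\<lambda>z. a I (\<Phi> z)) z * ?P I g z + a I (\<Phi> z) * pd l (?P I g) z"
        by (rule pd_mult[OF D ha[OF that(1)] hP[OF that(1,2)] z that(3)])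
      moreover have "pd l (?P I g) z = (\<Sum>b<k. pd l (pd (g b) (\<lambda>z. \<Phi> z (I ! b))) z * (\<Prod>c\<in>{..<k} - {b}. ?A I c (g c)))"
        using that gb by (intro pd_prod[OF D _ _ z that(3)]) (auto intro: hA)
      ultimately show ?thesis using pd_compose[OF D E a[OF that(1)] \<Phi> \<Phi>E z that(3)] by simp
    qed
    have zero: "(\<Sum>g\<in>?G. \<Sum>l<n. pd l (pd (g b) (\<lambda>z. \<Phi> z (I ! b))) z * (\<Prod>c\<in>{..<k} - {b}. ?A I c (g c)) * wd (l # map g [0..<k]) us) = 0"
      if I: "I \<in> MI n k" and b: "b < k" for I b
    proof -
      let ?h = "\<lambda>(g, l). pd l (pd (g b) (\<lambda>z. \<Phi> z (I ! b))) z * (\<Prod>c\<in>{..<k} - {b}. ?A I c (g c)) * wd (l # map g [0..<k]) us"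
      \<comment> \<open>The involution exchanging \<open>l\<close> with the value of
        \<open>g\<close> at \<open>b\<close>. Under it the second derivative is symmetric and
        \<open>wd\<close> changes sign, while the product avoids \<open>b\<close>; so the sum equals
        its own negative.\<close>
      let ?T = "\<lambda>(g, l). (g(b := l), g b)"
      have "g(b := l) \<in> ?G" if "g \<in> ?G" "l < n" for g l
        using that b by (auto simp: PiE_def Pi_def extensional_def)
      then have "?T ` (?G \<times> {..<n}) \<subseteq> ?G \<times> {..<n}"
        using gb[OF _ b] by auto
      then have "bij_betw ?T (?G \<times> {..<n}) (?G \<times> {..<n})"
        by (intro bij_betw_byWitness[where f' = ?T]) auto
      then have "sum ?h (?G \<times> {..<n}) = (\<Sum>x\<in>?G \<times> {..<n}. ?h (?T x))"
        by (rule sum.reindex_bij_betw[symmetric])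
      also have "\<dots> = (\<Sum>x\<in>?G \<times> {..<n}. - ?h x)"
      proof (intro sum.cong refl)
        fix x assume "x \<in> ?G \<times> {..<n}"
        then obtain g l where x: "x = (g, l)" "g \<in> ?G" "l < n" by auto
        have "l # map g [0..<k] = (g b # map (g(b := l)) [0..<k])[0 := (g b # map (g(b := l)) [0..<k]) ! Suc b, Suc b := (g b # map (g(b := l)) [0..<k]) ! 0]"
          using b by (intro nth_equalityI) (auto simp: nth_Cons nth_list_update split: nat.splits)
        then have "wd (g b # map (g(b := l)) [0..<k]) us = - wd (l # map g [0..<k]) us"
          using wd_swap[of 0 "g b # map (g(b := l)) [0..<k]" "Suc b" us] b by simp
        moreover have "pd (g b) (pd l (\<lambda>z. \<Phi> z (I ! b))) z = pd l (pd (g b) (\<lambda>z. \<Phi> z (I ! b))) z"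
          using pd_commute[OF D \<Phi>[OF Ib[OF I b]] x(3) gb[OF x(2) b] z] .
        moreover have "(\<Prod>c\<in>{..<k} - {b}. ?A I c ((g(b := l)) c)) = (\<Prod>c\<in>{..<k} - {b}. ?A I c (g c))"
          by (intro prod.cong) auto
        ultimately show "?h (?T x) = - ?h x" using x by simp
      qed
      finally have "sum ?h (?G \<times> {..<n}) = - sum ?h (?G \<times> {..<n})" by (simp add: sum_negf)
      then show ?thesis by (simp add: sum.cartesian_product')
    qed
    \<comment> \<open>The new row is expanded by Laplace and the remaining minors by
      \<open>wd_map_Jac\<close>; this is the pullback of \<open>dz^m\<close> wedge
      \<open>dz^I\<close>.\<close>
    have first: "wd (m # I) (map (Jac n \<Phi> z) us) =
        (\<Sum>g\<in>?G. \<Sum>l<n. pd l (\<lambda>z. \<Phi> z m) z * ?P I g z * wd (l # map g [0..<k]) us)"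
      if I: "I \<in> MI n k" and m: "m < n" for I m
    proof -
      have lI: "length I = k" using MI_length[OF I] .
      have "wd (m # I) (map (Jac n \<Phi> z) us) =
        (\<Sum>b<Suc k. (-1) ^ b * ((\<Sum>l<n. pd l (\<lambda>z. \<Phi> z m) z * (us ! b) l) * (\<Sum>g\<in>?G. ?P I g z * wd (map g [0..<k]) (del b us))))"
        using wd_Cons_row[of "map (Jac n \<Phi> z) us" I m] lus lI m
          wd_map_Jac[of "del b us" I n \<Phi> z for b] MI_set[OF I]
        by (simp add: Jac_def[of n \<Phi> z "us ! b" for b] length_del flip: map_del del: sum.lessThan_Suc)
      also have "\<dots> = (\<Sum>b<Suc k. \<Sum>g\<in>?G. \<Sum>l<n. pd l (\<lambda>z. \<Phi> z m) z * ?P I g z * ((-1) ^ b * ((us ! b) l * wd (map g [0..<k]) (del b us))))"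
      proof (rule sum.cong[OF refl])
        fix b
        have "(\<Sum>l<n. pd l (\<lambda>z. \<Phi> z m) z * (us ! b) l) * (\<Sum>g\<in>?G. ?P I g z * wd (map g [0..<k]) (del b us)) =
          (\<Sum>g\<in>?G. \<Sum>l<n. (pd l (\<lambda>z. \<Phi> z m) z * (us ! b) l) * (?P I g z * wd (map g [0..<k]) (del b us)))"
          by (subst sum_product) (rule sum.swap)
        then show "(-1) ^ b * ((\<Sum>l<n. pd l (\<lambda>z. \<Phi> z m) z * (us ! b) l) * (\<Sum>g\<in>?G. ?P I g z * wd (map g [0..<k]) (del b us))) =
          (\<Sum>g\<in>?G. \<Sum>l<n. pd l (\<lambda>z. \<Phi> z m) z * ?P I g z * ((-1) ^ b * ((us ! b) l * wd (map g [0..<k]) (del b us))))"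
          by (simp add: sum_distrib_left mult_ac)
      qed
      also have "\<dots> = (\<Sum>g\<in>?G. \<Sum>b<Suc k. \<Sum>l<n. pd l (\<lambda>z. \<Phi> z m) z * ?P I g z * ((-1) ^ b * ((us ! b) l * wd (map g [0..<k]) (del b us))))"
        by (rule sum.swap)
      also have "\<dots> = (\<Sum>g\<in>?G. \<Sum>l<n. \<Sum>b<Suc k. pd l (\<lambda>z. \<Phi> z m) z * ?P I g z * ((-1) ^ b * ((us ! b) l * wd (map g [0..<k]) (del b us))))"
        by (rule sum.cong[OF refl], rule sum.swap)
      also have "\<dots> = (\<Sum>g\<in>?G. \<Sum>l<n. pd l (\<lambda>z. \<Phi> z m) z * ?P I g z * wd (l # map g [0..<k]) us)"
        using lus by (intro sum.cong refl) (simp add: wd_Cons_row sum_distrib_left del: sum.lessThan_Suc)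
      finally show ?thesis .
    qed
    have "Dd n (pull n \<Phi> f) z us = (\<Sum>x\<in>?S. \<Sum>l<n. pd l (?c x) z * wd (l # ?L x) us)"
      by (rule Dd_sum[OF D fin(2) hc _ pf z us]) (use L in auto)
    also have "\<dots> = (\<Sum>I\<in>MI n k. \<Sum>g\<in>?G. \<Sum>l<n. pd l (?c (I, g)) z * wd (l # map g [0..<k]) us)"
      by (simp add: sum.cartesian_product')
    also have "\<dots> = (\<Sum>I\<in>MI n k. \<Sum>m<n. pd m (a I) (\<Phi> z) * wd (m # I) (map (Jac n \<Phi> z) us))"
    proof (intro sum.cong refl)
      fix I assume I: "I \<in> MI n k"
      let ?w = "\<lambda>l g. wd (l # map g [0..<k]) us"
      have "(\<Sum>g\<in>?G. \<Sum>l<n. pd l (?c (I, g)) z * ?w l g) =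
        (\<Sum>g\<in>?G. \<Sum>l<n. (\<Sum>m<n. pd m (a I) (\<Phi> z) * (pd l (\<lambda>z. \<Phi> z m) z * ?P I g z * ?w l g)) +
          (\<Sum>b<k. a I (\<Phi> z) * (pd l (pd (g b) (\<lambda>z. \<Phi> z (I ! b))) z * (\<Prod>c\<in>{..<k} - {b}. ?A I c (g c)) * ?w l g)))"
        using I by (intro sum.cong refl)
          (simp only: pdc lessThan_iff distrib_right sum_distrib_left sum_distrib_right mult.assoc)
      also have "\<dots> = (\<Sum>g\<in>?G. \<Sum>l<n. \<Sum>m<n. pd m (a I) (\<Phi> z) * (pd l (\<lambda>z. \<Phi> z m) z * ?P I g z * ?w l g)) +
        (\<Sum>g\<in>?G. \<Sum>l<n. \<Sum>b<k. a I (\<Phi> z) * (pd l (pd (g b) (\<lambda>z. \<Phi> z (I ! b))) z * (\<Prod>c\<in>{..<k} - {b}. ?A I c (g c)) * ?w l g))"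
        by (simp only: sum.distrib)
      also have "(\<Sum>g\<in>?G. \<Sum>l<n. \<Sum>b<k. a I (\<Phi> z) * (pd l (pd (g b) (\<lambda>z. \<Phi> z (I ! b))) z * (\<Prod>c\<in>{..<k} - {b}. ?A I c (g c)) * ?w l g)) =
        (\<Sum>b<k. a I (\<Phi> z) * (\<Sum>g\<in>?G. \<Sum>l<n. pd l (pd (g b) (\<lambda>z. \<Phi> z (I ! b))) z * (\<Prod>c\<in>{..<k} - {b}. ?A I c (g c)) * ?w l g))"
        unfolding sum_distrib_left by (rule sum_rotate)
      also have "\<dots> = 0" using zero[OF I] by simp
      also have "(\<Sum>g\<in>?G. \<Sum>l<n. \<Sum>m<n. pd m (a I) (\<Phi> z) * (pd l (\<lambda>z. \<Phi> z m) z * ?P I g z * ?w l g)) =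
         (\<Sum>m<n. pd m (a I) (\<Phi> z) * (\<Sum>g\<in>?G. \<Sum>l<n. pd l (\<lambda>z. \<Phi> z m) z * ?P I g z * ?w l g))"
        unfolding sum_distrib_left by (rule sum_rotate)
      finally show "(\<Sum>g\<in>?G. \<Sum>l<n. pd l (?c (I, g)) z * ?w l g) = (\<Sum>m<n. pd m (a I) (\<Phi> z) * wd (m # I) (map (Jac n \<Phi> z) us))"
        using first[OF I] by simp
    qed
    also have "\<dots> = pull n \<Phi> (Dd n f) z us"
      using Dd_expn[OF E f \<Phi>E[OF z] Lists_Jac[OF us]] by (simp add: pull_def)
    finally show ?thesis .
  qed
qed

subsection \<open>The Poincare lemma\<close>

text \<open>The primitive is the contraction of the radially averaged form with
  \<open>v = z - z0\<close>; on each \<open>dz^I\<close> it omits one index at a time with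
  alternating sign. Its derivative is \<open>f\<close> minus the contraction of the averaged
  derivative of \<open>f\<close>, where \<open>radial_euler\<close> recovers the coefficients of
  \<open>f\<close>, and closedness removes the second term.\<close>

lemma poincare:
  assumes z0: "z0 \<in> Cn n" and f: "expn n (Suc m) (polydisc n z0 r) f a"
    and closed: "\<And>z us. \<lbrakk>z \<in> polydisc n z0 r; us \<in> Lists n (Suc (Suc m))\<rbrakk> \<Longrightarrow> Dd n f z us = 0"
  obtains g b where "expn n m (polydisc n z0 r) g b"
    "\<And>z us. \<lbrakk>z \<in> polydisc n z0 r; us \<in> Lists n (Suc m)\<rbrakk> \<Longrightarrow> Dd n g z us = f z us"
proof -
  let ?P = "polydisc n z0 r" and ?k = "Suc m"
  note D = dom_polydisc[of n z0 r]
  have a: "hol n ?P (a I)" if "I \<in> MI n ?k" for I using f that by (simp add: expn_def)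
  define A where "A I = radial z0 m (a I)" for I
  have hA: "hol n ?P (A I)" if "I \<in> MI n ?k" for I unfolding A_def by (rule hol_radial[OF z0 a[OF that]])
  let ?S = "MI n ?k \<times> {..<?k}"
  let ?c = "\<lambda>(I, b) z. (-1) ^ b * ((z (I ! b) + - z0 (I ! b)) * A I z)"
  let ?L = "\<lambda>(I, b). del b I"
  define g where "g z us = (\<Sum>x\<in>?S. ?c x z * wd (?L x) us)" for z us
  have fin: "finite ?S" by (simp add: finite_MI)
  have hv: "hol n ?P (\<lambda>z. z j + - z0 j)" for j by (intro hol_add[OF D] hol_coord[OF D] hol_const[OF D])
  have hc: "hol n ?P (?c x)" if "x \<in> ?S" for x
    using that hv by (auto intro!: hol_cmult[OF D] hol_mult[OF D] hA)
  have L: "length (?L x) = m \<and> set (?L x) \<subseteq> {..<n}" if "x \<in> ?S" for x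
    using that MI_length[of "fst x" n ?k] MI_set[of "fst x" n ?k, THEN subsetD] set_del[of "snd x" "fst x", THEN subsetD]
    by (auto simp: length_del)
  obtain b where b: "expn n m ?P g b" using expn_exists[OF D fin hc L g_def] by blast
  have "Dd n g z us = f z us" if z: "z \<in> ?P" and us: "us \<in> Lists n ?k" for z us
  proof -
    define v where "v i = z i - z0 i" for i
    have lus: "length us = ?k" using us by (simp add: Lists_def)
    have vL: "v # us \<in> Lists n (Suc ?k)" using us z z0 by (auto simp: Lists_def v_def polydisc_def)
    have pdv: "pd l (\<lambda>z. z j + - z0 j) z = (if l = j then 1 else 0)" if "l < n" for l j
      using pd_add[OF D hol_coord[OF D] hol_const[OF D] z that, of j "- z0 j"] by (simp add: pd_coord)
    have pdc: "pd l (?c (I, b)) z = (-1) ^ b * ((if l = I ! b then 1 else 0) * A I z + v (I ! b) * pd l (A I) z)"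
      if "I \<in> MI n ?k" "l < n" for I b l
    proof -
      have "pd l (\<lambda>z. (z (I ! b) + - z0 (I ! b)) * A I z) z = (if l = I ! b then 1 else 0) * A I z + (z (I ! b) + - z0 (I ! b)) * pd l (A I) z"
        unfolding pd_mult[OF D hv hA[OF that(1)] z that(2)] pdv[OF that(2)] ..
      then show ?thesis
        using pd_cmult[OF D hol_mult[OF D hv hA[OF that(1)]] z that(2), of "(-1) ^ b"] by (simp add: v_def)
    qed
    have "Dd n g z us = (\<Sum>x\<in>?S. \<Sum>l<n. pd l (?c x) z * wd (l # ?L x) us)"
      by (rule Dd_sum[OF D fin hc _ g_def z us]) (use L in auto)
    also have "\<dots> = (\<Sum>I\<in>MI n ?k. \<Sum>b<?k. \<Sum>l<n. pd l (?c (I, b)) z * wd (l # del b I) us)"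
      by (simp add: sum.cartesian_product' del: sum.lessThan_Suc)
    also have "\<dots> = (\<Sum>I\<in>MI n ?k. (of_nat ?k * A I z + (\<Sum>l<n. v l * pd l (A I) z)) * wd I us -
        (\<Sum>l<n. pd l (A I) z * wd (l # I) (v # us)))"
    proof (intro sum.cong refl)
      fix I assume I: "I \<in> MI n ?k"
      have lI: "length I = ?k" using MI_length[OF I] .
      have Ib: "I ! b < n" if "b < ?k" for b using nth_mem[of b I] MI_set[OF I, THEN subsetD, of "I ! b"] lI that by simp
      \<comment> \<open>Laplace expansion of \<open>wd (l # I)\<close> along the column of
        \<open>v\<close>, with the term of the leading index \<open>l\<close> split off.\<close>
      have col: "(\<Sum>b<?k. (-1) ^ b * (v (I ! b) * wd (l # del b I) us)) = v l * wd I us - wd (l # I) (v # us)" for l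
      proof -
        have "wd (l # I) (v # us) = (\<Sum>b<Suc ?k. (-1) ^ b * (v ((l # I) ! b) * wd (del b (l # I)) us))"
          using wd_Cons_col[of "l # I" us v] lI lus by simp
        also have "\<dots> = v l * wd I us + (\<Sum>b<?k. (-1) ^ Suc b * (v (I ! b) * wd (l # del b I) us))"
          by (subst sum.lessThan_Suc_shift) (simp add: del_def)
        finally show ?thesis by (simp add: sum_negf del: sum.lessThan_Suc)
      qed
      have "(\<Sum>b<?k. \<Sum>l<n. pd l (?c (I, b)) z * wd (l # del b I) us) =
        (\<Sum>b<?k. \<Sum>l<n. (if l = I ! b then A I z * ((-1) ^ b * wd (I ! b # del b I) us) else 0) +
            pd l (A I) z * ((-1) ^ b * (v (I ! b) * wd (l # del b I) us)))"
        using I by (intro sum.cong refl) (simp only: pdc lessThan_iff, simp add: algebra_simps)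
      also have "\<dots> = (\<Sum>b<?k. A I z * ((-1) ^ b * wd (I ! b # del b I) us)) +
          (\<Sum>b<?k. \<Sum>l<n. pd l (A I) z * ((-1) ^ b * (v (I ! b) * wd (l # del b I) us)))"
        using Ib by (simp add: sum.distrib del: sum.lessThan_Suc)
      also have "(\<Sum>b<?k. A I z * ((-1) ^ b * wd (I ! b # del b I) us)) = of_nat ?k * A I z * wd I us"
      proof -
        have "(-1) ^ b * wd (I ! b # del b I) us = wd I us" if "b < ?k" for b
          using wd_move[of b I us] that lI lus by (simp flip: power_add mult.assoc mult_2)
        then show ?thesis by (simp del: sum.lessThan_Suc of_nat_Suc)
      qed
      also have "(\<Sum>b<?k. \<Sum>l<n. pd l (A I) z * ((-1) ^ b * (v (I ! b) * wd (l # del b I) us))) =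
          (\<Sum>l<n. pd l (A I) z * (v l * wd I us - wd (l # I) (v # us)))"
        unfolding col[symmetric] sum_distrib_left by (rule sum.swap)
      finally show "(\<Sum>b<?k. \<Sum>l<n. pd l (?c (I, b)) z * wd (l # del b I) us) =
        (of_nat ?k * A I z + (\<Sum>l<n. v l * pd l (A I) z)) * wd I us - (\<Sum>l<n. pd l (A I) z * wd (l # I) (v # us))"
        by (simp add: algebra_simps sum_subtractf sum_distrib_left sum_distrib_right del: of_nat_Suc)
    qed
    also have "\<dots> = (\<Sum>I\<in>MI n ?k. a I z * wd I us) - (\<Sum>I\<in>MI n ?k. \<Sum>l<n. pd l (A I) z * wd (l # I) (v # us))"
    proof -
      have "of_nat ?k * A I z + (\<Sum>l<n. v l * pd l (A I) z) = a I z" if "I \<in> MI n ?k" for I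
        using radial_euler(1)[OF z0 a[OF that] z, of m] pd_radial[OF z0 a[OF that] z, of _ m]
        by (simp add: A_def v_def add.commute)
      then show ?thesis by (simp add: sum_subtractf)
    qed
    \<comment> \<open>This is the radial average of \<open>Dd n f\<close> on the fixed list
      \<open>v # us\<close>; closedness along the whole segment makes the integrand vanish.\<close>
    also have "(\<Sum>I\<in>MI n ?k. \<Sum>l<n. pd l (A I) z * wd (l # I) (v # us)) = 0"
    proof -
      let ?T = "MI n ?k \<times> {..<n}"
      have "(\<Sum>I\<in>MI n ?k. \<Sum>l<n. pd l (A I) z * wd (l # I) (v # us)) =
          (\<Sum>x\<in>?T. radial z0 ?k (pd (snd x) (a (fst x))) z * wd (snd x # fst x) (v # us))"
        using pd_radial[OF z0 a z] by (simp add: sum.cartesian_product' A_def)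
      also have "\<dots> = radial z0 ?k (\<lambda>w. \<Sum>x\<in>?T. pd (snd x) (a (fst x)) w * wd (snd x # fst x) (v # us)) z"
        by (rule radial_sum[symmetric, OF _ z0 _ z])
          (auto simp: finite_MI intro!: pd_continuous[OF D] a)
      also have "\<dots> = integral {0..1} (\<lambda>t::real. 0 :: complex)"
        unfolding radial_def
      proof (rule integral_cong)
        fix t :: real assume "t \<in> {0..1}"
        then have y: "(\<lambda>i. z0 i + of_real t * (z i - z0 i)) \<in> ?P" by (rule polydisc_radial[OF z0 z])
        show "of_real t ^ ?k * (\<Sum>x\<in>?T. pd (snd x) (a (fst x)) (\<lambda>i. z0 i + of_real t * (z i - z0 i)) * wd (snd x # fst x) (v # us)) = 0"
          using closed[OF y vL] Dd_expn[OF D f y vL] by (simp add: sum.cartesian_product')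
      qed
      finally show ?thesis by simp
    qed
    finally show ?thesis using f z us by (simp add: expn_def)
  qed
  then show ?thesis using that b by blast
qed

lemma MI_0: "MI n 0 = {[]}"
  by (auto simp: multi_indices_def)

lemma wd_Nil [simp]: "wd [] us = 1"
  by (simp add: wd_def)

text \<open>Testing closedness on unit vectors shows that all partial derivatives of the coefficient
  vanish; the second part of \<open>radial_euler\<close> integrates this along the segment.\<close>

lemma poincare_0:
  assumes z0: "z0 \<in> Cn n" and f: "expn n 0 (polydisc n z0 r) f a"
    and closed: "\<And>z us. \<lbrakk>z \<in> polydisc n z0 r; us \<in> Lists n 1\<rbrakk> \<Longrightarrow> Dd n f z us = 0"
    and z: "z \<in> polydisc n z0 r"
  shows "f z [] = f z0 []"
proof -
  let ?P = "polydisc n z0 r"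
  note D = dom_polydisc[of n z0 r]
  have a: "hol n ?P (a [])" using f by (simp add: expn_def MI_0)
  have pd0: "pd l (a []) w = 0" if w: "w \<in> ?P" and l: "l < n" for l w
  proof -
    let ?e = "\<lambda>i. if i = l then 1 else 0 :: complex"
    have e: "[?e] \<in> Lists n 1" using l by (auto simp: Lists_def)
    have "wd [j] [?e] = ?e j" for j using wd_Cons_row[of "[?e]" "[]" j] by (simp add: del_def)
    then have "(\<Sum>j<n. pd j (a []) w * ?e j) = 0"
      using closed[OF w e] Dd_expn[OF D f w, of "[?e]"] e by (simp add: MI_0)
    then show ?thesis using l by (simp add: if_distrib cong: if_cong)
  qed
  have "radial z0 0 (pd l (a [])) z = integral {0..1} (\<lambda>t::real. 0 :: complex)" if "l < n" for l
    unfolding radial_def by (intro integral_cong) (simp add: pd0 polydisc_radial[OF z0 z] that)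
  then have "a [] z = a [] z0" using radial_euler(2)[OF z0 a z] by simp
  moreover have "[] \<in> Lists n 0" by (simp add: Lists_def)
  moreover have "z0 \<in> ?P" using z0 z by (auto simp: polydisc_def intro: order.strict_trans1[OF zero_le_dist])
  ultimately show ?thesis using f z by (simp add: expn_def MI_0)
qed

section \<open>Holomorphic forms on a complex manifold\<close>

locale cmanifold =
  fixes n :: nat and X :: "'a topology" and A :: "'a chart set"
  assumes man: "complex_manifold n X A"
begin

lemma chart:
  assumes "c \<in> A"
  shows "openin X (fst c)" "cdom n (snd c ` fst c)"
    "homeomorphic_map (subtopology X (fst c)) (subtopology (complex_space n) (snd c ` fst c)) (snd c)"
  using man assms unfolding complex_manifold_def by (auto split: prod.splits) (metis fst_conv snd_conv prod.collapse)+

lemma chart_at: "p \<in> topspace X \<Longrightarrow> \<exists>c\<in>A. p \<in> fst c"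
  using man unfolding complex_manifold_def by blast

lemma chart_sub: "c \<in> A \<Longrightarrow> fst c \<subseteq> topspace X"
  using chart(1) openin_subset by blast

lemma chart_inj: "c \<in> A \<Longrightarrow> inj_on (snd c) (fst c)"
  using chart(3)[of c] chart_sub[of c] by (auto simp: homeomorphic_eq_everything_map Int_absorb1)

lemma chart_open_image:
  assumes c: "c \<in> A" and N: "openin X N" "N \<subseteq> fst c"
  shows "cdom n (snd c ` N)"
proof -
  have "openin (subtopology X (fst c)) N" using N by (simp add: openin_open_subtopology chart(1)[OF c])
  then have "openin (subtopology (complex_space n) (snd c ` fst c)) (snd c ` N)"
    using chart(3)[OF c] homeomorphic_imp_open_map open_map_def by blast
  then show ?thesis using chart(2)[OF c] by (simp add: openin_open_subtopology)
qed

lemma chart_open_vimage: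
  assumes c: "c \<in> A" and E: "cdom n E" "E \<subseteq> snd c ` fst c"
  shows "openin X {q \<in> fst c. snd c q \<in> E}" "snd c ` {q \<in> fst c. snd c q \<in> E} = E"
proof -
  have "openin (subtopology (complex_space n) (snd c ` fst c)) E" using E chart(2)[OF c] by (simp add: openin_open_subtopology)
  then have "openin (subtopology X (fst c)) {q \<in> topspace (subtopology X (fst c)). snd c q \<in> E}"
    using chart(3)[OF c] homeomorphic_imp_continuous_map openin_continuous_map_preimage by blast
  then have "openin (subtopology X (fst c)) {q \<in> fst c. snd c q \<in> E}" using chart_sub[OF c] by (simp add: Int_absorb1)
  then show "openin X {q \<in> fst c. snd c q \<in> E}" using chart(1)[OF c] by (simp add: openin_open_subtopology)
  show "snd c ` {q \<in> fst c. snd c q \<in> E} = E" using E by auto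
qed

lemma transition_eq: "c \<in> A \<Longrightarrow> q \<in> fst c \<Longrightarrow> transition c d (snd c q) = snd d q"
  using chart_inj by (simp add: transition_def)

lemma hol_transition:
  assumes "c \<in> A" "d \<in> A" "j < n" "openin X N" "N \<subseteq> fst c \<inter> fst d"
  shows "hol n (snd c ` N) (\<lambda>z. transition c d z j)"
proof (rule hol_subset)
  show "hol n (snd c ` (fst c \<inter> fst d)) (\<lambda>z. transition c d z j)"
    using man assms unfolding complex_manifold_def by blast
  show "cdom n (snd c ` (fst c \<inter> fst d))"
    by (intro chart_open_image[OF assms(1)] openin_Int chart(1)[OF assms(1)] chart(1)[OF assms(2)]) auto
  show "cdom n (snd c ` N)" using assms by (intro chart_open_image) auto
qed (use assms in auto)

lemma pd_transition_id:
  assumes c: "c \<in> A" "p \<in> fst c" and i: "i < n"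
  shows "pd i (\<lambda>z. transition c c z j) (snd c p) = (if i = j then 1 else 0)"
proof -
  have "pd i (\<lambda>z. transition c c z j) (snd c p) = pd i (\<lambda>z. z j) (snd c p)"
    using c i by (intro pd_cong[OF chart(2)[OF c(1)]]) (auto simp: transition_eq[OF c(1), of _ c])
  then show ?thesis by (simp add: pd_coord)
qed

lemma chart_Cn: "c \<in> A \<Longrightarrow> q \<in> fst c \<Longrightarrow> snd c q \<in> Cn n"
  using dom_sub[OF chart(2)] by blast

lemma Jac_id:
  assumes "c \<in> A" "p \<in> fst c" "u \<in> Cn n"
  shows "Jac n (transition c c) (snd c p) u = u"
proof
  fix j show "Jac n (transition c c) (snd c p) u j = u j"
    using assms by (auto simp: Jac_def pd_transition_id if_distrib[of "\<lambda>x. x * _"] cong: if_cong)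
qed

text \<open>The chain rule for transition maps, valid near \<open>p\<close> on the triple overlap of
  the chart domains.\<close>

lemma Jac_cocycle:
  assumes c: "c \<in> A" "d \<in> A" "e \<in> A" and p: "p \<in> fst c" "p \<in> fst d" "p \<in> fst e"
  shows "Jac n (transition d e) (snd d p) (Jac n (transition c d) (snd c p) u) = Jac n (transition c e) (snd c p) u"
proof
  fix j
  let ?N = "fst c \<inter> fst d \<inter> fst e"
  have N: "openin X ?N" "p \<in> ?N" using chart(1)[OF c(1)] chart(1)[OF c(2)] chart(1)[OF c(3)] p by auto
  have D: "cdom n (snd c ` ?N)" and E: "cdom n (snd d ` ?N)"
    using N c by (auto intro!: chart_open_image)
  show "Jac n (transition d e) (snd d p) (Jac n (transition c d) (snd c p) u) j = Jac n (transition c e) (snd c p) u j"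
  proof (cases "j < n")
    case j: True
    have pde: "pd i (\<lambda>z. transition c e z j) (snd c p) =
        (\<Sum>l<n. pd l (\<lambda>z. transition d e z j) (snd d p) * pd i (\<lambda>z. transition c d z l) (snd c p))" if i: "i < n" for i
    proof -
      have "pd i (\<lambda>z. transition c e z j) (snd c p) = pd i (\<lambda>z. transition d e (transition c d z) j) (snd c p)"
        using c p i N by (intro pd_cong[OF D]) (auto simp: transition_eq)
      also have "\<dots> = (\<Sum>l<n. pd l (\<lambda>z. transition d e z j) (transition c d (snd c p)) * pd i (\<lambda>z. transition c d z l) (snd c p))"
      proof (rule pd_compose[OF D E _ _ _ _ i])
        show "hol n (snd d ` ?N) (\<lambda>z. transition d e z j)" using c N j by (intro hol_transition) auto
        show "hol n (snd c ` ?N) (\<lambda>z. transition c d z l)" if "l < n" for l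
          using c N that by (intro hol_transition) auto
        show "transition c d z \<in> snd d ` ?N" if "z \<in> snd c ` ?N" for z
          using that c by (auto simp: transition_eq)
        show "snd c p \<in> snd c ` ?N" using p by blast
      qed
      finally show ?thesis using transition_eq[OF c(1) p(1)] by simp
    qed
    have "Jac n (transition d e) (snd d p) (Jac n (transition c d) (snd c p) u) j =
       (\<Sum>l<n. \<Sum>i<n. pd l (\<lambda>z. transition d e z j) (snd d p) * pd i (\<lambda>z. transition c d z l) (snd c p) * u i)"
      using j by (simp add: Jac_def sum_distrib_left mult.assoc)
    also have "\<dots> = (\<Sum>i<n. \<Sum>l<n. pd l (\<lambda>z. transition d e z j) (snd d p) * pd i (\<lambda>z. transition c d z l) (snd c p) * u i)"
      by (rule sum.swap)
    also have "\<dots> = Jac n (transition c e) (snd c p) u j"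
      using j by (simp add: Jac_def pde sum_distrib_right)
    finally show ?thesis .
  qed (simp add: Jac_def)
qed

lemma tangent_iff:
  "v \<in> tangent_space n A p \<longleftrightarrow> (\<forall>c. c \<notin> A \<or> p \<notin> fst c \<longrightarrow> v c = (\<lambda>i. 0)) \<and>
     (\<forall>c\<in>A. p \<in> fst c \<longrightarrow> v c \<in> Cn n) \<and>
     (\<forall>c\<in>A. \<forall>d\<in>A. p \<in> fst c \<longrightarrow> p \<in> fst d \<longrightarrow> v d = Jac n (transition c d) (snd c p) (v c))"
proof -
  have "(\<forall>j<n. v d j = (\<Sum>i<n. pd i (\<lambda>z. transition c d z j) (snd c p) * v c i)) \<longleftrightarrow>
      v d = Jac n (transition c d) (snd c p) (v c)" if "v d \<in> Cn n" for c d
    using that by (auto simp: Jac_def fun_eq_iff)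
  then have "(\<forall>c\<in>A. \<forall>d\<in>A. p \<in> fst c \<longrightarrow> p \<in> fst d \<longrightarrow>
        (\<forall>j<n. v d j = (\<Sum>i<n. pd i (\<lambda>z. transition c d z j) (snd c p) * v c i))) \<longleftrightarrow>
      (\<forall>c\<in>A. \<forall>d\<in>A. p \<in> fst c \<longrightarrow> p \<in> fst d \<longrightarrow> v d = Jac n (transition c d) (snd c p) (v c))"
    if "\<forall>c\<in>A. p \<in> fst c \<longrightarrow> v c \<in> Cn n"
    using that by (intro ball_cong imp_cong refl) blast
  then show ?thesis
    unfolding tangent_space_def topspace_complex_space mem_Collect_eq by (intro conj_cong refl)
qed

text \<open>The components in the other charts are defined by Jacobians, and the cocycle rule makes
  them consistent. Realising all component vectors is what lets a form determine its coordinate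
  expression.\<close>

lemma tangent_exists:
  assumes c: "c \<in> A" "p \<in> fst c" and u: "u \<in> Cn n"
  shows "\<exists>v\<in>tangent_space n A p. v c = u"
proof
  let ?v = "\<lambda>d. if d \<in> A \<and> p \<in> fst d then Jac n (transition c d) (snd c p) u else (\<lambda>i. 0)"
  show "?v \<in> tangent_space n A p"
    unfolding tangent_iff using c by (auto simp: Jac_cocycle Jac_Cn)
  show "?v c = u" using c u by (simp add: Jac_id)
qed

section \<open>Forms in a chart and change of chart\<close>

abbreviation "TL \<equiv> tangent_lists n A"
abbreviation "ev c vs \<equiv> map (\<lambda>v. v c) vs"

lemma TL_Lists: "c \<in> A \<Longrightarrow> p \<in> fst c \<Longrightarrow> vs \<in> TL k p \<Longrightarrow> ev c vs \<in> Lists n k"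
proof -
  assume c: "c \<in> A" "p \<in> fst c" and vs: "vs \<in> TL k p"
  have "v c \<in> Cn n" if "v \<in> set vs" for v
  proof -
    have "v \<in> tangent_space n A p" using vs that unfolding tangent_lists_def by blast
    then show ?thesis using c unfolding tangent_iff by blast
  qed
  then have "set (ev c vs) \<subseteq> Cn n" by (simp only: set_map image_subset_iff) blast
  then show ?thesis using vs by (simp add: Lists_def tangent_lists_def)
qed

lemma TL_exists:
  assumes c: "c \<in> A" "p \<in> fst c" and us: "us \<in> Lists n k"
  shows "\<exists>vs\<in>TL k p. ev c vs = us"
proof -
  have "\<forall>u\<in>set us. \<exists>v. v \<in> tangent_space n A p \<and> v c = u"
    using tangent_exists[OF c] us by (auto simp: Lists_def)
  then obtain g where g: "\<And>u. u \<in> set us \<Longrightarrow> g u \<in> tangent_space n A p \<and> g u c = u" by metis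
  then have "map g us \<in> TL k p" "ev c (map g us) = us"
    using us by (auto simp: tangent_lists_def Lists_def intro: map_idI)
  then show ?thesis by blast
qed

lemma TL_change:
  assumes "c \<in> A" "d \<in> A" "p \<in> fst c" "p \<in> fst d" "vs \<in> TL k p"
  shows "ev d vs = map (Jac n (transition c d) (snd c p)) (ev c vs)"
proof -
  have "v d = Jac n (transition c d) (snd c p) (v c)" if "v \<in> set vs" for v
  proof -
    have "v \<in> tangent_space n A p" using assms(5) that unfolding tangent_lists_def by blast
    then show ?thesis using assms(1-4) unfolding tangent_iff by blast
  qed
  then show ?thesis by simp
qed

text \<open>\<open>local_expansion\<close> with the coordinate form \<open>f\<close> in place of its
  coefficients. A change of chart is then simply \<open>pull\<close>, and no multi-indices have to
  be sorted again.\<close>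

definition lexp :: "nat \<Rightarrow> 'a form \<Rightarrow> 'a chart \<Rightarrow> 'a set \<Rightarrow> ((nat \<Rightarrow> complex) \<Rightarrow> (nat \<Rightarrow> complex) list \<Rightarrow> complex) \<Rightarrow> bool" where
  "lexp k \<omega> c N f \<longleftrightarrow> c \<in> A \<and> openin X N \<and> N \<subseteq> fst c \<and> (\<exists>a. expn n k (snd c ` N) f a) \<and>
     (\<forall>q\<in>N. \<forall>vs\<in>TL k q. \<omega> q vs = f (snd c q) (ev c vs))"

lemma lexpD: "\<lbrakk>lexp k \<omega> c N f; q \<in> N; vs \<in> TL k q\<rbrakk> \<Longrightarrow> \<omega> q vs = f (snd c q) (ev c vs)"
  unfolding lexp_def by blast

lemma expnD: "\<lbrakk>expn n k D f a; z \<in> D; us \<in> Lists n k\<rbrakk> \<Longrightarrow> f z us = (\<Sum>I\<in>MI n k. a I z * wd I us)"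
  unfolding expn_def by blast

lemma lexp_dom: "lexp k \<omega> c N f \<Longrightarrow> cdom n (snd c ` N)"
  unfolding lexp_def using chart_open_image by blast

lemma local_expansion_lexp:
  assumes "local_expansion n X A k \<omega> c N a"
  shows "lexp k \<omega> c N (\<lambda>z us. \<Sum>I\<in>MI n k. a I z * wd I us)"
    and "expn n k (snd c ` N) (\<lambda>z us. \<Sum>I\<in>MI n k. a I z * wd I us) a"
proof -
  have e: "wedge_dz c I vs = wd I (ev c vs)" if "vs \<in> TL k q" "I \<in> MI n k" for vs q I
    using that by (intro wedge_dz_eq) (simp add: tangent_lists_def MI_length)
  show ex: "expn n k (snd c ` N) (\<lambda>z us. \<Sum>I\<in>MI n k. a I z * wd I us) a"
    using assms by (auto simp: expn_def local_expansion_def)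
  then show "lexp k \<omega> c N (\<lambda>z us. \<Sum>I\<in>MI n k. a I z * wd I us)"
    using assms unfolding lexp_def local_expansion_def by (auto simp: e intro!: sum.cong)
qed

lemma lexp_local_expansion:
  assumes "lexp k \<omega> c N f"
  obtains a where "local_expansion n X A k \<omega> c N a" "expn n k (snd c ` N) f a"
proof -
  obtain a where a: "expn n k (snd c ` N) f a" using assms by (auto simp: lexp_def)
  have c: "c \<in> A" "N \<subseteq> fst c" using assms by (auto simp: lexp_def)
  have "\<omega> q vs = (\<Sum>I\<in>MI n k. a I (snd c q) * wedge_dz c I vs)" if q: "q \<in> N" and vs: "vs \<in> TL k q" for q vs
  proof -
    have "ev c vs \<in> Lists n k" using TL_Lists[OF c(1) _ vs] c(2) q by blast
    then have "\<omega> q vs = (\<Sum>I\<in>MI n k. a I (snd c q) * wd I (ev c vs))"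
      using lexpD[OF assms q vs] expnD[OF a] q by simp
    also have "\<dots> = (\<Sum>I\<in>MI n k. a I (snd c q) * wedge_dz c I vs)"
      using vs by (intro sum.cong refl arg_cong2[where f = "(*)"] wedge_dz_eq[symmetric])
        (simp add: tangent_lists_def MI_length)
    finally show ?thesis .
  qed
  then have "local_expansion n X A k \<omega> c N a"
    using assms a by (auto simp: local_expansion_def lexp_def expn_def)
  then show ?thesis using that a by blast
qed

lemma expn_subset: "expn n k D f a \<Longrightarrow> cdom n D \<Longrightarrow> cdom n E \<Longrightarrow> E \<subseteq> D \<Longrightarrow> expn n k E f a"
  unfolding expn_def using hol_subset[of n D _ E] by blast

lemma lexp_subset:
  assumes "lexp k \<omega> c N f" "openin X M" "M \<subseteq> N" "\<And>q vs. \<lbrakk>q \<in> M; vs \<in> TL k q\<rbrakk> \<Longrightarrow> \<omega>' q vs = \<omega> q vs"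
  shows "lexp k \<omega>' c M f"
proof -
  have c: "c \<in> A" "M \<subseteq> fst c" using assms by (auto simp: lexp_def)
  obtain a where a: "expn n k (snd c ` N) f a" using assms by (auto simp: lexp_def)
  have "expn n k (snd c ` M) f a"
    by (rule expn_subset[OF a lexp_dom[OF assms(1)] chart_open_image[OF c(1) assms(2) c(2)] image_mono[OF assms(3)]])
  then have "\<exists>a. expn n k (snd c ` M) f a" by blast
  moreover have "\<omega>' q vs = f (snd c q) (ev c vs)" if "q \<in> M" "vs \<in> TL k q" for q vs
    using assms(4)[OF that] lexpD[OF assms(1) _ that(2)] that(1) assms(3) by auto
  ultimately show ?thesis using assms(2) c by (simp add: lexp_def)
qed

lemma lexp_change:
  assumes f: "lexp k \<omega> c N f" and d: "d \<in> A"
  shows "lexp k \<omega> d (N \<inter> fst d) (pull n (transition d c) f)"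
proof -
  have c: "c \<in> A" "N \<subseteq> fst c" "openin X N" using f by (auto simp: lexp_def)
  let ?M = "N \<inter> fst d"
  have M: "openin X ?M" using c chart(1)[OF d] by blast
  obtain a where a: "expn n k (snd c ` N) f a" using f by (auto simp: lexp_def)
  have "\<exists>b. expn n k (snd d ` ?M) (pull n (transition d c) f) b"
  proof (rule expn_pull[OF _ lexp_dom[OF f] a])
    show "cdom n (snd d ` ?M)" using M by (intro chart_open_image d) auto
    show "hol n (snd d ` ?M) (\<lambda>z. transition d c z j)" if "j < n" for j
      using c d M that by (intro hol_transition) auto
    show "transition d c z \<in> snd c ` N" if "z \<in> snd d ` ?M" for z
      using that d by (auto simp: transition_eq)
  qed
  moreover have "\<omega> q vs = pull n (transition d c) f (snd d q) (ev d vs)" if q: "q \<in> ?M" and vs: "vs \<in> TL k q" for q vs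
  proof -
    have "\<omega> q vs = f (snd c q) (ev c vs)" using lexpD[OF f _ vs] q by simp
    moreover have "ev c vs = map (Jac n (transition d c) (snd d q)) (ev d vs)"
      using q c by (intro TL_change[OF d c(1) _ _ vs]) auto
    moreover have "transition d c (snd d q) = snd c q" using q by (intro transition_eq[OF d]) auto
    ultimately show ?thesis by (simp add: pull_def)
  qed
  ultimately show ?thesis using d M unfolding lexp_def by auto
qed

lemma lexp_unique:
  assumes "lexp k \<omega> c N f" "lexp k \<omega> c N g" "z \<in> snd c ` N" "us \<in> Lists n k"
  shows "f z us = g z us"
proof -
  obtain q where q: "q \<in> N" "z = snd c q" using assms(3) by blast
  have c: "c \<in> A" "q \<in> fst c" using assms(1) q by (auto simp: lexp_def)
  obtain vs where vs: "vs \<in> TL k q" "ev c vs = us" using TL_exists[OF c assms(4)] by blast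
  have "f (snd c q) (ev c vs) = \<omega> q vs" "g (snd c q) (ev c vs) = \<omega> q vs"
    using lexpD[OF assms(1) q(1) vs(1)] lexpD[OF assms(2) q(1) vs(1)] by simp_all
  then show ?thesis using q vs by simp
qed

text \<open>On the overlap \<open>f\<close> and the pullback of \<open>g\<close> describe the same
  form, hence agree by \<open>lexp_unique\<close>; and \<open>Dd\<close> commutes with
  pullback.\<close>

lemma Dd_lexp_unique:
  assumes f: "lexp k \<omega> c N f" and g: "lexp k \<omega> d M g" and p: "p \<in> N" "p \<in> M" and vs: "vs \<in> TL (Suc k) p"
  shows "Dd n f (snd c p) (ev c vs) = Dd n g (snd d p) (ev d vs)"
proof -
  have c: "c \<in> A" "N \<subseteq> fst c" "openin X N" using f by (auto simp: lexp_def)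
  have d: "d \<in> A" "M \<subseteq> fst d" "openin X M" using g by (auto simp: lexp_def)
  have pcd: "p \<in> fst c" "p \<in> fst d" using c d p by auto
  obtain a where a: "expn n k (snd d ` M) g a" using g by (auto simp: lexp_def)
  let ?K = "N \<inter> M"
  have K: "openin X ?K" using c d by blast
  have D: "cdom n (snd c ` ?K)" using K c by (intro chart_open_image) auto
  have f': "lexp k \<omega> c ?K f" using lexp_subset[OF f K] by blast
  have "lexp k \<omega> c (M \<inter> fst c) (pull n (transition c d) g)" by (rule lexp_change[OF g c(1)])
  from lexp_subset[OF this K] have g': "lexp k \<omega> c ?K (pull n (transition c d) g)" using c by blast
  have z: "snd c p \<in> snd c ` ?K" using p by blast
  have us: "ev c vs \<in> Lists n (Suc k)" using TL_Lists[OF c(1) pcd(1) vs] .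
  have "Dd n f (snd c p) (ev c vs) = Dd n (pull n (transition c d) g) (snd c p) (ev c vs)"
    by (rule Dd_cong[OF D lexp_unique[OF f' g'] z us])
  also have "\<dots> = pull n (transition c d) (Dd n g) (snd c p) (ev c vs)"
  proof (rule Dd_pull[OF D lexp_dom[OF g] a _ _ z us])
    show "hol n (snd c ` ?K) (\<lambda>z. transition c d z j)" if "j < n" for j
      using c d K that by (intro hol_transition) auto
    show "transition c d z \<in> snd d ` M" if "z \<in> snd c ` ?K" for z
      using that c by (auto simp: transition_eq)
  qed
  also have "\<dots> = Dd n g (snd d p) (ev d vs)"
    unfolding pull_def TL_change[OF c(1) d(1) pcd vs] transition_eq[OF c(1) pcd(1)] ..
  finally show ?thesis .
qed

abbreviation "ed \<equiv> exterior_derivative n X A"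

text \<open>Unlocks the definite description in \<open>exterior_derivative\<close>: all local
  expansions around \<open>p\<close> give one value by \<open>Dd_lexp_unique\<close>, and
  \<open>f\<close> supplies at least one.\<close>

lemma ed_value:
  assumes f: "lexp k \<omega> c N f" and p: "p \<in> N" "N \<subseteq> W" and vs: "vs \<in> TL (Suc k) p"
  shows "ed k W \<omega> p vs = Dd n f (snd c p) (ev c vs)"
proof -
  let ?y = "\<lambda>c a. \<Sum>I\<in>MI n k. \<Sum>j<n. pd j (a I) (snd c p) * wedge_dz c (j # I) vs"
  have y: "?y c' a = Dd n f (snd c p) (ev c vs)"
    if e: "local_expansion n X A k \<omega> c' N' a" "p \<in> N'" for c' N' a
  proof -
    note l = local_expansion_lexp[OF e(1)]
    have c': "c' \<in> A" "p \<in> fst c'" using e by (auto simp: local_expansion_def)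
    have "?y c' a = (\<Sum>I\<in>MI n k. \<Sum>j<n. pd j (a I) (snd c' p) * wd (j # I) (ev c' vs))"
      using vs by (intro sum.cong refl arg_cong2[where f = "(*)"] wedge_dz_eq)
        (simp add: tangent_lists_def MI_length)
    also have "\<dots> = Dd n (\<lambda>z us. \<Sum>I\<in>MI n k. a I z * wd I us) (snd c' p) (ev c' vs)"
      using e(2) by (intro Dd_expn[OF lexp_dom[OF l(1)] l(2), symmetric] TL_Lists[OF c' vs]) blast
    also have "\<dots> = Dd n f (snd c p) (ev c vs)"
      by (rule Dd_lexp_unique[OF l(1) f e(2) p(1) vs])
    finally show ?thesis .
  qed
  obtain a where a: "local_expansion n X A k \<omega> c N a" using lexp_local_expansion[OF f] by blast
  have "(THE y. \<exists>c N a. p \<in> N \<and> N \<subseteq> W \<and> local_expansion n X A k \<omega> c N a \<and> y = ?y c a) = Dd n f (snd c p) (ev c vs)"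
  proof (rule the_equality)
    show "\<exists>c' N a. p \<in> N \<and> N \<subseteq> W \<and> local_expansion n X A k \<omega> c' N a \<and> Dd n f (snd c p) (ev c vs) = ?y c' a"
      by (intro exI[of _ c] exI[of _ N] exI[of _ a] conjI p a y[OF a p(1), symmetric])
  next
    fix y' assume "\<exists>c N a. p \<in> N \<and> N \<subseteq> W \<and> local_expansion n X A k \<omega> c N a \<and> y' = ?y c a"
    then show "y' = Dd n f (snd c p) (ev c vs)" using y by (elim exE conjE) simp
  qed
  then show ?thesis using p vs by (auto simp: exterior_derivative_def)
qed

lemma lexp_ed:
  assumes f: "lexp k \<omega> c N f" and N: "N \<subseteq> W"
  shows "lexp (Suc k) (ed k W \<omega>) c N (Dd n f)"
proof -
  obtain a where a: "expn n k (snd c ` N) f a" using f by (auto simp: lexp_def)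
  have "\<exists>b. expn n (Suc k) (snd c ` N) (Dd n f) b" by (rule expn_Dd[OF lexp_dom[OF f] a])
  then show ?thesis using f ed_value[OF f _ N] by (simp add: lexp_def)
qed

section \<open>Operations on sections and their local exactness\<close>

abbreviation "HF \<equiv> holomorphic_forms n X A"

lemma HF_iff: "\<omega> \<in> HF k W \<longleftrightarrow> (\<forall>p\<in>W. \<exists>c N f. p \<in> N \<and> N \<subseteq> W \<and> lexp k \<omega> c N f) \<and>
    (\<forall>p vs. p \<notin> W \<or> vs \<notin> TL k p \<longrightarrow> \<omega> p vs = 0)"
proof -
  have "(\<exists>c N a. p \<in> N \<and> N \<subseteq> W \<and> local_expansion n X A k \<omega> c N a) \<longleftrightarrow> (\<exists>c N f. p \<in> N \<and> N \<subseteq> W \<and> lexp k \<omega> c N f)" for p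
  proof
    assume "\<exists>c N a. p \<in> N \<and> N \<subseteq> W \<and> local_expansion n X A k \<omega> c N a"
    then show "\<exists>c N f. p \<in> N \<and> N \<subseteq> W \<and> lexp k \<omega> c N f" using local_expansion_lexp(1) by blast
  next
    assume "\<exists>c N f. p \<in> N \<and> N \<subseteq> W \<and> lexp k \<omega> c N f"
    then obtain c N f where "p \<in> N" "N \<subseteq> W" "lexp k \<omega> c N f" by blast
    then show "\<exists>c N a. p \<in> N \<and> N \<subseteq> W \<and> local_expansion n X A k \<omega> c N a"
      by (elim lexp_local_expansion) blast
  qed
  then show ?thesis unfolding holomorphic_forms_def by simp
qed

lemma HF_common:
  assumes "\<omega> \<in> HF k W" "\<eta> \<in> HF k W" "p \<in> W"
  obtains c N f g where "p \<in> N" "N \<subseteq> W" "lexp k \<omega> c N f" "lexp k \<eta> c N g"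
proof -
  obtain c N f where f: "p \<in> N" "N \<subseteq> W" "lexp k \<omega> c N f" using assms(1,3) unfolding HF_iff by blast
  obtain d M g where g: "p \<in> M" "M \<subseteq> W" "lexp k \<eta> d M g" using assms(2,3) unfolding HF_iff by blast
  have c: "c \<in> A" "N \<subseteq> fst c" "openin X N" using f by (auto simp: lexp_def)
  have o: "openin X (N \<inter> M)" using f g by (auto simp: lexp_def)
  have "lexp k \<eta> c (M \<inter> fst c) (pull n (transition c d) g)" by (rule lexp_change[OF g(3) c(1)])
  from lexp_subset[OF this o] have "lexp k \<eta> c (N \<inter> M) (pull n (transition c d) g)" using c by blast
  moreover have "lexp k \<omega> c (N \<inter> M) f" using lexp_subset[OF f(3) o] by blast
  ultimately show ?thesis using that[of "N \<inter> M"] f g by blast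
qed

lemma lexp_lin:
  assumes f: "lexp k \<omega> c N f" and g: "lexp k \<eta> c N g"
  shows "lexp k (\<lambda>p vs. s * \<omega> p vs + \<eta> p vs) c N (\<lambda>z us. s * f z us + g z us)"
    and "z \<in> snd c ` N \<Longrightarrow> us \<in> Lists n (Suc k) \<Longrightarrow> Dd n (\<lambda>z us. s * f z us + g z us) z us = s * Dd n f z us + Dd n g z us"
proof -
  obtain a where a: "expn n k (snd c ` N) f a" using f by (auto simp: lexp_def)
  obtain b where b: "expn n k (snd c ` N) g b" using g by (auto simp: lexp_def)
  note D = lexp_dom[OF f]
  have ha: "hol n (snd c ` N) (a I)" and hb: "hol n (snd c ` N) (b I)" if "I \<in> MI n k" for I
    using a b that by (auto simp: expn_def)
  have ab: "expn n k (snd c ` N) (\<lambda>z us. s * f z us + g z us) (\<lambda>I z. s * a I z + b I z)"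
    using a b ha hb by (auto simp: expn_def sum_distrib_left sum.distrib algebra_simps intro!: hol_add[OF D] hol_cmult[OF D])
  then show "lexp k (\<lambda>p vs. s * \<omega> p vs + \<eta> p vs) c N (\<lambda>z us. s * f z us + g z us)"
    using f g unfolding lexp_def by auto
  assume z: "z \<in> snd c ` N" "us \<in> Lists n (Suc k)"
  have "pd j (\<lambda>z. s * a I z + b I z) z = s * pd j (a I) z + pd j (b I) z" if "I \<in> MI n k" "j < n" for I j
    using pd_add[OF D hol_cmult[OF D ha[OF that(1)]] hb[OF that(1)] z(1) that(2)] pd_cmult[OF D ha[OF that(1)] z(1) that(2)] by simp
  then show "Dd n (\<lambda>z us. s * f z us + g z us) z us = s * Dd n f z us + Dd n g z us"
    unfolding Dd_expn[OF D a z] Dd_expn[OF D b z] Dd_expn[OF D ab z]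
    by (simp add: sum_distrib_left algebra_simps flip: sum.distrib)
qed

lemma HF_zero: 
  assumes "openin X W" shows "(\<lambda>p vs. 0) \<in> HF k W"
  unfolding HF_iff
proof (intro conjI ballI allI impI refl)
  fix p assume p: "p \<in> W"
  then obtain c where c: "c \<in> A" "p \<in> fst c" using chart_at openin_subset[OF assms] by blast
  have o: "openin X (fst c \<inter> W)" using assms chart(1)[OF c(1)] by blast
  have "expn n k (snd c ` (fst c \<inter> W)) (\<lambda>z us. 0) (\<lambda>I z. 0)"
    using chart_open_image[OF c(1) o] by (auto simp: expn_def intro: hol_const)
  then have "lexp k (\<lambda>p vs. 0) c (fst c \<inter> W) (\<lambda>z us. 0)" using c o unfolding lexp_def by auto
  then show "\<exists>c N f. p \<in> N \<and> N \<subseteq> W \<and> lexp k (\<lambda>p vs. 0) c N f" using c p by blast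
qed

lemma HF_lin:
  assumes "\<omega> \<in> HF k W" "\<eta> \<in> HF k W"
  shows "(\<lambda>p vs. s * \<omega> p vs + \<eta> p vs) \<in> HF k W"
    and "ed k W (\<lambda>p vs. s * \<omega> p vs + \<eta> p vs) = (\<lambda>p vs. s * ed k W \<omega> p vs + ed k W \<eta> p vs)"
proof -
  show "(\<lambda>p vs. s * \<omega> p vs + \<eta> p vs) \<in> HF k W"
    unfolding HF_iff
  proof (intro conjI ballI allI impI)
    fix p assume "p \<in> W"
    then obtain c N f g where N: "p \<in> N" "N \<subseteq> W" "lexp k \<omega> c N f" "lexp k \<eta> c N g" using HF_common[OF assms] by metis
    show "\<exists>c N f. p \<in> N \<and> N \<subseteq> W \<and> lexp k (\<lambda>p vs. s * \<omega> p vs + \<eta> p vs) c N f"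
      using N(1,2) lexp_lin(1)[OF N(3,4), of s] by blast
  qed (use assms in \<open>auto simp: HF_iff\<close>)
  show "ed k W (\<lambda>p vs. s * \<omega> p vs + \<eta> p vs) = (\<lambda>p vs. s * ed k W \<omega> p vs + ed k W \<eta> p vs)"
  proof (intro ext)
    fix p vs
    show "ed k W (\<lambda>p vs. s * \<omega> p vs + \<eta> p vs) p vs = s * ed k W \<omega> p vs + ed k W \<eta> p vs"
    proof (cases "p \<in> W \<and> vs \<in> TL (Suc k) p")
      case True
      then obtain c N f g where N: "p \<in> N" "N \<subseteq> W" "lexp k \<omega> c N f" "lexp k \<eta> c N g" using HF_common[OF assms] by metis
      have c: "c \<in> A" "p \<in> fst c" using N by (auto simp: lexp_def)
      show ?thesis
        using True N ed_value[OF lexp_lin(1)[OF N(3,4)] N(1,2)] lexp_lin(2)[OF N(3,4)] TL_Lists[OF c]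
        by (simp add: ed_value[OF N(3,1,2)] ed_value[OF N(4,1,2)])
    qed (auto simp: exterior_derivative_def)
  qed
qed

lemma HF_res:
  assumes "\<omega> \<in> HF k W" "openin X V" "V \<subseteq> W"
  shows "(\<lambda>p vs. if p \<in> V then \<omega> p vs else 0) \<in> HF k V"
    and "ed k V (\<lambda>p vs. if p \<in> V then \<omega> p vs else 0) = (\<lambda>p vs. if p \<in> V then ed k W \<omega> p vs else 0)"
proof -
  let ?\<omega> = "\<lambda>p vs. if p \<in> V then \<omega> p vs else 0"
  have l: "\<exists>c N f. p \<in> N \<and> N \<subseteq> V \<and> lexp k \<omega> c N f \<and> lexp k ?\<omega> c N f" if p: "p \<in> V" for p
  proof -
    obtain c N f where f: "p \<in> N" "N \<subseteq> W" "lexp k \<omega> c N f" using assms p unfolding HF_iff by blast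
    have o: "openin X (N \<inter> V)" using f assms by (auto simp: lexp_def)
    then show ?thesis using lexp_subset[OF f(3) o, of \<omega>] lexp_subset[OF f(3) o, of ?\<omega>] f p
      by (intro exI[of _ c] exI[of _ "N \<inter> V"] exI[of _ f]) auto
  qed
  then show "?\<omega> \<in> HF k V" unfolding HF_iff using assms(1) by (fastforce simp: HF_iff)
  show "ed k V ?\<omega> = (\<lambda>p vs. if p \<in> V then ed k W \<omega> p vs else 0)"
  proof (intro ext)
    fix p vs
    show "ed k V ?\<omega> p vs = (if p \<in> V then ed k W \<omega> p vs else 0)"
    proof (cases "p \<in> V \<and> vs \<in> TL (Suc k) p")
      case True
      then obtain c N f where N: "p \<in> N" "N \<subseteq> V" "lexp k \<omega> c N f" "lexp k ?\<omega> c N f" using l by blast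
      have NW: "N \<subseteq> W" using N(2) assms(3) by blast
      show ?thesis
        using True ed_value[OF N(4,1,2)] ed_value[OF N(3,1) NW] by simp
    qed (auto simp: exterior_derivative_def)
  qed
qed

lemma HF_ed:
  assumes "\<omega> \<in> HF k W"
  shows "ed k W \<omega> \<in> HF (Suc k) W" and "ed (Suc k) W (ed k W \<omega>) = (\<lambda>p vs. 0)"
proof -
  have l: "\<exists>c N f. p \<in> N \<and> N \<subseteq> W \<and> lexp k \<omega> c N f" if "p \<in> W" for p using assms that unfolding HF_iff by blast
  show "ed k W \<omega> \<in> HF (Suc k) W"
    unfolding HF_iff
  proof (intro conjI ballI allI impI)
    fix p assume "p \<in> W"
    then show "\<exists>c N f. p \<in> N \<and> N \<subseteq> W \<and> lexp (Suc k) (ed k W \<omega>) c N f" using l lexp_ed by metis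
  qed (auto simp: exterior_derivative_def)
  show "ed (Suc k) W (ed k W \<omega>) = (\<lambda>p vs. 0)"
  proof (intro ext)
    fix p vs
    show "ed (Suc k) W (ed k W \<omega>) p vs = 0"
    proof (cases "p \<in> W \<and> vs \<in> TL (Suc (Suc k)) p")
      case True
      then obtain c N f where N: "p \<in> N" "N \<subseteq> W" "lexp k \<omega> c N f" using l by blast
      obtain a where a: "expn n k (snd c ` N) f a" using N by (auto simp: lexp_def)
      have c: "c \<in> A" "p \<in> fst c" using N by (auto simp: lexp_def)
      show ?thesis
        using ed_value[OF lexp_ed[OF N(3,2)] N(1,2)] Dd_Dd[OF lexp_dom[OF N(3)] a _ TL_Lists[OF c]] True N(1) by auto
    qed (auto simp: exterior_derivative_def)
  qed
qed

lemma chart_polydisc: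
  assumes W: "openin X W" "p \<in> W" "W \<subseteq> fst c" and c: "c \<in> A"
  obtains r V where "r > 0" "openin X V" "p \<in> V" "V \<subseteq> W" "snd c ` V = polydisc n (snd c p) r"
proof -
  have "cdom n (snd c ` W)" using W c by (intro chart_open_image)
  then obtain r where r: "r > 0" "polydisc n (snd c p) r \<subseteq> snd c ` W"
    using dom_contains_polydisc[of n "snd c ` W" "snd c p"] W by blast
  let ?V = "{q \<in> fst c. snd c q \<in> polydisc n (snd c p) r}"
  have sub: "polydisc n (snd c p) r \<subseteq> snd c ` fst c" using r W by blast
  have pc: "p \<in> fst c" using W by blast
  have "?V \<subseteq> W"
  proof
    fix q assume q: "q \<in> ?V"
    then obtain q' where "q' \<in> W" "snd c q = snd c q'" using r by blast
    then show "q \<in> W" using q W chart_inj[OF c] by (auto dest: inj_onD)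
  qed
  moreover have "p \<in> ?V" using pc polydisc_center[OF chart_Cn[OF c pc] r(1)] by simp
  ultimately show ?thesis using that[OF r(1), of ?V] chart_open_vimage[OF c dom_polydisc sub] by blast
qed

text \<open>Closedness is given on lists of tangent vectors. By \<open>TL_exists\<close> these
  realise all lists of component vectors, so the coordinate form is closed and
  \<open>poincare\<close> applies on a coordinate polydisc.\<close>

lemma HF_locally_exact:
  assumes W: "openin X W" "p \<in> W" and \<omega>: "\<omega> \<in> HF (Suc k) W" and closed: "ed (Suc k) W \<omega> = (\<lambda>p vs. 0)"
  obtains V \<eta> where "openin X V" "p \<in> V" "V \<subseteq> W" "\<eta> \<in> HF k V" "ed k V \<eta> = (\<lambda>p vs. if p \<in> V then \<omega> p vs else 0)"
proof -
  obtain c N f where N: "p \<in> N" "N \<subseteq> W" "lexp (Suc k) \<omega> c N f" using \<omega> W(2) unfolding HF_iff by blast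
  have c: "c \<in> A" "N \<subseteq> fst c" "openin X N" using N by (auto simp: lexp_def)
  obtain r V where V: "r > 0" "openin X V" "p \<in> V" "V \<subseteq> N" "snd c ` V = polydisc n (snd c p) r"
    using chart_polydisc[OF c(3) N(1) c(2,1)] by metis
  let ?P = "polydisc n (snd c p) r"
  have f: "lexp (Suc k) \<omega> c V f" using lexp_subset[OF N(3) V(2,4)] by blast
  then obtain a where a: "expn n (Suc k) ?P f a" using V by (auto simp: lexp_def)
  have VW: "V \<subseteq> W" using V N by blast
  have pc: "p \<in> fst c" using c N by blast
  have "Dd n f z us = 0" if z: "z \<in> ?P" and us: "us \<in> Lists n (Suc (Suc k))" for z us
  proof -
    obtain q where q: "q \<in> V" "z = snd c q" using z V(5) by blast
    have qc: "q \<in> fst c" using q V c by blast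
    obtain vs where vs: "vs \<in> TL (Suc (Suc k)) q" "ev c vs = us" using TL_exists[OF c(1) qc us] by blast
    then show ?thesis using ed_value[OF f q(1) VW vs(1)] closed q(2) by simp
  qed
  then obtain g b where g: "expn n k ?P g b" "\<And>z us. \<lbrakk>z \<in> ?P; us \<in> Lists n (Suc k)\<rbrakk> \<Longrightarrow> Dd n g z us = f z us"
    using poincare[OF chart_Cn[OF c(1) pc] a] by metis
  define \<eta> where "\<eta> q vs = (if q \<in> V \<and> vs \<in> TL k q then g (snd c q) (ev c vs) else 0)" for q vs
  have l: "lexp k \<eta> c V g" using V c g(1) unfolding lexp_def \<eta>_def by auto
  show ?thesis
  proof (rule that[OF V(2,3) VW])
    show "\<eta> \<in> HF k V"
      unfolding HF_iff
    proof (intro conjI ballI allI impI)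
      show "\<exists>c N f. q \<in> N \<and> N \<subseteq> V \<and> lexp k \<eta> c N f" if "q \<in> V" for q
        using l that by (intro exI[of _ c] exI[of _ V] exI[of _ g]) simp
    qed (auto simp: \<eta>_def)
    show "ed k V \<eta> = (\<lambda>p vs. if p \<in> V then \<omega> p vs else 0)"
    proof (intro ext)
      fix q vs
      show "ed k V \<eta> q vs = (if q \<in> V then \<omega> q vs else 0)"
      proof (cases "q \<in> V \<and> vs \<in> TL (Suc k) q")
        case True
        then have q: "q \<in> fst c" "snd c q \<in> ?P" using V c by auto
        then show ?thesis using True ed_value[OF l] g(2)[OF q(2) TL_Lists[OF c(1) q(1)]] f by (auto simp: lexp_def)
      next
        case False
        then show ?thesis using \<omega> by (auto simp: exterior_derivative_def HF_iff)
      qed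
    qed
  qed
qed

lemma HF_locally_constant:
  assumes W: "openin X W" "p \<in> W" and \<omega>: "\<omega> \<in> HF 0 W" and closed: "ed 0 W \<omega> = (\<lambda>p vs. 0)"
  obtains V x where "openin X V" "p \<in> V" "V \<subseteq> W"
    "(\<lambda>p vs. if p \<in> V then \<omega> p vs else 0) = (\<lambda>p vs. if p \<in> V \<and> vs \<in> TL 0 p then x else 0)"
proof -
  obtain c N f where N: "p \<in> N" "N \<subseteq> W" "lexp 0 \<omega> c N f" using \<omega> W(2) unfolding HF_iff by blast
  have c: "c \<in> A" "N \<subseteq> fst c" "openin X N" using N by (auto simp: lexp_def)
  obtain r V where V: "r > 0" "openin X V" "p \<in> V" "V \<subseteq> N" "snd c ` V = polydisc n (snd c p) r"
    using chart_polydisc[OF c(3) N(1) c(2,1)] by metis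
  let ?P = "polydisc n (snd c p) r"
  have f: "lexp 0 \<omega> c V f" using lexp_subset[OF N(3) V(2,4)] by blast
  then obtain a where a: "expn n 0 ?P f a" using V by (auto simp: lexp_def)
  have VW: "V \<subseteq> W" using V N by blast
  have pc: "p \<in> fst c" using c N by blast
  have cl: "Dd n f z us = 0" if z: "z \<in> ?P" and us: "us \<in> Lists n 1" for z us
  proof -
    obtain q where q: "q \<in> V" "z = snd c q" using z V(5) by blast
    have qc: "q \<in> fst c" using q V c by blast
    obtain vs where vs: "vs \<in> TL (Suc 0) q" "ev c vs = us" using TL_exists[OF c(1) qc us] by auto
    then show ?thesis using ed_value[OF f q(1) VW vs(1)] closed q(2) by simp
  qed
  have "(if q \<in> V then \<omega> q vs else 0) = (if q \<in> V \<and> vs \<in> TL 0 q then f (snd c p) [] else 0)" for q vs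
  proof (cases "q \<in> V \<and> vs \<in> TL 0 q")
    case True
    then have "\<omega> q vs = f (snd c q) []" using f by (auto simp: lexp_def tangent_lists_def)
    also have "\<dots> = f (snd c p) []" using True V by (intro poincare_0[OF chart_Cn[OF c(1) pc] a cl]) auto
    finally show ?thesis using True by simp
  next
    case False
    then show ?thesis using \<omega> by (auto simp: HF_iff)
  qed
  then show ?thesis by (intro that[OF V(2,3) VW, of "f (snd c p) []"] ext)
qed

lemma HF_const:
  assumes "openin X W"
  shows "(\<lambda>p vs. if p \<in> W \<and> vs \<in> TL 0 p then x else 0) \<in> HF 0 W" (is "?\<omega> \<in> _")
    and "ed 0 W (\<lambda>p vs. if p \<in> W \<and> vs \<in> TL 0 p then x else 0) = (\<lambda>p vs. 0)"
proof -
  have l: "\<exists>c. p \<in> fst c \<inter> W \<and> lexp 0 ?\<omega> c (fst c \<inter> W) (\<lambda>z us. x) \<and> expn n 0 (snd c ` (fst c \<inter> W)) (\<lambda>z us. x) (\<lambda>I z. x)" if p: "p \<in> W" for p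
  proof -
    obtain c where c: "c \<in> A" "p \<in> fst c" using chart_at openin_subset[OF assms] p by blast
    have o: "openin X (fst c \<inter> W)" using assms chart(1)[OF c(1)] by blast
    have "expn n 0 (snd c ` (fst c \<inter> W)) (\<lambda>z us. x) (\<lambda>I z. x)"
      using chart_open_image[OF c(1) o] by (auto simp: expn_def MI_0 intro: hol_const)
    moreover from this have "lexp 0 ?\<omega> c (fst c \<inter> W) (\<lambda>z us. x)" using c o unfolding lexp_def by auto
    ultimately show ?thesis using c p by blast
  qed
  show "?\<omega> \<in> HF 0 W" unfolding HF_iff
  proof (intro conjI ballI allI impI)
    show "\<exists>c N f. p \<in> N \<and> N \<subseteq> W \<and> lexp 0 ?\<omega> c N f" if "p \<in> W" for p
      using l[OF that] by blast
  qed auto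
  show "ed 0 W ?\<omega> = (\<lambda>p vs. 0)"
  proof (intro ext)
    fix p vs
    show "ed 0 W ?\<omega> p vs = 0"
    proof (cases "p \<in> W \<and> vs \<in> TL (Suc 0) p")
      case True
      then obtain c where N: "p \<in> fst c \<inter> W" "lexp 0 ?\<omega> c (fst c \<inter> W) (\<lambda>z us. x)" using l by blast
      show ?thesis using ed_value[OF N(2,1)] True by (simp add: Dd_def)
    qed (auto simp: exterior_derivative_def)
  qed
qed

end

section \<open>Presheaves of complex functions\<close>

text \<open>The common shape of the holomorphic forms, the constants and the singular cochains, so
  that the presheaf laws are verified once for all three.\<close>

definition fpre :: "('a set \<Rightarrow> 'a form set) \<Rightarrow> ('a set \<Rightarrow> 'a set \<Rightarrow> 'a form \<Rightarrow> 'a form) \<Rightarrow> ('a, ('a, 'a form) gsec) presheaf" where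
  "fpre C r = \<lparr>sections = (\<lambda>U. \<lparr>carrier = Base ` C U,
     monoid.mult = (\<lambda>x y. Base (\<lambda>p vs. base x p vs + base y p vs)), one = Base (\<lambda>p vs. 0)\<rparr>),
     restriction = (\<lambda>U V x. Base (r U V (base x)))\<rparr>"

lemma fpre_simps [simp]:
  "Sc (fpre C r) U = Base ` C U" "one (sections (fpre C r) U) = Base (\<lambda>p vs. 0)"
  "monoid.mult (sections (fpre C r) U) = (\<lambda>x y. Base (\<lambda>p vs. base x p vs + base y p vs))"
  "restriction (fpre C r) U V x = Base (r U V (base x))"
  by (simp_all add: fpre_def)

lemma gpresheaf_fpre:
  assumes zero: "\<And>U. openin X U \<Longrightarrow> (\<lambda>p vs. 0) \<in> C U"
    and lin: "\<And>U s \<omega> \<eta>. \<lbrakk>openin X U; \<omega> \<in> C U; \<eta> \<in> C U\<rbrakk> \<Longrightarrow> (\<lambda>p vs. s * \<omega> p vs + \<eta> p vs) \<in> C U"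
    and r: "\<And>U V \<omega>. \<lbrakk>openin X U; openin X V; V \<subseteq> U; \<omega> \<in> C U\<rbrakk> \<Longrightarrow> r U V \<omega> \<in> C V"
    and rl: "\<And>U V \<omega> \<eta>. r U V (\<lambda>p vs. \<omega> p vs + \<eta> p vs) = (\<lambda>p vs. r U V \<omega> p vs + r U V \<eta> p vs)"
    and rid: "\<And>U \<omega>. \<lbrakk>openin X U; \<omega> \<in> C U\<rbrakk> \<Longrightarrow> r U U \<omega> = \<omega>"
    and rr: "\<And>U V W \<omega>. \<lbrakk>openin X U; openin X V; openin X W; V \<subseteq> U; W \<subseteq> V; \<omega> \<in> C U\<rbrakk> \<Longrightarrow> r V W (r U V \<omega>) = r U W \<omega>"
  shows "gpresheaf X (fpre C r)"
proof (intro gpresheaf.intro abpresheaf.intro)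
  show "comm_group (sections (fpre C r) U)" if U: "openin X U" for U
  proof (rule comm_groupI)
    show "x \<otimes>\<^bsub>sections (fpre C r) U\<^esub> y \<in> Sc (fpre C r) U" if "x \<in> Sc (fpre C r) U" "y \<in> Sc (fpre C r) U" for x y
      using that lin[OF U, of _ _ 1] by auto
    show "\<exists>y\<in>Sc (fpre C r) U. y \<otimes>\<^bsub>sections (fpre C r) U\<^esub> x = \<one>\<^bsub>sections (fpre C r) U\<^esub>" if "x \<in> Sc (fpre C r) U" for x
    proof -
      obtain \<omega> where \<omega>: "\<omega> \<in> C U" "x = Base \<omega>" using \<open>x \<in> _\<close> by auto
      have "(\<lambda>p vs. (-1) * \<omega> p vs + 0) \<in> C U" by (rule lin[OF U \<omega>(1) zero[OF U]])
      with \<omega> show ?thesis by (intro bexI[of _ "Base (\<lambda>p vs. (-1) * \<omega> p vs + 0)"]) auto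
    qed
  qed (use zero[OF U] in \<open>auto simp: algebra_simps\<close>)
  show "restriction (fpre C r) U V \<in> hom (sections (fpre C r) U) (sections (fpre C r) V)"
    if "openin X U" "openin X V" "V \<subseteq> U" for U V
    using r[OF that] by (intro homI) (auto simp: rl)
qed (auto simp: rid rr)

lemma gmor_fpre:
  assumes P: "gpresheaf X (fpre C r)" "gpresheaf X (fpre C' r')"
    and \<phi>: "\<And>U \<omega>. \<lbrakk>openin X U; \<omega> \<in> C U\<rbrakk> \<Longrightarrow> \<phi> U \<omega> \<in> C' U"
    and l: "\<And>U \<omega> \<eta>. \<lbrakk>openin X U; \<omega> \<in> C U; \<eta> \<in> C U\<rbrakk> \<Longrightarrow>
       \<phi> U (\<lambda>p vs. \<omega> p vs + \<eta> p vs) = (\<lambda>p vs. \<phi> U \<omega> p vs + \<phi> U \<eta> p vs)"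
    and c: "\<And>U V \<omega>. \<lbrakk>openin X U; openin X V; V \<subseteq> U; \<omega> \<in> C U\<rbrakk> \<Longrightarrow> r' U V (\<phi> U \<omega>) = \<phi> V (r U V \<omega>)"
  shows "gmor X (fpre C r) (fpre C' r') (\<lambda>U x. Base (\<phi> U (base x)))"
  using assms by (intro gmor.intro) (auto simp: pshom_def hom_def)

text \<open>The constant presheaf, with all of \<open>\<complex>\<close> as sections over every open
  set, the empty one included. It is not a sheaf, but local exactness and \<open>C^p\<close> depend
  only on its germs.\<close>

definition CC :: "('a, ('a, 'a form) gsec) presheaf" where
  "CC = fpre (\<lambda>U. {\<omega>. \<exists>c. \<omega> = (\<lambda>p vs. c)}) (\<lambda>U V \<omega>. \<omega>)"

lemma gpresheaf_CC: "gpresheaf X CC"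
  unfolding CC_def by (rule gpresheaf_fpre) auto

lemma gmor_scale:
  assumes P: "gpresheaf X (fpre C r)"
    and \<phi>: "\<And>U \<omega>. \<lbrakk>openin X U; \<omega> \<in> C U\<rbrakk> \<Longrightarrow> (\<lambda>p vs. s * \<omega> p vs) \<in> C U"
    and c: "\<And>U V \<omega>. \<lbrakk>openin X U; openin X V; V \<subseteq> U; \<omega> \<in> C U\<rbrakk> \<Longrightarrow>
      (\<lambda>p vs. s * r U V \<omega> p vs) = r U V (\<lambda>p vs. s * \<omega> p vs)"
  shows "gmor X (fpre C r) (fpre C r) (scale_Omega s)"
proof -
  have e: "scale_Omega s = (\<lambda>U x. Base ((\<lambda>U \<omega> p vs. s * \<omega> p vs) U (base x)))"
    by (simp add: scale_Omega_def fun_eq_iff)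
  show ?thesis unfolding e using \<phi> c by (intro gmor_fpre[OF P P]) (auto simp: distrib_left)
qed

lemma gmor_scale_CC: "gmor X CC CC (scale_Omega s)"
  unfolding CC_def by (rule gmor_scale[OF gpresheaf_CC[unfolded CC_def]]) auto

context cmanifold
begin

lemma Omega_fpre: "Omega n X A k = fpre (HF k) (\<lambda>U V \<omega> p vs. if p \<in> V then \<omega> p vs else 0)"
  by (simp add: Omega_def fpre_def)

lemma gpresheaf_Omega: "gpresheaf X (Omega n X A k)"
  unfolding Omega_fpre
proof (rule gpresheaf_fpre)
  show "(\<lambda>p vs. if p \<in> U then \<omega> p vs else 0) = \<omega>" if "\<omega> \<in> HF k U" for U \<omega>
    using that unfolding HF_iff by (auto simp: fun_eq_iff)
qed (auto simp: HF_zero HF_res HF_lin fun_eq_iff)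

lemma gmor_scale_Omega: "gmor X (Omega n X A k) (Omega n X A k) (scale_Omega s)"
  unfolding Omega_fpre
proof (rule gmor_scale[OF gpresheaf_Omega[unfolded Omega_fpre]])
  show "(\<lambda>p vs. s * \<omega> p vs) \<in> HF k U" if "openin X U" "\<omega> \<in> HF k U" for U \<omega>
    using HF_lin(1)[OF that(2) HF_zero[OF that(1)]] by simp
qed (auto simp: fun_eq_iff)

lemma ed_zero: "openin X W \<Longrightarrow> ed k W (\<lambda>p vs. 0) = (\<lambda>p vs. 0)"
  using HF_lin(2)[OF HF_zero HF_zero, of W k "-1"] by simp

lemma gmor_d_Omega: "gmor X (Omega n X A k) (Omega n X A (Suc k)) (d_Omega n X A k)"
proof -
  have e: "d_Omega n X A k = (\<lambda>U x. Base (ed k U (base x)))" by (simp add: d_Omega_def fun_eq_iff)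
  show ?thesis
    unfolding e Omega_fpre
  proof (rule gmor_fpre[OF gpresheaf_Omega[unfolded Omega_fpre] gpresheaf_Omega[unfolded Omega_fpre]])
    show "ed k U (\<lambda>p vs. \<omega> p vs + \<eta> p vs) = (\<lambda>p vs. ed k U \<omega> p vs + ed k U \<eta> p vs)"
      if "\<omega> \<in> HF k U" "\<eta> \<in> HF k U" for U \<omega> \<eta>
      using HF_lin(2)[OF that, of 1] by simp
  qed (auto simp: HF_res(2) HF_ed)
qed

text \<open>The inclusion of constants into holomorphic functions. The case distinction supplies the
  zero values that \<open>holomorphic_forms\<close> prescribes off \<open>U\<close> and off lists of
  tangent vectors.\<close>

definition eps :: "'a set \<Rightarrow> ('a, 'a form) gsec \<Rightarrow> ('a, 'a form) gsec" where
  "eps U x = Base (\<lambda>p vs. if p \<in> U \<and> vs \<in> TL 0 p then base x p vs else 0)"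

text \<open>The augmented complex, shifted as \<open>locally_exact\<close> expects: constants at
  index 0, holomorphic \<open>q\<close>-forms at index \<open>q + 1\<close>.\<close>

definition FO :: "nat \<Rightarrow> ('a, ('a, 'a form) gsec) presheaf" where
  "FO = case_nat CC (Omega n X A)"

definition dO :: "nat \<Rightarrow> 'a set \<Rightarrow> ('a, 'a form) gsec \<Rightarrow> ('a, 'a form) gsec" where
  "dO = case_nat eps (d_Omega n X A)"

lemma gmor_eps: "gmor X CC (Omega n X A 0) eps"
proof -
  have e: "eps = (\<lambda>U x. Base ((\<lambda>U \<omega> p vs. if p \<in> U \<and> vs \<in> TL 0 p then \<omega> p vs else 0) U (base x)))"
    by (simp add: eps_def fun_eq_iff)
  show ?thesis
    unfolding e CC_def Omega_fpre
    by (rule gmor_fpre[OF gpresheaf_CC[unfolded CC_def] gpresheaf_Omega[unfolded Omega_fpre]])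
      (use HF_const(1) in \<open>auto cong: if_cong intro!: ext\<close>)
qed

lemma locally_exact_Omega: "locally_exact X FO dO"
proof -
  note S = FO_def dO_def Omega_fpre
  show ?thesis
    unfolding locally_exact_def presheaf_complex_def
  proof (intro conjI allI impI)
    show "gmor X (FO q) (FO (Suc q)) (dO q)" for q
      by (cases q) (simp_all add: FO_def dO_def gmor_eps gmor_d_Omega)
    show "dO (Suc q) U (dO q U s) = \<one>\<^bsub>sections (FO (Suc (Suc q))) U\<^esub>" if "openin X U" "s \<in> Sc (FO q) U" for q U s
    proof (cases q)
      case 0
      then show ?thesis using that by (auto simp: S CC_def d_Omega_def eps_def HF_const(2) cong: if_cong)
    next
      case (Suc j)
      then show ?thesis using that by (auto simp: S d_Omega_def HF_ed)
    qed
    show "\<exists>V. openin X V \<and> p \<in> V \<and> V \<subseteq> U \<and> restriction (FO 0) U V s = \<one>\<^bsub>sections (FO 0) V\<^esub>"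
      if U: "openin X U" "p \<in> U" and s: "s \<in> Sc (FO 0) U" and z: "dO 0 U s = \<one>\<^bsub>sections (FO 1) U\<^esub>" for U s p
    proof -
      obtain c where c: "s = Base (\<lambda>p vs. c)" using s by (auto simp: S CC_def)
      have "(\<lambda>p vs. if p \<in> U \<and> vs \<in> TL 0 p then c else 0) = (\<lambda>p vs. 0)"
        using z by (simp add: S eps_def c cong: if_cong)
      from fun_cong[OF fun_cong[OF this, of p], of "[]"] U have "c = 0" by (simp add: tangent_lists_def)
      then show ?thesis using U by (intro exI[of _ U]) (auto simp: c S CC_def)
    qed
    show "\<exists>V t. openin X V \<and> p \<in> V \<and> V \<subseteq> U \<and> t \<in> Sc (FO q) V \<and> dO q V t = restriction (FO (Suc q)) U V s"
      if U: "openin X U" "p \<in> U" and s: "s \<in> Sc (FO (Suc q)) U"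
        and z: "dO (Suc q) U s = \<one>\<^bsub>sections (FO (Suc (Suc q))) U\<^esub>" for q U s p
    proof -
      obtain \<omega> where \<omega>: "\<omega> \<in> HF q U" "s = Base \<omega>" using s by (auto simp: S)
      have cl: "ed q U \<omega> = (\<lambda>p vs. 0)" using z by (simp add: S d_Omega_def \<omega>)
      show ?thesis
      proof (cases q)
        case 0
        obtain V x where V: "openin X V" "p \<in> V" "V \<subseteq> U"
            "(\<lambda>p vs. if p \<in> V then \<omega> p vs else 0) = (\<lambda>p vs. if p \<in> V \<and> vs \<in> TL 0 p then x else 0)"
          using HF_locally_constant[OF U \<omega>(1)[unfolded 0] cl[unfolded 0]] by blast
        then show ?thesis unfolding 0
          by (intro exI[of _ V] exI[of _ "Base (\<lambda>p vs. x)"]) (auto simp: S CC_def eps_def \<omega> cong: if_cong)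
      next
        case (Suc j)
        obtain V \<eta> where V: "openin X V" "p \<in> V" "V \<subseteq> U" "\<eta> \<in> HF j V" "ed j V \<eta> = (\<lambda>p vs. if p \<in> V then \<omega> p vs else 0)"
          using HF_locally_exact[OF U \<omega>(1)[unfolded Suc] cl[unfolded Suc]] by blast
        then show ?thesis unfolding Suc
          by (intro exI[of _ V] exI[of _ "Base \<eta>"]) (auto simp: S d_Omega_def \<omega>)
      qed
    qed
  qed
qed

lemma scale_FO:
  "gmor X (FO q) (FO q) (scale_Omega s)"
  "\<lbrakk>openin X U; x \<in> Sc (FO q) U\<rbrakk> \<Longrightarrow> scale_Omega s U (dO q U x) = dO q U (scale_Omega s U x)"
proof -
  show "gmor X (FO q) (FO q) (scale_Omega s)"
    by (cases q) (simp_all add: FO_def gmor_scale_CC gmor_scale_Omega)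
  assume U: "openin X U" and x: "x \<in> Sc (FO q) U"
  show "scale_Omega s U (dO q U x) = dO q U (scale_Omega s U x)"
  proof (cases q)
    case 0
    then show ?thesis using x by (auto simp: FO_def dO_def CC_def scale_Omega_def eps_def fun_eq_iff)
  next
    case (Suc j)
    then obtain \<omega> where \<omega>: "\<omega> \<in> HF j U" "x = Base \<omega>" using x by (auto simp: FO_def Omega_fpre)
    show ?thesis using HF_lin(2)[OF \<omega>(1) HF_zero[OF U], of s] ed_zero[OF U, of j]
      by (simp add: Suc dO_def scale_Omega_def d_Omega_def \<omega>)
  qed
qed

end

section \<open>Additive functions on integral chains\<close>

definition evl :: "('b \<Rightarrow> complex) \<Rightarrow> ('b \<Rightarrow>\<^sub>0 int) \<Rightarrow> complex" where
  "evl f c = (\<Sum>x\<in>Poly_Mapping.keys c. of_int (Poly_Mapping.lookup c x) * f x)"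

lemma evl_superset:
  assumes "finite S" "Poly_Mapping.keys c \<subseteq> S"
  shows "evl f c = (\<Sum>x\<in>S. of_int (Poly_Mapping.lookup c x) * f x)"
  unfolding evl_def using assms by (intro sum.mono_neutral_left) (auto simp: in_keys_iff)

lemma evl_diff: "evl f (c - d) = evl f c - evl f d"
proof -
  let ?S = "Poly_Mapping.keys c \<union> Poly_Mapping.keys d"
  have "evl f (c - d) = (\<Sum>x\<in>?S. of_int (Poly_Mapping.lookup (c - d) x) * f x)"
    using keys_diff[of c d] by (intro evl_superset) auto
  also have "\<dots> = (\<Sum>x\<in>?S. of_int (Poly_Mapping.lookup c x) * f x) - (\<Sum>x\<in>?S. of_int (Poly_Mapping.lookup d x) * f x)"
    by (simp add: lookup_minus algebra_simps sum_subtractf)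
  finally show ?thesis using evl_superset[of ?S c f] evl_superset[of ?S d f] by simp
qed

lemma evl_0 [simp]: "evl f 0 = 0" by (simp add: evl_def)

lemma evl_of [simp]: "evl f (frag_of x) = f x"
  by (simp add: evl_def)

lemma evl_add: "evl f (c + d) = evl f c + evl f d"
  using evl_diff[of f c "-d"] evl_diff[of f 0 d] by simp

lemma evl_cong: "(\<And>x. x \<in> Poly_Mapping.keys c \<Longrightarrow> f x = g x) \<Longrightarrow> evl f c = evl g c"
  by (simp add: evl_def)

lemma evl_zero: "(\<And>x. x \<in> Poly_Mapping.keys c \<Longrightarrow> f x = 0) \<Longrightarrow> evl f c = 0"
  by (simp add: evl_def)

lemma evl_lin: "evl (\<lambda>x. s * f x + g x) c = s * evl f c + evl g c"
  by (simp add: evl_def sum.distrib sum_distrib_left algebra_simps)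

lemma additive_eqI:
  fixes F G :: "('b \<Rightarrow>\<^sub>0 int) \<Rightarrow> 'c::ab_group_add"
  assumes "\<And>x y. \<lbrakk>Poly_Mapping.keys x \<subseteq> S; Poly_Mapping.keys y \<subseteq> S\<rbrakk> \<Longrightarrow> F (x - y) = F x - F y"
    and "\<And>x y. \<lbrakk>Poly_Mapping.keys x \<subseteq> S; Poly_Mapping.keys y \<subseteq> S\<rbrakk> \<Longrightarrow> G (x - y) = G x - G y"
    and "\<And>x. x \<in> S \<Longrightarrow> F (frag_of x) = G (frag_of x)" and "Poly_Mapping.keys c \<subseteq> S"
  shows "F c = G c"
proof -
  have "Poly_Mapping.keys c \<subseteq> S \<and> F c = G c"
    using assms(4)
  proof (induction rule: frag_induction)
    case zero
    show ?case using assms(1)[of 0 0] assms(2)[of 0 0] by simp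
  next
    case (diff a b)
    then show ?case using assms(1,2) keys_diff[of a b] by auto
  qed (use assms(3) in auto)
  then show ?thesis by simp
qed

text \<open>Zorn's lemma; an extension to one more chain exists because \<open>\<complex>\<close> is divisible.\<close>

lemma additive_extension:
  fixes H :: "('b \<Rightarrow>\<^sub>0 int) set" and f :: "('b \<Rightarrow>\<^sub>0 int) \<Rightarrow> complex"
  assumes H0: "0 \<in> H" and Hd: "\<And>x y. \<lbrakk>x \<in> H; y \<in> H\<rbrakk> \<Longrightarrow> x - y \<in> H"
    and f: "\<And>x y. \<lbrakk>x \<in> H; y \<in> H\<rbrakk> \<Longrightarrow> f (x - y) = f x - f y"
  obtains g where "\<And>x. x \<in> H \<Longrightarrow> evl g x = f x"
proof -
  \<comment> \<open>Extensions of \<open>f\<close> are represented by their graphs, as subgroups;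
    single-valuedness then only has to be required at \<open>0\<close>.\<close>
  define P where "P \<Gamma> \<longleftrightarrow> (\<lambda>x. (x, f x)) ` H \<subseteq> \<Gamma> \<and> (\<forall>a b c d. (a, b) \<in> \<Gamma> \<longrightarrow> (c, d) \<in> \<Gamma> \<longrightarrow> (a - c, b - d) \<in> \<Gamma>) \<and>
     (\<forall>b. (0, b) \<in> \<Gamma> \<longrightarrow> b = 0)" for \<Gamma> :: "(('b \<Rightarrow>\<^sub>0 int) \<times> complex) set"
  have f0: "f 0 = 0" using f[OF H0 H0] by simp
  have ch: "P (\<Union>C)" if "subset.chain (Collect P) C" "C \<noteq> {}" for C
  proof -
    have "\<exists>A\<in>C. x \<in> A \<and> y \<in> A" if xy: "x \<in> \<Union>C" "y \<in> \<Union>C" for x y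
    proof -
      obtain A where "A \<in> C" "x \<in> A" using xy(1) by (rule UnionE)
      moreover obtain B where "B \<in> C" "y \<in> B" using xy(2) by (rule UnionE)
      ultimately have "A \<subseteq> B \<or> B \<subseteq> A" using \<open>subset.chain _ _\<close> \<open>A \<in> C\<close> \<open>B \<in> C\<close> by (auto simp: subset_chain_def)
      then show ?thesis using \<open>A \<in> C\<close> \<open>x \<in> A\<close> \<open>B \<in> C\<close> \<open>y \<in> B\<close> by blast
    qed
    moreover have CP: "P A" if "A \<in> C" for A using \<open>subset.chain _ _\<close> that by (auto simp: subset_chain_def)
    ultimately have "(a - c, b - d) \<in> \<Union>C" if "(a, b) \<in> \<Union>C" "(c, d) \<in> \<Union>C" for a b c d
      using that unfolding P_def by (meson Union_iff)
    moreover have "(\<lambda>x. (x, f x)) ` H \<subseteq> \<Union>C"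
      using CP \<open>C \<noteq> {}\<close> unfolding P_def by blast
    moreover have "b = 0" if "(0, b) \<in> \<Union>C" for b using CP that unfolding P_def by blast
    ultimately show ?thesis unfolding P_def by blast
  qed
  have "P ((\<lambda>x. (x, f x)) ` H)" using Hd f f0 by (auto simp: P_def)
  then have "\<exists>M\<in>Collect P. \<forall>X\<in>Collect P. M \<subseteq> X \<longrightarrow> X = M"
    by (intro subset_Zorn_nonempty) (use ch in auto)
  then obtain \<Gamma> where \<Gamma>: "P \<Gamma>" and max: "\<And>X. \<lbrakk>P X; \<Gamma> \<subseteq> X\<rbrakk> \<Longrightarrow> X = \<Gamma>" by auto
  have z: "(0, 0) \<in> \<Gamma>" using \<Gamma> H0 f0 unfolding P_def by (metis (no_types, lifting) image_eqI subsetD)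
  have d: "(a - c, b - d) \<in> \<Gamma>" if "(a, b) \<in> \<Gamma>" "(c, d) \<in> \<Gamma>" for a b c d
    using \<Gamma> that unfolding P_def by blast
  have u: "b = 0" if "(0, b) \<in> \<Gamma>" for b using \<Gamma> that unfolding P_def by blast
  have u': "b = d" if "(a, b) \<in> \<Gamma>" "(a, d) \<in> \<Gamma>" for a b d
    using u[of "b - d"] d[OF that] by simp
  have s: "(a + c, b + d) \<in> \<Gamma>" if "(a, b) \<in> \<Gamma>" "(c, d) \<in> \<Gamma>" for a b c d
    using d[OF that(1) d[OF z that(2)]] by simp
  have m: "(frag_cmul n a, of_int n * b) \<in> \<Gamma>" if "(a, b) \<in> \<Gamma>" for n a b
  proof (induction n rule: int_induct[where k = 0])
    case base
    show ?case using z by simp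
  next
    case (step1 i)
    show ?case using s[OF step1(2) that] by (simp add: frag_cmul_distrib algebra_simps)
  next
    case (step2 i)
    show ?case using d[OF step2(2) that] by (simp add: frag_cmul_diff_distrib algebra_simps)
  qed
  have total: "\<exists>y. (x, y) \<in> \<Gamma>" for x
  proof -
    \<comment> \<open>The value \<open>c\<close> at the new chain \<open>x\<close> is forced if a
      nonzero multiple of \<open>x\<close> already has a value, and is found by division in
      \<open>\<complex>\<close>. Otherwise any value works and \<open>0\<close> is taken.\<close>
    obtain c where c: "\<And>n y. (frag_cmul n x, y) \<in> \<Gamma> \<Longrightarrow> y = of_int n * c"
    proof (cases "\<exists>n y. n \<noteq> 0 \<and> (frag_cmul n x, y) \<in> \<Gamma>")
      case True
      then obtain k w where k: "k \<noteq> 0" "(frag_cmul k x, w) \<in> \<Gamma>" by blast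
      have "y = of_int n * (w / of_int k)" if "(frag_cmul n x, y) \<in> \<Gamma>" for n y
        using u'[OF m[OF that, of k] m[OF k(2), of n, simplified frag_cmul_cmul mult.commute[of n k], folded frag_cmul_cmul]] k(1)
        by (simp add: field_simps)
      then show ?thesis using that by blast
    next
      case False
      then have "y = of_int n * 0" if "(frag_cmul n x, y) \<in> \<Gamma>" for n y
        using that u[of y] by (cases "n = 0") auto
      then show ?thesis using that by blast
    qed
    define \<Gamma>' where "\<Gamma>' = {(a + frag_cmul n x, b + of_int n * c) |a b n. (a, b) \<in> \<Gamma>}"
    have sub: "\<Gamma> \<subseteq> \<Gamma>'"
    proof
      fix z assume "z \<in> \<Gamma>"
      then show "z \<in> \<Gamma>'" unfolding \<Gamma>'_def
        by (cases z) (auto intro!: exI[of _ "fst z"] exI[of _ "snd z"] exI[of _ "0::int"])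
    qed
    have "P \<Gamma>'"
      unfolding P_def
    proof (intro conjI allI impI)
      show "(\<lambda>x. (x, f x)) ` H \<subseteq> \<Gamma>'" using \<Gamma> sub unfolding P_def by blast
      show "(a1 - a2, b1 - b2) \<in> \<Gamma>'" if g: "(a1, b1) \<in> \<Gamma>'" "(a2, b2) \<in> \<Gamma>'" for a1 b1 a2 b2
      proof -
        obtain h y n where 1: "a1 = h + frag_cmul n x" "b1 = y + of_int n * c" "(h, y) \<in> \<Gamma>" using g(1) by (auto simp: \<Gamma>'_def)
        obtain h' y' n' where 2: "a2 = h' + frag_cmul n' x" "b2 = y' + of_int n' * c" "(h', y') \<in> \<Gamma>" using g(2) by (auto simp: \<Gamma>'_def)
        show ?thesis unfolding \<Gamma>'_def using d[OF 1(3) 2(3)]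
          by (intro CollectI exI[of _ "h - h'"] exI[of _ "y - y'"] exI[of _ "n - n'"])
            (simp add: 1 2 frag_cmul_diff_distrib algebra_simps)
      qed
      show "b = 0" if b: "(0, b) \<in> \<Gamma>'" for b
      proof -
        obtain h y n where 1: "0 = h + frag_cmul n x" "b = y + of_int n * c" "(h, y) \<in> \<Gamma>"
          using b unfolding \<Gamma>'_def by blast
        have "h = frag_cmul (-n) x" using 1(1) by (metis add_eq_0_iff2 minus_frag_cmul)
        then show ?thesis using c[of "-n" y] 1 by simp
      qed
    qed
    then have "\<Gamma>' = \<Gamma>" using max sub by blast
    moreover have "(x, c) \<in> \<Gamma>'"
      unfolding \<Gamma>'_def using z by (intro CollectI exI[of _ 0] exI[of _ 1]) auto
    ultimately show ?thesis by blast
  qed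
  define F where "F x = (SOME y. (x, y) \<in> \<Gamma>)" for x
  have F: "(x, F x) \<in> \<Gamma>" for x unfolding F_def using total by (rule someI_ex)
  have "evl (\<lambda>x. F (frag_of x)) x = F x" for x
    by (rule additive_eqI[of UNIV]) (use u'[OF F d[OF F F]] in \<open>auto simp: evl_diff\<close>)
  moreover have "F x = f x" if "x \<in> H" for x
    using u'[OF F[of x], of "f x"] \<Gamma> that unfolding P_def by blast
  ultimately show ?thesis using that by metis
qed

text \<open>The value \<open>evl f c\<close> is well defined on \<open>D c + b\<close> because
  \<open>f\<close> kills every chain of \<open>C\<close> that \<open>D\<close> sends into
  \<open>B\<close>; then it is extended from this subgroup. \<open>B = 0\<close> yields primitives
  on contractible sets, \<open>B\<close> = small chains yields primitives that vanish
  locally.\<close>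

lemma additive_factor:
  fixes C :: "('b \<Rightarrow>\<^sub>0 int) set" and B :: "('c \<Rightarrow>\<^sub>0 int) set"
  assumes C0: "0 \<in> C" and Cd: "\<And>x y. \<lbrakk>x \<in> C; y \<in> C\<rbrakk> \<Longrightarrow> x - y \<in> C"
    and B0: "0 \<in> B" and Bd: "\<And>x y. \<lbrakk>x \<in> B; y \<in> B\<rbrakk> \<Longrightarrow> x - y \<in> B"
    and D: "\<And>x y. D (x - y) = D x - D y"
    and f: "\<And>c. \<lbrakk>c \<in> C; D c \<in> B\<rbrakk> \<Longrightarrow> evl f c = 0"
  obtains g where "\<And>c. c \<in> C \<Longrightarrow> evl g (D c) = evl f c" "\<And>b. b \<in> B \<Longrightarrow> evl g b = 0"
proof -
  define H where "H = {D c + b |c b. c \<in> C \<and> b \<in> B}"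
  define h where "h x = (SOME y. \<exists>c\<in>C. \<exists>b\<in>B. x = D c + b \<and> y = evl f c)" for x
  have D0: "D 0 = 0" using D[of 0 0] by simp
  have h: "h (D c + b) = evl f c" if "c \<in> C" "b \<in> B" for c b
  proof -
    have "\<exists>c'\<in>C. \<exists>b'\<in>B. D c + b = D c' + b' \<and> h (D c + b) = evl f c'"
      unfolding h_def by (rule someI_ex) (use that in blast)
    then obtain c' b' where c': "c' \<in> C" "b' \<in> B" "D c + b = D c' + b'" "h (D c + b) = evl f c'" by blast
    have "D (c' - c) = b - b'" using c'(3) by (simp add: D algebra_simps)
    then have "evl f (c' - c) = 0" using f[of "c' - c"] Cd Bd that c' by simp
    then show ?thesis using c' by (simp add: evl_diff)
  qed
  have "0 \<in> H \<and> (\<forall>x\<in>H. \<forall>y\<in>H. x - y \<in> H \<and> h (x - y) = h x - h y)"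
  proof (intro conjI ballI)
    show "0 \<in> H" unfolding H_def using C0 B0 D0 by (intro CollectI exI[of _ 0]) auto
    fix x y assume "x \<in> H" "y \<in> H"
    then obtain c b c' b' where cb: "x = D c + b" "c \<in> C" "b \<in> B" "y = D c' + b'" "c' \<in> C" "b' \<in> B"
      unfolding H_def by auto
    have e: "x - y = D (c - c') + (b - b')" by (simp add: cb D algebra_simps)
    show "x - y \<in> H" unfolding H_def e using cb Cd Bd by blast
    show "h (x - y) = h x - h y" unfolding e using cb Cd Bd by (simp add: h evl_diff)
  qed
  then obtain g where g: "\<And>x. x \<in> H \<Longrightarrow> evl g x = h x"
    using additive_extension[of H h] by blast
  show ?thesis
  proof (rule that[of g])
    show "evl g (D c) = evl f c" if "c \<in> C" for c
    proof -
      have "D c + 0 \<in> H" unfolding H_def using that B0 by blast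
      then show ?thesis using g[of "D c + 0"] h[OF that B0] by simp
    qed
    show "evl g b = 0" if "b \<in> B" for b
    proof -
      have "D 0 + b \<in> H" unfolding H_def using that C0 by blast
      then show ?thesis using g[of "D 0 + b"] h[OF C0 that] D0 by simp
    qed
  qed
qed

section \<open>Presheaves of singular cochains\<close>

text \<open>A map \<open>\<sigma>\<close> from sequences of reals to the manifold is coded by the tangent vector which is \<open>1\<close>
  exactly at the pseudo-charts \<open>({\<sigma> t}, t)\<close>. Singular cochains thereby become forms in the sense of
  the type, so that they and the holomorphic forms are sections of presheaves of one and the same type.\<close>

definition dec :: "'a tangent list \<Rightarrow> (nat \<Rightarrow> real) \<Rightarrow> 'a" where
  "dec vs t = (SOME x. hd vs ({x}, \<lambda>_ i. complex_of_real (t i)) 0 = 1)"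

lemma surj_dec: "surj dec"
proof (rule surjI)
  fix \<sigma> :: "(nat \<Rightarrow> real) \<Rightarrow> 'a"
  let ?v = "\<lambda>c i. if \<exists>t. c = ({\<sigma> t}, \<lambda>_ i. complex_of_real (t i)) then 1 else (0::complex)"
  have "(SOME x. ?v ({x}, \<lambda>_ i. complex_of_real (t i)) 0 = 1) = \<sigma> t" for t
  proof (rule some_equality)
    fix x assume "?v ({x}, \<lambda>_ i. complex_of_real (t i)) 0 = 1"
    then obtain t' where t': "x = \<sigma> t'" "\<forall>i. complex_of_real (t i) = complex_of_real (t' i)"
      by (auto simp: fun_eq_iff split: if_splits)
    then have "t = t'" by (auto simp: fun_eq_iff)
    then show "x = \<sigma> t" using t'(1) by simp
  qed auto
  then show "dec [?v] = \<sigma>" by (simp add: dec_def fun_eq_iff)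
qed

definition enc :: "(((nat \<Rightarrow> real) \<Rightarrow> 'a) \<Rightarrow> complex) \<Rightarrow> 'a form" where "enc f = (\<lambda>p vs. f (dec vs))"

text \<open>Left inverse of \<open>enc\<close>. The point is arbitrary, since encoded cochains do
  not depend on it, and any code of \<open>\<sigma>\<close> will do.\<close>

definition unc :: "'a form \<Rightarrow> ((nat \<Rightarrow> real) \<Rightarrow> 'a) \<Rightarrow> complex" where "unc \<omega> = (\<lambda>\<sigma>. \<omega> undefined (inv_into UNIV dec \<sigma>))"

lemma unc_enc [simp]: "unc (enc f) = f"
  by (simp add: unc_def enc_def surj_f_inv_f[OF surj_dec])

lemma enc_eq_iff [simp]: "enc f = enc g \<longleftrightarrow> f = g"
  using unc_enc by metis

lemma enc_add: "(\<lambda>p vs. enc f p vs + enc g p vs) = enc (\<lambda>\<sigma>. f \<sigma> + g \<sigma>)"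
  and enc_scale: "(\<lambda>p vs. s * enc f p vs) = enc (\<lambda>\<sigma>. s * f \<sigma>)"
  and enc_lin: "(\<lambda>p vs. s * enc f p vs + enc g p vs) = enc (\<lambda>\<sigma>. s * f \<sigma> + g \<sigma>)"
  and enc_zero: "(\<lambda>p vs. 0) = enc (\<lambda>\<sigma>. 0)"
  by (simp_all add: enc_def)

abbreviation Sx :: "'a topology \<Rightarrow> nat \<Rightarrow> 'a set \<Rightarrow> ((nat \<Rightarrow> real) \<Rightarrow> 'a) set" where
  "Sx X q U \<equiv> Collect (singular_simplex q (subtopology X U))"

text \<open>Cochains are functions on all maps. Setting them to \<open>0\<close> off the simplices
  in \<open>U\<close> makes equality of sections mean equality on simplices.\<close>

definition CS :: "'a topology \<Rightarrow> nat \<Rightarrow> 'a set \<Rightarrow> (((nat \<Rightarrow> real) \<Rightarrow> 'a) \<Rightarrow> complex) set" where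
  "CS X q U = {f. \<forall>\<sigma>. \<sigma> \<notin> Sx X q U \<longrightarrow> f \<sigma> = 0}"

definition cutc :: "'a topology \<Rightarrow> nat \<Rightarrow> 'a set \<Rightarrow> (((nat \<Rightarrow> real) \<Rightarrow> 'a) \<Rightarrow> complex) \<Rightarrow> ((nat \<Rightarrow> real) \<Rightarrow> 'a) \<Rightarrow> complex" where
  "cutc X q U f = (\<lambda>\<sigma>. if \<sigma> \<in> Sx X q U then f \<sigma> else 0)"

definition db :: "'a topology \<Rightarrow> nat \<Rightarrow> 'a set \<Rightarrow> (((nat \<Rightarrow> real) \<Rightarrow> 'a) \<Rightarrow> complex) \<Rightarrow> ((nat \<Rightarrow> real) \<Rightarrow> 'a) \<Rightarrow> complex" where
  "db X q U f = cutc X (Suc q) U (\<lambda>\<sigma>. evl f (chain_boundary (Suc q) (frag_of \<sigma>)))"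

definition SS :: "'a topology \<Rightarrow> nat \<Rightarrow> ('a, ('a, 'a form) gsec) presheaf" where
  "SS X q = fpre (\<lambda>U. enc ` CS X q U) (\<lambda>U V \<omega>. enc (cutc X q V (unc \<omega>)))"

definition dS :: "'a topology \<Rightarrow> nat \<Rightarrow> 'a set \<Rightarrow> ('a, 'a form) gsec \<Rightarrow> ('a, 'a form) gsec" where
  "dS X q U x = Base (enc (db X q U (unc (base x))))"

definition eS :: "'a topology \<Rightarrow> 'a set \<Rightarrow> ('a, 'a form) gsec \<Rightarrow> ('a, 'a form) gsec" where
  "eS X U x = Base (enc (cutc X 0 U (\<lambda>\<sigma>. base x undefined undefined)))"

lemma Sx_mono: "V \<subseteq> U \<Longrightarrow> \<sigma> \<in> Sx X q V \<Longrightarrow> \<sigma> \<in> Sx X q U"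
  using singular_simplex_mono by blast

lemma Sx_iff: "\<sigma> \<in> Sx X q U \<longleftrightarrow> singular_simplex q X \<sigma> \<and> \<sigma> ` standard_simplex q \<subseteq> U"
  by (simp add: singular_simplex_subtopology)

lemma cut_CS [simp]: "cutc X q U f \<in> CS X q U" by (simp add: cutc_def CS_def)

lemma cut_id: "f \<in> CS X q U \<Longrightarrow> cutc X q U f = f"
  by (fastforce simp add: cutc_def CS_def)

lemma cut_cut: "W \<subseteq> V \<Longrightarrow> cutc X q W (cutc X q V f) = cutc X q W f"
  by (auto simp: cutc_def fun_eq_iff dest: singular_simplex_mono)

lemma cut_lin: "cutc X q U (\<lambda>\<sigma>. s * f \<sigma> + g \<sigma>) = (\<lambda>\<sigma>. s * cutc X q U f \<sigma> + cutc X q U g \<sigma>)"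
  by (auto simp: cutc_def)

lemma evl_cut: "singular_chain q (subtopology X U) c \<Longrightarrow> evl (cutc X q U f) c = evl f c"
  by (rule evl_cong) (auto simp: cutc_def singular_chain_def)

lemma evl_db:
  assumes "singular_chain (Suc q) (subtopology X U) c"
  shows "evl (db X q U f) c = evl f (chain_boundary (Suc q) c)"
  by (rule additive_eqI[of "Sx X (Suc q) U" "evl (db X q U f)" "\<lambda>c. evl f (chain_boundary (Suc q) c)"])
    (use assms in \<open>auto simp: evl_diff chain_boundary_diff db_def cutc_def singular_chain_def\<close>)

lemma db_lin: "db X q U (\<lambda>\<sigma>. s * f \<sigma> + g \<sigma>) = (\<lambda>\<sigma>. s * db X q U f \<sigma> + db X q U g \<sigma>)"
  by (simp add: db_def evl_lin cut_lin)

lemma db_CS [simp]: "db X q U f \<in> CS X (Suc q) U" by (simp add: db_def)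

text \<open>The faces of a simplex in \<open>V\<close> lie in \<open>V\<close>, so cutting off does
  not affect the values on its boundary.\<close>

lemma db_cut: "V \<subseteq> U \<Longrightarrow> db X q V (cutc X q V f) = cutc X (Suc q) V (db X q U f)"
proof -
  assume "V \<subseteq> U"
  have "evl (cutc X q V f) (chain_boundary (Suc q) (frag_of \<sigma>)) = evl f (chain_boundary (Suc q) (frag_of \<sigma>))"
    if "\<sigma> \<in> Sx X (Suc q) V" for \<sigma>
    using that by (intro evl_cut singular_chain_boundary_alt) (simp add: singular_chain_of)
  then have "db X q V (cutc X q V f) = cutc X (Suc q) V (\<lambda>\<sigma>. evl f (chain_boundary (Suc q) (frag_of \<sigma>)))"
    by (auto simp: db_def cutc_def fun_eq_iff)
  then show ?thesis using \<open>V \<subseteq> U\<close> by (simp add: db_def cut_cut)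
qed

lemma db_db: "db X (Suc q) U (db X q U f) = (\<lambda>\<sigma>. 0)"
proof
  fix \<sigma>
  have "evl (db X q U f) (chain_boundary (Suc (Suc q)) (frag_of \<sigma>)) = 0" if "\<sigma> \<in> Sx X (Suc (Suc q)) U"
  proof -
    have c: "singular_chain (Suc (Suc q)) (subtopology X U) (frag_of \<sigma>)" using that by (simp add: singular_chain_of)
    show ?thesis
      using chain_boundary_boundary_alt[OF c] by (simp add: evl_db[OF singular_chain_boundary_alt[OF c]])
  qed
  then show "db X (Suc q) U (db X q U f) \<sigma> = 0" by (simp add: db_def[of X "Suc q"] cutc_def)
qed

lemma db_add: "db X q U (\<lambda>\<sigma>. f \<sigma> + g \<sigma>) = (\<lambda>\<sigma>. db X q U f \<sigma> + db X q U g \<sigma>)"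
  using db_lin[of X q U 1] by simp

lemma db_zero: "db X q U (\<lambda>\<sigma>. 0) = (\<lambda>\<sigma>. 0)"
  using db_lin[of X q U "-1" "\<lambda>\<sigma>. 0" "\<lambda>\<sigma>. 0"] by simp

lemma db_scale: "db X q U (\<lambda>\<sigma>. s * f \<sigma>) = (\<lambda>\<sigma>. s * db X q U f \<sigma>)"
  using db_lin[of X q U s f "\<lambda>\<sigma>. 0"] by (simp add: db_zero)

lemma SS_section: "x \<in> Sc (SS X q) U \<longleftrightarrow> (\<exists>f\<in>CS X q U. x = Base (enc f))"
  by (auto simp: SS_def)

lemma SS_simps [simp]:
  "\<one>\<^bsub>sections (SS X q) U\<^esub> = Base (enc (\<lambda>\<sigma>. 0))"
  "restriction (SS X q) U V (Base (enc f)) = Base (enc (cutc X q V f))"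
  "Base (enc f) \<otimes>\<^bsub>sections (SS X q) U\<^esub> Base (enc g) = Base (enc (\<lambda>\<sigma>. f \<sigma> + g \<sigma>))"
  "dS X q U (Base (enc f)) = Base (enc (db X q U f))"
  "scale_Omega s U (Base (enc f)) = Base (enc (\<lambda>\<sigma>. s * f \<sigma>))"
  by (simp_all add: SS_def enc_zero enc_add enc_scale dS_def scale_Omega_def)

lemma gpresheaf_SS: "gpresheaf X (SS X q)"
  unfolding SS_def
proof (rule gpresheaf_fpre)
  show "(\<lambda>p vs. 0) \<in> enc ` CS X q U" for U unfolding enc_zero by (intro imageI) (simp add: CS_def)
  show "(\<lambda>p vs. s * \<omega> p vs + \<eta> p vs) \<in> enc ` CS X q U" if "\<omega> \<in> enc ` CS X q U" "\<eta> \<in> enc ` CS X q U" for U s \<omega> \<eta>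
    using that by (auto simp: enc_lin CS_def intro!: imageI)
  show "enc (cutc X q V (unc (\<lambda>p vs. \<omega> p vs + \<eta> p vs))) =
      (\<lambda>p vs. enc (cutc X q V (unc \<omega>)) p vs + enc (cutc X q V (unc \<eta>)) p vs)" for V \<omega> \<eta>
    by (simp add: enc_def unc_def cutc_def fun_eq_iff)
qed (auto simp: cut_id cut_cut)

lemma gmor_dS: "gmor X (SS X q) (SS X (Suc q)) (dS X q)"
proof -
  have e: "dS X q = (\<lambda>U x. Base ((\<lambda>U \<omega>. enc (db X q U (unc \<omega>))) U (base x)))" by (simp add: dS_def fun_eq_iff)
  show ?thesis unfolding e SS_def
  proof (rule gmor_fpre[OF gpresheaf_SS[unfolded SS_def] gpresheaf_SS[unfolded SS_def]])
    show "enc (db X q U (unc (\<lambda>p vs. \<omega> p vs + \<eta> p vs))) =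
      (\<lambda>p vs. enc (db X q U (unc \<omega>)) p vs + enc (db X q U (unc \<eta>)) p vs)"
      if "\<omega> \<in> enc ` CS X q U" "\<eta> \<in> enc ` CS X q U" for U \<omega> \<eta>
      using that by (auto simp: enc_add db_add)
    show "enc (cutc X (Suc q) V (unc (enc (db X q U (unc \<omega>))))) = enc (db X q V (unc (enc (cutc X q V (unc \<omega>)))))"
      if "V \<subseteq> U" for U V \<omega> using db_cut[OF that] by simp
  qed auto
qed

lemma gmor_scale_SS: "gmor X (SS X q) (SS X q) (scale_Omega s)"
  unfolding SS_def
proof (rule gmor_scale[OF gpresheaf_SS[unfolded SS_def]])
  show "(\<lambda>p vs. s * \<omega> p vs) \<in> enc ` CS X q U" if "\<omega> \<in> enc ` CS X q U" for U \<omega>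
    using that by (auto simp: enc_scale CS_def intro!: imageI)
  show "(\<lambda>p vs. s * enc (cutc X q V (unc \<omega>)) p vs) = enc (cutc X q V (unc (\<lambda>p vs. s * \<omega> p vs)))" for V \<omega>
    by (simp add: enc_def unc_def cutc_def fun_eq_iff)
qed

lemma gmor_eS: "gmor X CC (SS X 0) (eS X)"
proof -
  have e: "eS X = (\<lambda>U x. Base ((\<lambda>U \<omega>. enc (cutc X 0 U (\<lambda>\<sigma>. \<omega> undefined undefined))) U (base x)))"
    by (simp add: eS_def fun_eq_iff)
  show ?thesis unfolding e CC_def SS_def
    by (rule gmor_fpre[OF gpresheaf_CC[unfolded CC_def] gpresheaf_SS[unfolded SS_def]])
      (auto simp: enc_add cut_cut, auto simp: cutc_def)
qed

lemma presheaf_complex_SS: "presheaf_complex X (SS X) (dS X)"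
  unfolding presheaf_complex_def by (auto simp: gmor_dS SS_section db_db)

lemma SS_locally_zero_iff:
  assumes "openin X U" "p \<in> U" "f \<in> CS X q U"
  shows "germ X (SS X q) p U (Base (enc f)) = \<one>\<^bsub>stalk X (SS X q) p\<^esub> \<longleftrightarrow>
    (\<exists>V. openin X V \<and> p \<in> V \<and> V \<subseteq> U \<and> (\<forall>\<sigma>\<in>Sx X q V. f \<sigma> = 0))"
proof -
  interpret gpresheaf X "SS X q" by (rule gpresheaf_SS)
  have "Base (enc f) \<in> Sc (SS X q) U" using assms by (auto simp: SS_section)
  moreover have "restriction (SS X q) U V (Base (enc f)) = \<one>\<^bsub>sections (SS X q) V\<^esub> \<longleftrightarrow> (\<forall>\<sigma>\<in>Sx X q V. f \<sigma> = 0)" for V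
    by (simp only: SS_simps gsec.inject enc_eq_iff) (auto simp: cutc_def fun_eq_iff)
  ultimately show ?thesis using stalk_one_iff[OF assms(1,2)] by simp
qed

section \<open>Singular cochains on contractible sets\<close>

lemma contractible_homologous_const:
  assumes Y: "contractible_space Y" and ne: "topspace Y \<noteq> {}"
  obtains a where "a \<in> topspace Y"
    "\<And>q c. \<lbrakk>singular_chain q Y c; chain_boundary q c = 0\<rbrakk> \<Longrightarrow>
       \<exists>e. singular_chain (Suc q) Y e \<and> chain_boundary (Suc q) e = c - chain_map q (\<lambda>x. a) c"
proof -
  obtain a where a: "homotopic_with (\<lambda>x. True) Y Y id (\<lambda>x. a)"
    using Y by (auto simp: contractible_space_def)
  then have "continuous_map Y Y (\<lambda>x. a)" by (rule homotopic_with_imp_continuous_maps[THEN conjunct2])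
  then have at: "a \<in> topspace Y" using ne by (auto simp: continuous_map_def)
  show ?thesis
  proof (rule that[OF at])
    fix q c assume c: "singular_chain q Y c" "chain_boundary q c = 0"
    have "homologous_rel q Y {} (chain_map q id c) (chain_map q (\<lambda>x. a) c)"
      by (rule homotopic_imp_homologous_rel_chain_maps[where T = "{}" and S = Y]) (use a c in \<open>auto simp: singular_cycle\<close>)
    then show "\<exists>e. singular_chain (Suc q) Y e \<and> chain_boundary (Suc q) e = c - chain_map q (\<lambda>x. a) c"
      using chain_map_ident[OF c(1)] by (simp del: chain_map_id_gen add: homologous_rel_def singular_boundary)
  qed
qed

text \<open>The cycle is homologous to its image under a constant map, and in a one-point space
  cycles of positive degree bound. This last step fails in degree 0, where the constants
  appear.\<close>

lemma contractible_cycle_is_boundary: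
  assumes Y: "contractible_space Y" and ne: "topspace Y \<noteq> {}"
    and c: "singular_chain q Y c" "chain_boundary q c = 0" and q: "q > 0"
  obtains e where "singular_chain (Suc q) Y e" "chain_boundary (Suc q) e = c"
proof -
  obtain a e where a: "a \<in> topspace Y" and e: "singular_chain (Suc q) Y e"
     "chain_boundary (Suc q) e = c - chain_map q (\<lambda>x. a) c"
    using contractible_homologous_const[OF Y ne] c by metis
  let ?Z = "subtopology Y {a}"
  have tz: "topspace ?Z = {a}" using a by auto
  have "continuous_map Y ?Z (\<lambda>x. a)" using a by (auto simp: continuous_map_in_subtopology)
  then have "singular_relcycle q ?Z {} (chain_map q (\<lambda>x. a) c)"
    by (intro singular_relcycle_chain_map[of q Y "{}"]) (use c in \<open>auto simp: singular_cycle\<close>)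
  then have "singular_relboundary q ?Z {} (chain_map q (\<lambda>x. a) c)"
    using singular_boundary_eq_cycle_singleton[OF tz, of q] q by simp
  then obtain d where d: "singular_chain (Suc q) ?Z d" "chain_boundary (Suc q) d = chain_map q (\<lambda>x. a) c"
    by (auto simp: singular_boundary)
  show ?thesis
    by (rule that[of "e + d"])
      (use d e in \<open>auto simp: chain_boundary_add singular_chain_subtopology intro!: singular_chain_add\<close>)
qed

definition FS :: "'a topology \<Rightarrow> nat \<Rightarrow> ('a, ('a, 'a form) gsec) presheaf" where
  "FS X = case_nat CC (SS X)"

definition dFS :: "'a topology \<Rightarrow> nat \<Rightarrow> 'a set \<Rightarrow> ('a, 'a form) gsec \<Rightarrow> ('a, 'a form) gsec" where
  "dFS X = case_nat (eS X) (dS X)"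

lemma eS_const: "eS X U (Base (\<lambda>p vs. c)) = Base (enc (cutc X 0 U (\<lambda>\<sigma>. c)))"
  by (simp add: eS_def)

lemma boundary_1_const:
  "evl (\<lambda>\<sigma>. c) (chain_boundary (Suc 0) (frag_of \<sigma>)) = 0"
  by (simp add: chain_boundary_of evl_diff)

lemma db_const: "db X 0 U (cutc X 0 U (\<lambda>\<sigma>. c)) = (\<lambda>\<sigma>. 0)"
  using db_cut[of U U X 0 "\<lambda>\<sigma>. c"] by (simp add: db_def boundary_1_const) (simp add: cutc_def)

lemma vertex_simplex: "p \<in> topspace X \<Longrightarrow> restrict (\<lambda>x. p) (standard_simplex q) \<in> {\<sigma>. singular_simplex q X \<sigma>}"
  by (simp add: singular_simplex_def)

text \<open>On a contractible \<open>V\<close> a cocycle of positive degree vanishes on cycles, as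
  these bound, and so factors through the boundary by \<open>additive_factor\<close>. In degree 0 it
  takes the same value on every point, because each point is homologous to \<open>a\<close>.\<close>

lemma locally_exact_SS:
  assumes lc: "\<And>U p. \<lbrakk>openin X U; p \<in> U\<rbrakk> \<Longrightarrow> \<exists>V. openin X V \<and> p \<in> V \<and> V \<subseteq> U \<and> contractible_space (subtopology X V)"
  shows "locally_exact X (FS X) (dFS X)"
  unfolding locally_exact_def presheaf_complex_def
proof (intro conjI allI impI)
  show "gmor X (FS X q) (FS X (Suc q)) (dFS X q)" for q
    by (cases q) (simp_all add: FS_def dFS_def gmor_eS gmor_dS)
  show "dFS X (Suc q) U (dFS X q U s) = \<one>\<^bsub>sections (FS X (Suc (Suc q))) U\<^esub>" if s: "openin X U" "s \<in> Sc (FS X q) U" for q U s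
  proof (cases q)
    case 0
    then obtain c where "s = Base (\<lambda>p vs. c)" using s by (auto simp: FS_def CC_def)
    then show ?thesis using s 0 by (simp add: FS_def dFS_def eS_const db_const)
  next
    case (Suc j)
    then show ?thesis using s by (auto simp: FS_def dFS_def SS_section db_db)
  qed
  show "\<exists>V. openin X V \<and> p \<in> V \<and> V \<subseteq> U \<and> restriction (FS X 0) U V s = \<one>\<^bsub>sections (FS X 0) V\<^esub>"
    if U: "openin X U" "p \<in> U" and s: "s \<in> Sc (FS X 0) U" and z: "dFS X 0 U s = \<one>\<^bsub>sections (FS X 1) U\<^esub>" for U s p
  proof -
    obtain c where c: "s = Base (\<lambda>p vs. c)" using s by (auto simp: FS_def CC_def)
    have e: "cutc X 0 U (\<lambda>\<sigma>. c) = (\<lambda>\<sigma>. 0)" using z by (simp add: FS_def dFS_def c eS_const)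
    have "p \<in> topspace (subtopology X U)" using U openin_subset[OF U(1)] by auto
    then have "restrict (\<lambda>x. p) (standard_simplex 0) \<in> Sx X 0 U" by (rule vertex_simplex)
    then have "c = 0" using fun_cong[OF e, of "restrict (\<lambda>x. p) (standard_simplex 0)"] by (simp add: cutc_def)
    then show ?thesis using U by (intro exI[of _ U]) (auto simp: c FS_def CC_def)
  qed
  show "\<exists>V t. openin X V \<and> p \<in> V \<and> V \<subseteq> U \<and> t \<in> Sc (FS X q) V \<and> dFS X q V t = restriction (FS X (Suc q)) U V s"
    if U: "openin X U" "p \<in> U" and s: "s \<in> Sc (FS X (Suc q)) U"
      and z: "dFS X (Suc q) U s = \<one>\<^bsub>sections (FS X (Suc (Suc q))) U\<^esub>" for q U s p
  proof -
    obtain f where f: "f \<in> CS X q U" "s = Base (enc f)" using s by (auto simp: FS_def SS_section)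
    have cl: "db X q U f = (\<lambda>\<sigma>. 0)" using z by (simp add: FS_def dFS_def f)
    obtain V where V: "openin X V" "p \<in> V" "V \<subseteq> U" "contractible_space (subtopology X V)" using lc[OF U] by blast
    let ?Y = "subtopology X V"
    have ne: "topspace ?Y \<noteq> {}" using V(2) openin_subset[OF V(1)] by auto
    have zero: "evl f (chain_boundary (Suc q) e) = 0" if "singular_chain (Suc q) ?Y e" for e
      using evl_db[OF singular_chain_mono[OF that V(3)], of f] by (simp add: cl) (metis evl_zero)
    show ?thesis
    proof (cases q)
      case 0
      obtain a where a: "a \<in> topspace ?Y"
        "\<And>c. singular_chain 0 ?Y c \<Longrightarrow> \<exists>e. singular_chain (Suc 0) ?Y e \<and> chain_boundary (Suc 0) e = c - chain_map 0 (\<lambda>x. a) c"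
        using contractible_homologous_const[OF V(4) ne] by (metis chain_boundary_def)
      let ?\<tau> = "restrict (\<lambda>x. a) (standard_simplex 0)"
      have "f \<sigma> = f ?\<tau>" if \<sigma>: "\<sigma> \<in> Sx X 0 V" for \<sigma>
      proof -
        obtain e where e: "singular_chain (Suc 0) ?Y e" "chain_boundary (Suc 0) e = frag_of \<sigma> - chain_map 0 (\<lambda>x. a) (frag_of \<sigma>)"
          using a(2)[of "frag_of \<sigma>"] \<sigma> by (auto simp: singular_chain_of)
        have "simplex_map 0 (\<lambda>x. a) \<sigma> = ?\<tau>" by (auto simp: simplex_map_def)
        then show ?thesis using zero[unfolded 0, OF e(1)] by (simp add: e(2) evl_diff)
      qed
      then have "cutc X 0 V (\<lambda>\<sigma>. f ?\<tau>) = cutc X 0 V f" by (auto simp: cutc_def)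
      then show ?thesis unfolding 0 using V
        by (intro exI[of _ V] exI[of _ "Base (\<lambda>p vs. f ?\<tau>)"]) (auto simp: FS_def dFS_def CC_def eS_const f)
    next
      case (Suc j)
      obtain g where g: "\<And>c. singular_chain q ?Y c \<Longrightarrow> evl g (chain_boundary q c) = evl f c"
      proof (rule additive_factor[of "{c. singular_chain q ?Y c}" "{0}" "chain_boundary q" f])
        show "evl f c = 0" if c: "c \<in> {c. singular_chain q ?Y c}" "chain_boundary q c \<in> {0}" for c
        proof -
          obtain e where "singular_chain (Suc q) ?Y e" "chain_boundary (Suc q) e = c"
            using contractible_cycle_is_boundary[OF V(4) ne, of q c] c Suc by auto
          then show ?thesis using zero by metis
        qed
      qed (auto simp: singular_chain_diff chain_boundary_diff)
      have "db X j V (cutc X j V g) = cutc X q V f"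
        unfolding Suc using g[unfolded Suc, OF singular_chain_of[THEN iffD2]]
        by (subst db_cut) (auto simp: db_def cutc_def fun_eq_iff)
      then show ?thesis unfolding Suc using V
        by (intro exI[of _ V] exI[of _ "Base (enc (cutc X j V g))"]) (auto simp: FS_def dFS_def SS_section f Suc)
    qed
  qed
qed

lemma scale_FS:
  "gmor X (FS X q) (FS X q) (scale_Omega s)"
  "\<lbrakk>openin X U; x \<in> Sc (FS X q) U\<rbrakk> \<Longrightarrow> scale_Omega s U (dFS X q U x) = dFS X q U (scale_Omega s U x)"
proof -
  show "gmor X (FS X q) (FS X q) (scale_Omega s)"
    by (cases q) (simp_all add: FS_def gmor_scale_CC gmor_scale_SS)
  assume U: "openin X U" and x: "x \<in> Sc (FS X q) U"
  show "scale_Omega s U (dFS X q U x) = dFS X q U (scale_Omega s U x)"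
  proof (cases q)
    case 0
    then obtain c where c: "x = Base (\<lambda>p vs. c)" using x by (auto simp: FS_def CC_def)
    have "scale_Omega s U x = Base (\<lambda>p vs. s * c)" by (simp add: c scale_Omega_def)
    then show ?thesis using 0 by (simp add: dFS_def c eS_const) (simp add: cutc_def fun_eq_iff)
  next
    case (Suc j)
    then show ?thesis using x by (auto simp: FS_def dFS_def SS_section db_scale)
  qed
qed

text \<open>Subdivision makes any chain small up to a chain homotopy, so \<open>f\<close> kills not
  only small chains but every chain with small boundary (\<open>key\<close>). By
  \<open>additive_factor\<close> it then factors through the boundary by a cochain that vanishes on
  small chains. In degree 0 every chain has boundary 0, so \<open>f\<close> itself is zero.\<close>

lemma small_cochains_acyclic:
  assumes f: "f \<in> CS X k (topspace X)" and cl: "db X k (topspace X) f = (\<lambda>\<sigma>. 0)"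
    and small: "\<And>p. p \<in> topspace X \<Longrightarrow> \<exists>V. openin X V \<and> p \<in> V \<and> (\<forall>\<sigma>\<in>Sx X k V. f \<sigma> = 0)"
  shows "case k of 0 \<Rightarrow> f = (\<lambda>\<sigma>. 0) | Suc r \<Rightarrow> \<exists>g\<in>CS X r (topspace X).
     (\<forall>p\<in>topspace X. \<exists>V. openin X V \<and> p \<in> V \<and> (\<forall>\<sigma>\<in>Sx X r V. g \<sigma> = 0)) \<and> db X r (topspace X) g = f"
proof -
  define \<C> where "\<C> = {V. openin X V \<and> (\<forall>\<sigma>\<in>Sx X k V. f \<sigma> = 0)}"
  define S where "S = {\<sigma>. \<exists>V\<in>\<C>. \<sigma> \<in> Sx X (k - Suc 0) V}"
  have cov: "topspace X \<subseteq> \<Union>\<C>" using small unfolding \<C>_def by blast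
  have key: "evl f c = 0" if c: "singular_chain k X c" "Poly_Mapping.keys (chain_boundary k c) \<subseteq> S" for c
  proof -
    obtain n where n: "\<And>m \<sigma>. \<lbrakk>n \<le> m; \<sigma> \<in> Poly_Mapping.keys ((singular_subdivision k ^^ m) c)\<rbrakk>
        \<Longrightarrow> \<exists>V\<in>\<C>. \<sigma> \<in> standard_simplex k \<rightarrow> V"
      by (rule sufficient_iterated_singular_subdivision_exists[OF _ cov c(1)]) (auto simp: \<C>_def)
    obtain h where h: "\<And>p. h p 0 = (0 :: 'a chain)" "\<And>p c1 c2. h p (c1 - c2) = h p c1 - h p c2"
        "\<And>p X c. singular_chain p X c \<Longrightarrow> singular_chain (Suc p) X (h p c)"
        "\<And>p X c. singular_chain p X c \<Longrightarrow> chain_boundary (Suc p) (h p c) + h (p - Suc 0) (chain_boundary p c)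
                   = (singular_subdivision p ^^ n) c - c"
      by (rule chain_homotopic_iterated_singular_subdivision[where n = n]) blast
    have "singular_chain k X ((singular_subdivision k ^^ n) c)"
      by (induction n) (auto simp: c(1) intro: singular_chain_singular_subdivision)
    then have 1: "evl f ((singular_subdivision k ^^ n) c) = 0"
      using n[OF order_refl] by (intro evl_zero) (fastforce simp: \<C>_def singular_chain_def singular_simplex_subtopology)
    have 2: "evl f (chain_boundary (Suc k) (h k c)) = 0"
      using evl_db[of k X "topspace X" "h k c" f] h(3)[OF c(1)] by (simp add: cl) (metis evl_zero)
    \<comment> \<open>The homotopy \<open>h\<close> is given by one formula in all spaces, so it
      carries chains of \<open>V\<close> to chains of \<open>V\<close>. Applied to the small
      boundary of \<open>c\<close> it yields a small chain.\<close>
    have "k = 0 \<or> evl f (h (k - Suc 0) b) = 0" if "Poly_Mapping.keys b \<subseteq> S" for b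
      using that
    proof (induction rule: frag_induction)
      case (one \<sigma>)
      show ?case
      proof (cases k)
        case (Suc r)
        obtain V where V: "V \<in> \<C>" "\<sigma> \<in> Sx X r V" using one by (auto simp: S_def Suc)
        then have "singular_chain k (subtopology X V) (h r (frag_of \<sigma>))"
          unfolding Suc by (intro h(3)) (simp add: singular_chain_of)
        then have "evl f (h r (frag_of \<sigma>)) = 0"
          using V(1) by (intro evl_zero) (auto simp: \<C>_def singular_chain_def)
        then show ?thesis by (simp add: Suc)
      qed simp
    qed (auto simp: h evl_diff)
    then have 3: "evl f (h (k - Suc 0) (chain_boundary k c)) = 0"
      using c(2) h(1) by (cases k) (auto simp: chain_boundary_def)
    have "c = (singular_subdivision k ^^ n) c - (chain_boundary (Suc k) (h k c) + h (k - Suc 0) (chain_boundary k c))"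
      by (simp add: h(4)[OF c(1)])
    then show ?thesis using 1 2 3 by (metis evl_diff evl_add add_0 diff_0_right)
  qed
  show ?thesis
  proof (cases k)
    case 0
    have "f \<sigma> = 0" if "singular_simplex 0 X \<sigma>" for \<sigma>
      using key[of "frag_of \<sigma>"] that by (simp add: 0 singular_chain_of chain_boundary_def)
    then have "f = (\<lambda>\<sigma>. 0)" using f by (auto simp: CS_def 0 fun_eq_iff)
    then show ?thesis using 0 by simp
  next
    case (Suc r)
    \<comment> \<open>Taking all small chains for \<open>B\<close>, and not only \<open>0\<close>,
      is what forces the primitive to vanish near every point.\<close>
    obtain g where g: "\<And>c. singular_chain k X c \<Longrightarrow> evl g (chain_boundary k c) = evl f c"
        "\<And>b. Poly_Mapping.keys b \<subseteq> S \<Longrightarrow> evl g b = 0"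
    proof (rule additive_factor[of "{c. singular_chain k X c}" "{b. Poly_Mapping.keys b \<subseteq> S}" "chain_boundary k" f])
      show "x - y \<in> {b. Poly_Mapping.keys b \<subseteq> S}" if "x \<in> {b. Poly_Mapping.keys b \<subseteq> S}" "y \<in> {b. Poly_Mapping.keys b \<subseteq> S}"
        for x y :: "'a chain" using that keys_diff[of x y] by auto
    qed (auto simp: singular_chain_diff chain_boundary_diff key)
    let ?g = "cutc X r (topspace X) g"
    have "db X r (topspace X) ?g = f"
      using g(1)[unfolded Suc, OF singular_chain_of[THEN iffD2]] f
      by (subst db_cut) (auto simp: db_def cutc_def fun_eq_iff CS_def Suc)
    moreover have "\<exists>V. openin X V \<and> p \<in> V \<and> (\<forall>\<sigma>\<in>Sx X r V. ?g \<sigma> = 0)" if p: "p \<in> topspace X" for p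
    proof -
      obtain V where V: "V \<in> \<C>" "p \<in> V" using cov p by blast
      have "g \<sigma> = 0" if "\<sigma> \<in> Sx X r V" for \<sigma>
        using g(2)[of "frag_of \<sigma>"] V that by (auto simp: S_def Suc)
      then show ?thesis using V by (intro exI[of _ V]) (auto simp: \<C>_def cutc_def)
    qed
    ultimately show ?thesis unfolding Suc by (auto intro!: bexI[of _ ?g])
  qed
qed

section \<open>Neighbourhoods in the manifold and flabbiness of cochains\<close>

lemma polydisc_contractible:
  assumes z: "z \<in> Cn n"
  shows "contractible_space (subtopology (complex_space n) (polydisc n z r))"
proof -
  let ?P = "polydisc n z r"
  have sub: "subtopology (complex_space n) ?P = top_of_set ?P"
    by (auto simp: complex_space_eq subtopology_subtopology polydisc_def intro!: arg_cong[where f = "subtopology _"])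
  let ?h = "\<lambda>x i. z i + of_real (1 - fst x) * (snd x i - z i)"
  have "continuous_on ({0..1} \<times> ?P) ?h"
    by (rule continuous_on_coordinatewise_then_product)
      (intro continuous_intros continuous_on_product_then_coordinatewise[OF continuous_on_snd[OF continuous_on_id]])
  moreover have "?h x \<in> ?P" if "x \<in> {0..1} \<times> ?P" for x
    using polydisc_radial[OF z, of "snd x" r "1 - fst x"] that by (auto simp: mem_Times_iff)
  ultimately have c: "continuous_map (prod_topology (top_of_set {0..1}) (top_of_set ?P)) (top_of_set ?P) ?h"
    by (simp add: continuous_map_in_subtopology prod_topology_subtopology_eu image_subset_iff Pi_iff)
  show ?thesis
    unfolding contractible_space_def sub homotopic_with_def
    by (intro exI[of _ z] exI[of _ ?h]) (use c in auto)
qed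

lemma compact_polydisc: "compactin (complex_space n) {w. (\<forall>i<n. dist (z i) (w i) \<le> r) \<and> (\<forall>i\<ge>n. w i = 0)}" (is "compactin _ ?K")
proof -
  have e: "?K = (\<Pi>\<^sub>E i\<in>UNIV. if i < n then cball (z i) r else {0})"
    by (auto simp: PiE_iff if_split_mem2 not_less)
  have "compactin (product_topology (\<lambda>i. euclidean) UNIV) ?K"
    unfolding e compactin_PiE by auto
  then show ?thesis by (auto simp: complex_space_def compactin_subtopology)
qed

context cmanifold
begin

lemma chart_homeo:
  assumes c: "c \<in> A" and V: "V \<subseteq> fst c"
  shows "homeomorphic_map (subtopology X V) (subtopology (complex_space n) (snd c ` V)) (snd c)"
proof -
  have s: "fst c \<inter> V = V" "snd c ` fst c \<inter> snd c ` V = snd c ` V" using V by auto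
  have "homeomorphic_map (subtopology (subtopology X (fst c)) V) (subtopology (subtopology (complex_space n) (snd c ` fst c)) (snd c ` V)) (snd c)"
    by (rule homeomorphic_map_subtopologies[OF chart(3)[OF c]])
      (use homeomorphic_imp_surjective_map[OF chart(3)[OF c]] V chart_sub[OF c] in auto)
  then show ?thesis by (simp add: subtopology_subtopology s)
qed

lemma polydisc_nbhd:
  assumes "openin X U" "p \<in> U"
  obtains c r V where "c \<in> A" "r > 0" "openin X V" "p \<in> V" "V \<subseteq> U" "V \<subseteq> fst c" "snd c ` V = polydisc n (snd c p) r"
proof -
  obtain c where c: "c \<in> A" "p \<in> fst c" using chart_at assms openin_subset by blast
  have "openin X (U \<inter> fst c)" using assms(1) chart(1)[OF c(1)] by blast
  from chart_polydisc[OF this _ _ c(1), of p] obtain r V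
    where "r > 0" "openin X V" "p \<in> V" "V \<subseteq> U \<inter> fst c" "snd c ` V = polydisc n (snd c p) r"
    using assms c by auto
  then show ?thesis using that c by auto
qed

lemma contractible_nbhd:
  assumes "openin X U" "p \<in> U"
  shows "\<exists>V. openin X V \<and> p \<in> V \<and> V \<subseteq> U \<and> contractible_space (subtopology X V)"
proof -
  obtain c r V where V: "c \<in> A" "r > 0" "openin X V" "p \<in> V" "V \<subseteq> U" "V \<subseteq> fst c" "snd c ` V = polydisc n (snd c p) r"
    by (rule polydisc_nbhd[OF assms])
  have "snd c p \<in> Cn n" using V by (intro chart_Cn) auto
  then have "contractible_space (subtopology (complex_space n) (snd c ` V))" 
    unfolding V(7) by (rule polydisc_contractible)
  then have "contractible_space (subtopology X V)"
    using homeomorphic_space_contractibility[OF homeomorphic_map_imp_homeomorphic_space[OF chart_homeo[OF V(1,6)]]] by simp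
  then show ?thesis using V by blast
qed

text \<open>The closed coordinate polydisc of half radius is compact, and compact sets are closed
  because \<open>X\<close> is Hausdorff.\<close>

lemma closed_nbhd:
  assumes "openin X U" "p \<in> U"
  shows "\<exists>B K. openin X B \<and> closedin X K \<and> p \<in> B \<and> B \<subseteq> K \<and> K \<subseteq> U"
proof -
  obtain c r V where V: "c \<in> A" "r > 0" "openin X V" "p \<in> V" "V \<subseteq> U" "V \<subseteq> fst c" "snd c ` V = polydisc n (snd c p) r"
    by (rule polydisc_nbhd[OF assms])
  let ?z = "snd c p"
  let ?K = "{w. (\<forall>i<n. dist (?z i) (w i) \<le> r / 2) \<and> (\<forall>i\<ge>n. w i = 0)}"
  let ?P = "polydisc n ?z (r / 2)"
  have z: "?z \<in> Cn n" using V by (intro chart_Cn) auto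
  have sub: "?P \<subseteq> ?K" "?K \<subseteq> polydisc n ?z r" "?z \<in> ?P"
    using V(2) z by (fastforce simp: polydisc_def)+
  define K where "K = {q \<in> V. snd c q \<in> ?K}"
  have im: "snd c ` K = ?K" unfolding K_def using sub(2)[folded V(7)] by blast
  have "compactin (subtopology (complex_space n) (snd c ` V)) (snd c ` K)"
    unfolding im V(7) using sub(2) compact_polydisc[of n ?z "r / 2"] by (simp only: compactin_subtopology)
  then have "compactin (subtopology X V) K"
    by (subst (asm) homeomorphic_map_compactness[OF chart_homeo[OF V(1,6)]]) (use openin_subset[OF V(3)] in \<open>auto simp: K_def\<close>)
  then have "compactin X K" by (simp add: compactin_subtopology)
  then have cl: "closedin X K" using man by (intro compactin_imp_closedin) (auto simp: complex_manifold_def)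
  have o: "openin X {q \<in> fst c. snd c q \<in> ?P}"
  proof (rule chart_open_vimage(1)[OF V(1) dom_polydisc])
    show "?P \<subseteq> snd c ` fst c" 
      by (rule order_trans[OF order_trans[OF sub(1,2)] V(6)[THEN image_mono, of "snd c", unfolded V(7)]])
  qed
  let ?B = "V \<inter> {q \<in> fst c. snd c q \<in> ?P}"
  have "openin X ?B" using o V(3) by blast
  moreover have "p \<in> ?B" "?B \<subseteq> K" using V sub by (auto simp: K_def)
  moreover have "K \<subseteq> U" using V by (auto simp: K_def)
  ultimately show ?thesis using cl by blast
qed

text \<open>With \<open>j x\<close> the first member of a countable cover \<open>B\<^sub>0, B\<^sub>1, \<dots>\<close> containing \<open>x\<close>, only finitely many
  values occur near \<open>x\<close>, and those whose closures miss \<open>x\<close> can be avoided.\<close>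

lemma locally_finite_choice:
  assumes U: "openin X U" and V: "\<And>p. p \<in> U \<Longrightarrow> openin X (V p) \<and> p \<in> V p"
  obtains j where "\<And>x. x \<in> U \<Longrightarrow> j x \<in> U \<and> x \<in> V (j x)"
    "\<And>x. x \<in> U \<Longrightarrow> \<exists>W I. openin X W \<and> x \<in> W \<and> W \<subseteq> U \<and> finite I \<and> I \<subseteq> U \<and> (\<forall>z\<in>W. j z \<in> I) \<and> (\<forall>i\<in>I. x \<in> V i)"
proof -
  have "\<exists>B K. openin X B \<and> closedin X K \<and> p \<in> B \<and> B \<subseteq> K \<and> K \<subseteq> U \<inter> V p" if "p \<in> U" for p
    using that U V[OF that] by (intro closed_nbhd) auto
  then obtain B K where BK: "\<And>p. p \<in> U \<Longrightarrow> openin X (B p) \<and> closedin X (K p) \<and> p \<in> B p \<and> B p \<subseteq> K p \<and> K p \<subseteq> U \<inter> V p"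
    by metis
  show ?thesis
  proof (cases "U = {}")
    case False
    have "Lindelof_space (subtopology X U)"
      using man by (auto simp: complex_manifold_def intro: second_countable_imp_Lindelof_space second_countable_subtopology)
    moreover have "\<forall>W\<in>B ` U. openin X W" "U \<subseteq> \<Union>(B ` U)" using BK by auto
    ultimately obtain \<V> where \<V>: "countable \<V>" "\<V> \<subseteq> B ` U" "U \<subseteq> \<Union>\<V>"
      using Lindelof_space_subtopology_subset[of U X] openin_subset[OF U] by meson
    then have "\<V> \<noteq> {}" using False by auto
    then obtain b :: "nat \<Rightarrow> 'a set" where b: "range b = \<V>" using \<V>(1) by (metis range_from_nat_into)
    have "\<exists>p. p \<in> U \<and> b m = B p" for m :: nat using b \<V>(2) by blast
    then obtain P where P: "\<And>m. P m \<in> U" "\<And>m. b m = B (P m)" by metis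
    define l where "l x = (LEAST m. x \<in> B (P m))" for x
    have ex: "\<exists>m. x \<in> B (P m)" if "x \<in> U" for x using that \<V>(3) P(2) by (auto simp flip: b)
    have l: "x \<in> B (P (l x))" if "x \<in> U" for x unfolding l_def using ex[OF that] by (rule LeastI_ex)
    have in_V: "x \<in> V (P m)" if "x \<in> K (P m)" for x m using BK[OF P(1)[of m]] that by blast
    show ?thesis
    proof (rule that[of "\<lambda>x. P (l x)"])
      show "P (l x) \<in> U \<and> x \<in> V (P (l x))" if "x \<in> U" for x
        using l[OF that] BK[OF P(1)] in_V P(1) by blast
      show "\<exists>W I. openin X W \<and> x \<in> W \<and> W \<subseteq> U \<and> finite I \<and> I \<subseteq> U \<and> (\<forall>z\<in>W. P (l z) \<in> I) \<and> (\<forall>i\<in>I. x \<in> V i)"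
        if x: "x \<in> U" for x
      proof -
        let ?N = "{m. m \<le> l x \<and> x \<notin> K (P m)}"
        let ?M = "{m. m \<le> l x \<and> x \<in> K (P m)}"
        let ?W = "B (P (l x)) - \<Union>((\<lambda>m. K (P m)) ` ?N)"
        have "closedin X (\<Union>((\<lambda>m. K (P m)) ` ?N))" using BK[OF P(1)] by (intro closedin_Union) auto
        then have "openin X ?W" using BK[OF P(1)] by blast
        moreover have "x \<in> ?W" using l[OF x] by auto
        moreover have "?W \<subseteq> U" using BK[OF P(1)] by blast
        moreover have "P (l z) \<in> P ` ?M" if z: "z \<in> ?W" for z
        proof -
          have zU: "z \<in> U" using z BK[OF P(1)] by blast
          have "l z \<le> l x" unfolding l_def[of z] using z by (intro Least_le) auto
          moreover have "z \<in> K (P (l z))" using l[OF zU] BK[OF P(1)] by blast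
          ultimately have "l z \<in> ?M" using z by auto
          then show ?thesis by blast
        qed
        ultimately show ?thesis using P(1) in_V
          by (intro exI[of _ ?W] exI[of _ "P ` ?M"]) auto
      qed
    qed
  qed (use that in auto)
qed

text \<open>Extension is by zero. For gluing, a simplex gets its value from the local cochain
  attached by \<open>j\<close> to the position of one fixed point \<open>v\<close> of the simplex.
  Near \<open>p\<close> only finitely many of these cochains are involved, and each has the germ of
  \<open>f (j p)\<close> at \<open>p\<close>, so the glued cochain has it too.\<close>

lemma flabby_SS: "flabby X (SS X q)"
  unfolding flabby_def
proof (intro conjI allI impI ballI)
  interpret gpresheaf X "SS X q" by (rule gpresheaf_SS)
  show "\<exists>t\<in>Sc (SS X q) (topspace X). restriction (SS X q) (topspace X) U t = s" if "openin X U" "s \<in> Sc (SS X q) U" for U s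
  proof -
    obtain f where f: "f \<in> CS X q U" "s = Base (enc f)" using \<open>s \<in> _\<close> by (auto simp: SS_section)
    have "f \<in> CS X q (topspace X)"
      using f(1) Sx_mono[OF openin_subset[OF \<open>openin X U\<close>], of _ q X] unfolding CS_def by blast
    then show ?thesis using f by (intro bexI[of _ s]) (auto simp: SS_section cut_id)
  qed
  fix U x assume U: "openin X U" and x: "induced X (SS X q) U x"
  have "\<forall>p\<in>U. \<exists>V f. openin X V \<and> p \<in> V \<and> V \<subseteq> U \<and> f \<in> CS X q V \<and>
      (\<forall>z\<in>V. family x z = germ X (SS X q) z V (Base (enc f)))"
  proof
    fix p assume "p \<in> U"
    then obtain V t where V: "openin X V" "p \<in> V" "V \<subseteq> U" "t \<in> Sc (SS X q) V" "\<forall>z\<in>V. family x z = germ X (SS X q) z V t"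
      using x unfolding induced_def by blast
    then show "\<exists>V f. openin X V \<and> p \<in> V \<and> V \<subseteq> U \<and> f \<in> CS X q V \<and> (\<forall>z\<in>V. family x z = germ X (SS X q) z V (Base (enc f)))"
      by (auto simp: SS_section)
  qed
  then obtain V f where Vf: "\<And>p. p \<in> U \<Longrightarrow> openin X (V p) \<and> p \<in> V p \<and> V p \<subseteq> U \<and> f p \<in> CS X q (V p) \<and>
      (\<forall>z\<in>V p. family x z = germ X (SS X q) z (V p) (Base (enc (f p))))" by metis
  obtain j where j: "\<And>x. x \<in> U \<Longrightarrow> j x \<in> U \<and> x \<in> V (j x)"
    "\<And>x. x \<in> U \<Longrightarrow> \<exists>W I. openin X W \<and> x \<in> W \<and> W \<subseteq> U \<and> finite I \<and> I \<subseteq> U \<and> (\<forall>z\<in>W. j z \<in> I) \<and> (\<forall>i\<in>I. x \<in> V i)"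
    using locally_finite_choice[OF U, of V] Vf by metis
  obtain v where v: "v \<in> standard_simplex q" using nonempty_standard_simplex by blast
  define g where "g = cutc X q U (\<lambda>\<sigma>. f (j (\<sigma> v)) \<sigma>)"
  have gC: "Base (enc g) \<in> Sc (SS X q) U" by (auto simp: SS_section g_def)
  have fC: "Base (enc (f p)) \<in> Sc (SS X q) (V p)" if "p \<in> U" for p using Vf[OF that] by (auto simp: SS_section)
  have "germ X (SS X q) p U (Base (enc g)) = family x p" if p: "p \<in> U" for p
  proof -
    obtain W I where W: "openin X W" "p \<in> W" "W \<subseteq> U" "finite I" "I \<subseteq> U" "\<forall>z\<in>W. j z \<in> I" "\<forall>i\<in>I. p \<in> V i"
      using j(2)[OF p] by blast
    have jp: "j p \<in> I" using W by blast
    have "\<exists>N. openin X N \<and> p \<in> N \<and> (\<forall>\<sigma>\<in>Sx X q N. \<sigma> \<in> Sx X q (V (j p)) \<and> f i \<sigma> = f (j p) \<sigma>)" if i: "i \<in> I" for i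
    proof -
      have iU: "i \<in> U" "j p \<in> U" "p \<in> V i" "p \<in> V (j p)" using i jp W by auto
      have "germ X (SS X q) p (V i) (Base (enc (f i))) = germ X (SS X q) p (V (j p)) (Base (enc (f (j p))))"
        using Vf[OF iU(1)] Vf[OF iU(2)] iU by metis
      then have "same_germ X (SS X q) p (V i) (Base (enc (f i))) (V (j p)) (Base (enc (f (j p))))"
        using germ_eq_iff[OF _ iU(3) fC[OF iU(1)] _ iU(4) fC[OF iU(2)]] Vf[OF iU(1)] Vf[OF iU(2)] by blast
      then obtain N where N: "openin X N" "p \<in> N" "N \<subseteq> V i \<inter> V (j p)" "cutc X q N (f i) = cutc X q N (f (j p))"
        unfolding same_germ_def by auto
      have "\<sigma> \<in> Sx X q (V (j p)) \<and> f i \<sigma> = f (j p) \<sigma>" if s: "\<sigma> \<in> Sx X q N" for \<sigma>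
        using fun_cong[OF N(4), of \<sigma>] s N(3) Sx_mono[of N "V (j p)" \<sigma> q X] by (simp add: cutc_def)
      then show ?thesis using N by blast
    qed
    then obtain N where N: "\<And>i. i \<in> I \<Longrightarrow> openin X (N i) \<and> p \<in> N i \<and>
        (\<forall>\<sigma>\<in>Sx X q (N i). \<sigma> \<in> Sx X q (V (j p)) \<and> f i \<sigma> = f (j p) \<sigma>)" by metis
    \<comment> \<open>A finite intersection over the indices occurring near \<open>p\<close>: on it
      all the cochains that can be selected agree with that of \<open>j p\<close>.\<close>
    let ?O = "W \<inter> (\<Inter>(N ` I) \<inter> V (j p))"
    have jU: "j p \<in> U" "p \<in> V (j p)" using j(1)[OF p] by auto
    have o: "openin X ?O"
      using W(1) N jp Vf[OF jU(1)] W(4) by (intro openin_Int openin_Inter) auto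
    have pO: "p \<in> ?O" using W N jU by auto
    have "cutc X q ?O g = cutc X q ?O (f (j p))"
    proof
      fix \<sigma>
      have "g \<sigma> = f (j p) \<sigma>" if s: "\<sigma> \<in> Sx X q ?O"
      proof -
        have im: "\<sigma> v \<in> ?O" using s v unfolding Sx_iff by blast
        then have i: "j (\<sigma> v) \<in> I" using W(6) by blast
        have "\<sigma> \<in> Sx X q (N (j (\<sigma> v)))" using s i by (rule_tac Sx_mono[of ?O]) auto
        moreover have "\<sigma> \<in> Sx X q U" using s W(3) by (rule_tac Sx_mono[of ?O]) auto
        ultimately show ?thesis using N[OF i] by (auto simp: g_def cutc_def)
      qed
      then show "cutc X q ?O g \<sigma> = cutc X q ?O (f (j p)) \<sigma>" by (simp add: cutc_def)
    qed
    then have "same_germ X (SS X q) p U (Base (enc g)) (V (j p)) (Base (enc (f (j p))))"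
      unfolding same_germ_def using o pO W(3) by (intro exI[of _ ?O]) auto
    then have "germ X (SS X q) p U (Base (enc g)) = germ X (SS X q) p (V (j p)) (Base (enc (f (j p))))"
      using germ_eq_iff[OF U p gC _ jU(2) fC[OF jU(1)]] Vf[OF jU(1)] by blast
    then show ?thesis using Vf[OF jU(1)] jU(2) by metis
  qed
  then have "germ_family X (SS X q) U (Base (enc g)) = x"
    using x gC U by (intro G_eqI[of _ X "SS X q" U]) (auto simp: induced_def germ_family_at germ_family_closed)
  then show "x \<in> germ_image X (SS X q) U" unfolding germ_image_def using gC by blast
qed

end

section \<open>Comparison of singular cohomology and hypercohomology\<close>

text \<open>Turns a function on simplices into an element of \<open>singular_cochain_group\<close>;
  not to be confused with the sign operator inside \<open>bicomplex\<close>.\<close>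

definition sg :: "'a topology \<Rightarrow> nat \<Rightarrow> (((nat \<Rightarrow> real) \<Rightarrow> 'a) \<Rightarrow> complex) \<Rightarrow> 'a chain \<Rightarrow> complex" where
  "sg X k f = (\<lambda>c\<in>carrier (chain_group k X). evl f c)"

text \<open>Singular chains are free on simplices, so a homomorphism is determined by its values on
  generators.\<close>

lemma sg_carrier: "carrier (singular_cochain_group X k) = range (sg X k)"
proof
  show "range (sg X k) \<subseteq> carrier (singular_cochain_group X k)"
    by (auto simp: singular_cochain_group_def sg_def complex_group_def evl_add singular_chain_add intro!: homI)
  show "carrier (singular_cochain_group X k) \<subseteq> range (sg X k)"
  proof
    fix \<phi> assume \<phi>: "\<phi> \<in> carrier (singular_cochain_group X k)"
    then have add: "\<phi> (x + y) = \<phi> x + \<phi> y" if "singular_chain k X x" "singular_chain k X y" for x y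
      using that by (auto simp: singular_cochain_group_def hom_def complex_group_def)
    have diff: "\<phi> (x - y) = \<phi> x - \<phi> y" if "singular_chain k X x" "singular_chain k X y" for x y
      using add[OF singular_chain_diff[OF that] that(2)] by simp
    have "\<phi> c = evl (\<lambda>\<sigma>. \<phi> (frag_of \<sigma>)) c" if "singular_chain k X c" for c
    proof (rule additive_eqI[of "Collect (singular_simplex k X)"])
      show "\<phi> (x - y) = \<phi> x - \<phi> y" if "Poly_Mapping.keys x \<subseteq> Collect (singular_simplex k X)"
        "Poly_Mapping.keys y \<subseteq> Collect (singular_simplex k X)" for x y
        using that by (intro diff) (simp_all add: singular_chain_def)
    qed (use that in \<open>simp_all add: singular_chain_def evl_diff\<close>)
    then have "\<phi> = sg X k (\<lambda>\<sigma>. \<phi> (frag_of \<sigma>))"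
      using \<phi> by (auto simp: singular_cochain_group_def sg_def extensional_def fun_eq_iff)
    then show "\<phi> \<in> range (sg X k)" by blast
  qed
qed

lemma sg_simps:
  "\<one>\<^bsub>singular_cochain_group X k\<^esub> = sg X k (\<lambda>\<sigma>. 0)"
  "sg X k f \<otimes>\<^bsub>singular_cochain_group X k\<^esub> sg X k g = sg X k (\<lambda>\<sigma>. f \<sigma> + g \<sigma>)"
  "singular_coboundary X k (sg X k f) = sg X (Suc k) (db X k (topspace X) f)"
  "(\<lambda>x\<in>carrier (chain_group k X). s * sg X k f x) = sg X k (\<lambda>\<sigma>. s * f \<sigma>)"
  "sg X k (cutc X k (topspace X) f) = sg X k f"
proof -
  show "\<one>\<^bsub>singular_cochain_group X k\<^esub> = sg X k (\<lambda>\<sigma>. 0)"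
    by (simp add: singular_cochain_group_def sg_def evl_zero)
  show "sg X k f \<otimes>\<^bsub>singular_cochain_group X k\<^esub> sg X k g = sg X k (\<lambda>\<sigma>. f \<sigma> + g \<sigma>)"
    using evl_lin[of 1 f g] by (auto simp: singular_cochain_group_def sg_def fun_eq_iff)
  show "singular_coboundary X k (sg X k f) = sg X (Suc k) (db X k (topspace X) f)"
    using evl_db[of k X "topspace X" _ f]
    by (auto simp: singular_coboundary_def sg_def fun_eq_iff singular_chain_boundary_alt)
  show "(\<lambda>x\<in>carrier (chain_group k X). s * sg X k f x) = sg X k (\<lambda>\<sigma>. s * f \<sigma>)"
    using evl_lin[of s f "\<lambda>\<sigma>. 0"] by (auto simp: sg_def fun_eq_iff evl_zero)
  show "sg X k (cutc X k (topspace X) f) = sg X k f"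
    using evl_cut[of k X "topspace X" _ f] by (auto simp: sg_def fun_eq_iff)
qed

lemma cochain_singular: "cochain (singular_cochain_group X) (singular_coboundary X)"
proof (rule cochain.intro)
  show "comm_group (singular_cochain_group X k)" for k
  proof (rule comm_groupI)
    fix x assume "x \<in> carrier (singular_cochain_group X k)"
    then obtain f where f: "x = sg X k f" by (auto simp: sg_carrier)
    have "sg X k (\<lambda>\<sigma>. - f \<sigma>) \<otimes>\<^bsub>singular_cochain_group X k\<^esub> x = \<one>\<^bsub>singular_cochain_group X k\<^esub>"
      by (simp add: f sg_simps)
    then show "\<exists>y\<in>carrier (singular_cochain_group X k). y \<otimes>\<^bsub>singular_cochain_group X k\<^esub> x = \<one>\<^bsub>singular_cochain_group X k\<^esub>"
      by (auto simp: sg_carrier)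
  qed (auto simp: sg_carrier sg_simps algebra_simps)
  show "singular_coboundary X k \<in> hom (singular_cochain_group X k) (singular_cochain_group X (Suc k))" for k
    by (intro homI) (auto simp: sg_carrier sg_simps db_add)
  show "singular_coboundary X (Suc k) (singular_coboundary X k x) = \<one>\<^bsub>singular_cochain_group X (Suc (Suc k))\<^esub>"
    if "x \<in> carrier (singular_cochain_group X k)" for k x
    using that by (auto simp: sg_carrier sg_simps db_db)
qed

abbreviation "scale_sing X s \<equiv> (\<lambda>k f. \<lambda>x\<in>carrier (chain_group k X). s * f x)"

lemma cochain_endo_scale_sing: "cochain_endo (singular_cochain_group X) (singular_coboundary X) (scale_sing X s)"
proof (intro cochain_endo.intro cochain_singular cochain_endo_axioms.intro)
  show "scale_sing X s k \<in> hom (singular_cochain_group X k) (singular_cochain_group X k)" for k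
    by (intro homI) (auto simp only: sg_carrier sg_simps distrib_left)
  show "scale_sing X s (Suc k) (singular_coboundary X k a) = singular_coboundary X k (scale_sing X s k a)"
    if "a \<in> carrier (singular_cochain_group X k)" for k a
    using that by (auto simp only: sg_carrier sg_simps db_scale)
qed

definition sec :: "'a topology \<Rightarrow> nat \<Rightarrow> ('a chain \<Rightarrow> complex) \<Rightarrow> ('a, 'a form) gsec" where
  "sec X k \<phi> = Base (enc (cutc X k (topspace X) (\<lambda>\<sigma>. \<phi> (frag_of \<sigma>))))"

lemma sec_sg: "sec X k (sg X k f) = Base (enc (cutc X k (topspace X) f))"
proof -
  have "cutc X k (topspace X) (\<lambda>\<sigma>. sg X k f (frag_of \<sigma>)) = cutc X k (topspace X) f"
    by (auto simp: sg_def cutc_def singular_chain_of)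
  then show ?thesis by (simp add: sec_def)
qed

text \<open>\<open>sec\<close> identifies singular cochains with global sections of
  \<open>SS\<close>. The edge map kills those that vanish near every point, and
  \<open>small_cochains_acyclic\<close> shows that they form an acyclic complex.\<close>

lemma singular_total_cohrel:
  assumes fl: "\<And>q. flabby X (SS X q)"
  obtains R where
    "cohrel (singular_cochain_group X) (singular_coboundary X) (total_group X (SS X)) (total_differential X (SS X) (dS X)) k R"
    "\<And>s a b. R a b \<Longrightarrow> R (scale_sing X s k a) (tot_endo X (SS X) (\<lambda>q. scale_Omega s) k b)"
proof (rule flabby_cohrel[where L = "SS X" and d = "dS X" and e = "sec X" and s = "\<lambda>s q. scale_Omega s"
      and E = "singular_cochain_group X" and dE = "singular_coboundary X" and sE = "scale_sing X" and k = k])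
  let ?T = "topspace X"
  show "presheaf_complex X (SS X) (dS X)" by (rule presheaf_complex_SS)
  show "gmor X (SS X q) (SS X q) (scale_Omega s)" for s q by (rule gmor_scale_SS)
  show "scale_Omega s U (dS X q U x) = dS X q U (scale_Omega s U x)" if "x \<in> Sc (SS X q) U" for s q U x
    using that by (auto simp: SS_section db_scale)
  show "sec X q \<in> hom (singular_cochain_group X q) (sections (SS X q) ?T)" for q
    by (intro homI) (auto simp: sg_carrier sec_sg sg_simps SS_section, auto simp: cutc_def)
  show "sec X q ` carrier (singular_cochain_group X q) = Sc (SS X q) ?T" for q
  proof
    show "Sc (SS X q) ?T \<subseteq> sec X q ` carrier (singular_cochain_group X q)"
    proof
      fix x assume "x \<in> Sc (SS X q) ?T"
      then obtain f where "f \<in> CS X q ?T" "x = Base (enc f)" by (auto simp: SS_section)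
      then have "x = sec X q (sg X q f)" by (simp add: sec_sg cut_id)
      then show "x \<in> sec X q ` carrier (singular_cochain_group X q)" by (auto simp: sg_carrier)
    qed
  qed (auto simp: sg_carrier sec_sg SS_section)
  show "dS X q ?T (sec X q a) = sec X (Suc q) (singular_coboundary X q a)"
    if "a \<in> carrier (singular_cochain_group X q)" for q a
    using that db_cut[of ?T ?T X q] by (auto simp: sg_carrier sec_sg sg_simps)
  show "scale_Omega s ?T (sec X q a) = sec X q (scale_sing X s q a)"
    if a: "a \<in> carrier (singular_cochain_group X q)" for s q a
  proof -
    obtain f where f: "a = sg X q f" using a by (auto simp: sg_carrier)
    show ?thesis unfolding f sg_simps sec_sg SS_simps gsec.inject enc_eq_iff by (auto simp: cutc_def)
  qed
  show "case k of 0 \<Rightarrow> a = \<one>\<^bsub>singular_cochain_group X k\<^esub> | Suc r \<Rightarrow> \<exists>c\<in>carrier (singular_cochain_group X r).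
       (\<forall>p\<in>?T. germ X (SS X r) p ?T (sec X r c) = \<one>\<^bsub>stalk X (SS X r) p\<^esub>) \<and> singular_coboundary X r c = a"
    if a: "a \<in> carrier (singular_cochain_group X k)" "singular_coboundary X k a = \<one>\<^bsub>singular_cochain_group X (Suc k)\<^esub>"
      and g: "\<And>p. p \<in> ?T \<Longrightarrow> germ X (SS X k) p ?T (sec X k a) = \<one>\<^bsub>stalk X (SS X k) p\<^esub>" for k a
  proof -
    obtain f0 where "a = sg X k f0" using a by (auto simp: sg_carrier)
    then obtain f where f: "f \<in> CS X k ?T" "a = sg X k f" using sg_simps(5) cut_CS by metis
    have "sec X (Suc k) (sg X (Suc k) (db X k ?T f)) = sec X (Suc k) (sg X (Suc k) (\<lambda>\<sigma>. 0))"
      using a(2) unfolding f sg_simps by simp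
    then have cl: "db X k ?T f = (\<lambda>\<sigma>. 0)" unfolding sec_sg by (simp add: cut_id[OF db_CS]) (simp add: cutc_def)
    have se: "sec X k a = Base (enc f)" by (simp add: f sec_sg cut_id)
    have sm: "\<exists>V. openin X V \<and> p \<in> V \<and> (\<forall>\<sigma>\<in>Sx X k V. f \<sigma> = 0)" if "p \<in> ?T" for p
      using g[OF that] SS_locally_zero_iff[OF openin_topspace that f(1)] unfolding se by blast
    note * = small_cochains_acyclic[OF f(1) cl sm]
    show ?thesis
    proof (cases k)
      case 0
      then show ?thesis using * by (simp add: f sg_simps)
    next
      case (Suc r)
      then obtain h where h: "h \<in> CS X r ?T" "db X r ?T h = f"
          "\<And>p. p \<in> ?T \<Longrightarrow> \<exists>V. openin X V \<and> p \<in> V \<and> (\<forall>\<sigma>\<in>Sx X r V. h \<sigma> = 0)" using * by auto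
      have "germ X (SS X r) p ?T (Base (enc h)) = \<one>\<^bsub>stalk X (SS X r) p\<^esub>" if "p \<in> ?T" for p
        using h(3)[OF that] openin_subset SS_locally_zero_iff[OF openin_topspace that h(1)] by blast
      then show ?thesis unfolding Suc f(2)
        by (simp, intro bexI[of _ "sg X r h"]) (auto simp: sg_carrier sg_simps sec_sg cut_id h)
    qed
  qed
qed (use fl cochain_singular cochain_endo_scale_sing that in auto)

context cmanifold
begin

text \<open>The comparison is the zigzag from singular cochains to the total complex of
  \<open>SS\<close>, back to the Godement complex of the constants, and on to the total complex of
  \<open>Omega\<close>. The middle arrow is traversed backwards by
  \<open>cohrel_converse\<close>.\<close>

lemma singular_Omega_cohrel:
  obtains R where
    "cohrel (singular_cochain_group X) (singular_coboundary X)
       (total_group X (Omega n X A)) (total_differential X (Omega n X A) (d_Omega n X A)) k R"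
    "\<And>s a b. R a b \<Longrightarrow> R (scale_sing X s k a) (tot_endo X (Omega n X A) (\<lambda>q. scale_Omega s) k b)"
    "presheaf_complex X (Omega n X A) (d_Omega n X A)"
proof -
  let ?E = "\<lambda>p. sections (godement_C X CC p) (topspace X)"
  let ?\<delta> = "\<lambda>p. godement_delta X CC p (topspace X)"
  have SS: "FS X (Suc q) = SS X q" "dFS X (Suc q) = dS X q" "FS X 0 = CC" for q by (auto simp: FS_def dFS_def)
  have OO: "FO (Suc q) = Omega n X A q" "dO (Suc q) = d_Omega n X A q" "FO 0 = CC" for q by (auto simp: FO_def dO_def)
  obtain R1 where R1:
    "cohrel (singular_cochain_group X) (singular_coboundary X) (total_group X (SS X)) (total_differential X (SS X) (dS X)) k R1"
    "\<And>s a b. R1 a b \<Longrightarrow> R1 (scale_sing X s k a) (tot_endo X (SS X) (\<lambda>q. scale_Omega s) k b)"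
    using singular_total_cohrel[OF flabby_SS] by blast
  have LE: "locally_exact X (FS X) (dFS X)" by (rule locally_exact_SS) (rule contractible_nbhd)
  have "\<exists>R. cohrel ?E ?\<delta> (total_group X (SS X)) (total_differential X (SS X) (dS X)) k R \<and>
     (\<forall>s a b. R a b \<longrightarrow> R (godement_C_map X CC (scale_Omega s) k (topspace X) a) (tot_endo X (SS X) (\<lambda>q. scale_Omega s) k b))"
  proof (rule resolution_cohrel[OF LE, of "\<lambda>s q. scale_Omega s" k, unfolded SS])
    fix R assume "cohrel ?E ?\<delta> (total_group X (SS X)) (total_differential X (SS X) (dS X)) k R"
      and "\<And>s a b. R a b \<Longrightarrow> R (godement_C_map X CC (scale_Omega s) k (topspace X) a)
        (tot_endo X (SS X) (\<lambda>q. scale_Omega s) k b)"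
      and "presheaf_complex X (SS X) (dS X)"
    then show ?thesis by (intro exI[of _ R] conjI allI impI)
  qed (rule scale_FS(1), erule (1) scale_FS(2))
  then obtain R2 where R2:
    "cohrel ?E ?\<delta> (total_group X (SS X)) (total_differential X (SS X) (dS X)) k R2"
    "\<And>s a b. R2 a b \<Longrightarrow> R2 (godement_C_map X CC (scale_Omega s) k (topspace X) a) (tot_endo X (SS X) (\<lambda>q. scale_Omega s) k b)"
    by blast
  have "\<exists>R. cohrel ?E ?\<delta> (total_group X (Omega n X A)) (total_differential X (Omega n X A) (d_Omega n X A)) k R \<and>
     (\<forall>s a b. R a b \<longrightarrow> R (godement_C_map X CC (scale_Omega s) k (topspace X) a) (tot_endo X (Omega n X A) (\<lambda>q. scale_Omega s) k b)) \<and>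
     presheaf_complex X (Omega n X A) (d_Omega n X A)"
  proof (rule resolution_cohrel[OF locally_exact_Omega, of "\<lambda>s q. scale_Omega s" k, unfolded OO])
    fix R assume "cohrel ?E ?\<delta> (total_group X (Omega n X A)) (total_differential X (Omega n X A) (d_Omega n X A)) k R"
      and "\<And>s a b. R a b \<Longrightarrow> R (godement_C_map X CC (scale_Omega s) k (topspace X) a)
        (tot_endo X (Omega n X A) (\<lambda>q. scale_Omega s) k b)"
      and "presheaf_complex X (Omega n X A) (d_Omega n X A)"
    then show ?thesis by (intro exI[of _ R] conjI allI impI)
  qed (rule scale_FO(1), erule (1) scale_FO(2))
  then obtain R3 where R3:
    "cohrel ?E ?\<delta> (total_group X (Omega n X A)) (total_differential X (Omega n X A) (d_Omega n X A)) k R3"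
    "\<And>s a b. R3 a b \<Longrightarrow> R3 (godement_C_map X CC (scale_Omega s) k (topspace X) a) (tot_endo X (Omega n X A) (\<lambda>q. scale_Omega s) k b)"
    "presheaf_complex X (Omega n X A) (d_Omega n X A)"
    by blast
  show ?thesis
  proof (rule that[of "R1 OO (\<lambda>b a. R2 a b) OO R3"])
    show "cohrel (singular_cochain_group X) (singular_coboundary X)
       (total_group X (Omega n X A)) (total_differential X (Omega n X A) (d_Omega n X A)) k (R1 OO (\<lambda>b a. R2 a b) OO R3)"
      by (intro cohrel_compose[OF R1(1)] cohrel_compose[OF cohrel_converse[OF R2(1)]] R3(1))
    show "(R1 OO (\<lambda>b a. R2 a b) OO R3) (scale_sing X s k a) (tot_endo X (Omega n X A) (\<lambda>q. scale_Omega s) k b)"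
      if R: "(R1 OO (\<lambda>b a. R2 a b) OO R3) a b" for s a b
    proof -
      obtain u v where "R1 a u" "R2 v u" "R3 v b" using R by auto
      from R1(2)[OF this(1), of s] R2(2)[OF this(2), of s] R3(2)[OF this(3), of s] show ?thesis
        by (intro relcomppI)
    qed
  qed (rule R3(3))
qed

end

text \<open>The isomorphism and its compatibility with scalars are read off from one relation
  \<open>R\<close> between cocycles. Commuting with every scalar makes \<open>h\<close> complex
  linear and not merely additive.\<close>

theorem mainTheorem2:
  fixes n k :: nat and X :: "'a topology" and A :: "'a chart set"
  assumes "complex_manifold n X A"
  shows "\<exists>h \<in> iso (singular_cohomology X k) (hypercohomology X (Omega n X A) (d_Omega n X A) k).
           \<forall>c. \<forall>x \<in> carrier (singular_cohomology X k).
             h (scale_singular_cohomology c X k x) =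
             hypercohomology_map X (Omega n X A) (d_Omega n X A) (\<lambda>q. scale_Omega c) k (h x)"
proof -
  interpret cmanifold n X A using assms by (rule cmanifold.intro)
  obtain R where R: "cohrel (singular_cochain_group X) (singular_coboundary X)
       (total_group X (Omega n X A)) (total_differential X (Omega n X A) (d_Omega n X A)) k R"
    "\<And>s a b. R a b \<Longrightarrow> R (scale_sing X s k a) (tot_endo X (Omega n X A) (\<lambda>q. scale_Omega s) k b)"
    and pc: "presheaf_complex X (Omega n X A) (d_Omega n X A)"
    by (rule singular_Omega_cohrel[of k]) blast
  have e: "cochain_endo (total_group X (Omega n X A)) (total_differential X (Omega n X A) (d_Omega n X A))
      (tot_endo X (Omega n X A) (\<lambda>q. scale_Omega s))" for s
    by (rule cochain_endo_total[OF pc gmor_scale_Omega])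
      (use scale_FO(2)[of _ _ "Suc _"] in \<open>auto simp: FO_def dO_def\<close>)
  show ?thesis
    unfolding singular_cohomology_def hypercohomology_def scale_singular_cohomology_def hypercohomology_map_def
    by (rule cohrel_iso_endo[OF cochain_singular cochain_endo.axioms(1)[OF e] R(1),
          where f = "scale_sing X" and f' = "\<lambda>s. tot_endo X (Omega n X A) (\<lambda>q. scale_Omega s)"])
      (rule cochain_endo_scale_sing e R(2), assumption?)+
qed

end
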